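(* Let $p$ be a prime, let $N$ be a normal solvable subgroup of a finite group $G$ and let $Q$ be a self-normalizing Sylow $p$-subgroup of $N$ (that is, $\mathbf{N}_N(Q)=Q$). Then there exists an $(\mathbf{N}_G(Q)\times \mathrm{Gal}(\mathbb{Q}_{|G|}/\mathbb{Q}))$-equivariant bijection $${}^*:\mathrm{Irr}_{p'}(N)\rightarrow \mathrm{Lin}(Q)$$ such that the character triples $(G_\theta,N,\theta)$ and $(\mathbf{N}_G(Q)_{\theta^*},Q,\theta^* )$ are isomorphic for every $\theta\in\mathrm{Irr}_{p'}(N)$. Also, if $\mathcal{A}$ denotes the set of irreducible characters of $G$ lying over some member of $\mathrm{Irr}_{p'}(N)$, and $Q'=[Q,Q]$, then there exists a bijection $$':\mathcal{A}\rightarrow\mathrm{Irr}(\mathbf{N}_G(Q)/Q'),\qquad \chi\mapsto\chi',$$ such that $\chi(1)_p=\chi'(1)_p$ for every $\chi\in\mathcal{A}$. In particular, $$|\mathrm{Irr}_{p'}(G)|=|\mathrm{Irr}_{p'}(\mathbf{N}_G(Q))|.$$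
   Context: All groups are finite and all characters are complex. $\mathrm{Irr}(X)$ is the set of irreducible characters of $X$, $\mathrm{Irr}_{p'}(X)$ the subset of those of degree not divisible by $p$, and $\mathrm{Lin}(X)$ the set of linear (degree 1) characters. $n_p$ denotes the $p$-part of the positive integer $n$. For $Y\le X$, $\chi\in\mathrm{Irr}(X)$ lies over $\theta\in\mathrm{Irr}(Y)$ if $\theta$ is a constituent of $\chi_Y$. $\mathbb{Q}_n=\mathbb{Q}(e^{2\pi i/n})$. $\mathbf{N}_G(Q)$ acts on characters of $N$ and of $Q$ by conjugation, $\mathrm{Gal}(\mathbb{Q}_{|G|}/\mathbb{Q})$ acts on characters by acting on their values, and $G_\theta$ denotes the stabilizer of $\theta$ in $G$. A map $f$ is $A$-equivariant if $f(x^a)=f(x)^a$ for all $x$ and all $a\in A$. Characters of a quotient $X/Y$ are identified with characters of $X$ with $Y$ in their kernel. Character triples: $(G,N,\theta)$ is a character triple if $N\lhd G$ and $\theta\in\mathrm{Irr}(N)$ is $G$-invariant. For $N\le X\le G$, $\mathrm{Char}(X|\theta)$ is the set of characters $\xi$ of $X$ such that $\xi_N$ is a multiple of $\theta$. An isomorphism from $(G,N,\theta)$ to $(\Gamma,M,\varphi)$ is a group isomorphism $\tau:G/N\to\Gamma/M$ together with, for every $N\le X\le G$, a bijection $\sigma_X:\mathrm{Char}(X|\theta)\to\mathrm{Char}(X^\tau|\varphi)$, where $X^\tau/M=\tau(X/N)$, such that for all $N\le Y\le X\le G$ and $\chi,\psi\in\mathrm{Char}(X|\theta)$: (a) $\sigma_X(\chi+\psi)=\sigma_X(\chi)+\sigma_X(\psi)$;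 (b) $[\chi,\psi]=[\sigma_X(\chi),\sigma_X(\psi)]$; (c) $\sigma_Y(\chi_Y)=(\sigma_X(\chi))_{Y^\tau}$; (d) $\sigma_X(\chi\beta)=\sigma_X(\chi)\beta^\tau$ for every $\beta\in\mathrm{Irr}(X/N)$, where $\beta^\tau$ is the character of $X^\tau/M$ corresponding to $\beta$ via $\tau$. *)

theory Defs
  imports
    "HOL-Algebra.Group_Action"
    "HOL-Algebra.Solvable_Groups"
    "HOL-Algebra.Generated_Fields"
    "HOL-Computational_Algebra.Primes"
    "Jordan_Normal_Form.VS_Connect"
begin

text \<open>
  A subgroup \<open>H\<close> of \<open>G\<close>, regarded as a group, is \<open>G\<lparr>carrier := H\<rparr>\<close>. All characters and
  class functions are extended by zero outside the carrier of their group, so that equality of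
  functions is equality of characters, and sums, products and restrictions are again of this form.
\<close>

section \<open>Complex characters\<close>

definition is_rep ::
  "('a, 'b) monoid_scheme \<Rightarrow> nat \<Rightarrow> ('a \<Rightarrow> complex mat) \<Rightarrow> bool" where
  "is_rep G n \<rho> \<longleftrightarrow> 0 < n \<and> \<rho> \<in> hom G (units_of (ring_mat TYPE(complex) n ()))"

definition irreducible_rep ::
  "('a, 'b) monoid_scheme \<Rightarrow> nat \<Rightarrow> ('a \<Rightarrow> complex mat) \<Rightarrow> bool" where
  "irreducible_rep G n \<rho> \<longleftrightarrow> is_rep G n \<rho> \<and>
     (\<forall>W. subspace class_ring W (module_vec TYPE(complex) n) \<and>
          (\<forall>g\<in>carrier G. \<forall>w\<in>W. \<rho> g *\<^sub>v w \<in> W)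
        \<longrightarrow> W = {0\<^sub>v n} \<or> W = carrier_vec n)"

definition rep_char ::
  "('a, 'b) monoid_scheme \<Rightarrow> nat \<Rightarrow> ('a \<Rightarrow> complex mat) \<Rightarrow> 'a \<Rightarrow> complex" where
  "rep_char G n \<rho> = (\<lambda>g. if g \<in> carrier G then \<Sum>i<n. \<rho> g $$ (i, i) else 0)"

definition Chars :: "('a, 'b) monoid_scheme \<Rightarrow> ('a \<Rightarrow> complex) set" where
  "Chars G = {rep_char G n \<rho> | n \<rho>. is_rep G n \<rho>}"

definition Irr :: "('a, 'b) monoid_scheme \<Rightarrow> ('a \<Rightarrow> complex) set" where
  "Irr G = {rep_char G n \<rho> | n \<rho>. irreducible_rep G n \<rho>}"

definition char_degree :: "('a, 'b) monoid_scheme \<Rightarrow> ('a \<Rightarrow> complex) \<Rightarrow> nat" where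
  "char_degree G \<chi> = (THE n. of_nat n = \<chi> \<one>\<^bsub>G\<^esub>)"

definition Irr_p' :: "nat \<Rightarrow> ('a, 'b) monoid_scheme \<Rightarrow> ('a \<Rightarrow> complex) set" where
  "Irr_p' p G = {\<chi> \<in> Irr G. \<not> p dvd char_degree G \<chi>}"

definition Lin :: "('a, 'b) monoid_scheme \<Rightarrow> ('a \<Rightarrow> complex) set" where
  "Lin G = {\<chi> \<in> Chars G. char_degree G \<chi> = 1}"

definition char_inner ::
  "('a, 'b) monoid_scheme \<Rightarrow> ('a \<Rightarrow> complex) \<Rightarrow> ('a \<Rightarrow> complex) \<Rightarrow> complex" where
  "char_inner G \<chi> \<psi> = (\<Sum>g\<in>carrier G. \<chi> g * cnj (\<psi> g)) / of_nat (Coset.order G)"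

definition char_res :: "'a set \<Rightarrow> ('a \<Rightarrow> complex) \<Rightarrow> 'a \<Rightarrow> complex" where
  "char_res Y \<chi> = (\<lambda>y. if y \<in> Y then \<chi> y else 0)"

text \<open>The character of \<open>G\<close> obtained from a character of \<open>G/N\<close>, here a function on cosets.\<close>

definition inflate ::
  "('a, 'b) monoid_scheme \<Rightarrow> 'a set \<Rightarrow> ('a set \<Rightarrow> complex) \<Rightarrow> 'a \<Rightarrow> complex" where
  "inflate G N \<beta> = (\<lambda>g. if g \<in> carrier G then \<beta> (N #>\<^bsub>G\<^esub> g) else 0)"

definition lies_over ::
  "('a, 'b) monoid_scheme \<Rightarrow> 'a set \<Rightarrow> ('a \<Rightarrow> complex) \<Rightarrow> ('a \<Rightarrow> complex) \<Rightarrow> bool" where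
  "lies_over G Y \<chi> \<theta> \<longleftrightarrow> char_inner (G\<lparr>carrier := Y\<rparr>) (char_res Y \<chi>) \<theta> \<noteq> 0"

section \<open>Actions on characters\<close>

text \<open>
  \<open>conj_char G Y g \<theta>\<close> is \<open>\<theta>\<^sup>g\<close>, where \<open>\<theta>\<^sup>g(y\<^sup>g) = \<theta>(y)\<close> and \<open>y\<^sup>g = g\<^sup>-\<^sup>1yg\<close>, for a
  character \<open>\<theta>\<close> of \<open>Y\<close> and \<open>g\<close> normalizing \<open>Y\<close>.
\<close>

definition conj_char ::
  "('a, 'b) monoid_scheme \<Rightarrow> 'a set \<Rightarrow> 'a \<Rightarrow> ('a \<Rightarrow> complex) \<Rightarrow> 'a \<Rightarrow> complex" where
  "conj_char G Y g \<theta> =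
     (\<lambda>y. if y \<in> Y then \<theta> (g \<otimes>\<^bsub>G\<^esub> y \<otimes>\<^bsub>G\<^esub> inv\<^bsub>G\<^esub> g) else 0)"

definition cyclotomic :: "nat \<Rightarrow> complex set" where
  "cyclotomic n = generate_field class_ring {cis (2 * pi / real n)}"

text \<open>Outside the field, automorphisms are \<open>undefined\<close>, so each one occurs exactly once.\<close>

definition Gal_cyclotomic :: "nat \<Rightarrow> (complex \<Rightarrow> complex) set" where
  "Gal_cyclotomic n =
     {\<sigma> \<in> ring_iso (class_ring\<lparr>carrier := cyclotomic n\<rparr>)
                    (class_ring\<lparr>carrier := cyclotomic n\<rparr>).
        (\<forall>q\<in>\<rat>. \<sigma> q = q) \<and> \<sigma> \<in> extensional (cyclotomic n)}"

definition galois_char ::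
  "(complex \<Rightarrow> complex) \<Rightarrow> ('a \<Rightarrow> complex) \<Rightarrow> 'a \<Rightarrow> complex" where
  "galois_char \<sigma> \<theta> = (\<lambda>x. \<sigma> (\<theta> x))"

section \<open>Character triples\<close>

definition char_triple ::
  "('a, 'b) monoid_scheme \<Rightarrow> 'a set \<Rightarrow> ('a \<Rightarrow> complex) \<Rightarrow> bool" where
  "char_triple G N \<theta> \<longleftrightarrow>
     group G \<and> finite (carrier G) \<and> N \<lhd> G \<and> \<theta> \<in> Irr (G\<lparr>carrier := N\<rparr>) \<and>
     (\<forall>g\<in>carrier G. conj_char G N g \<theta> = \<theta>)"

definition Char_over ::
  "('a, 'b) monoid_scheme \<Rightarrow> 'a set \<Rightarrow> ('a \<Rightarrow> complex) \<Rightarrow> ('a \<Rightarrow> complex) set" where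
  "Char_over X N \<theta> =
     {\<xi> \<in> Chars X. \<exists>m::nat. char_res N \<xi> = (\<lambda>x. of_nat m * \<theta> x)}"

text \<open>
  For \<open>\<tau>\<close> from \<open>G/N\<close> to \<open>\<Gamma>/M\<close> and \<open>N \<le> X \<le> G\<close>, the subgroup \<open>X\<^sup>\<tau>\<close> of \<open>\<Gamma>\<close> with
  \<open>X\<^sup>\<tau>/M = \<tau>(X/N)\<close>.
\<close>

definition image_subgroup ::
  "('a, 'b) monoid_scheme \<Rightarrow> 'a set \<Rightarrow> ('a set \<Rightarrow> 'c set) \<Rightarrow> 'a set \<Rightarrow> 'c set" where
  "image_subgroup G N \<tau> X = \<Union> (\<tau> ` carrier (G\<lparr>carrier := X\<rparr> Mod N))"

definition char_triple_iso ::
  "('a, 'b) monoid_scheme \<Rightarrow> 'a set \<Rightarrow> ('a \<Rightarrow> complex) \<Rightarrow>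
   ('c, 'd) monoid_scheme \<Rightarrow> 'c set \<Rightarrow> ('c \<Rightarrow> complex) \<Rightarrow>
   ('a set \<Rightarrow> 'c set) \<Rightarrow> ('a set \<Rightarrow> ('a \<Rightarrow> complex) \<Rightarrow> ('c \<Rightarrow> complex)) \<Rightarrow> bool" where
  "char_triple_iso G N \<theta> \<Gamma> M \<phi> \<tau> \<sigma> \<longleftrightarrow>
     \<tau> \<in> iso (G Mod N) (\<Gamma> Mod M) \<and>
     (\<forall>X. subgroup X G \<and> N \<subseteq> X \<longrightarrow>
        (let GX = G\<lparr>carrier := X\<rparr>;
             X\<tau> = image_subgroup G N \<tau> X;
             \<Gamma>X = \<Gamma>\<lparr>carrier := X\<tau>\<rparr>
         in bij_betw (\<sigma> X) (Char_over GX N \<theta>) (Char_over \<Gamma>X M \<phi>) \<and>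
            (\<forall>\<chi>\<in>Char_over GX N \<theta>.
               (\<forall>\<psi>\<in>Char_over GX N \<theta>.
                  \<sigma> X (\<lambda>x. \<chi> x + \<psi> x) = (\<lambda>y. \<sigma> X \<chi> y + \<sigma> X \<psi> y) \<and>
                  char_inner GX \<chi> \<psi> = char_inner \<Gamma>X (\<sigma> X \<chi>) (\<sigma> X \<psi>)) \<and>
               (\<forall>Y. subgroup Y G \<and> N \<subseteq> Y \<and> Y \<subseteq> X \<longrightarrow>
                  \<sigma> Y (char_res Y \<chi>) =
                    char_res (image_subgroup G N \<tau> Y) (\<sigma> X \<chi>)) \<and>
               (\<forall>\<beta>\<in>Irr (GX Mod N).
                  \<sigma> X (\<lambda>x. \<chi> x * inflate GX N \<beta> x) =
                    (\<lambda>y. \<sigma> X \<chi> y *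
                       inflate \<Gamma>X M (\<beta> \<circ> inv_into (carrier (G Mod N)) \<tau>) y)))))"

definition char_triples_isomorphic ::
  "('a, 'b) monoid_scheme \<Rightarrow> 'a set \<Rightarrow> ('a \<Rightarrow> complex) \<Rightarrow>
   ('c, 'd) monoid_scheme \<Rightarrow> 'c set \<Rightarrow> ('c \<Rightarrow> complex) \<Rightarrow> bool" where
  "char_triples_isomorphic G N \<theta> \<Gamma> M \<phi> \<longleftrightarrow>
     char_triple G N \<theta> \<and> char_triple \<Gamma> M \<phi> \<and>
     (\<exists>\<tau> \<sigma>. char_triple_iso G N \<theta> \<Gamma> M \<phi> \<tau> \<sigma>)"

section \<open>Sylow subgroups and p-parts\<close>

definition p_part :: "nat \<Rightarrow> nat \<Rightarrow> nat" where
  "p_part p n = p ^ multiplicity p n"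

definition sylow_subgroup :: "nat \<Rightarrow> ('a, 'b) monoid_scheme \<Rightarrow> 'a set \<Rightarrow> bool" where
  "sylow_subgroup p G Q \<longleftrightarrow> subgroup Q G \<and> card Q = p_part p (Coset.order G)"

end

theory Submission
  imports Defs "Jordan_Normal_Form.DL_Rank" "Jordan_Normal_Form.Char_Poly" "HOL-Number_Theory.Cong"
    "HOL-Algebra.SndIsomorphismGrp" "HOL-Algebra.Sylow"
begin

text \<open>
  For a self-normalizing Sylow \<open>p\<close>-subgroup \<open>Q\<close> of the solvable group \<open>N\<close>, the restriction to \<open>Q\<close> of each
  \<open>\<theta> \<in> Irr\<^sub>p\<^sub>'(N)\<close> has a unique linear constituent \<open>\<theta>\<^sup>*\<close>, and it has multiplicity one. This is shown
  by induction along a normal series with abelian \<open>p\<close>- and \<open>p'\<close>-factors. A \<open>p'\<close>-layer is contained in the kernel of every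
  \<open>p'\<close>-character, because \<open>Q\<close> is abnormal. Over a \<open>p\<close>-layer one uses the Clifford correspondence for a
  \<open>Q\<close>-invariant linear character, which extends to its stabilizer by a determinant argument.
  Equivariance follows from uniqueness.

  By the Frattini argument \<open>G = N N\<^sub>G(Q)\<close>, so Mackey's formula expresses
  \<open>\<Sum>\<^sub>\<chi> [\<chi>\<^sub>H, \<psi>] [\<chi>\<^sub>N, \<theta>]\<close>, with \<open>H = N\<^sub>G(Q)\<close>, through \<open>Q = N \<inter> H\<close>. The row and column sums of the
  matrix of multiplicities \<open>[\<chi>\<^sub>H, \<psi>]\<close>, weighted by degrees, then match those of a permutation matrix,
  which forces it to be one. The resulting bijections satisfy \<open>\<chi>(1) = \<theta>(1) \<chi>'(1)\<close>, and on all characters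
  over \<open>\<theta>\<close> they are given by projecting the restriction onto the part over \<open>\<theta>\<^sup>*\<close>. This projection is an
  explicit averaging formula, visibly compatible with sums, restriction and products.
\<close>

section \<open>Representations and Schur's lemma\<close>

text \<open>Abnormality is the heritable form of self-normalization: a subgroup containing
  \<open>P\<close> and \<open>h P h^-1\<close> contains \<open>h\<close>, because both are Sylow
  modulo \<open>Z\<close> in it and hence conjugate there. This makes the \<open>P\<close>-invariant
  constituent on a layer unique and lets the hypotheses pass to stabilizers and larger sections, so
  the induction stays in one class of triples. The degree condition enters through orbit lengths:
  the orbit of a linear constituent has length dividing the degree, so it is prime to p and
  \<open>P\<close> fixes one of its members. The matrix argument is used three times: over a
  stabilizer with the index as weight, over one invariant \<theta> with the degree of \<theta> as
  weight, and over all \<theta> at once with varying weights. Working with multiplicities in the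
  natural numbers is what lets positivity turn equal totals into equality term by term. The maps of
  a triple isomorphism have to fit together for all intermediate subgroups \<open>X\<close>.
  Bijections chosen separately for each \<open>X\<close> would not; an average over the fixed group
  \<open>Q\<close> does, and only its bijectivity and isometry need character theory.\<close>

lemma (in group) is_repD:
  assumes "is_rep G n \<rho>"
  shows "0 < n" "g \<in> carrier G \<Longrightarrow> \<rho> g \<in> carrier_mat n n"
    "g \<in> carrier G \<Longrightarrow> h \<in> carrier G \<Longrightarrow> \<rho> (g \<otimes> h) = \<rho> g * \<rho> h"
    "\<rho> \<one> = 1\<^sub>m n"
proof -
  interpret M: semiring "ring_mat TYPE(complex) n ()" by (rule semiring_mat)
  have U: "Group.group (units_of (ring_mat TYPE(complex) n ()))"
    by (rule M.units_group)
  have h: "\<rho> \<in> hom G (units_of (ring_mat TYPE(complex) n ()))"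
    using assms by (simp add: is_rep_def)
  show "0 < n" using assms by (simp add: is_rep_def)
  show "\<rho> g \<in> carrier_mat n n" if "g \<in> carrier G"
    using hom_in_carrier[OF h that] by (auto simp: units_of_def Units_def ring_mat_simps)
  show "\<rho> (g \<otimes> h) = \<rho> g * \<rho> h" if "g \<in> carrier G" "h \<in> carrier G"
    using hom_mult[OF h that] by (simp add: units_of_def ring_mat_simps)
  interpret gh: group_hom G "units_of (ring_mat TYPE(complex) n ())" \<rho>
    using U h by (simp add: group_hom_def group_hom_axioms_def is_group)
  show "\<rho> \<one> = 1\<^sub>m n" using gh.hom_one by (simp add: units_of_def ring_mat_simps)
qed

lemma (in group) is_repI:
  assumes "0 < n" "\<And>g. g \<in> carrier G \<Longrightarrow> \<rho> g \<in> carrier_mat n n"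
    and mult: "\<And>g h. g \<in> carrier G \<Longrightarrow> h \<in> carrier G \<Longrightarrow> \<rho> (g \<otimes> h) = \<rho> g * \<rho> h"
    and one: "\<rho> \<one> = 1\<^sub>m n"
  shows "is_rep G n \<rho>"
proof -
  have "\<rho> g \<in> Units (ring_mat TYPE(complex) n ())" if g: "g \<in> carrier G" for g
  proof -
    have "\<rho> g * \<rho> (inv g) = 1\<^sub>m n" "\<rho> (inv g) * \<rho> g = 1\<^sub>m n"
      using mult[OF g inv_closed[OF g]] mult[OF inv_closed[OF g] g] g one by simp_all
    then show ?thesis using assms(2)[OF g] assms(2)[OF inv_closed[OF g]]
      by (auto simp: Units_def ring_mat_simps)
  qed
  then show ?thesis using assms(1) mult
    by (auto simp: is_rep_def hom_def units_of_def ring_mat_simps)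
qed

lemma module_vec_subspaceI:
  fixes W :: "complex vec set"
  assumes "W \<subseteq> carrier_vec n" "0\<^sub>v n \<in> W" "\<And>v w. v \<in> W \<Longrightarrow> w \<in> W \<Longrightarrow> v + w \<in> W"
    "\<And>c v. v \<in> W \<Longrightarrow> c \<cdot>\<^sub>v v \<in> W"
  shows "subspace class_ring W (module_vec TYPE(complex) n)"
proof -
  interpret vec_space "TYPE(complex)" n .
  have "LinearCombinations.submodule class_ring W V"
    unfolding LinearCombinations.submodule_def using assms vec_module by auto
  then show ?thesis unfolding subspace_def using vec_vs by blast
qed

text \<open>In such coordinates a reducible representation becomes block triangular.\<close>

lemma subspace_coordinates:
  fixes W :: "complex vec set"
  assumes "subspace class_ring W (module_vec TYPE(complex) n)"
    and "W \<noteq> {0\<^sub>v n}" "W \<noteq> carrier_vec n"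
  obtains S T k where "S \<in> carrier_mat n n" "T \<in> carrier_mat n n" "S * T = 1\<^sub>m n" "T * S = 1\<^sub>m n"
    "0 < k" "k < n" "\<And>w. w \<in> carrier_vec n \<Longrightarrow> w \<in> W \<longleftrightarrow> (\<forall>i. k \<le> i \<and> i < n \<longrightarrow> (T *\<^sub>v w) $ i = 0)"
proof -
  interpret vec_space "TYPE(complex)" n .
  have W: "LinearCombinations.submodule class_ring W V" using assms(1) by (simp add: subspace_def)
  have Wc: "W \<subseteq> carrier_vec n" using LinearCombinations.submodule.subset[OF W] by simp
  have fin: "finite A \<and> card A \<le> n" if "A \<subseteq> W \<and> lin_indpt A" for A
    using li_le_dim[OF fin_dim, of A] Wc dim_is_n that by auto
  \<comment> \<open>A maximal independent subset of \<open>W\<close> spans \<open>W\<close>. It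
    exists because independent sets have at most \<open>n\<close> elements.\<close>
  obtain A where A: "maximal A (\<lambda>S. S \<subseteq> W \<and> lin_indpt S)"
    using maximal_exists[of "\<lambda>S. S \<subseteq> W \<and> lin_indpt S" n "{}"] fin
      finite_lin_indpt2[of "{}"] by auto
  then have AW: "A \<subseteq> W" "lin_indpt A" and Amax: "\<And>B. A \<subseteq> B \<Longrightarrow> B \<subseteq> W \<Longrightarrow> lin_indpt B \<Longrightarrow> B = A"
    by (auto simp: maximal_def)
  have Ac: "A \<subseteq> carrier_vec n" and finA: "finite A" using AW Wc fin by auto
  have spanA: "span A = W"
  proof
    show "span A \<subseteq> W" using span_is_subset[OF AW(1) W] .
    show "W \<subseteq> span A"
    proof
      fix w assume w: "w \<in> W"
      show "w \<in> span A"
      proof (cases "w \<in> A")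
        case True then show ?thesis using in_own_span[of A] Ac by auto
      next
        case False
        have "lin_dep (A \<union> {w})" using Amax[of "A \<union> {w}"] w AW False by auto
        then show ?thesis using lin_dep_iff_in_span[of A w] Ac AW w Wc False by auto
      qed
    qed
  qed
  have cU: "card (set (unit_vecs n) :: complex vec set) = n"
    using distinct_card[OF unit_vecs_distinct] unit_vecs_length by metis
  have AU: "A \<subseteq> span (set (unit_vecs n))" using Ac span_unit_vecs_is_carrier by simp
  have Uc: "set (unit_vecs n) \<subseteq> carrier_vec n" by (auto simp: unit_vecs_def)
  \<comment> \<open>Steinitz exchange completes \<open>A\<close> to a spanning set. The bound on
    \<open>card C\<close> must then be an equality, so \<open>A\<close> and \<open>C\<close>
    together have exactly \<open>n\<close> elements.\<close>
  obtain C where C: "finite C" "C \<subseteq> carrier_vec n" "C \<inter> A = {}" "int (card C) \<le> int n - int (card A)"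
      "span (A \<union> C) = carrier_vec n"
    using replacement[OF finA finite_set Uc AW(2) AU]
    unfolding cU span_unit_vecs_is_carrier by metis
  have fAC: "finite (A \<union> C)" and cAC: "A \<union> C \<subseteq> carrier_vec n" using finA C Ac by auto
  have "n \<le> card (A \<union> C)" using gen_ge_dim[OF fAC] cAC C(5) dim_is_n by simp
  then have card: "card A + card C = n" using card_Un_disjoint[OF finA C(1)] C(3,4) by (simp add: Int_commute)
  obtain xs where xs: "set xs = A" "distinct xs" using finite_distinct_list[OF finA] by blast
  obtain ys where ys: "set ys = C" "distinct ys" using finite_distinct_list[OF C(1)] by blast
  define k where "k = card A"
  have lxs: "length xs = k" using xs distinct_card[of xs] by (simp add: k_def)
  have lys: "length ys = n - k" using ys distinct_card[of ys] card by (simp add: k_def)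
  have kn: "k \<le> n" using card by (simp add: k_def)
  define S where "S = mat_of_cols n (xs @ ys)"
  have S: "S \<in> carrier_mat n n" unfolding S_def carrier_mat_def using lxs lys kn by simp
  have setc: "set (xs @ ys) \<subseteq> carrier_vec n" using xs ys cAC by simp
  have ex: "\<exists>v \<in> carrier_vec n. S *\<^sub>v v = w" if w: "w \<in> carrier_vec n" for w
  proof -
    have "w \<in> span (set (xs @ ys))" using w C(5) xs ys by simp
    then obtain c where "w = lincomb_list c (xs @ ys)"
      using span_list_as_span[OF setc] by (auto simp: span_list_def)
    then have "w = S *\<^sub>v vec n c"
      using lincomb_list_as_mat_mult[of "xs @ ys" c] lxs lys kn
        carrier_vecD[OF subsetD[OF setc]] by (simp add: S_def)
    then show ?thesis by (intro bexI[of _ "vec n c"]) auto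
  qed
  \<comment> \<open>Column \<open>j\<close> is a chosen preimage of the \<open>j\<close>-th unit
    vector under \<open>S\<close>, so \<open>S * T\<close> is the identity; for square matrices the
    inverse is two-sided.\<close>
  define T where "T = mat n n (\<lambda>(i,j). (SOME v. v \<in> carrier_vec n \<and> S *\<^sub>v v = unit_vec n j) $ i)"
  have T: "T \<in> carrier_mat n n" by (simp add: T_def)
  have ST: "S * T = 1\<^sub>m n"
  proof (rule eq_matI)
    fix i j assume i: "i < dim_row (1\<^sub>m n :: complex mat)" and j: "j < dim_col (1\<^sub>m n :: complex mat)"
    let ?v = "SOME v. v \<in> carrier_vec n \<and> S *\<^sub>v v = unit_vec n j"
    have "\<exists>v. v \<in> carrier_vec n \<and> S *\<^sub>v v = unit_vec n j" using ex[of "unit_vec n j"] by auto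
    then have v: "?v \<in> carrier_vec n \<and> S *\<^sub>v ?v = unit_vec n j" by (rule someI_ex)
    have "col T j = ?v" using v j by (intro eq_vecI) (auto simp: T_def)
    then have "(S * T) $$ (i,j) = (S *\<^sub>v ?v) $ i" using i j S T by simp
    then show "(S * T) $$ (i,j) = 1\<^sub>m n $$ (i,j)" using v i j by simp
  qed (use S T in auto)
  have TS: "T * S = 1\<^sub>m n" using mat_mult_left_right_inverse[OF S T ST] .
  \<comment> \<open>\<open>T\<close> computes coordinates in the basis \<open>xs @ ys\<close>, whose
    first \<open>k\<close> vectors span \<open>W\<close>.\<close>
  have char: "w \<in> W \<longleftrightarrow> (\<forall>i. k \<le> i \<and> i < n \<longrightarrow> (T *\<^sub>v w) $ i = 0)" if w: "w \<in> carrier_vec n" for w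
  proof -
    have Sc: "S *\<^sub>v vec n (\<lambda>i. if i < k then c i else 0) = mat_of_cols n xs *\<^sub>v vec k c" for c
    proof (rule eq_vecI)
      fix i assume "i < dim_vec (mat_of_cols n xs *\<^sub>v vec k c)"
      then have i: "i < n" by simp
      have "(S *\<^sub>v vec n (\<lambda>i. if i < k then c i else 0)) $ i
          = (\<Sum>j<n. (xs @ ys) ! j $ i * (if j < k then c j else 0))"
        using i lxs lys kn
        by (simp add: S_def scalar_prod_def mat_of_cols_def lessThan_atLeast0)
      also have "\<dots> = (\<Sum>j<k. (xs @ ys) ! j $ i * c j)"
        using kn by (intro sum.mono_neutral_cong_right) auto
      also have "\<dots> = (\<Sum>j<k. xs ! j $ i * c j)"
        by (intro sum.cong) (auto simp: nth_append lxs)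
      also have "\<dots> = (mat_of_cols n xs *\<^sub>v vec k c) $ i"
        using i lxs by (simp add: scalar_prod_def mat_of_cols_def lessThan_atLeast0)
      finally show "(S *\<^sub>v vec n (\<lambda>i. if i < k then c i else 0)) $ i = (mat_of_cols n xs *\<^sub>v vec k c) $ i" .
    qed (simp add: S_def)
    have lin: "lincomb_list c xs = mat_of_cols n xs *\<^sub>v vec k c" for c
      using lincomb_list_as_mat_mult[of xs c] xs lxs carrier_vecD[OF subsetD[OF Ac]] by simp
    have Wlist: "W = {lincomb_list c xs | c. True}"
      using span_list_as_span[of xs] xs Ac spanA by (auto simp: span_list_def)
    show ?thesis
    proof
      assume "w \<in> W"
      then obtain c where "w = S *\<^sub>v vec n (\<lambda>i. if i < k then c i else 0)" using Wlist lin Sc by auto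
      then have "T *\<^sub>v w = (T * S) *\<^sub>v vec n (\<lambda>i. if i < k then c i else 0)"
        using S T by (simp add: assoc_mult_mat_vec[of _ n n _ n])
      then show "\<forall>i. k \<le> i \<and> i < n \<longrightarrow> (T *\<^sub>v w) $ i = 0" using TS by simp
    next
      assume *: "\<forall>i. k \<le> i \<and> i < n \<longrightarrow> (T *\<^sub>v w) $ i = 0"
      have "T *\<^sub>v w = vec n (\<lambda>i. if i < k then (T *\<^sub>v w) $ i else 0)"
        using * T by (intro eq_vecI) auto
      moreover have "S *\<^sub>v (T *\<^sub>v w) = w"
        using S T ST w by (simp flip: assoc_mult_mat_vec[of _ n n _ n])
      ultimately have "w = S *\<^sub>v vec n (\<lambda>i. if i < k then (T *\<^sub>v w) $ i else 0)" by simp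
      then have "w = lincomb_list (\<lambda>i. (T *\<^sub>v w) $ i) xs" using Sc lin by simp
      then show "w \<in> W" using Wlist by blast
    qed
  qed
  have "k \<noteq> 0"
  proof
    assume "k = 0"
    then have "A = {}" using finA by (simp add: k_def)
    then show False using spanA assms(2) span_empty by auto
  qed
  moreover have "k \<noteq> n"
  proof
    assume "k = n"
    then have "C = {}" using card C(1) by (simp add: k_def)
    then show False using C(5) spanA assms(3) by simp
  qed
  ultimately show ?thesis using that[OF S T ST TS _ _ char] kn by auto
qed

section \<open>Traces, intertwiners and Schur's lemma\<close>

abbreviation tr :: "nat \<Rightarrow> complex mat \<Rightarrow> complex" where
  "tr n A \<equiv> (\<Sum>i<n. A $$ (i, i))"

lemma mult_mat_index:
  assumes "A \<in> carrier_mat n m" "B \<in> carrier_mat m l" "i < n" "j < l"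
  shows "(A * B) $$ (i, j) = (\<Sum>k<m. A $$ (i, k) * B $$ (k, j))"
  using assms by (simp add: scalar_prod_def lessThan_atLeast0)

lemma tr_mult_commute:
  assumes A: "A \<in> carrier_mat n m" and B: "B \<in> carrier_mat m n"
  shows "tr n (A * B) = tr m (B * A)"
proof -
  have "tr n (A * B) = (\<Sum>i<n. \<Sum>k<m. A $$ (i, k) * B $$ (k, i))"
    using mult_mat_index[OF A B] by simp
  also have "\<dots> = (\<Sum>k<m. \<Sum>i<n. B $$ (k, i) * A $$ (i, k))"
    by (subst sum.swap) (simp add: mult.commute)
  also have "\<dots> = tr m (B * A)" using mult_mat_index[OF B A] by simp
  finally show ?thesis .
qed

lemma tr_similar:
  assumes "M \<in> carrier_mat n n" "S \<in> carrier_mat n n" "T \<in> carrier_mat n n" "S * T = 1\<^sub>m n"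
  shows "tr n (T * M * S) = tr n M"
proof -
  have "tr n (T * M * S) = tr n (S * (T * M))"
    by (rule tr_mult_commute) (use assms in auto)
  also have "S * (T * M) = M" using assoc_mult_mat[of S n n T n M n] assms by simp
  finally show ?thesis .
qed

lemma eq_mat_by_vec:
  fixes A B :: "complex mat"
  assumes A: "A \<in> carrier_mat n m" and B: "B \<in> carrier_mat n m"
    and "\<And>v. v \<in> carrier_vec m \<Longrightarrow> A *\<^sub>v v = B *\<^sub>v v"
  shows "A = B"
proof (rule eq_matI)
  fix i j assume ij: "i < dim_row B" "j < dim_col B"
  have "(A *\<^sub>v unit_vec m j) $ i = (B *\<^sub>v unit_vec m j) $ i" using assms(3) by simp
  then show "A $$ (i, j) = B $$ (i, j)" using A B ij by simp
qed (use A B in auto)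

lemma zero_mat_mult_vec: "v \<in> carrier_vec m \<Longrightarrow> 0\<^sub>m n m *\<^sub>v v = 0\<^sub>v n"
  by (intro eq_vecI) (auto simp: scalar_prod_def)

lemma smult_one_mult_vec:
  "v \<in> carrier_vec n \<Longrightarrow> (c \<cdot>\<^sub>m 1\<^sub>m n) *\<^sub>v v = (c :: complex) \<cdot>\<^sub>v v"
  by (intro eq_vecI) auto

lemma mat_right_inverse_of_surj:
  fixes Y :: "complex mat"
  assumes Y: "Y \<in> carrier_mat n m" and ex: "\<And>w. w \<in> carrier_vec n \<Longrightarrow> \<exists>v \<in> carrier_vec m. Y *\<^sub>v v = w"
  obtains R where "R \<in> carrier_mat m n" "Y * R = 1\<^sub>m n"
proof -
  define R where "R = mat m n (\<lambda>(i,j). (SOME v. v \<in> carrier_vec m \<and> Y *\<^sub>v v = unit_vec n j) $ i)"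
  have R: "R \<in> carrier_mat m n" by (simp add: R_def)
  have "Y * R = 1\<^sub>m n"
  proof (rule eq_matI)
    fix i j assume i: "i < dim_row (1\<^sub>m n :: complex mat)" and j: "j < dim_col (1\<^sub>m n :: complex mat)"
    let ?v = "SOME v. v \<in> carrier_vec m \<and> Y *\<^sub>v v = unit_vec n j"
    have "\<exists>v. v \<in> carrier_vec m \<and> Y *\<^sub>v v = unit_vec n j" using ex[of "unit_vec n j"] by auto
    then have v: "?v \<in> carrier_vec m \<and> Y *\<^sub>v ?v = unit_vec n j" by (rule someI_ex)
    have "col R j = ?v" using v j by (intro eq_vecI) (auto simp: R_def)
    then have "(Y * R) $$ (i,j) = (Y *\<^sub>v ?v) $ i" using i j Y R by simp
    then show "(Y * R) $$ (i,j) = 1\<^sub>m n $$ (i,j)" using v i j by simp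
  qed (use Y R in auto)
  with R show ?thesis by (rule that)
qed

text \<open>Kernel and image of the intertwiner \<open>Y\<close> are invariant subspaces. Since
  \<open>Y\<close> is nonzero, irreducibility makes the kernel zero and the image
  everything.\<close>

lemma (in group) schur_iso:
  assumes irr1: "irreducible_rep G n \<rho>" and irr2: "irreducible_rep G m \<rho>'"
    and Y: "Y \<in> carrier_mat n m" and Y0: "Y \<noteq> 0\<^sub>m n m"
    and comm: "\<And>g. g \<in> carrier G \<Longrightarrow> \<rho> g * Y = Y * \<rho>' g"
  obtains R where "m = n" "R \<in> carrier_mat n n" "Y * R = 1\<^sub>m n" "R * Y = 1\<^sub>m n"
proof -
  have rep1: "is_rep G n \<rho>" and rep2: "is_rep G m \<rho>'"
    using irr1 irr2 by (auto simp: irreducible_rep_def)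
  note r1 = is_repD[OF rep1] and r2 = is_repD[OF rep2]
  have act: "\<rho> g *\<^sub>v (Y *\<^sub>v v) = Y *\<^sub>v (\<rho>' g *\<^sub>v v)" if "g \<in> carrier G" "v \<in> carrier_vec m" for g v
    using comm[OF that(1)] assoc_mult_mat_vec[OF r1(2)[OF that(1)] Y that(2)]
      assoc_mult_mat_vec[OF Y r2(2)[OF that(1)] that(2)] by simp
  define K where "K = {v \<in> carrier_vec m. Y *\<^sub>v v = 0\<^sub>v n}"
  have Ksub: "subspace class_ring K (module_vec TYPE(complex) m)"
    by (rule module_vec_subspaceI)
      (use Y in \<open>auto simp: K_def mult_add_distrib_mat_vec[of _ n m] mult_mat_vec[of _ n m]\<close>)
  have Kinv: "\<forall>g\<in>carrier G. \<forall>w\<in>K. \<rho>' g *\<^sub>v w \<in> K"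
  proof (intro ballI)
    fix g w assume g: "g \<in> carrier G" and w: "w \<in> K"
    then have "Y *\<^sub>v (\<rho>' g *\<^sub>v w) = \<rho> g *\<^sub>v 0\<^sub>v n" using act[of g w] by (simp add: K_def)
    then show "\<rho>' g *\<^sub>v w \<in> K"
      using r1(2)[OF g] r2(2)[OF g] w by (auto simp: K_def)
  qed
  have "K = {0\<^sub>v m} \<or> K = carrier_vec m"
    using irr2 Ksub Kinv by (auto simp: irreducible_rep_def)
  moreover have "K \<noteq> carrier_vec m"
  proof
    assume K: "K = carrier_vec m"
    have "Y = 0\<^sub>m n m"
      by (rule eq_mat_by_vec[OF Y]) (use K in \<open>auto simp: K_def zero_mat_mult_vec\<close>)
    with Y0 show False by simp
  qed
  ultimately have K: "K = {0\<^sub>v m}" by blast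
  define I where "I = (\<lambda>v. Y *\<^sub>v v) ` carrier_vec m"
  have Isub: "subspace class_ring I (module_vec TYPE(complex) n)"
  proof (rule module_vec_subspaceI)
    show "I \<subseteq> carrier_vec n" using Y by (auto simp: I_def)
    show "0\<^sub>v n \<in> I" unfolding I_def using Y by (intro image_eqI[of _ _ "0\<^sub>v m"]) auto
    show "v + w \<in> I" if "v \<in> I" "w \<in> I" for v w
    proof -
      from that obtain x y where "x \<in> carrier_vec m" "v = Y *\<^sub>v x" "y \<in> carrier_vec m" "w = Y *\<^sub>v y"
        by (auto simp: I_def)
      then have "v + w = Y *\<^sub>v (x + y)" "x + y \<in> carrier_vec m"
        using mult_add_distrib_mat_vec[OF Y] by auto
      then show ?thesis by (auto simp: I_def)
    qed
    show "c \<cdot>\<^sub>v v \<in> I" if "v \<in> I" for c v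
    proof -
      from that obtain x where "x \<in> carrier_vec m" "v = Y *\<^sub>v x" by (auto simp: I_def)
      then have "c \<cdot>\<^sub>v v = Y *\<^sub>v (c \<cdot>\<^sub>v x)" "c \<cdot>\<^sub>v x \<in> carrier_vec m"
        using mult_mat_vec[OF Y] by auto
      then show ?thesis by (auto simp: I_def)
    qed
  qed
  have Iinv: "\<forall>g\<in>carrier G. \<forall>w\<in>I. \<rho> g *\<^sub>v w \<in> I"
  proof (intro ballI)
    fix g w assume g: "g \<in> carrier G" and "w \<in> I"
    then obtain v where v: "v \<in> carrier_vec m" "w = Y *\<^sub>v v" by (auto simp: I_def)
    show "\<rho> g *\<^sub>v w \<in> I" unfolding v(2) act[OF g v(1)] I_def
      using r2(2)[OF g] v(1) by (intro imageI) auto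
  qed
  have "I = {0\<^sub>v n} \<or> I = carrier_vec n"
    using irr1 Isub Iinv by (auto simp: irreducible_rep_def)
  moreover have "I \<noteq> {0\<^sub>v n}"
  proof
    assume I: "I = {0\<^sub>v n}"
    have "Y = 0\<^sub>m n m"
      by (rule eq_mat_by_vec[OF Y]) (use I in \<open>auto simp: I_def zero_mat_mult_vec\<close>)
    with Y0 show False by simp
  qed
  ultimately have I: "I = carrier_vec n" by blast
  obtain R where R: "R \<in> carrier_mat m n" "Y * R = 1\<^sub>m n"
  proof (rule mat_right_inverse_of_surj[OF Y])
    show "\<exists>v\<in>carrier_vec m. Y *\<^sub>v v = w" if "w \<in> carrier_vec n" for w
      using that unfolding I[symmetric] I_def by auto
  qed
  have RY: "R * Y = 1\<^sub>m m"
  proof (rule eq_mat_by_vec[of _ m m])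
    fix v :: "complex vec" assume v: "v \<in> carrier_vec m"
    let ?u = "R *\<^sub>v (Y *\<^sub>v v)"
    have u: "?u \<in> carrier_vec m" using R Y v by auto
    have "Y *\<^sub>v ?u = Y *\<^sub>v v"
      using assoc_mult_mat_vec[OF Y R(1), of "Y *\<^sub>v v"] R(2) Y v by simp
    then have "Y *\<^sub>v (?u - v) = 0\<^sub>v n"
      using Y u v by (simp add: mult_minus_distrib_mat_vec[of _ n m])
    then have "?u - v \<in> K" unfolding K_def using minus_carrier_vec[OF u v] by blast
    then have diff: "?u - v = 0\<^sub>v m" unfolding K by blast
    have "?u = v"
    proof (rule eq_vecI)
      fix i assume "i < dim_vec v"
      then have i: "i < m" using v by simp
      have "(?u - v) $ i = 0" unfolding diff using i by simp
      then show "?u $ i = v $ i" using i u v by simp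
    qed (use R v in simp)
    then show "R * Y *\<^sub>v v = 1\<^sub>m m *\<^sub>v v" using R Y v by (simp add: assoc_mult_mat_vec[of _ m n _ m])
  qed (use R Y in auto)
  \<comment> \<open>The traces of \<open>Y * R\<close> and \<open>R * Y\<close> agree, and both
    products are identity matrices; this compares the two dimensions.\<close>
  have "of_nat n = (of_nat m :: complex)"
    using tr_mult_commute[OF Y R(1)] R(2) RY by simp
  then have "m = n" by simp
  then show ?thesis using that R RY by blast
qed

text \<open>Over the complex numbers \<open>Y\<close> has an eigenvalue \<open>c\<close>. Then
  \<open>Y - c\<close> is an intertwiner with nonzero kernel, so by \<open>schur_iso\<close> it
  vanishes.\<close>

lemma (in group) schur_scalar:
  assumes irr: "irreducible_rep G n \<rho>" and Y: "Y \<in> carrier_mat n n"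
    and comm: "\<And>g. g \<in> carrier G \<Longrightarrow> \<rho> g * Y = Y * \<rho> g"
  obtains c where "Y = c \<cdot>\<^sub>m 1\<^sub>m n"
proof -
  have rep: "is_rep G n \<rho>" using irr by (simp add: irreducible_rep_def)
  note r = is_repD[OF rep]
  have "degree (char_poly Y) = n" using degree_monic_char_poly[OF Y] by simp
  then have "\<not> constant (poly (char_poly Y))" using r(1) by (simp add: constant_degree)
  then obtain c where "poly (char_poly Y) c = 0" using fundamental_theorem_of_algebra by blast
  then have "eigenvalue Y c" using eigenvalue_root_char_poly[OF Y] by simp
  then obtain v where v: "v \<in> carrier_vec n" "v \<noteq> 0\<^sub>v n" "Y *\<^sub>v v = c \<cdot>\<^sub>v v"
    using Y by (auto simp: eigenvalue_def eigenvector_def)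
  let ?Z = "Y - c \<cdot>\<^sub>m 1\<^sub>m n"
  have Z: "?Z \<in> carrier_mat n n" using Y by auto
  have "?Z = 0\<^sub>m n n"
  proof (rule ccontr)
    assume "?Z \<noteq> 0\<^sub>m n n"
    moreover have "\<rho> g * ?Z = ?Z * \<rho> g" if g: "g \<in> carrier G" for g
      using comm[OF g] r(2)[OF g] Y
      by (simp add: mult_minus_distrib_mat[of _ n n _ n] minus_mult_distrib_mat[of _ n n _ _ n]
          mult_smult_distrib[of _ n n _ n] mult_smult_assoc_mat[of _ n n _ n])
    ultimately obtain R where R: "R \<in> carrier_mat n n" "R * ?Z = 1\<^sub>m n"
      using schur_iso[OF irr irr Z] by metis
    have Zv: "?Z *\<^sub>v v = 0\<^sub>v n" using v Y by (simp add: minus_mult_distrib_mat_vec[of _ n n] smult_one_mult_vec)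
    have "R * ?Z *\<^sub>v v = R *\<^sub>v (?Z *\<^sub>v v)" by (rule assoc_mult_mat_vec[OF R(1) Z v(1)])
    also have "\<dots> = 0\<^sub>v n" unfolding Zv using R(1) by auto
    finally have "R * ?Z *\<^sub>v v = 0\<^sub>v n" .
    with R(2) v show False by simp
  qed
  then have "Y = c \<cdot>\<^sub>m 1\<^sub>m n"
    using Y by (intro eq_matI) (auto simp: mat_eq_iff)
  then show ?thesis by (rule that)
qed

section \<open>Averaged intertwiners and the orthogonality sums\<close>

lemma (in group) sum_left_translate:
  assumes "h \<in> carrier G"
  shows "(\<Sum>g\<in>carrier G. f (h \<otimes> g)) = (\<Sum>g\<in>carrier G. f g)"
  by (rule sum.reindex_bij_witness[of _ "\<lambda>g. inv h \<otimes> g" "\<lambda>g. h \<otimes> g"])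
    (use assms in \<open>auto simp flip: m_assoc\<close>)

text \<open>\<open>Y\<close> is the sum over the group of
  \<open>\<rho> g * E * \<rho>' (inv g)\<close>, where \<open>E\<close> is the elementary matrix
  with its 1 in position \<open>(j,k)\<close>. Averages of this form intertwine, by translation of
  the summation variable.\<close>

lemma (in group) schur_average_intertwines:
  assumes rep1: "is_rep G n \<rho>" and rep2: "is_rep G m \<rho>'" and j: "j < n" and k: "k < m"
    and h: "h \<in> carrier G"
  defines "Y \<equiv> mat n m (\<lambda>(i,l). \<Sum>g\<in>carrier G. \<rho> g $$ (i,j) * \<rho>' (inv g) $$ (k,l))"
  shows "\<rho> h * Y = Y * \<rho>' h"
proof (rule eq_matI)
  note r1 = is_repD[OF rep1] and r2 = is_repD[OF rep2]
  have Y: "Y \<in> carrier_mat n m" by (simp add: Y_def)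
  show "dim_row (\<rho> h * Y) = dim_row (Y * \<rho>' h)" "dim_col (\<rho> h * Y) = dim_col (Y * \<rho>' h)"
    using r1(2)[OF h] r2(2)[OF h] Y by auto
  fix i l assume "i < dim_row (Y * \<rho>' h)" "l < dim_col (Y * \<rho>' h)"
  then have i: "i < n" and l: "l < m" using Y r2(2)[OF h] by auto
  have "(\<rho> h * Y) $$ (i,l) = (\<Sum>a<n. \<Sum>g\<in>carrier G. \<rho> h $$ (i,a) * \<rho> g $$ (a,j) * \<rho>' (inv g) $$ (k,l))"
    unfolding mult_mat_index[OF r1(2)[OF h] Y i l] using l by (simp add: Y_def sum_distrib_left mult.assoc)
  also have "\<dots> = (\<Sum>g\<in>carrier G. (\<Sum>a<n. \<rho> h $$ (i,a) * \<rho> g $$ (a,j)) * \<rho>' (inv g) $$ (k,l))"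
    by (subst sum.swap) (simp add: sum_distrib_right)
  also have "\<dots> = (\<Sum>g\<in>carrier G. \<rho> (h \<otimes> g) $$ (i,j) * \<rho>' (inv g) $$ (k,l))"
    using mult_mat_index[OF r1(2)[OF h] r1(2) i j] r1(3)[OF h] by (intro sum.cong) auto
  \<comment> \<open>Rewriting \<open>inv g\<close> through \<open>h \<otimes> g\<close> makes the
    summand a function of \<open>h \<otimes> g\<close> alone, so that translation applies.\<close>
  also have "\<dots> = (\<Sum>g\<in>carrier G. \<rho> (h \<otimes> g) $$ (i,j) * \<rho>' (inv (h \<otimes> g) \<otimes> h) $$ (k,l))"
    using h by (intro sum.cong) (auto simp: inv_mult_group m_assoc)
  also have "\<dots> = (\<Sum>g\<in>carrier G. \<rho> g $$ (i,j) * \<rho>' (inv g \<otimes> h) $$ (k,l))"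
    by (rule sum_left_translate[OF h, of "\<lambda>g. \<rho> g $$ (i,j) * \<rho>' (inv g \<otimes> h) $$ (k,l)"])
  also have "\<dots> = (\<Sum>g\<in>carrier G. \<rho> g $$ (i,j) * (\<Sum>a<m. \<rho>' (inv g) $$ (k,a) * \<rho>' h $$ (a,l)))"
    using mult_mat_index[OF r2(2) r2(2)[OF h] k l] r2(3)[OF _ h] by (intro sum.cong) auto
  also have "\<dots> = (\<Sum>a<m. \<Sum>g\<in>carrier G. \<rho> g $$ (i,j) * \<rho>' (inv g) $$ (k,a) * \<rho>' h $$ (a,l))"
    by (subst sum.swap) (simp add: sum_distrib_left mult.assoc)
  also have "\<dots> = (Y * \<rho>' h) $$ (i,l)"
    unfolding mult_mat_index[OF Y r2(2)[OF h] i l] using i by (simp add: Y_def sum_distrib_right)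
  finally show "(\<rho> h * Y) $$ (i,l) = (Y * \<rho>' h) $$ (i,l)" .
qed

text \<open>A nonzero average \<open>Y j k\<close> would be an isomorphism and force equal traces.
  So all averages vanish, and the sum in question is the sum of the entries \<open>(i,k)\<close> of
  \<open>Y i k\<close>.\<close>

lemma (in group) irreducible_orthogonal:
  assumes irr1: "irreducible_rep G n \<rho>" and irr2: "irreducible_rep G m \<rho>'"
    and neq: "rep_char G n \<rho> \<noteq> rep_char G m \<rho>'"
  shows "(\<Sum>g\<in>carrier G. rep_char G n \<rho> g * rep_char G m \<rho>' (inv g)) = 0"
proof -
  have rep1: "is_rep G n \<rho>" and rep2: "is_rep G m \<rho>'"
    using irr1 irr2 by (auto simp: irreducible_rep_def)
  note r1 = is_repD[OF rep1] and r2 = is_repD[OF rep2]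
  define Y where "Y j k = mat n m (\<lambda>(i,l). \<Sum>g\<in>carrier G. \<rho> g $$ (i,j) * \<rho>' (inv g) $$ (k,l))" for j k
  have Y: "Y j k \<in> carrier_mat n m" for j k by (simp add: Y_def)
  have Y0: "Y j k = 0\<^sub>m n m" if j: "j < n" and k: "k < m" for j k
  proof (rule ccontr)
    assume nz: "Y j k \<noteq> 0\<^sub>m n m"
    have comm: "\<rho> g * Y j k = Y j k * \<rho>' g" if "g \<in> carrier G" for g
      using schur_average_intertwines[OF rep1 rep2 j k that] by (simp add: Y_def)
    obtain R where mn: "m = n" and R: "R \<in> carrier_mat n n" "Y j k * R = 1\<^sub>m n" "R * Y j k = 1\<^sub>m n"
      using schur_iso[OF irr1 irr2 Y nz comm] by metis
    have "tr n (\<rho> g) = tr m (\<rho>' g)" if g: "g \<in> carrier G" for g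
    proof -
      have Yn: "Y j k \<in> carrier_mat n n" using Y mn by metis
      have r2n: "\<rho>' g \<in> carrier_mat n n" using r2(2)[OF g] mn by metis
      have "R * \<rho> g * Y j k = R * (Y j k * \<rho>' g)"
        using comm[OF g] assoc_mult_mat[OF R(1) r1(2)[OF g] Yn] by simp
      also have "\<dots> = \<rho>' g" using assoc_mult_mat[OF R(1) Yn r2n] R(3) r2n by simp
      finally show ?thesis using tr_similar[OF r1(2)[OF g] Yn R(1,2)] mn by simp
    qed
    then show False using neq by (auto simp: rep_char_def fun_eq_iff split: if_splits)
  qed
  have "(\<Sum>g\<in>carrier G. rep_char G n \<rho> g * rep_char G m \<rho>' (inv g))
      = (\<Sum>g\<in>carrier G. \<Sum>i<n. \<Sum>k<m. \<rho> g $$ (i,i) * \<rho>' (inv g) $$ (k,k))"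
    by (simp add: rep_char_def sum_product)
  also have "\<dots> = (\<Sum>i<n. \<Sum>k<m. \<Sum>g\<in>carrier G. \<rho> g $$ (i,i) * \<rho>' (inv g) $$ (k,k))"
    by (subst sum.swap, rule sum.cong[OF refl], rule sum.swap)
  also have "\<dots> = (\<Sum>i<n. \<Sum>k<m. Y i k $$ (i,k))" by (simp add: Y_def)
  also have "\<dots> = 0" using Y0 by simp
  finally show ?thesis .
qed

text \<open>Each average is scalar by Schur. Its trace is the order of the group if
  \<open>j = k\<close> and 0 otherwise, which determines the scalar.\<close>

lemma (in group) irreducible_norm:
  assumes irr: "irreducible_rep G n \<rho>"
  shows "(\<Sum>g\<in>carrier G. rep_char G n \<rho> g * rep_char G n \<rho> (inv g)) = of_nat (Coset.order G)"
proof -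
  have rep: "is_rep G n \<rho>" using irr by (auto simp: irreducible_rep_def)
  note r = is_repD[OF rep]
  define Y where "Y j k = mat n n (\<lambda>(i,l). \<Sum>g\<in>carrier G. \<rho> g $$ (i,j) * \<rho> (inv g) $$ (k,l))" for j k
  have Y: "Y j k \<in> carrier_mat n n" for j k by (simp add: Y_def)
  have diag: "Y j k $$ (j,k) = (if j = k then of_nat (Coset.order G) / of_nat n else 0)"
    if j: "j < n" and k: "k < n" for j k
  proof -
    have comm: "\<rho> g * Y j k = Y j k * \<rho> g" if "g \<in> carrier G" for g
      using schur_average_intertwines[OF rep rep j k that] by (simp add: Y_def)
    obtain c where c: "Y j k = c \<cdot>\<^sub>m 1\<^sub>m n" using schur_scalar[OF irr Y comm] by metis
    have "of_nat n * c = tr n (Y j k)" by (simp add: c)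
    also have "\<dots> = (\<Sum>g\<in>carrier G. \<Sum>i<n. \<rho> (inv g) $$ (k,i) * \<rho> g $$ (i,j))"
      by (simp add: Y_def mult.commute) (rule sum.swap)
    also have "\<dots> = (\<Sum>g\<in>carrier G. (\<rho> (inv g) * \<rho> g) $$ (k,j))"
      using mult_mat_index[OF r(2) r(2) k j] by (intro sum.cong) auto
    also have "\<dots> = (\<Sum>g\<in>carrier G. if j = k then 1 else 0)"
      using j k r(4) by (intro sum.cong) (auto simp flip: r(3))
    finally have "of_nat n * c = (if j = k then of_nat (Coset.order G) else 0)" by (simp add: Coset.order_def)
    then have "c = (if j = k then of_nat (Coset.order G) / of_nat n else 0)"
      using r(1) by (auto simp: field_simps)
    then show ?thesis using j k by (auto simp: c)
  qed
  have "(\<Sum>g\<in>carrier G. rep_char G n \<rho> g * rep_char G n \<rho> (inv g))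
      = (\<Sum>g\<in>carrier G. \<Sum>i<n. \<Sum>k<n. \<rho> g $$ (i,i) * \<rho> (inv g) $$ (k,k))"
    by (simp add: rep_char_def sum_product)
  also have "\<dots> = (\<Sum>i<n. \<Sum>k<n. \<Sum>g\<in>carrier G. \<rho> g $$ (i,i) * \<rho> (inv g) $$ (k,k))"
    by (subst sum.swap, rule sum.cong[OF refl], rule sum.swap)
  also have "\<dots> = (\<Sum>i<n. \<Sum>k<n. Y i k $$ (i,k))" by (simp add: Y_def)
  also have "\<dots> = (\<Sum>i<n. \<Sum>k<n. if i = k then of_nat (Coset.order G) / of_nat n else 0)"
    using diag by simp
  also have "\<dots> = of_nat (Coset.order G)" using r(1) by simp
  finally show ?thesis .
qed

section \<open>Characters and orthogonality\<close>

text \<open>The image of the group algebra element with coefficients \<open>c\<close>. Its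
  determinant will decide whether such an element acts invertibly.\<close>

definition rep_sum ::
  "('a, 'b) monoid_scheme \<Rightarrow> nat \<Rightarrow> ('a \<Rightarrow> complex) \<Rightarrow> ('a \<Rightarrow> complex mat) \<Rightarrow> complex mat" where
  "rep_sum G n c \<rho> = mat n n (\<lambda>(i,j). \<Sum>g\<in>carrier G. c g * \<rho> g $$ (i,j))"

lemma mat_eqI:
  assumes "A \<in> carrier_mat n m" "B \<in> carrier_mat n m"
    "\<And>i j. i < n \<Longrightarrow> j < m \<Longrightarrow> A $$ (i,j) = B $$ (i,j)"
  shows "A = B"
  using assms by (intro eq_matI) auto

lemma sum_lessThan_add:
  "(\<Sum>i<k + m. f i) = (\<Sum>i<k. f i) + (\<Sum>i<m. f (i + k :: nat) :: 'a :: comm_monoid_add)"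
  by (induct m) (auto simp: add.assoc add.commute[of k])

lemma rep_sum_carrier: "rep_sum G n c \<rho> \<in> carrier_mat n n"
  by (simp add: rep_sum_def)

lemma triple_mult_index:
  assumes T: "T \<in> carrier_mat n n" and M: "M \<in> carrier_mat n n" and S: "S \<in> carrier_mat n n"
    and i: "i < n" and j: "j < n"
  shows "(T * M * S) $$ (i,j) = (\<Sum>b<n. \<Sum>a<n. T $$ (i,a) * M $$ (a,b) * S $$ (b,j))"
proof -
  have TM: "T * M \<in> carrier_mat n n" using T M by simp
  show ?thesis
    unfolding mult_mat_index[OF TM S i j] using mult_mat_index[OF T M i]
    by (simp add: sum_distrib_right)
qed

lemma rep_sum_similar:
  assumes \<rho>: "\<And>g. g \<in> carrier G \<Longrightarrow> \<rho> g \<in> carrier_mat n n"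
    and T: "T \<in> carrier_mat n n" and S: "S \<in> carrier_mat n n"
  shows "rep_sum G n c (\<lambda>g. T * \<rho> g * S) = T * rep_sum G n c \<rho> * S"
proof (rule eq_matI)
  fix i j assume "i < dim_row (T * rep_sum G n c \<rho> * S)" "j < dim_col (T * rep_sum G n c \<rho> * S)"
  then have i: "i < n" and j: "j < n" using T S by auto
  have "(T * rep_sum G n c \<rho> * S) $$ (i,j)
      = (\<Sum>b<n. \<Sum>a<n. \<Sum>g\<in>carrier G. c g * (T $$ (i,a) * \<rho> g $$ (a,b) * S $$ (b,j)))"
    unfolding triple_mult_index[OF T rep_sum_carrier S i j]
    by (simp add: rep_sum_def sum_distrib_left sum_distrib_right mult_ac)
  also have "\<dots> = (\<Sum>b<n. \<Sum>g\<in>carrier G. \<Sum>a<n. c g * (T $$ (i,a) * \<rho> g $$ (a,b) * S $$ (b,j)))"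
    by (rule sum.cong[OF refl]) (rule sum.swap)
  also have "\<dots> = (\<Sum>g\<in>carrier G. \<Sum>b<n. \<Sum>a<n. c g * (T $$ (i,a) * \<rho> g $$ (a,b) * S $$ (b,j)))"
    by (rule sum.swap)
  also have "\<dots> = (\<Sum>g\<in>carrier G. c g * (T * \<rho> g * S) $$ (i,j))"
    using triple_mult_index[OF T \<rho> S i j] by (simp add: sum_distrib_left)
  also have "\<dots> = rep_sum G n c (\<lambda>g. T * \<rho> g * S) $$ (i,j)" using i j by (simp add: rep_sum_def)
  finally show "rep_sum G n c (\<lambda>g. T * \<rho> g * S) $$ (i,j) = (T * rep_sum G n c \<rho> * S) $$ (i,j)" by simp
qed (use T S in \<open>auto simp: rep_sum_def\<close>)

text \<open>One change of basis makes all \<open>\<rho> g\<close> block triangular at once. Hence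
  traces add, and determinants multiply for every linear combination of the \<open>\<rho> g\<close>;
  these two facts are all that later inductions on the dimension use.\<close>

lemma (in group) reducible_blocks:
  assumes rep: "is_rep G n \<rho>" and red: "\<not> irreducible_rep G n \<rho>"
  obtains k m A D where "n = k + m" "is_rep G k A" "is_rep G m D"
    "\<And>g. rep_char G n \<rho> g = rep_char G k A g + rep_char G m D g"
    "\<And>c. det (rep_sum G n c \<rho>) = det (rep_sum G k c A) * det (rep_sum G m c D)"
proof -
  note r = is_repD[OF rep]
  obtain W where W: "subspace class_ring W (module_vec TYPE(complex) n)"
    and Winv: "\<And>g w. g \<in> carrier G \<Longrightarrow> w \<in> W \<Longrightarrow> \<rho> g *\<^sub>v w \<in> W"
    and W0: "W \<noteq> {0\<^sub>v n}" and W1: "W \<noteq> carrier_vec n"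
    using rep red by (auto simp: irreducible_rep_def)
  obtain S T k where S: "S \<in> carrier_mat n n" and T: "T \<in> carrier_mat n n"
    and ST: "S * T = 1\<^sub>m n" and TS: "T * S = 1\<^sub>m n" and k: "0 < k" "k < n"
    and Wc: "\<And>w. w \<in> carrier_vec n \<Longrightarrow> w \<in> W \<longleftrightarrow> (\<forall>i. k \<le> i \<and> i < n \<longrightarrow> (T *\<^sub>v w) $ i = 0)"
    using subspace_coordinates[OF W W0 W1] by metis
  define m where "m = n - k"
  have n: "n = k + m" and m: "0 < m" using k by (auto simp: m_def)
  define M where "M g = T * \<rho> g * S" for g
  have Mc: "M g \<in> carrier_mat n n" if "g \<in> carrier G" for g using r(2)[OF that] S T by (simp add: M_def)
  have Mmult: "M (g \<otimes> h) = M g * M h" if g: "g \<in> carrier G" and h: "h \<in> carrier G" for g h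
  proof -
    note c = r(2)[OF g] r(2)[OF h] S T
    have "M g * M h = T * \<rho> g * (S * (T * (\<rho> h * S)))"
      using c by (simp add: M_def assoc_mult_mat[of _ n n _ n _ n])
    also have "S * (T * (\<rho> h * S)) = \<rho> h * S"
      using c ST assoc_mult_mat[of S n n T n "\<rho> h * S" n] by simp
    also have "T * \<rho> g * (\<rho> h * S) = M (g \<otimes> h)"
      using c r(3)[OF g h] by (simp add: M_def assoc_mult_mat[of _ n n _ n _ n])
    finally show ?thesis by simp
  qed
  have M1: "M \<one> = 1\<^sub>m n" using r(4) T TS by (simp add: M_def)
  \<comment> \<open>The first \<open>k\<close> columns of \<open>S\<close> lie in \<open>W\<close>,
    and \<open>W\<close> is invariant, so their images have no coordinates from \<open>k\<close>
    on.\<close>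
  have low: "M g $$ (i,j) = 0" if g: "g \<in> carrier G" and i: "k \<le> i" "i < n" and j: "j < k" for g i j
  proof -
    let ?w = "S *\<^sub>v unit_vec n j"
    have "T *\<^sub>v ?w = unit_vec n j"
      using assoc_mult_mat_vec[OF T S, of "unit_vec n j"] TS by simp
    then have "?w \<in> W" using Wc[of ?w] S j by auto
    then have "\<rho> g *\<^sub>v ?w \<in> W" by (rule Winv[OF g])
    then have "(T *\<^sub>v (\<rho> g *\<^sub>v ?w)) $ i = 0"
      using Wc[of "\<rho> g *\<^sub>v ?w"] i r(2)[OF g] S by auto
    also have "T *\<^sub>v (\<rho> g *\<^sub>v ?w) = M g *\<^sub>v unit_vec n j"
      unfolding M_def using r(2)[OF g] S T
      by (simp add: assoc_mult_mat_vec[of _ n n _ n])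
    finally show ?thesis using Mc[OF g] i j n by simp
  qed
  define A where "A g = mat k k (\<lambda>(i,j). M g $$ (i,j))" for g
  define B where "B g = mat k m (\<lambda>(i,j). M g $$ (i,j + k))" for g
  define D where "D g = mat m m (\<lambda>(i,j). M g $$ (i + k,j + k))" for g
  have block: "M g = four_block_mat (A g) (B g) (0\<^sub>m m k) (D g)" if g: "g \<in> carrier G" for g
    using Mc[OF g] low[OF g] n by (intro eq_matI) (auto simp: A_def B_def D_def)
  have prod: "A (g \<otimes> h) = A g * A h \<and> D (g \<otimes> h) = D g * D h"
    if g: "g \<in> carrier G" and h: "h \<in> carrier G" for g h
  proof -
    have c: "A x \<in> carrier_mat k k" "B x \<in> carrier_mat k m" "D x \<in> carrier_mat m m" for x
      by (auto simp: A_def B_def D_def)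
    have z: "B g * 0\<^sub>m m k = 0\<^sub>m k k" "0\<^sub>m m k * A h = 0\<^sub>m m k" "D g * 0\<^sub>m m k = 0\<^sub>m m k"
      "0\<^sub>m m k * B h = 0\<^sub>m m m"
      using right_mult_zero_mat[OF c(2)[of g]] left_mult_zero_mat[OF c(1)[of h]]
        right_mult_zero_mat[OF c(3)[of g]] left_mult_zero_mat[OF c(2)[of h]] by auto
    have c': "A g * A h \<in> carrier_mat k k" "D g * D h \<in> carrier_mat m m"
      using mult_carrier_mat c by blast+
    have "M g * M h = four_block_mat (A g * A h) (A g * B h + B g * D h) (0\<^sub>m m k) (D g * D h)"
      unfolding block[OF g] block[OF h]
      by (subst mult_four_block_mat[OF c(1,2) zero_carrier_mat c(3) c(1,2) zero_carrier_mat c(3)])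
        (use c' in \<open>simp add: z\<close>)
    then have eq: "four_block_mat (A (g \<otimes> h)) (B (g \<otimes> h)) (0\<^sub>m m k) (D (g \<otimes> h))
       = four_block_mat (A g * A h) (A g * B h + B g * D h) (0\<^sub>m m k) (D g * D h)"
      using Mmult[OF g h] block[of "g \<otimes> h"] g h by simp
    have "A (g \<otimes> h) $$ (i,j) = (A g * A h) $$ (i,j)" if "i < k" "j < k" for i j
      using arg_cong[OF eq, of "\<lambda>X. X $$ (i,j)"] c that by (simp add: A_def D_def)
    moreover have "D (g \<otimes> h) $$ (i,j) = (D g * D h) $$ (i,j)" if "i < m" "j < m" for i j
      using arg_cong[OF eq, of "\<lambda>X. X $$ (i + k,j + k)"] c that by (simp add: A_def D_def)
    ultimately show ?thesis using mat_eqI[OF c(1) c'(1)] mat_eqI[OF c(3) c'(2)] by blast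
  qed
  have repA: "is_rep G k A"
    by (rule is_repI) (use k prod M1 n in \<open>auto simp: A_def intro!: eq_matI\<close>)
  have repD: "is_rep G m D"
    by (rule is_repI) (use m prod M1 n in \<open>auto simp: D_def intro!: eq_matI\<close>)
  have char: "rep_char G n \<rho> g = rep_char G k A g + rep_char G m D g" for g
  proof (cases "g \<in> carrier G")
    case True
    have "tr n (\<rho> g) = tr n (M g)" using tr_similar[OF r(2)[OF True] S T ST] by (simp add: M_def)
    also have "\<dots> = tr k (A g) + tr m (D g)"
      unfolding n by (simp add: A_def D_def sum_lessThan_add)
    finally show ?thesis using True by (simp add: rep_char_def)
  qed (simp add: rep_char_def)
  have det: "det (rep_sum G n c \<rho>) = det (rep_sum G k c A) * det (rep_sum G m c D)" for c
  proof -
    have "det T * det S = 1" using TS T S by (metis det_mult det_one)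
    then have "det (rep_sum G n c \<rho>) = det (T * rep_sum G n c \<rho> * S)"
      using T S rep_sum_carrier[of G n c \<rho>] by (simp add: det_mult[of _ n])
    also have "\<dots> = det (rep_sum G n c M)"
      unfolding M_def by (subst rep_sum_similar) (use r(2) T S in auto)
    also have "rep_sum G n c M = four_block_mat (rep_sum G k c A)
       (mat k m (\<lambda>(i,j). \<Sum>g\<in>carrier G. c g * M g $$ (i,j + k))) (0\<^sub>m m k) (rep_sum G m c D)"
      using n low by (intro eq_matI) (auto simp: rep_sum_def A_def D_def intro!: sum.neutral)
    also have "det \<dots> = det (rep_sum G k c A) * det (rep_sum G m c D)"
      by (rule det_four_block_mat_lower_left_zero) (auto simp: rep_sum_def)
    finally show ?thesis .
  qed
  show ?thesis using that[OF n repA repD char det] .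
qed

section \<open>Decomposition into irreducible characters\<close>

lemma (in group) rep_char_one: "is_rep G n \<rho> \<Longrightarrow> rep_char G n \<rho> \<one> = of_nat n"
  using is_repD(4)[of n \<rho>] by (simp add: rep_char_def)

lemma char_degree_eqI: "\<chi> \<one>\<^bsub>G\<^esub> = of_nat n \<Longrightarrow> char_degree G \<chi> = n"
  unfolding char_degree_def by (rule the_equality) auto

lemma Irr_subset_Chars: "Irr G \<subseteq> Chars G"
  by (auto simp: Irr_def Chars_def irreducible_rep_def)

lemma Chars_outside: "\<chi> \<in> Chars G \<Longrightarrow> g \<notin> carrier G \<Longrightarrow> \<chi> g = 0"
  by (auto simp: Chars_def rep_char_def)

lemma (in group) Chars_one:
  assumes "\<chi> \<in> Chars G" shows "\<chi> \<one> = of_nat (char_degree G \<chi>)" "0 < char_degree G \<chi>"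
proof -
  obtain n \<rho> where "\<chi> = rep_char G n \<rho>" "is_rep G n \<rho>" using assms by (auto simp: Chars_def)
  then have "\<chi> \<one> = of_nat n" "0 < n" using rep_char_one is_repD(1) by auto
  then show "\<chi> \<one> = of_nat (char_degree G \<chi>)" "0 < char_degree G \<chi>"
    using char_degree_eqI[of \<chi> G n] by auto
qed

text \<open>The list collects the characters of the composition factors, with repetition. It is
  nonempty because dimensions are positive.\<close>

lemma (in group) rep_char_sum_Irr:
  assumes "is_rep G n \<rho>"
  shows "\<exists>xs. xs \<noteq> [] \<and> set xs \<subseteq> Irr G \<and> rep_char G n \<rho> = (\<lambda>g. \<Sum>\<psi>\<leftarrow>xs. \<psi> g)"
  using assms
proof (induction n arbitrary: \<rho> rule: less_induct)
  case (less n)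
  show ?case
  proof (cases "irreducible_rep G n \<rho>")
    case True
    then show ?thesis by (intro exI[of _ "[rep_char G n \<rho>]"]) (auto simp: Irr_def)
  next
    case False
    obtain k m A D where n: "n = k + m" and A: "is_rep G k A" and D: "is_rep G m D"
      and sum: "\<And>g. rep_char G n \<rho> g = rep_char G k A g + rep_char G m D g"
      using reducible_blocks[OF less.prems False] by metis
    have "k < n" "m < n" using n is_repD(1)[OF A] is_repD(1)[OF D] by auto
    from less.IH[OF this(1) A] less.IH[OF this(2) D]
    obtain xs ys where "xs \<noteq> []" "set xs \<subseteq> Irr G" "rep_char G k A = (\<lambda>g. \<Sum>\<psi>\<leftarrow>xs. \<psi> g)"
      "set ys \<subseteq> Irr G" "rep_char G m D = (\<lambda>g. \<Sum>\<psi>\<leftarrow>ys. \<psi> g)" by auto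
    then show ?thesis using sum by (intro exI[of _ "xs @ ys"]) (auto simp: fun_eq_iff)
  qed
qed

text \<open>The second factor is evaluated at \<open>inv g\<close> instead of being conjugated; the
  two are identified only in \<open>char_inv\<close>, whose proof already relies on
  decompositions.\<close>

lemma (in group) Irr_orthogonal:
  assumes "\<phi> \<in> Irr G" "\<psi> \<in> Irr G"
  shows "(\<Sum>g\<in>carrier G. \<phi> g * \<psi> (inv g)) = (if \<phi> = \<psi> then of_nat (Coset.order G) else 0)"
proof -
  obtain n \<rho> m \<rho>' where "\<phi> = rep_char G n \<rho>" "irreducible_rep G n \<rho>"
    "\<psi> = rep_char G m \<rho>'" "irreducible_rep G m \<rho>'"
    using assms by (auto simp: Irr_def)
  then show ?thesis using irreducible_orthogonal irreducible_norm by auto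
qed

lemma (in group) Chars_Irr_multiplicity:
  assumes "\<chi> \<in> Chars G" "\<psi> \<in> Irr G"
  shows "\<exists>k::nat. (\<Sum>g\<in>carrier G. \<chi> g * \<psi> (inv g)) = of_nat (k * Coset.order G)"
proof -
  obtain n \<rho> where "\<chi> = rep_char G n \<rho>" "is_rep G n \<rho>" using assms by (auto simp: Chars_def)
  then obtain xs where xs: "set xs \<subseteq> Irr G" "\<chi> = (\<lambda>g. \<Sum>\<psi>\<leftarrow>xs. \<psi> g)"
    using rep_char_sum_Irr by blast
  have "\<exists>k::nat. (\<Sum>g\<in>carrier G. (\<Sum>\<phi>\<leftarrow>ys. \<phi> g) * \<psi> (inv g)) = of_nat (k * Coset.order G)"
    if "set ys \<subseteq> Irr G" for ys using that
  proof (induction ys)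
    case Nil then show ?case by (intro exI[of _ 0]) simp
  next
    case (Cons \<phi> ys)
    then obtain k :: nat where k: "(\<Sum>g\<in>carrier G. (\<Sum>\<phi>\<leftarrow>ys. \<phi> g) * \<psi> (inv g)) = of_nat (k * Coset.order G)"
      by auto
    have "(\<Sum>g\<in>carrier G. (\<Sum>\<phi>\<leftarrow>\<phi> # ys. \<phi> g) * \<psi> (inv g))
      = (\<Sum>g\<in>carrier G. \<phi> g * \<psi> (inv g)) + of_nat (k * Coset.order G)"
      unfolding k[symmetric] by (simp add: ring_distribs sum.distrib)
    also have "\<dots> = of_nat ((k + (if \<phi> = \<psi> then 1 else 0)) * Coset.order G)"
      using Irr_orthogonal[of \<phi> \<psi>] Cons.prems assms(2) by (auto simp: algebra_simps)
    finally show ?case by blast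
  qed
  from this[OF xs(1)] show ?thesis by (simp add: xs(2))
qed

lemma irreducible_rep_dim_one:
  assumes "is_rep G 1 \<rho>" shows "irreducible_rep G 1 \<rho>"
proof -
  have "W = {0\<^sub>v 1} \<or> W = carrier_vec 1"
    if W: "subspace class_ring W (module_vec TYPE(complex) 1)" for W
  proof -
    interpret vec_space "TYPE(complex)" 1 .
    have sm: "LinearCombinations.submodule class_ring W V" using W by (simp add: subspace_def)
    have Wc: "W \<subseteq> carrier_vec 1" using LinearCombinations.submodule.subset[OF sm] unfolding module_vec_simps .
    have z: "0\<^sub>v 1 \<in> W" using LinearCombinations.submodule.zero_closed[OF sm] unfolding module_vec_simps .
    have sc: "c \<cdot>\<^sub>v v \<in> W" if "v \<in> W" for c v
      using LinearCombinations.submodule.smult_closed[OF sm, of c v] that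
      unfolding module_vec_simps by auto
    show ?thesis
    proof (rule disjCI)
      assume "W \<noteq> carrier_vec 1"
      show "W = {0\<^sub>v 1}"
      proof (rule ccontr)
        assume "W \<noteq> {0\<^sub>v 1}"
        then obtain v where v: "v \<in> W" "v \<noteq> 0\<^sub>v 1" using z by blast
        then have vc: "v \<in> carrier_vec 1" using Wc by blast
        have v0: "v $ 0 \<noteq> 0"
        proof
          assume "v $ 0 = 0"
          then have "v = 0\<^sub>v 1" using vc by (intro eq_vecI) auto
          with v(2) show False by simp
        qed
        have "w \<in> W" if w: "w \<in> carrier_vec 1" for w
        proof -
          have "w = (w $ 0 / v $ 0) \<cdot>\<^sub>v v" using w vc v0 by (intro eq_vecI) auto
          then show ?thesis using sc[OF v(1)] by metis
        qed
        then show False using Wc \<open>W \<noteq> carrier_vec 1\<close> by blast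
      qed
    qed
  qed
  then show ?thesis using assms by (auto simp: irreducible_rep_def)
qed

section \<open>Linear characters and abelian groups\<close>

lemma (in group) LinI:
  assumes "\<And>g. g \<notin> carrier G \<Longrightarrow> \<nu> g = 0" "\<nu> \<one> = 1"
    "\<And>g h. g \<in> carrier G \<Longrightarrow> h \<in> carrier G \<Longrightarrow> \<nu> (g \<otimes> h) = \<nu> g * \<nu> h"
  shows "\<nu> \<in> Lin G" "\<nu> \<in> Irr G"
proof -
  let ?\<rho> = "\<lambda>g. mat 1 1 (\<lambda>_. \<nu> g)"
  have rep: "is_rep G 1 ?\<rho>"
    by (rule is_repI) (use assms in \<open>auto intro!: eq_matI simp: scalar_prod_def\<close>)
  have eq: "rep_char G 1 ?\<rho> = \<nu>" using assms(1) by (auto simp: rep_char_def)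
  have irr: "irreducible_rep G 1 ?\<rho>" by (rule irreducible_rep_dim_one[OF rep])
  show "\<nu> \<in> Irr G" unfolding Irr_def
    by (rule CollectI, intro exI conjI, rule eq[symmetric], rule irr)
  then have "\<nu> \<in> Chars G" using Irr_subset_Chars by blast
  moreover have "char_degree G \<nu> = 1" by (rule char_degree_eqI) (use assms(2) in simp)
  ultimately show "\<nu> \<in> Lin G" by (simp add: Lin_def)
qed

lemma (in group) LinD:
  assumes "\<nu> \<in> Lin G"
  shows "\<And>g. g \<notin> carrier G \<Longrightarrow> \<nu> g = 0" "\<nu> \<one> = 1"
    "\<And>g h. g \<in> carrier G \<Longrightarrow> h \<in> carrier G \<Longrightarrow> \<nu> (g \<otimes> h) = \<nu> g * \<nu> h"
    "\<nu> \<in> Irr G"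
proof -
  have ch: "\<nu> \<in> Chars G" and deg: "char_degree G \<nu> = 1" using assms by (auto simp: Lin_def)
  show out: "\<And>g. g \<notin> carrier G \<Longrightarrow> \<nu> g = 0" by (rule Chars_outside[OF ch])
  show one: "\<nu> \<one> = 1" using Chars_one[OF ch] deg by simp
  obtain n \<rho> where \<rho>: "\<nu> = rep_char G n \<rho>" "is_rep G n \<rho>" using ch by (auto simp: Chars_def)
  have n: "n = 1" using rep_char_one[OF \<rho>(2)] one \<rho>(1) by simp
  note r = is_repD[OF \<rho>(2)[unfolded n]]
  show mult: "\<nu> (g \<otimes> h) = \<nu> g * \<nu> h" if g: "g \<in> carrier G" and h: "h \<in> carrier G" for g h
    using that mult_mat_index[OF r(2)[OF g] r(2)[OF h], of 0 0] r(3)[OF g h]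
    by (simp add: \<rho>(1) n rep_char_def)
  show "\<nu> \<in> Irr G" by (rule LinI(2)[OF out one mult])
qed

lemma (in group) Lin_pow:
  assumes "\<nu> \<in> Lin G" "g \<in> carrier G" shows "\<nu> (g [^] (n::nat)) = \<nu> g ^ n"
  by (induction n) (use LinD[OF assms(1)] assms(2) in auto)

text \<open>Every \<open>\<rho> g\<close> commutes with the whole representation and is scalar by
  Schur. Then the first coordinate axis is invariant, which is impossible for an irreducible
  representation of dimension above 1.\<close>

lemma (in group) commuting_irreducible_dim_one:
  assumes irr: "irreducible_rep G n \<rho>"
    and comm: "\<And>g h. g \<in> carrier G \<Longrightarrow> h \<in> carrier G \<Longrightarrow> \<rho> g * \<rho> h = \<rho> h * \<rho> g"
  shows "n = 1"
proof (rule ccontr)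
  assume n1: "n \<noteq> 1"
  have rep: "is_rep G n \<rho>" using irr by (simp add: irreducible_rep_def)
  note r = is_repD[OF rep]
  have n: "1 < n" using r(1) n1 by simp
  have scal: "\<exists>c. \<rho> g = c \<cdot>\<^sub>m 1\<^sub>m n" if g: "g \<in> carrier G" for g
    using schur_scalar[OF irr r(2)[OF g] comm[OF _ g]] by metis
  define W where "W = {v \<in> carrier_vec n. \<forall>i<n. 0 < i \<longrightarrow> v $ i = (0::complex)}"
  have "subspace class_ring W (module_vec TYPE(complex) n)"
    by (rule module_vec_subspaceI) (auto simp: W_def)
  moreover have "\<forall>g\<in>carrier G. \<forall>w\<in>W. \<rho> g *\<^sub>v w \<in> W"
  proof (intro ballI)
    fix g w assume g: "g \<in> carrier G" and w: "w \<in> W"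
    obtain c where "\<rho> g = c \<cdot>\<^sub>m 1\<^sub>m n" using scal[OF g] by blast
    then show "\<rho> g *\<^sub>v w \<in> W" using w by (auto simp: W_def smult_one_mult_vec)
  qed
  ultimately have "W = {0\<^sub>v n} \<or> W = carrier_vec n" using irr by (simp add: irreducible_rep_def)
  moreover have "unit_vec n 0 \<in> W" using n by (auto simp: W_def)
  moreover have "unit_vec n 0 \<noteq> (0\<^sub>v n :: complex vec)"
  proof
    assume "unit_vec n 0 = (0\<^sub>v n :: complex vec)"
    from arg_cong[OF this, of "\<lambda>v. v $ 0"] show False using n by simp
  qed
  moreover have "unit_vec n 1 \<notin> W" using n by (auto simp: W_def)
  ultimately show False by (metis singletonD unit_vec_carrier)
qed

lemma (in group) subgroup_rep:
  assumes H: "subgroup H G" and rep: "is_rep G n \<rho>"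
  shows "is_rep (G\<lparr>carrier := H\<rparr>) n \<rho>"
    "rep_char (G\<lparr>carrier := H\<rparr>) n \<rho> = char_res H (rep_char G n \<rho>)"
proof -
  interpret H: group "G\<lparr>carrier := H\<rparr>" by (rule subgroup_imp_group[OF H])
  note r = is_repD[OF rep]
  show "is_rep (G\<lparr>carrier := H\<rparr>) n \<rho>"
    by (rule H.is_repI) (use r subgroup.mem_carrier[OF H] in auto)
  show "rep_char (G\<lparr>carrier := H\<rparr>) n \<rho> = char_res H (rep_char G n \<rho>)"
    using subgroup.mem_carrier[OF H] by (auto simp: rep_char_def char_res_def)
qed

lemma (in group) Chars_res:
  assumes "subgroup H G" "\<chi> \<in> Chars G" shows "char_res H \<chi> \<in> Chars (G\<lparr>carrier := H\<rparr>)"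
proof -
  obtain n \<rho> where "\<chi> = rep_char G n \<rho>" "is_rep G n \<rho>" using assms(2) by (auto simp: Chars_def)
  then show ?thesis using subgroup_rep[OF assms(1), of n \<rho>]
    unfolding Chars_def by (metis (mono_tags, lifting) mem_Collect_eq)
qed

lemma (in group) pow_order_one_char:
  assumes "\<nu> \<in> Lin G" "finite (carrier G)" "g \<in> carrier G"
  shows "\<nu> g ^ Coset.order G = 1"
  using Lin_pow[OF assms(1,3), of "Coset.order G"] pow_order_eq_1[OF assms(3)] LinD(2)[OF assms(1)]
  by simp

lemma (in comm_group) Irr_subset_Lin: "Irr G \<subseteq> Lin G"
proof
  fix \<psi> assume \<psi>: "\<psi> \<in> Irr G"
  then obtain n \<rho> where \<rho>: "\<psi> = rep_char G n \<rho>" "irreducible_rep G n \<rho>" by (auto simp: Irr_def)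
  then have rep: "is_rep G n \<rho>" by (simp add: irreducible_rep_def)
  have "n = 1"
    by (rule commuting_irreducible_dim_one[OF \<rho>(2)]) (metis is_repD(3)[OF rep] m_comm)
  then have "char_degree G \<psi> = 1"
    using rep_char_one[OF rep] \<rho>(1) char_degree_eqI[of \<psi> G 1] by simp
  then show "\<psi> \<in> Lin G" using \<psi> Irr_subset_Chars by (auto simp: Lin_def)
qed

lemma (in group) generate_single_comm:
  assumes "a \<in> carrier G" shows "comm_group (G\<lparr>carrier := generate G {a}\<rparr>)"
proof -
  have "group (G\<lparr>carrier := generate G {a}\<rparr>)"
    using assms generate_is_subgroup[of "{a}"] by (simp add: subgroup_imp_group)
  then show ?thesis
  proof (rule group.group_comm_groupI)
    fix x y assume "x \<in> carrier (G\<lparr>carrier := generate G {a}\<rparr>)" "y \<in> carrier (G\<lparr>carrier := generate G {a}\<rparr>)"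
    then obtain i j :: int where "x = a [^] i" "y = a [^] j" using generate_pow[OF assms] by auto
    then show "x \<otimes>\<^bsub>G\<lparr>carrier := generate G {a}\<rparr>\<^esub> y = y \<otimes>\<^bsub>G\<lparr>carrier := generate G {a}\<rparr>\<^esub> x"
      using assms by (simp add: int_pow_mult[symmetric] add.commute)
  qed
qed

text \<open>Restrict to the cyclic group generated by \<open>g\<close>, all of whose irreducible characters are linear.\<close>

lemma (in group) char_value_roots_of_unity:
  assumes fin: "finite (carrier G)" and \<chi>: "\<chi> \<in> Chars G" and g: "g \<in> carrier G"
  obtains zs where "\<chi> g = sum_list zs" "\<chi> (inv g) = sum_list (map inverse zs)"
    "\<And>z. z \<in> set zs \<Longrightarrow> z ^ Coset.order G = 1"
proof -
  let ?H = "generate G {g}"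
  have H: "subgroup ?H G" using generate_is_subgroup g by simp
  interpret H: comm_group "G\<lparr>carrier := ?H\<rparr>" by (rule generate_single_comm[OF g])
  have gH: "g \<in> ?H" using generate.incl[of g "{g}"] by simp
  have igH: "inv g \<in> ?H" using subgroup.m_inv_closed[OF H gH] .
  obtain n \<rho> where "char_res ?H \<chi> = rep_char (G\<lparr>carrier := ?H\<rparr>) n \<rho>" "is_rep (G\<lparr>carrier := ?H\<rparr>) n \<rho>"
    using Chars_res[OF H \<chi>] by (auto simp: Chars_def)
  then obtain xs where xs: "set xs \<subseteq> Irr (G\<lparr>carrier := ?H\<rparr>)" "char_res ?H \<chi> = (\<lambda>g. \<Sum>\<psi>\<leftarrow>xs. \<psi> g)"
    using H.rep_char_sum_Irr by metis
  have lin: "\<psi> \<in> Lin (G\<lparr>carrier := ?H\<rparr>)" if "\<psi> \<in> set xs" for \<psi>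
    using that xs(1) H.Irr_subset_Lin by auto
  have finH: "finite ?H" using finite_subset[OF subgroup.subset[OF H] fin] .
  have "Coset.order G = Coset.order (G\<lparr>carrier := ?H\<rparr>) * card (rcosets ?H)"
    using lagrange[OF H] by (simp add: Coset.order_def mult.commute)
  then have pow: "\<psi> g ^ Coset.order G = 1" if "\<psi> \<in> set xs" for \<psi>
    using H.pow_order_one_char[OF lin[OF that], of g] finH gH by (simp add: power_mult)
  have inv: "\<psi> (inv g) = inverse (\<psi> g)" if "\<psi> \<in> set xs" for \<psi>
  proof -
    have "\<psi> g * \<psi> (inv g) = \<psi> (g \<otimes> inv g)"
      using H.LinD(3)[OF lin[OF that], of g "inv g"] gH igH by simp
    also have "\<dots> = 1" using H.LinD(2)[OF lin[OF that]] g by simp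
    finally show ?thesis by (rule inverse_unique[symmetric])
  qed
  have "\<chi> g = sum_list (map (\<lambda>\<psi>. \<psi> g) xs)" using fun_cong[OF xs(2), of g] gH by (simp add: char_res_def)
  moreover have "\<chi> (inv g) = sum_list (map inverse (map (\<lambda>\<psi>. \<psi> g) xs))"
    using fun_cong[OF xs(2), of "inv g"] igH inv by (simp add: char_res_def o_def cong: map_cong)
  ultimately show ?thesis using pow by (intro that[of "map (\<lambda>\<psi>. \<psi> g) xs"]) auto
qed

lemma root_of_unity_cnj:
  assumes "z ^ n = 1" "0 < n" shows "inverse z = cnj z"
proof -
  have "norm z ^ n = 1" using assms(1) by (metis norm_one norm_power)
  then have "norm z = 1" using power_eq_imp_eq_base[of "norm z" n 1] assms(2) by simp
  then have "z * cnj z = 1" by (simp add: complex_norm_square[symmetric])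
  then show ?thesis by (rule inverse_unique)
qed

lemma (in group) char_inv:
  assumes fin: "finite (carrier G)" and \<chi>: "\<chi> \<in> Chars G" and g: "g \<in> carrier G"
  shows "\<chi> (inv g) = cnj (\<chi> g)"
proof -
  obtain zs where zs: "\<chi> g = sum_list zs" "\<chi> (inv g) = sum_list (map inverse zs)"
    "\<And>z. z \<in> set zs \<Longrightarrow> z ^ Coset.order G = 1"
    using char_value_roots_of_unity[OF assms] by metis
  have "map inverse zs = map cnj zs"
    using root_of_unity_cnj[OF zs(3)] fin order_gt_0_iff_finite by auto
  moreover have "sum_list (map cnj ys) = cnj (sum_list ys)" for ys by (induction ys) auto
  ultimately show ?thesis unfolding zs(1,2) by metis
qed

text \<open>\<open>orth\<close> says that \<nu> is the only composition factor. In block triangular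
  form the group algebra element then has its \<nu>-value in all \<open>n\<close> diagonal
  places.\<close>

lemma (in group) rep_sum_det_homogeneous:
  assumes fin: "finite (carrier G)" and \<nu>: "\<nu> \<in> Lin G"
    and rep: "is_rep G n \<rho>"
    and orth: "\<And>\<psi>. \<psi> \<in> Irr G \<Longrightarrow> \<psi> \<noteq> \<nu> \<Longrightarrow> (\<Sum>g\<in>carrier G. rep_char G n \<rho> g * \<psi> (inv g)) = 0"
  shows "det (rep_sum G n c \<rho>) = (\<Sum>g\<in>carrier G. c g * \<nu> g) ^ n"
  using rep orth
proof (induction n arbitrary: \<rho> rule: less_induct)
  case (less n)
  have ord: "0 < Coset.order G" using fin by (simp add: order_gt_0_iff_finite)
  show ?case
  proof (cases "irreducible_rep G n \<rho>")
    case True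
    then have irr: "rep_char G n \<rho> \<in> Irr G" by (auto simp: Irr_def)
    have eq: "rep_char G n \<rho> = \<nu>"
    proof (rule ccontr)
      assume "rep_char G n \<rho> \<noteq> \<nu>"
      from less.prems(2)[OF irr this] show False using Irr_orthogonal[OF irr irr] ord by simp
    qed
    have n: "n = 1" using rep_char_one[OF less.prems(1)] LinD(2)[OF \<nu>] eq by simp
    have "rep_sum G n c \<rho> \<in> carrier_mat 1 1" unfolding n by (rule rep_sum_carrier)
    then have "det (rep_sum G n c \<rho>) = rep_sum G n c \<rho> $$ (0,0)" by (rule det_single)
    also have "\<dots> = (\<Sum>g\<in>carrier G. c g * rep_char G n \<rho> g)"
      by (simp add: rep_sum_def n rep_char_def)
    finally show ?thesis using eq n by simp
  next
    case False
    obtain k m A D where n: "n = k + m" and A: "is_rep G k A" and D: "is_rep G m D"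
      and sum: "\<And>g. rep_char G n \<rho> g = rep_char G k A g + rep_char G m D g"
      and det: "\<And>c. det (rep_sum G n c \<rho>) = det (rep_sum G k c A) * det (rep_sum G m c D)"
      using reducible_blocks[OF less.prems(1) False] by metis
    have lt: "k < n" "m < n" using n is_repD(1)[OF A] is_repD(1)[OF D] by auto
    have zero: "(\<Sum>g\<in>carrier G. rep_char G k A g * \<psi> (inv g)) = 0 \<and>
        (\<Sum>g\<in>carrier G. rep_char G m D g * \<psi> (inv g)) = 0"
      if \<psi>: "\<psi> \<in> Irr G" "\<psi> \<noteq> \<nu>" for \<psi>
    proof -
      obtain a b :: nat where
        a: "(\<Sum>g\<in>carrier G. rep_char G k A g * \<psi> (inv g)) = of_nat (a * Coset.order G)" and
        b: "(\<Sum>g\<in>carrier G. rep_char G m D g * \<psi> (inv g)) = of_nat (b * Coset.order G)"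
        using Chars_Irr_multiplicity[OF _ \<psi>(1)] A D unfolding Chars_def by blast
      \<comment> \<open>Both blocks pair with \<psi> to natural numbers and the sum of the two is
        zero, so \<open>orth\<close> is inherited by each block.\<close>
      have "of_nat (a * Coset.order G) + of_nat (b * Coset.order G) = (0 :: complex)"
        unfolding a[symmetric] b[symmetric] less.prems(2)[OF \<psi>, symmetric]
        by (simp add: sum ring_distribs sum.distrib)
      then have "of_nat (a * Coset.order G + b * Coset.order G) = (0 :: complex)" by simp
      then have "a * Coset.order G + b * Coset.order G = 0" unfolding of_nat_eq_0_iff .
      then show ?thesis using a b by simp
    qed
    have "det (rep_sum G k c A) = (\<Sum>g\<in>carrier G. c g * \<nu> g) ^ k"
      "det (rep_sum G m c D) = (\<Sum>g\<in>carrier G. c g * \<nu> g) ^ m"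
      using less.IH[OF lt(1) A] less.IH[OF lt(2) D] zero by blast+
    then show ?thesis using det n by (simp add: power_add)
  qed
qed

section \<open>Inner products and induction\<close>

locale finite_group = group +
  assumes fin [simp]: "finite (carrier G)"
begin

lemma order_pos: "0 < Coset.order G"
  using fin by (simp add: order_gt_0_iff_finite)

lemma subgroup_finite_group:
  assumes "subgroup H G" shows "finite_group (G\<lparr>carrier := H\<rparr>)"
  using subgroup_imp_group[OF assms] finite_subset[OF subgroup.subset[OF assms] fin]
  by (simp add: finite_group_def finite_group_axioms_def)

text \<open>\<open>e\<close> is the projection onto the \<nu>-isotypic part; translating the
  summation variable by \<open>h\<close> pulls out the factor \<open>\<nu> h\<close>.\<close>

lemma rep_average:
  assumes \<nu>: "\<nu> \<in> Lin G" and rep: "is_rep G n \<rho>" and h: "h \<in> carrier G"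
  defines "e \<equiv> rep_sum G n (\<lambda>g. \<nu> (inv g) / of_nat (Coset.order G)) \<rho>"
  shows "\<rho> h * e = \<nu> h \<cdot>\<^sub>m e"
proof (rule mat_eqI[of _ n n])
  note r = is_repD[OF rep] and l = LinD[OF \<nu>]
  define c where "c g = \<nu> (inv g) / of_nat (Coset.order G)" for g
  have e_def: "e = rep_sum G n c \<rho>" by (simp add: e_def c_def[abs_def])
  have e: "e \<in> carrier_mat n n" by (simp add: e_def rep_sum_carrier)
  show "\<rho> h * e \<in> carrier_mat n n" "\<nu> h \<cdot>\<^sub>m e \<in> carrier_mat n n" using r(2)[OF h] e by auto
  fix i j assume i: "i < n" and j: "j < n"
  have "(\<rho> h * e) $$ (i,j) = (\<Sum>a<n. \<Sum>g\<in>carrier G. c g * (\<rho> h $$ (i,a) * \<rho> g $$ (a,j)))"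
    unfolding mult_mat_index[OF r(2)[OF h] e i j] using j
    by (simp add: e_def rep_sum_def sum_distrib_left mult_ac)
  also have "\<dots> = (\<Sum>g\<in>carrier G. \<Sum>a<n. c g * (\<rho> h $$ (i,a) * \<rho> g $$ (a,j)))"
    by (rule sum.swap)
  also have "\<dots> = (\<Sum>g\<in>carrier G. c g * (\<rho> h * \<rho> g) $$ (i,j))"
    using mult_mat_index[OF r(2)[OF h] r(2) i j] by (intro sum.cong) (auto simp: sum_distrib_left)
  also have "\<dots> = (\<Sum>g\<in>carrier G. c (inv h \<otimes> (h \<otimes> g)) * \<rho> (h \<otimes> g) $$ (i,j))"
    using h r(3) by (intro sum.cong) (auto simp flip: m_assoc)
  also have "\<dots> = (\<Sum>g\<in>carrier G. c (inv h \<otimes> g) * \<rho> g $$ (i,j))"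
    by (rule sum_left_translate[OF h, of "\<lambda>g. c (inv h \<otimes> g) * \<rho> g $$ (i,j)"])
  also have "\<dots> = (\<Sum>g\<in>carrier G. \<nu> h * (c g * \<rho> g $$ (i,j)))"
    using h by (intro sum.cong) (auto simp: c_def inv_mult_group l(3))
  also have "\<dots> = (\<nu> h \<cdot>\<^sub>m e) $$ (i,j)" using i j by (simp add: e_def rep_sum_def sum_distrib_left)
  finally show "(\<rho> h * e) $$ (i,j) = (\<nu> h \<cdot>\<^sub>m e) $$ (i,j)" .
qed

text \<open>Composition factors alone only make \<open>\<rho> h\<close> triangular with diagonal
  \<open>\<nu> h\<close>. But the averaging element \<open>e\<close> has determinant 1, and
  cancelling it from \<open>\<rho> h * e = \<nu> h * e\<close> makes \<open>\<rho> h\<close>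
  scalar.\<close>

lemma rep_scalar:
  assumes \<nu>: "\<nu> \<in> Lin G" and rep: "is_rep G n \<rho>"
    and char: "\<And>g. g \<in> carrier G \<Longrightarrow> rep_char G n \<rho> g = of_nat n * \<nu> g"
    and h: "h \<in> carrier G"
  shows "\<rho> h = \<nu> h \<cdot>\<^sub>m 1\<^sub>m n"
proof -
  note r = is_repD[OF rep] and l = LinD[OF \<nu>]
  define c where "c g = \<nu> (inv g) / of_nat (Coset.order G)" for g
  define e where "e = rep_sum G n c \<rho>"
  have e: "e \<in> carrier_mat n n" by (simp add: e_def rep_sum_carrier)
  have ord: "of_nat (Coset.order G) \<noteq> (0::complex)" using order_pos by simp
  have "det e = (\<Sum>g\<in>carrier G. c g * \<nu> g) ^ n"
    unfolding e_def
  proof (rule rep_sum_det_homogeneous[OF fin \<nu> rep])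
    fix \<psi> assume \<psi>: "\<psi> \<in> Irr G" "\<psi> \<noteq> \<nu>"
    have "(\<Sum>g\<in>carrier G. rep_char G n \<rho> g * \<psi> (inv g)) = of_nat n * (\<Sum>g\<in>carrier G. \<nu> g * \<psi> (inv g))"
      by (simp add: char sum_distrib_left mult.assoc)
    then show "(\<Sum>g\<in>carrier G. rep_char G n \<rho> g * \<psi> (inv g)) = 0"
      using Irr_orthogonal[OF l(4) \<psi>(1)] \<psi>(2) by simp
  qed
  also have "(\<Sum>g\<in>carrier G. c g * \<nu> g) = (\<Sum>g\<in>carrier G. \<nu> g * \<nu> (inv g)) / of_nat (Coset.order G)"
    by (simp add: c_def sum_divide_distrib mult.commute)
  also have "\<dots> = 1" using Irr_orthogonal[OF l(4) l(4)] ord by simp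
  finally have "det e \<noteq> 0" by simp
  then obtain e' where e': "e' \<in> carrier_mat n n" "e * e' = 1\<^sub>m n"
    using det_non_zero_imp_unit[OF e, of "()"] by (auto simp: Units_def ring_mat_simps)
  have "\<rho> h * e = \<nu> h \<cdot>\<^sub>m e"
    using rep_average[OF \<nu> rep h] by (simp add: e_def c_def[abs_def])
  then have "\<rho> h * e * e' = \<nu> h \<cdot>\<^sub>m (e * e')"
    using mult_smult_assoc_mat[OF e e'(1)] by simp
  then show ?thesis using assoc_mult_mat[OF r(2)[OF h] e e'(1)] e'(2) r(2)[OF h] by simp
qed

lemma char_inner_eq:
  assumes "\<psi> \<in> Chars G"
  shows "char_inner G \<chi> \<psi> = (\<Sum>g\<in>carrier G. \<chi> g * \<psi> (inv g)) / of_nat (Coset.order G)"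
  using char_inv[OF fin assms] by (simp add: char_inner_def cong: sum.cong)

lemma char_inner_Irr:
  assumes "\<phi> \<in> Irr G" "\<psi> \<in> Irr G"
  shows "char_inner G \<phi> \<psi> = (if \<phi> = \<psi> then 1 else 0)"
  using char_inner_eq[OF subsetD[OF Irr_subset_Chars assms(2)], of \<phi>] Irr_orthogonal[OF assms] order_pos
  by simp

lemma char_inner_nat:
  assumes "\<chi> \<in> Chars G" "\<psi> \<in> Irr G"
  obtains k :: nat where "char_inner G \<chi> \<psi> = of_nat k"
  using char_inner_eq[of \<psi> \<chi>] Chars_Irr_multiplicity[OF assms] assms(2) Irr_subset_Chars order_pos
  by (metis (no_types, lifting) nonzero_mult_div_cancel_right of_nat_0_eq_iff of_nat_mult
      order_less_irrefl subsetD)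

end

lemma char_inner_add: "char_inner G (\<lambda>g. \<phi> g + \<psi> g) \<theta> = char_inner G \<phi> \<theta> + char_inner G \<psi> \<theta>"
  by (simp add: char_inner_def ring_distribs sum.distrib add_divide_distrib)

lemma char_inner_scale: "char_inner G (\<lambda>g. c * \<phi> g) \<theta> = c * char_inner G \<phi> \<theta>"
  by (simp add: char_inner_def sum_distrib_left mult.assoc)

lemma char_inner_sum: "char_inner G (\<lambda>g. \<Sum>a\<in>A. \<phi> a g) \<theta> = (\<Sum>a\<in>A. char_inner G (\<phi> a) \<theta>)"
  unfolding char_inner_def sum_distrib_right sum_divide_distrib by (rule sum.swap)

lemma char_inner_cnj: "char_inner G \<phi> \<theta> = cnj (char_inner G \<theta> \<phi>)"
  by (simp add: char_inner_def mult.commute)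

lemma (in group) Chars_conj:
  assumes "\<chi> \<in> Chars G" "x \<in> carrier G" "g \<in> carrier G"
  shows "\<chi> (inv x \<otimes> g \<otimes> x) = \<chi> g" "\<chi> (x \<otimes> g \<otimes> inv x) = \<chi> g"
proof -
  obtain n \<rho> where \<rho>: "\<chi> = rep_char G n \<rho>" "is_rep G n \<rho>" using assms by (auto simp: Chars_def)
  note r = is_repD[OF \<rho>(2)]
  have *: "\<chi> (inv y \<otimes> g \<otimes> y) = \<chi> g" if y: "y \<in> carrier G" for y
  proof -
    have "\<rho> (inv y \<otimes> g \<otimes> y) = \<rho> (inv y) * \<rho> g * \<rho> y" using y assms(3) by (simp add: r(3))
    moreover have "\<rho> y * \<rho> (inv y) = 1\<^sub>m n" using y by (simp add: r(4) flip: r(3))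
    ultimately have "tr n (\<rho> (inv y \<otimes> g \<otimes> y)) = tr n (\<rho> g)"
      using tr_similar[OF r(2)[OF assms(3)] r(2)[OF y] r(2)[OF inv_closed[OF y]]] by simp
    then show ?thesis using y assms(3) by (simp add: \<rho>(1) rep_char_def)
  qed
  show "\<chi> (inv x \<otimes> g \<otimes> x) = \<chi> g" using *[OF assms(2)] .
  show "\<chi> (x \<otimes> g \<otimes> inv x) = \<chi> g" using *[OF inv_closed[OF assms(2)]] assms(2) by simp
qed

lemma (in group) Chars_add:
  assumes "\<phi> \<in> Chars G" "\<psi> \<in> Chars G" shows "(\<lambda>g. \<phi> g + \<psi> g) \<in> Chars G"
proof -
  obtain n \<rho> where \<rho>: "\<phi> = rep_char G n \<rho>" "is_rep G n \<rho>" using assms by (auto simp: Chars_def)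
  obtain m \<rho>' where \<rho>': "\<psi> = rep_char G m \<rho>'" "is_rep G m \<rho>'" using assms by (auto simp: Chars_def)
  note r = is_repD[OF \<rho>(2)] and r' = is_repD[OF \<rho>'(2)]
  define R where "R g = four_block_mat (\<rho> g) (0\<^sub>m n m) (0\<^sub>m m n) (\<rho>' g)" for g
  have "R (g \<otimes> h) = R g * R h" if g: "g \<in> carrier G" and h: "h \<in> carrier G" for g h
  proof -
    note c = r(2)[OF g] r(2)[OF h] r'(2)[OF g] r'(2)[OF h]
    have z: "0\<^sub>m n m * 0\<^sub>m m n = 0\<^sub>m n n" "0\<^sub>m m n * 0\<^sub>m n m = 0\<^sub>m m m"
      "\<rho> g * 0\<^sub>m n m = 0\<^sub>m n m" "0\<^sub>m n m * \<rho>' h = 0\<^sub>m n m" "0\<^sub>m m n * \<rho> h = 0\<^sub>m m n" "\<rho>' g * 0\<^sub>m m n = 0\<^sub>m m n"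
      using c by auto
    have c': "\<rho> g * \<rho> h \<in> carrier_mat n n" "\<rho>' g * \<rho>' h \<in> carrier_mat m m" using c by auto
    show ?thesis unfolding R_def
      by (subst mult_four_block_mat[OF c(1) zero_carrier_mat zero_carrier_mat c(3) c(2) zero_carrier_mat
            zero_carrier_mat c(4)]) (use c' g h in \<open>simp add: z r(3) r'(3)\<close>)
  qed
  moreover have "R \<one> = 1\<^sub>m (n + m)" by (simp add: R_def r(4) r'(4))
  ultimately have "is_rep G (n + m) R"
    by (intro is_repI) (use r r' in \<open>auto simp: R_def\<close>)
  moreover have "rep_char G (n + m) R = (\<lambda>g. \<phi> g + \<psi> g)"
  proof
    fix g
    have "tr (n + m) (R g) = tr n (\<rho> g) + tr m (\<rho>' g)" if g: "g \<in> carrier G"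
      unfolding sum_lessThan_add
      by (intro arg_cong2[of _ _ _ _ "(+)"] sum.cong refl)
        (use carrier_matD[OF r(2)[OF g]] carrier_matD[OF r'(2)[OF g]] in \<open>auto simp: R_def\<close>)
    then show "rep_char G (n + m) R g = \<phi> g + \<psi> g" by (simp add: rep_char_def \<rho>(1) \<rho>'(1))
  qed
  ultimately show ?thesis unfolding Chars_def by (metis (mono_tags, lifting) mem_Collect_eq)
qed

section \<open>Induced characters and Frobenius reciprocity\<close>

definition ind_char :: "('a, 'b) monoid_scheme \<Rightarrow> 'a set \<Rightarrow> ('a \<Rightarrow> complex) \<Rightarrow> 'a \<Rightarrow> complex" where
  "ind_char G H \<psi> = (\<lambda>g. if g \<in> carrier G
     then (\<Sum>x\<in>carrier G. \<psi> (inv\<^bsub>G\<^esub> x \<otimes>\<^bsub>G\<^esub> g \<otimes>\<^bsub>G\<^esub> x)) / of_nat (card H) else 0)"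

text \<open>An index below \<open>r * n\<close> encodes a block number and a position in the block;
  this splits the sums that occur in products of block matrices.\<close>

lemma sum_div_mod:
  fixes f :: "nat \<Rightarrow> nat \<Rightarrow> 'c :: comm_monoid_add"
  assumes "0 < n"
  shows "(\<Sum>c<r * n. f (c div n) (c mod n)) = (\<Sum>k<r. \<Sum>e<n. f k e)"
proof -
  have "(\<Sum>k<r. \<Sum>e<n. f k e) = (\<Sum>(k,e)\<in>{..<r} \<times> {..<n}. f k e)" by (simp add: sum.cartesian_product)
  also have "\<dots> = (\<Sum>c<r * n. f (c div n) (c mod n))"
  proof (rule sum.reindex_bij_witness[of _ "\<lambda>c. (c div n, c mod n)" "\<lambda>(k,e). k * n + e"])
    fix a assume "a \<in> {..<r} \<times> {..<n}"
    then obtain k e where a: "a = (k,e)" "k < r" "e < n" by auto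
    have "Suc k * n \<le> r * n" using a by (intro mult_le_mono1) simp
    then have "k * n + e < r * n" using a by simp
    then show "(case a of (k, e) \<Rightarrow> k * n + e) \<in> {..<r * n}" using a by simp
  qed (use assms in \<open>auto simp: less_mult_imp_div_less\<close>)
  finally show ?thesis by simp
qed

text \<open>The inverses of representatives of right cosets represent the left cosets. Numbering
  them by naturals makes them block indices of an induced matrix.\<close>

lemma (in group) left_transversal:
  assumes fin: "finite (carrier G)" and H: "subgroup H G"
  obtains t :: "nat \<Rightarrow> 'a" and r where "\<And>i. i < r \<Longrightarrow> t i \<in> carrier G"
    "\<And>g. g \<in> carrier G \<Longrightarrow> \<exists>!i. i < r \<and> inv (t i) \<otimes> g \<in> H" "0 < r" "r * card H = Coset.order G"
proof -
  have finr: "finite (rcosets H)" using finite_UnionD[of "rcosets H"] rcosets_part_G[OF H] fin by simp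
  define r where "r = card (rcosets H)"
  obtain C where C: "bij_betw C {..<r} (rcosets H)"
    using ex_bij_betw_nat_finite[OF finr] by (auto simp: r_def atLeast0LessThan)
  have "\<exists>s\<in>carrier G. C i = H #> s" if "i < r" for i
    using bij_betwE[OF C] that by (auto simp: RCOSETS_def)
  then obtain s where s: "\<And>i. i < r \<Longrightarrow> s i \<in> carrier G" "\<And>i. i < r \<Longrightarrow> C i = H #> s i" by metis
  have iff: "inv (inv (s i)) \<otimes> g \<in> H \<longleftrightarrow> H #> inv g = C i" if i: "i < r" and g: "g \<in> carrier G" for i g
  proof -
    have "s i \<otimes> g \<in> H \<longleftrightarrow> inv (s i \<otimes> g) \<in> H"
      using subgroup.m_inv_closed[OF H] s(1)[OF i] g by (metis inv_inv m_closed)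
    also have "inv (s i \<otimes> g) = inv g \<otimes> inv (s i)" using s(1)[OF i] g by (simp add: inv_mult_group)
    also have "inv g \<otimes> inv (s i) \<in> H \<longleftrightarrow> inv g \<in> H #> s i"
    proof
      assume "inv g \<otimes> inv (s i) \<in> H"
      then have "inv g \<otimes> inv (s i) \<otimes> s i \<in> H #> s i" by (auto simp: r_coset_def)
      then show "inv g \<in> H #> s i" using s(1)[OF i] g by (simp add: m_assoc)
    next
      assume "inv g \<in> H #> s i"
      then obtain h where "h \<in> H" "inv g = h \<otimes> s i" by (auto simp: r_coset_def)
      then show "inv g \<otimes> inv (s i) \<in> H" using s(1)[OF i] subgroup.mem_carrier[OF H] by (simp add: m_assoc)
    qed
    also have "\<dots> \<longleftrightarrow> H #> inv g = C i"
      unfolding s(2)[OF i]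
      using repr_independence[of "inv g" H "s i"] rcos_self[of "inv g" H] s(1)[OF i] g H
      by (metis inv_closed)
    finally show ?thesis using s(1)[OF i] by simp
  qed
  show ?thesis
  proof (rule that[of r "\<lambda>i. inv (s i)"])
    show "inv (s i) \<in> carrier G" if "i < r" for i using s(1)[OF that] by simp
    show "\<exists>!i. i < r \<and> inv (inv (s i)) \<otimes> g \<in> H" if g: "g \<in> carrier G" for g
    proof -
      have "H #> inv g \<in> rcosets H" using g subgroup.subset[OF H] by (simp add: rcosetsI)
      then obtain i where "i < r" "C i = H #> inv g"
        using bij_betw_imp_surj_on[OF C] by (metis imageE lessThan_iff)
      then show ?thesis using iff[OF _ g] C by (metis (no_types, lifting) bij_betw_def inj_onD lessThan_iff)
    qed
    show "r * card H = Coset.order G" using lagrange[OF H] by (simp add: r_def)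
    then show "0 < r" using fin order_gt_0_iff_finite by (metis mult_is_0 neq0_conv)
  qed
qed

text \<open>The element \<open>y\<close> may lie outside \<open>H\<close>: conjugation by
  \<open>H\<close> preserves the complement, where the character is 0. The sum in
  \<open>ind_char\<close> runs over all conjugates and relies on this convention.\<close>

lemma (in group) Chars_conj_subgroup:
  assumes H: "subgroup H G" and \<psi>: "\<psi> \<in> Chars (G\<lparr>carrier := H\<rparr>)"
    and h: "h \<in> H" and y: "y \<in> carrier G"
  shows "\<psi> (inv h \<otimes> y \<otimes> h) = \<psi> y"
proof (cases "y \<in> H")
  case True
  interpret H: group "G\<lparr>carrier := H\<rparr>" by (rule subgroup_imp_group[OF H])
  show ?thesis using H.Chars_conj(1)[OF \<psi>, of h y] h H True by (simp add: m_inv_consistent)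
next
  case False
  have hc: "h \<in> carrier G" using subgroup.mem_carrier[OF H h] .
  have "inv h \<otimes> y \<otimes> h \<notin> H"
  proof
    assume "inv h \<otimes> y \<otimes> h \<in> H"
    then have "h \<otimes> (inv h \<otimes> y \<otimes> h) \<otimes> inv h \<in> H"
      using h subgroup.m_closed[OF H] subgroup.m_inv_closed[OF H] by blast
    then show False using False hc y by (simp add: m_assoc) (simp add: m_assoc[symmetric])
  qed
  then show ?thesis using False Chars_outside[OF \<psi>] by simp
qed

text \<open>The induced representation consists of block monomial matrices: block
  \<open>(i,j)\<close> of \<open>R g\<close> is \<rho> at
  \<open>inv (t i) \<otimes> g \<otimes> t j\<close> if this lies in \<open>H\<close>, and zero
  otherwise.\<close>

lemma (in finite_group) ind_char_Chars:
  assumes H: "subgroup H G" and \<psi>: "\<psi> \<in> Chars (G\<lparr>carrier := H\<rparr>)"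
  shows "ind_char G H \<psi> \<in> Chars G"
proof -
  let ?H = "G\<lparr>carrier := H\<rparr>"
  interpret H: finite_group ?H by (rule subgroup_finite_group[OF H])
  note Hc = subgroup.mem_carrier[OF H]
  obtain n \<rho> where \<rho>: "\<psi> = rep_char ?H n \<rho>" "is_rep ?H n \<rho>" using \<psi> by (auto simp: Chars_def)
  note rr = H.is_repD[OF \<rho>(2)]
  have r: "0 < n" "h \<in> H \<Longrightarrow> \<rho> h \<in> carrier_mat n n" "h \<in> H \<Longrightarrow> k \<in> H \<Longrightarrow> \<rho> (h \<otimes> k) = \<rho> h * \<rho> k"
     "\<rho> \<one> = 1\<^sub>m n" for h k using rr by auto
  obtain t :: "nat \<Rightarrow> 'a" and q where t: "\<And>i. i < q \<Longrightarrow> t i \<in> carrier G"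
    "\<And>g. g \<in> carrier G \<Longrightarrow> \<exists>!i. i < q \<and> inv (t i) \<otimes> g \<in> H" "0 < q" "q * card H = Coset.order G"
    using left_transversal[OF fin H] by metis
  define P where "P x = (if x \<in> H then \<rho> x else 0\<^sub>m n n)" for x
  have P: "P x \<in> carrier_mat n n" for x using r(2) by (simp add: P_def)
  define R where "R g = mat (q * n) (q * n)
    (\<lambda>(a,b). P (inv (t (a div n)) \<otimes> g \<otimes> t (b div n)) $$ (a mod n, b mod n))" for g
  have Rc: "R g \<in> carrier_mat (q * n) (q * n)" for g by (simp add: R_def)
  have dm: "a div n < q" "a mod n < n" if "a < q * n" for a
    using that r(1) by (auto simp: less_mult_imp_div_less)
  have mult: "R (g \<otimes> h) = R g * R h" if g: "g \<in> carrier G" and h: "h \<in> carrier G" for g h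
  proof (rule mat_eqI[of _ "q * n" "q * n"])
    fix a b assume a: "a < q * n" and b: "b < q * n"
    define i j where "i = a div n" and "j = b div n"
    have i: "i < q" and j: "j < q" using dm a b by (auto simp: i_def j_def)
    note ti = t(1)[OF i] and tj = t(1)[OF j]
    let ?L = "\<lambda>k. inv (t i) \<otimes> g \<otimes> t k" and ?M = "\<lambda>k. inv (t k) \<otimes> h \<otimes> t j"
    have "h \<otimes> t j \<in> carrier G" using h tj by simp
    \<comment> \<open>In block column \<open>j\<close> of \<open>R h\<close> only block row
      \<open>k\<close> is nonzero, so the block product has a single term.\<close>
    then obtain k where k: "k < q" "inv (t k) \<otimes> (h \<otimes> t j) \<in> H"
      and uniq: "\<And>l. l < q \<Longrightarrow> inv (t l) \<otimes> (h \<otimes> t j) \<in> H \<Longrightarrow> l = k" using t(2) by metis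
    note tk = t(1)[OF k(1)]
    have Mk: "?M k \<in> H" using k tk h tj by (simp add: m_assoc)
    have Mz: "P (?M l) = 0\<^sub>m n n" if "l < q" "l \<noteq> k" for l
      using uniq[OF that(1)] that t(1)[OF that(1)] h tj by (auto simp: P_def m_assoc)
    have split: "inv (t i) \<otimes> (g \<otimes> h) \<otimes> t j = ?L k \<otimes> ?M k"
      using ti tk tj g h by (simp add: m_assoc) (simp add: m_assoc[symmetric])
    have PP: "P (inv (t i) \<otimes> (g \<otimes> h) \<otimes> t j) = P (?L k) * P (?M k)"
    proof (cases "?L k \<in> H")
      case True
      then show ?thesis unfolding split using Mk r(3) subgroup.m_closed[OF H] by (simp add: P_def)
    next
      case False
      have "?L k \<otimes> ?M k \<notin> H"
      proof
        assume "?L k \<otimes> ?M k \<in> H"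
        then have "(?L k \<otimes> ?M k) \<otimes> inv (?M k) \<in> H"
          using subgroup.m_closed[OF H] subgroup.m_inv_closed[OF H] Mk by blast
        moreover have "?L k \<in> carrier G" using ti tk g by simp
        ultimately show False using False Hc[OF Mk] by (simp add: m_assoc)
      qed
      then show ?thesis unfolding split using False Mk left_mult_zero_mat[OF r(2)[OF Mk]] by (simp add: P_def)
    qed
    have "(R g * R h) $$ (a,b) = (\<Sum>c<q * n. R g $$ (a,c) * R h $$ (c,b))"
      by (rule mult_mat_index[OF Rc Rc a b])
    also have "\<dots> = (\<Sum>c<q * n. P (?L (c div n)) $$ (a mod n, c mod n) * P (?M (c div n)) $$ (c mod n, b mod n))"
      using a b by (intro sum.cong) (auto simp: R_def i_def j_def)
    also have "\<dots> = (\<Sum>l<q. \<Sum>e<n. P (?L l) $$ (a mod n, e) * P (?M l) $$ (e, b mod n))"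
      by (rule sum_div_mod[OF r(1), of "\<lambda>l e. P (?L l) $$ (a mod n, e) * P (?M l) $$ (e, b mod n)"])
    also have "\<dots> = (\<Sum>l<q. (P (?L l) * P (?M l)) $$ (a mod n, b mod n))"
      using mult_mat_index[OF P P dm(2)[OF a] dm(2)[OF b]] by simp
    also have "\<dots> = (\<Sum>l<q. if l = k then (P (?L l) * P (?M l)) $$ (a mod n, b mod n) else 0)"
      using Mz P dm(2)[OF a] dm(2)[OF b] by (intro sum.cong) (auto simp: right_mult_zero_mat[of _ n n])
    also have "\<dots> = (P (?L k) * P (?M k)) $$ (a mod n, b mod n)" using k(1) by simp
    also have "\<dots> = R (g \<otimes> h) $$ (a,b)" unfolding PP[symmetric] using a b by (simp add: R_def i_def j_def)
    finally show "R (g \<otimes> h) $$ (a,b) = (R g * R h) $$ (a,b)" by simp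
  qed (use Rc mult_carrier_mat[OF Rc Rc] in auto)
  have one: "R \<one> = 1\<^sub>m (q * n)"
  proof (rule mat_eqI[of _ "q * n" "q * n"])
    fix a b assume a: "a < q * n" and b: "b < q * n"
    note ta = t(1)[OF dm(1)[OF a]] and tb = t(1)[OF dm(1)[OF b]]
    have "inv (t (a div n)) \<otimes> t (b div n) \<in> H \<longleftrightarrow> a div n = b div n"
      using t(2)[OF tb] dm(1)[OF a] dm(1)[OF b] tb subgroup.one_closed[OF H] by (metis l_inv)
    then have "P (inv (t (a div n)) \<otimes> \<one> \<otimes> t (b div n)) = (if a div n = b div n then 1\<^sub>m n else 0\<^sub>m n n)"
      using ta tb r(4) by (auto simp: P_def)
    then show "R \<one> $$ (a,b) = 1\<^sub>m (q * n) $$ (a,b)"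
      using a b dm(2)[OF a] dm(2)[OF b] by (auto simp: R_def) (metis div_mult_mod_eq)
  qed (use Rc in auto)
  have rep: "is_rep G (q * n) R"
    by (rule is_repI) (use r(1) t(3) mult one Rc in auto)
  have H0: "(of_nat (card H) :: complex) \<noteq> 0"
    using t(4) order_pos by (metis mult_0_right of_nat_eq_0_iff less_irrefl)
  have trP: "tr n (P x) = \<psi> x" for x
    by (simp add: P_def \<rho>(1) rep_char_def)
  have "rep_char G (q * n) R g = ind_char G H \<psi> g" for g
  proof (cases "g \<in> carrier G")
    case True
    \<comment> \<open>Writing \<open>x = t i \<otimes> h\<close> with \<open>h\<close> in
      \<open>H\<close>, the value depends only on \<open>i\<close>. The factor \<open>card H\<close>
      this produces cancels the denominator of \<open>ind_char\<close>.\<close>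
    have "(\<Sum>x\<in>carrier G. \<psi> (inv x \<otimes> g \<otimes> x)) = (\<Sum>(i,h)\<in>{..<q} \<times> H. \<psi> (inv (t i) \<otimes> g \<otimes> t i))"
    proof (rule sum.reindex_bij_witness[of _ "\<lambda>(i,h). t i \<otimes> h"
        "\<lambda>x. let i = THE i. i < q \<and> inv (t i) \<otimes> x \<in> H in (i, inv (t i) \<otimes> x)"])
      fix x assume x: "x \<in> carrier G"
      define i where "i = (THE i. i < q \<and> inv (t i) \<otimes> x \<in> H)"
      have i: "i < q" "inv (t i) \<otimes> x \<in> H" using theI'[OF t(2)[OF x]] by (auto simp: i_def)
      note ti = t(1)[OF i(1)]
      show "(case let i = THE i. i < q \<and> inv (t i) \<otimes> x \<in> H in (i, inv (t i) \<otimes> x) of (i, h) \<Rightarrow> t i \<otimes> h) = x"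
        using x ti by (simp add: Let_def i_def[symmetric] m_assoc[symmetric])
      show "(let i = THE i. i < q \<and> inv (t i) \<otimes> x \<in> H in (i, inv (t i) \<otimes> x)) \<in> {..<q} \<times> H"
        using i by (simp add: Let_def i_def[symmetric])
      have "inv x \<otimes> g \<otimes> x = inv (inv (t i) \<otimes> x) \<otimes> (inv (t i) \<otimes> g \<otimes> t i) \<otimes> (inv (t i) \<otimes> x)"
        using x ti True by (simp add: inv_mult_group m_assoc) (simp add: m_assoc[symmetric])
      moreover note Chars_conj_subgroup[OF H \<psi>]
      ultimately show "(case let i = THE i. i < q \<and> inv (t i) \<otimes> x \<in> H in (i, inv (t i) \<otimes> x) of
          (i, h) \<Rightarrow> \<psi> (inv (t i) \<otimes> g \<otimes> t i)) = \<psi> (inv x \<otimes> g \<otimes> x)"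
        using i ti True by (simp add: Let_def i_def[symmetric])
    next
      fix p assume "p \<in> {..<q} \<times> H"
      then obtain i h where p: "p = (i,h)" and i: "i < q" and h: "h \<in> H" by auto
      note ti = t(1)[OF i]
      have th: "t i \<otimes> h \<in> carrier G" using ti Hc[OF h] by simp
      have "inv (t i) \<otimes> (t i \<otimes> h) = h" using ti Hc[OF h] by (simp add: m_assoc[symmetric])
      moreover from this have "(THE i'. i' < q \<and> inv (t i') \<otimes> (t i \<otimes> h) \<in> H) = i"
        using the1_equality[OF t(2)[OF th], of i] i h by simp
      ultimately show "(let i' = THE i'. i' < q \<and> inv (t i') \<otimes> (case p of (i, h) \<Rightarrow> t i \<otimes> h) \<in> H
         in (i', inv (t i') \<otimes> (case p of (i, h) \<Rightarrow> t i \<otimes> h))) = p"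
        by (simp add: p Let_def)
      show "(case p of (i, h) \<Rightarrow> t i \<otimes> h) \<in> carrier G" using th by (simp add: p)
    qed
    also have "\<dots> = of_nat (card H) * (\<Sum>i<q. \<psi> (inv (t i) \<otimes> g \<otimes> t i))"
      by (simp add: sum.cartesian_product[symmetric] sum_distrib_left)
    finally have "ind_char G H \<psi> g = (\<Sum>i<q. tr n (P (inv (t i) \<otimes> g \<otimes> t i)))"
      using True H0 by (simp add: ind_char_def trP)
    also have "\<dots> = tr (q * n) (R g)"
      using sum_div_mod[OF r(1), of "\<lambda>i e. P (inv (t i) \<otimes> g \<otimes> t i) $$ (e,e)" q]
      by (simp add: R_def)
    finally show ?thesis using True by (simp add: rep_char_def)
  qed (simp add: rep_char_def ind_char_def)
  then have "ind_char G H \<psi> = rep_char G (q * n) R" by auto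
  then show ?thesis using rep unfolding Chars_def by blast
qed

text \<open>Since \<chi> is a class function, each conjugating element \<open>x\<close> contributes
  the same inner sum. Only the support of \<psi> is constrained, so restrictions of characters can
  be inserted directly.\<close>

lemma (in finite_group) frobenius:
  assumes H: "subgroup H G" and \<psi>: "\<And>h. h \<notin> H \<Longrightarrow> \<psi> h = 0" and \<chi>: "\<chi> \<in> Chars G"
  shows "char_inner G (ind_char G H \<psi>) \<chi> = char_inner (G\<lparr>carrier := H\<rparr>) \<psi> (char_res H \<chi>)"
proof -
  note Hc = subgroup.subset[OF H]
  have "(\<Sum>g\<in>carrier G. (\<Sum>x\<in>carrier G. \<psi> (inv x \<otimes> g \<otimes> x)) * cnj (\<chi> g))
      = (\<Sum>x\<in>carrier G. \<Sum>g\<in>carrier G. \<psi> (inv x \<otimes> g \<otimes> x) * cnj (\<chi> g))"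
    unfolding sum_distrib_right by (rule sum.swap)
  also have "\<dots> = (\<Sum>x\<in>carrier G. \<Sum>g\<in>carrier G. \<psi> g * cnj (\<chi> g))"
  proof (rule sum.cong[OF refl])
    fix x assume x: "x \<in> carrier G"
    show "(\<Sum>g\<in>carrier G. \<psi> (inv x \<otimes> g \<otimes> x) * cnj (\<chi> g)) = (\<Sum>g\<in>carrier G. \<psi> g * cnj (\<chi> g))"
    proof (rule sum.reindex_bij_witness[of _ "\<lambda>g. x \<otimes> g \<otimes> inv x" "\<lambda>g. inv x \<otimes> g \<otimes> x"])
      fix g assume g: "g \<in> carrier G"
      show "x \<otimes> (inv x \<otimes> g \<otimes> x) \<otimes> inv x = g" "inv x \<otimes> (x \<otimes> g \<otimes> inv x) \<otimes> x = g"
        using x g by (simp_all add: m_assoc) (simp_all add: m_assoc[symmetric])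
      show "\<psi> (inv x \<otimes> g \<otimes> x) * cnj (\<chi> (inv x \<otimes> g \<otimes> x)) = \<psi> (inv x \<otimes> g \<otimes> x) * cnj (\<chi> g)"
        using Chars_conj(1)[OF \<chi> x g] by simp
    qed (use x in auto)
  qed
  also have "\<dots> = of_nat (Coset.order G) * (\<Sum>g\<in>carrier G. \<psi> g * cnj (\<chi> g))"
    by (simp add: Coset.order_def)
  also have "(\<Sum>g\<in>carrier G. \<psi> g * cnj (\<chi> g)) = (\<Sum>g\<in>H. \<psi> g * cnj (char_res H \<chi> g))"
    using Hc \<psi> by (intro sum.mono_neutral_cong_right) (auto simp: char_res_def)
  finally have eq: "(\<Sum>g\<in>carrier G. (\<Sum>x\<in>carrier G. \<psi> (inv x \<otimes> g \<otimes> x)) * cnj (\<chi> g))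
    = of_nat (Coset.order G) * (\<Sum>g\<in>H. \<psi> g * cnj (char_res H \<chi> g))" .
  have "char_inner G (ind_char G H \<psi>) \<chi>
      = (\<Sum>g\<in>carrier G. (\<Sum>x\<in>carrier G. \<psi> (inv x \<otimes> g \<otimes> x)) * cnj (\<chi> g)) / (of_nat (card H) * of_nat (Coset.order G))"
    by (simp add: char_inner_def ind_char_def sum_divide_distrib[symmetric])
  also have "\<dots> = (\<Sum>g\<in>H. \<psi> g * cnj (char_res H \<chi> g)) / of_nat (card H)"
    unfolding eq using order_pos by simp
  finally show ?thesis by (simp add: char_inner_def Coset.order_def)
qed

section \<open>Finiteness, multiplicities and decompositions\<close>

context finite_group begin

text \<open>The character induced from the identity subgroup is the regular character. By
  reciprocity every irreducible character pairs with it to a nonzero value, and it is a sum over a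
  finite list.\<close>

lemma finite_Irr: "finite (Irr G)"
proof -
  let ?\<delta> = "\<lambda>g. if g = \<one> then 1 else (0::complex)"
  have H: "subgroup {\<one>} G" by (rule triv_subgroup)
  interpret H: finite_group "G\<lparr>carrier := {\<one>}\<rparr>" by (rule subgroup_finite_group[OF H])
  have "?\<delta> \<in> Irr (G\<lparr>carrier := {\<one>}\<rparr>)" by (rule H.LinI) auto
  then have ind: "ind_char G {\<one>} ?\<delta> \<in> Chars G"
    using ind_char_Chars[OF H] Irr_subset_Chars by blast
  obtain n \<rho> where "ind_char G {\<one>} ?\<delta> = rep_char G n \<rho>" "is_rep G n \<rho>"
    using ind by (auto simp: Chars_def)
  then obtain xs where xs: "set xs \<subseteq> Irr G" "ind_char G {\<one>} ?\<delta> = (\<lambda>g. \<Sum>\<psi>\<leftarrow>xs. \<psi> g)"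
    using rep_char_sum_Irr by metis
  have zero: "char_inner G (\<lambda>g. \<Sum>\<phi>\<leftarrow>ys. \<phi> g) \<psi> = 0"
    if "\<psi> \<in> Irr G" "\<psi> \<notin> set ys" "set ys \<subseteq> Irr G" for \<psi> ys
    using that
  proof (induction ys)
    case Nil then show ?case by (simp add: char_inner_def)
  next
    case (Cons \<phi> ys)
    then show ?case using char_inner_add[of G \<phi> "\<lambda>g. \<Sum>\<phi>\<leftarrow>ys. \<phi> g" \<psi>] char_inner_Irr[of \<phi> \<psi>] by auto
  qed
  have "\<psi> \<in> set xs" if \<psi>: "\<psi> \<in> Irr G" for \<psi>
  proof (rule ccontr)
    assume "\<psi> \<notin> set xs"
    then have "char_inner G (ind_char G {\<one>} ?\<delta>) \<psi> = 0" using zero[OF \<psi> _ xs(1)] xs(2) by simp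
    moreover have \<psi>C: "\<psi> \<in> Chars G" using \<psi> Irr_subset_Chars by blast
    ultimately have "char_inner (G\<lparr>carrier := {\<one>}\<rparr>) ?\<delta> (char_res {\<one>} \<psi>) = 0"
      using frobenius[OF H, of ?\<delta> \<psi>] by simp
    then have "\<psi> \<one> = 0" by (simp add: char_inner_def char_res_def Coset.order_def)
    then show False using Chars_one[OF \<psi>C] by simp
  qed
  then show ?thesis using finite_subset[of "Irr G" "set xs"] by blast
qed

lemma Chars_decomp:
  assumes "\<chi> \<in> Chars G"
  shows "\<chi> = (\<lambda>g. \<Sum>\<psi>\<in>Irr G. char_inner G \<chi> \<psi> * \<psi> g)"
proof -
  obtain n \<rho> where "\<chi> = rep_char G n \<rho>" "is_rep G n \<rho>" using assms by (auto simp: Chars_def)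
  then obtain xs where xs: "set xs \<subseteq> Irr G" "\<chi> = (\<lambda>g. \<Sum>\<psi>\<leftarrow>xs. \<psi> g)"
    using rep_char_sum_Irr by metis
  have "(\<Sum>\<phi>\<leftarrow>ys. \<phi> g) = (\<Sum>\<psi>\<in>Irr G. char_inner G (\<lambda>g. \<Sum>\<phi>\<leftarrow>ys. \<phi> g) \<psi> * \<psi> g)"
    if "set ys \<subseteq> Irr G" for ys g
    using that
  proof (induction ys)
    case Nil then show ?case by (simp add: char_inner_def)
  next
    case (Cons \<phi> ys)
    then have \<phi>: "\<phi> \<in> Irr G" by simp
    have "(\<Sum>\<psi>\<in>Irr G. char_inner G (\<lambda>g. \<Sum>\<phi>\<leftarrow>\<phi> # ys. \<phi> g) \<psi> * \<psi> g)
      = (\<Sum>\<psi>\<in>Irr G. char_inner G \<phi> \<psi> * \<psi> g)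
        + (\<Sum>\<psi>\<in>Irr G. char_inner G (\<lambda>g. \<Sum>\<phi>\<leftarrow>ys. \<phi> g) \<psi> * \<psi> g)"
      using char_inner_add[of G \<phi> "\<lambda>g. \<Sum>\<phi>\<leftarrow>ys. \<phi> g"] by (simp add: ring_distribs sum.distrib)
    also have "(\<Sum>\<psi>\<in>Irr G. char_inner G \<phi> \<psi> * \<psi> g) = (\<Sum>\<psi>\<in>Irr G. if \<psi> = \<phi> then \<phi> g else 0)"
      using char_inner_Irr[OF \<phi>] by (intro sum.cong) auto
    also have "\<dots> = \<phi> g" using \<phi> finite_Irr by simp
    finally show ?case using Cons by simp
  qed
  from this[OF xs(1)] show ?thesis unfolding xs(2) by (rule ext)
qed

end

text \<open>The multiplicity as a natural number, so that sums of multiplicities can be compared by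
  positivity and divisibility. \<open>of_nat_cmult\<close> justifies the choice when the second
  argument is irreducible.\<close>

definition cmult :: "('a, 'b) monoid_scheme \<Rightarrow> ('a \<Rightarrow> complex) \<Rightarrow> ('a \<Rightarrow> complex) \<Rightarrow> nat" where
  "cmult G \<chi> \<psi> = (THE k. of_nat k = char_inner G \<chi> \<psi>)"

context finite_group begin

lemma of_nat_cmult:
  assumes "\<chi> \<in> Chars G" "\<psi> \<in> Irr G"
  shows "of_nat (cmult G \<chi> \<psi>) = char_inner G \<chi> \<psi>"
proof -
  obtain k :: nat where k: "char_inner G \<chi> \<psi> = of_nat k" using char_inner_nat[OF assms] by metis
  then have "cmult G \<chi> \<psi> = k" unfolding cmult_def by (intro the_equality) auto
  then show ?thesis using k by simp
qed

lemma cmult_eqI: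
  assumes "\<chi> \<in> Chars G" "\<psi> \<in> Irr G" "char_inner G \<chi> \<psi> = of_nat k"
  shows "cmult G \<chi> \<psi> = k"
  using of_nat_cmult[OF assms(1,2)] assms(3) by simp

lemma Irr_Chars: "\<psi> \<in> Irr G \<Longrightarrow> \<psi> \<in> Chars G"
  using Irr_subset_Chars by blast

lemma cmult_Irr: "\<phi> \<in> Irr G \<Longrightarrow> \<psi> \<in> Irr G \<Longrightarrow> cmult G \<phi> \<psi> = (if \<phi> = \<psi> then 1 else 0)"
  by (intro cmult_eqI) (auto simp: char_inner_Irr Irr_Chars)

lemma decomp: "\<chi> \<in> Chars G \<Longrightarrow> \<chi> g = (\<Sum>\<psi>\<in>Irr G. of_nat (cmult G \<chi> \<psi>) * \<psi> g)"
  by (subst Chars_decomp, assumption) (simp add: of_nat_cmult)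

lemma degree_decomp:
  assumes "\<chi> \<in> Chars G"
  shows "char_degree G \<chi> = (\<Sum>\<psi>\<in>Irr G. cmult G \<chi> \<psi> * char_degree G \<psi>)"
proof (rule char_degree_eqI)
  show "\<chi> \<one> = of_nat (\<Sum>\<psi>\<in>Irr G. cmult G \<chi> \<psi> * char_degree G \<psi>)"
    by (subst decomp[OF assms]) (simp add: Chars_one(1)[OF Irr_Chars])
qed

lemma inner_expand:
  assumes "\<chi> \<in> Chars G" shows "char_inner G \<chi> \<theta> = (\<Sum>\<psi>\<in>Irr G. of_nat (cmult G \<chi> \<psi>) * char_inner G \<psi> \<theta>)"
proof -
  have eq: "\<chi> = (\<lambda>g. \<Sum>\<psi>\<in>Irr G. of_nat (cmult G \<chi> \<psi>) * \<psi> g)"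
    by (rule ext) (rule decomp[OF assms])
  have "char_inner G \<chi> \<theta> = char_inner G (\<lambda>g. \<Sum>\<psi>\<in>Irr G. of_nat (cmult G \<chi> \<psi>) * \<psi> g) \<theta>"
    by (rule arg_cong[OF eq])
  then show ?thesis by (simp add: char_inner_sum char_inner_scale)
qed

lemma inner_cmult:
  assumes "\<chi> \<in> Chars G" "\<xi> \<in> Chars G"
  shows "char_inner G \<chi> \<xi> = of_nat (\<Sum>\<psi>\<in>Irr G. cmult G \<chi> \<psi> * cmult G \<xi> \<psi>)"
proof -
  have "char_inner G \<psi> \<xi> = of_nat (cmult G \<xi> \<psi>)" if "\<psi> \<in> Irr G" for \<psi>
    using of_nat_cmult[OF assms(2) that] char_inner_cnj[of G \<psi> \<xi>] by (metis complex_cnj_of_nat)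
  then show ?thesis using inner_expand[OF assms(1), of \<xi>] by simp
qed

text \<open>The norm is the sum of the squares of the multiplicities; if it is 1, exactly one
  multiplicity is 1 and the others vanish.\<close>

lemma irreducible_iff_norm:
  assumes "\<chi> \<in> Chars G" "char_inner G \<chi> \<chi> = 1" shows "\<chi> \<in> Irr G"
proof -
  have "of_nat (\<Sum>\<psi>\<in>Irr G. cmult G \<chi> \<psi> * cmult G \<chi> \<psi>) = (of_nat 1 :: complex)"
    using inner_cmult[OF assms(1,1)] assms(2) by simp
  then have s: "(\<Sum>\<psi>\<in>Irr G. cmult G \<chi> \<psi> * cmult G \<chi> \<psi>) = 1" unfolding of_nat_eq_iff .
  then obtain \<psi> where \<psi>: "\<psi> \<in> Irr G" "cmult G \<chi> \<psi> * cmult G \<chi> \<psi> = 1"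
      "\<And>\<phi>. \<phi> \<in> Irr G \<Longrightarrow> \<phi> \<noteq> \<psi> \<Longrightarrow> cmult G \<chi> \<phi> * cmult G \<chi> \<phi> = 0"
    using sum_eq_1_iff[OF finite_Irr] by (metis (no_types, lifting))
  then have "cmult G \<chi> \<psi> = 1" "\<And>\<phi>. \<phi> \<in> Irr G \<Longrightarrow> \<phi> \<noteq> \<psi> \<Longrightarrow> cmult G \<chi> \<phi> = 0" by auto
  then have "(\<Sum>\<phi>\<in>Irr G. of_nat (cmult G \<chi> \<phi>) * \<phi> g) = (\<Sum>\<phi>\<in>Irr G. if \<phi> = \<psi> then \<psi> g else 0)" for g
    by (intro sum.cong) auto
  then have "\<chi> g = \<psi> g" for g using decomp[OF assms(1), of g] \<psi>(1) finite_Irr by simp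
  then show ?thesis using \<psi>(1) by (metis ext)
qed

lemma Irr_norm: "\<chi> \<in> Irr G \<Longrightarrow> char_inner G \<chi> \<chi> = 1"
  by (simp add: char_inner_Irr)

lemma Chars_combination:
  assumes fin: "finite A" and A: "A \<subseteq> Irr G" and pos: "a \<in> A" "0 < m a"
  shows "(\<lambda>g. \<Sum>\<psi>\<in>A. of_nat (m \<psi>) * \<psi> g) \<in> Chars G"
proof -
  \<comment> \<open>The zero function is not a character, since degrees are positive. It is adjoined
    to make the set closed under the induction and is excluded at the end by the value at the
    identity.\<close>
  define C where "C = insert (\<lambda>_. 0) (Chars G)"
  have add: "(\<lambda>g. f g + h g) \<in> C" if "f \<in> C" "h \<in> C" for f h
    using that Chars_add[of f h] by (auto simp: C_def)
  have mul: "(\<lambda>g. of_nat k * f g) \<in> C" if "f \<in> C" for f and k :: nat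
  proof (induction k)
    case 0 then show ?case by (simp add: C_def)
  next
    case (Suc k)
    then show ?case using add[OF that Suc.IH] by (simp add: ring_distribs)
  qed
  have "(\<lambda>g. \<Sum>\<psi>\<in>A. of_nat (m \<psi>) * \<psi> g) \<in> C" using fin A
  proof (induction A rule: finite_induct)
    case empty then show ?case by (simp add: C_def)
  next
    case (insert \<psi> A)
    then have "\<psi> \<in> C" using Irr_Chars by (auto simp: C_def)
    from add[OF mul[OF this] insert.IH] insert show ?case by simp
  qed
  moreover have "(\<Sum>\<psi>\<in>A. of_nat (m \<psi>) * \<psi> \<one>) \<noteq> 0"
  proof -
    have "(\<Sum>\<psi>\<in>A. of_nat (m \<psi>) * \<psi> \<one>) = of_nat (\<Sum>\<psi>\<in>A. m \<psi> * char_degree G \<psi>)"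
      using A by (auto simp: Chars_one(1)[OF Irr_Chars] intro!: sum.cong)
    moreover have "0 < (\<Sum>\<psi>\<in>A. m \<psi> * char_degree G \<psi>)"
      using fin pos Chars_one(2)[OF Irr_Chars[OF subsetD[OF A pos(1)]]] by (intro sum_pos2[of _ a]) auto
    ultimately show ?thesis by (metis less_irrefl of_nat_eq_0_iff)
  qed
  then have "(\<lambda>g. \<Sum>\<psi>\<in>A. of_nat (m \<psi>) * \<psi> g) \<noteq> (\<lambda>_. 0)" by (auto dest: fun_cong[where x = "\<one>"])
  ultimately show ?thesis by (simp add: C_def)
qed

lemma ex_constituent:
  assumes "\<chi> \<in> Chars G" obtains \<psi> where "\<psi> \<in> Irr G" "cmult G \<chi> \<psi> \<noteq> 0"
proof -
  have "(\<Sum>\<psi>\<in>Irr G. cmult G \<chi> \<psi> * char_degree G \<psi>) \<noteq> 0"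
    using degree_decomp[OF assms] Chars_one(2)[OF assms] by simp
  then obtain \<psi> where "\<psi> \<in> Irr G" "cmult G \<chi> \<psi> * char_degree G \<psi> \<noteq> 0"
    by (meson sum.neutral)
  then show ?thesis using that by auto
qed

lemma char_res_self: "\<chi> \<in> Chars G \<Longrightarrow> char_res (carrier G) \<chi> = \<chi>"
  using Chars_outside by (fastforce simp: char_res_def)

lemma char_inner_res_decomp:
  assumes D: "subgroup D G" and \<chi>: "\<chi> \<in> Chars G"
  shows "char_inner (G\<lparr>carrier := D\<rparr>) (char_res D \<chi>) \<eta>
    = (\<Sum>\<psi>\<in>Irr G. of_nat (cmult G \<chi> \<psi>) * char_inner (G\<lparr>carrier := D\<rparr>) (char_res D \<psi>) \<eta>)"
proof -
  have "char_res D \<chi> = (\<lambda>g. \<Sum>\<psi>\<in>Irr G. of_nat (cmult G \<chi> \<psi>) * char_res D \<psi> g)"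
    using decomp[OF \<chi>] by (auto simp: char_res_def fun_eq_iff)
  then show ?thesis by (simp add: char_inner_sum char_inner_scale)
qed

lemma cmult_res_decomp:
  assumes D: "subgroup D G" and \<chi>: "\<chi> \<in> Chars G" and \<eta>: "\<eta> \<in> Irr (G\<lparr>carrier := D\<rparr>)"
  shows "cmult (G\<lparr>carrier := D\<rparr>) (char_res D \<chi>) \<eta>
    = (\<Sum>\<psi>\<in>Irr G. cmult G \<chi> \<psi> * cmult (G\<lparr>carrier := D\<rparr>) (char_res D \<psi>) \<eta>)"
proof -
  interpret D: finite_group "G\<lparr>carrier := D\<rparr>" by (rule subgroup_finite_group[OF D])
  show ?thesis
    by (rule D.cmult_eqI[OF Chars_res[OF D \<chi>] \<eta>])
      (simp add: char_inner_res_decomp[OF D \<chi>] D.of_nat_cmult[OF Chars_res[OF D Irr_Chars] \<eta>])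
qed

lemma constituent_trans:
  assumes D: "subgroup D G" and \<chi>: "\<chi> \<in> Chars G" and \<psi>: "\<psi> \<in> Irr G"
    and \<eta>: "\<eta> \<in> Irr (G\<lparr>carrier := D\<rparr>)"
    and "cmult G \<chi> \<psi> \<noteq> 0" "cmult (G\<lparr>carrier := D\<rparr>) (char_res D \<psi>) \<eta> \<noteq> 0"
  shows "cmult (G\<lparr>carrier := D\<rparr>) (char_res D \<chi>) \<eta> \<noteq> 0"
  unfolding cmult_res_decomp[OF D \<chi> \<eta>] using assms finite_Irr by (auto simp: sum_eq_0_iff)

end

lemma char_res_res: "A \<subseteq> B \<Longrightarrow> char_res A (char_res B \<chi>) = char_res A \<chi>"
  by (auto simp: char_res_def fun_eq_iff)

text \<open>A nonzero entry \<open>a = a x y\<close> satisfies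
  \<open>w' y * e y \<ge> a * d x \<ge> a\<^sup>2 * w x * e y = a\<^sup>2 * w' y * e y\<close>. Hence \<open>a = 1\<close> and equality holds
  throughout, so it is the only nonzero entry in its row and in its column.\<close>

lemma weighted_permutation_matrix:
  fixes a :: "'a \<Rightarrow> 'b \<Rightarrow> nat" and d w :: "'a \<Rightarrow> nat" and e w' :: "'b \<Rightarrow> nat"
  assumes A: "finite A" and B: "finite B"
    and d: "\<And>x. x \<in> A \<Longrightarrow> 0 < d x" and e: "\<And>y. y \<in> B \<Longrightarrow> 0 < e y"
    and w': "\<And>y. y \<in> B \<Longrightarrow> 0 < w' y"
    and row: "\<And>x. x \<in> A \<Longrightarrow> w x * (\<Sum>y\<in>B. a x y * e y) = d x"
    and col: "\<And>y. y \<in> B \<Longrightarrow> (\<Sum>x\<in>A. a x y * d x) = w' y * e y"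
    and comp: "\<And>x y. x \<in> A \<Longrightarrow> y \<in> B \<Longrightarrow> a x y \<noteq> 0 \<Longrightarrow> w x = w' y"
  obtains f where "bij_betw f A B" "\<And>x y. x \<in> A \<Longrightarrow> y \<in> B \<Longrightarrow> a x y = (if y = f x then 1 else 0)"
    "\<And>x. x \<in> A \<Longrightarrow> d x = w x * e (f x)"
proof -
  have key: "a x y = 1 \<and> d x = w x * e y \<and> (\<forall>y'\<in>B. y' \<noteq> y \<longrightarrow> a x y' = 0) \<and> (\<forall>x'\<in>A. x' \<noteq> x \<longrightarrow> a x' y = 0)"
    if x: "x \<in> A" and y: "y \<in> B" and nz: "a x y \<noteq> 0" for x y
  proof -
    have ww: "w x = w' y" using comp[OF x y nz] .
    have r: "w x * (a x y * e y) + w x * (\<Sum>y'\<in>B - {y}. a x y' * e y') = d x"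
      using row[OF x] by (simp add: sum.remove[OF B y] algebra_simps)
    have c: "a x y * d x + (\<Sum>x'\<in>A - {x}. a x' y * d x') = w x * e y"
      using col[OF y] ww by (simp add: sum.remove[OF A x])
    have we: "0 < w x * e y" using ww w'[OF y] e[OF y] by simp
    have "a x y * (a x y * (w x * e y)) \<le> a x y * d x" using r by (intro mult_le_mono2) (simp add: algebra_simps)
    also have "\<dots> \<le> w x * e y" using c by simp
    finally have le: "a x y * a x y * (w x * e y) \<le> 1 * (w x * e y)" by (simp add: mult.assoc)
    have "a x y * a x y \<le> 1" using le we by (metis mult_le_cancel2)
    moreover have "a x y \<le> a x y * a x y" by simp
    ultimately have a1: "a x y = 1" using nz by linarith
    have d1: "d x = w x * e y" using r c a1 by simp
    have "w x * (\<Sum>y'\<in>B - {y}. a x y' * e y') = 0" using r a1 d1 by simp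
    then have s0: "(\<Sum>y'\<in>B - {y}. a x y' * e y') = 0" using we by simp
    have "a x y' = 0" if "y' \<in> B" "y' \<noteq> y" for y'
      using s0 that B e[OF that(1)] by (auto simp: sum_eq_0_iff)
    moreover have t0: "(\<Sum>x'\<in>A - {x}. a x' y * d x') = 0" using c a1 d1 by simp
    have "a x' y = 0" if "x' \<in> A" "x' \<noteq> x" for x'
      using t0 that A d[OF that(1)] by (auto simp: sum_eq_0_iff)
    ultimately show ?thesis using a1 d1 by blast
  qed
  have exr: "\<exists>y\<in>B. a x y \<noteq> 0" if x: "x \<in> A" for x
  proof (rule ccontr)
    assume "\<not> ?thesis"
    then show False using row[OF x] d[OF x] by simp
  qed
  have exc: "\<exists>x\<in>A. a x y \<noteq> 0" if y: "y \<in> B" for y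
  proof (rule ccontr)
    assume "\<not> ?thesis"
    then show False using col[OF y] w'[OF y] e[OF y] by simp
  qed
  obtain f where f: "\<And>x. x \<in> A \<Longrightarrow> f x \<in> B \<and> a x (f x) \<noteq> 0" using exr by metis
  have bij: "bij_betw f A B"
  proof (rule bij_betw_imageI)
    show "inj_on f A" using f key by (intro inj_onI) metis
    show "f ` A = B"
    proof
      show "f ` A \<subseteq> B" using f by auto
      show "B \<subseteq> f ` A"
      proof
        fix y assume y: "y \<in> B"
        obtain x where "x \<in> A" "a x y \<noteq> 0" using exc[OF y] by blast
        then have "f x = y" using key[of x y] f[of x] y by metis
        then show "y \<in> f ` A" using \<open>x \<in> A\<close> by blast
      qed
    qed
  qed
  show ?thesis
  proof (rule that[OF bij])
    show "a x y = (if y = f x then 1 else 0)" if "x \<in> A" "y \<in> B" for x y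
      using key[of x "f x"] f[OF that(1)] that by auto
    show "d x = w x * e (f x)" if "x \<in> A" for x using key[of x "f x"] f[OF that] that by auto
  qed
qed

section \<open>Linear characters and Clifford theory\<close>

context finite_group begin

lemma Lin_norm:
  assumes "\<nu> \<in> Lin G" "g \<in> carrier G"
  shows "\<nu> g * cnj (\<nu> g) = 1" "\<nu> (inv g) = cnj (\<nu> g)" "\<nu> g \<noteq> 0"
proof -
  have C: "\<nu> \<in> Chars G" using assms(1) by (simp add: Lin_def)
  show i: "\<nu> (inv g) = cnj (\<nu> g)" by (rule char_inv[OF fin C assms(2)])
  have "\<nu> g * \<nu> (inv g) = 1" using LinD(2,3)[OF assms(1)] assms(2) by (simp flip: LinD(3)[OF assms(1)])
  then show "\<nu> g * cnj (\<nu> g) = 1" by (simp add: i)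
  then show "\<nu> g \<noteq> 0" by auto
qed

lemma Lin_cnj: "\<nu> \<in> Lin G \<Longrightarrow> (\<lambda>g. cnj (\<nu> g)) \<in> Lin G"
  using LinD[of \<nu>] by (intro LinI) auto

lemma Lin_mult: "\<mu> \<in> Lin G \<Longrightarrow> \<nu> \<in> Lin G \<Longrightarrow> (\<lambda>g. \<mu> g * \<nu> g) \<in> Lin G"
  using LinD[of \<nu>] LinD[of \<mu>] by (intro LinI) auto

lemma Lin_Irr: "\<nu> \<in> Lin G \<Longrightarrow> \<nu> \<in> Irr G"
  by (rule LinD(4))

lemma Chars_times_Lin:
  assumes "\<chi> \<in> Chars G" "\<nu> \<in> Lin G" shows "(\<lambda>g. \<chi> g * \<nu> g) \<in> Chars G"
proof -
  obtain n \<rho> where \<rho>: "\<chi> = rep_char G n \<rho>" "is_rep G n \<rho>" using assms by (auto simp: Chars_def)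
  note r = is_repD[OF \<rho>(2)] and l = LinD[OF assms(2)]
  let ?R = "\<lambda>g. \<nu> g \<cdot>\<^sub>m \<rho> g"
  have smult_smult: "c \<cdot>\<^sub>m (d \<cdot>\<^sub>m A) = (c * d) \<cdot>\<^sub>m A" for c d and A :: "complex mat"
    by (intro eq_matI) auto
  have "?R (g \<otimes> h) = ?R g * ?R h" if "g \<in> carrier G" "h \<in> carrier G" for g h
    using mult_smult_assoc_mat[OF r(2)[OF that(1)] smult_carrier_mat[OF r(2)[OF that(2)]], of "\<nu> g" "\<nu> h"]
      mult_smult_distrib[OF r(2)[OF that(1)] r(2)[OF that(2)], of "\<nu> h"] that
    smult_smult by (simp add: r(3) l(3))
  then have "is_rep G n ?R" by (intro is_repI) (use r l(2) in auto)
  moreover have "rep_char G n ?R = (\<lambda>g. \<chi> g * \<nu> g)"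
  proof
    fix g
    show "rep_char G n ?R g = \<chi> g * \<nu> g"
      using carrier_matD[OF r(2), of g] by (auto simp: rep_char_def \<rho>(1) sum_distrib_left mult.commute)
  qed
  ultimately show ?thesis unfolding Chars_def by (metis (mono_tags, lifting) mem_Collect_eq)
qed

lemma char_inner_times_Lin:
  assumes "\<nu> \<in> Lin G"
  shows "char_inner G (\<lambda>g. \<chi> g * \<nu> g) (\<lambda>g. \<xi> g * \<nu> g) = char_inner G \<chi> \<xi>"
proof -
  have "\<chi> g * \<nu> g * cnj (\<xi> g * \<nu> g) = \<chi> g * cnj (\<xi> g)" if "g \<in> carrier G" for g
  proof -
    have "\<chi> g * \<nu> g * cnj (\<xi> g * \<nu> g) = \<chi> g * cnj (\<xi> g) * (\<nu> g * cnj (\<nu> g))" by simp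
    then show ?thesis using Lin_norm(1)[OF assms that] by simp
  qed
  then have "(\<Sum>g\<in>carrier G. \<chi> g * \<nu> g * cnj (\<xi> g * \<nu> g)) = (\<Sum>g\<in>carrier G. \<chi> g * cnj (\<xi> g))"
    by (intro sum.cong refl)
  then show ?thesis by (simp add: char_inner_def)
qed

lemma Irr_times_Lin:
  assumes "\<chi> \<in> Irr G" "\<nu> \<in> Lin G" shows "(\<lambda>g. \<chi> g * \<nu> g) \<in> Irr G"
  by (rule irreducible_iff_norm[OF Chars_times_Lin[OF Irr_Chars[OF assms(1)] assms(2)]])
    (simp add: char_inner_times_Lin[OF assms(2)] Irr_norm[OF assms(1)])

lemma degree_times_Lin: "\<chi> \<in> Chars G \<Longrightarrow> \<nu> \<in> Lin G \<Longrightarrow> char_degree G (\<lambda>g. \<chi> g * \<nu> g) = char_degree G \<chi>"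
  by (rule char_degree_eqI) (simp add: LinD(2) Chars_one)

lemma Lin_degree: "\<nu> \<in> Lin G \<Longrightarrow> char_degree G \<nu> = 1"
  by (simp add: Lin_def)

lemma Lin_iff_Irr: "\<nu> \<in> Lin G \<longleftrightarrow> \<nu> \<in> Irr G \<and> char_degree G \<nu> = 1"
  using Lin_Irr Irr_Chars by (auto simp: Lin_def)

end

section \<open>Conjugation of characters and Clifford's theorem\<close>

definition normalizes :: "('a, 'b) monoid_scheme \<Rightarrow> 'a set \<Rightarrow> 'a \<Rightarrow> bool" where
  "normalizes G Y g \<longleftrightarrow> g \<in> carrier G \<and>
     (\<forall>y\<in>Y. g \<otimes>\<^bsub>G\<^esub> y \<otimes>\<^bsub>G\<^esub> inv\<^bsub>G\<^esub> g \<in> Y \<and> inv\<^bsub>G\<^esub> g \<otimes>\<^bsub>G\<^esub> y \<otimes>\<^bsub>G\<^esub> g \<in> Y)"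

context group begin

lemma normalizesD:
  assumes "normalizes G Y g"
  shows "g \<in> carrier G" "y \<in> Y \<Longrightarrow> g \<otimes> y \<otimes> inv g \<in> Y" "y \<in> Y \<Longrightarrow> inv g \<otimes> y \<otimes> g \<in> Y"
  using assms by (auto simp: normalizes_def)

lemma normalizes_inv: "normalizes G Y g \<Longrightarrow> normalizes G Y (inv g)"
  by (auto simp: normalizes_def)

lemma conj_mult:
  assumes "g \<in> carrier G" "h \<in> carrier G" "y \<in> carrier G"
  shows "(g \<otimes> h) \<otimes> y \<otimes> inv (g \<otimes> h) = g \<otimes> (h \<otimes> y \<otimes> inv h) \<otimes> inv g"
  using assms by (simp add: inv_mult_group m_assoc)

lemma conj_inv_cancel:
  assumes "g \<in> carrier G" "y \<in> carrier G"
  shows "g \<otimes> (inv g \<otimes> y \<otimes> g) \<otimes> inv g = y" "inv g \<otimes> (g \<otimes> y \<otimes> inv g) \<otimes> g = y"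
  using assms by (simp_all add: m_assoc) (simp_all flip: m_assoc)

lemma normal_normalizes: "N \<lhd> G \<Longrightarrow> g \<in> carrier G \<Longrightarrow> normalizes G N g"
  using normal.inv_op_closed1 normal.inv_op_closed2 by (fastforce simp: normalizes_def)

lemma subgroup_normalizes: "subgroup H G \<Longrightarrow> h \<in> H \<Longrightarrow> normalizes G H h"
  using subgroup.m_closed subgroup.m_inv_closed subgroup.mem_carrier
  by (fastforce simp: normalizes_def)

text \<open>Conjugation acts from the right, which is why the element applied first is the left
  factor of the product.\<close>

lemma conj_char_comp:
  assumes Y: "Y \<subseteq> carrier G" and g: "normalizes G Y g" and h: "normalizes G Y h"
  shows "conj_char G Y g (conj_char G Y h \<theta>) = conj_char G Y (h \<otimes> g) \<theta>"
  using normalizesD[OF g] normalizesD[OF h] Y conj_mult[of h g]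
  by (auto simp: conj_char_def fun_eq_iff subset_iff)

lemma conj_char_one:
  assumes "Y \<subseteq> carrier G" "\<And>y. y \<notin> Y \<Longrightarrow> \<theta> y = 0"
  shows "conj_char G Y \<one> \<theta> = \<theta>"
  using assms by (auto simp: conj_char_def fun_eq_iff subset_iff)

lemma conj_char_inv:
  assumes "Y \<subseteq> carrier G" "normalizes G Y g" "\<And>y. y \<notin> Y \<Longrightarrow> \<theta> y = 0"
  shows "conj_char G Y (inv g) (conj_char G Y g \<theta>) = \<theta>" "conj_char G Y g (conj_char G Y (inv g) \<theta>) = \<theta>"
  using conj_char_comp[OF assms(1) normalizes_inv[OF assms(2)] assms(2)]
    conj_char_comp[OF assms(1,2) normalizes_inv[OF assms(2)]] conj_char_one[OF assms(1,3)] normalizesD(1)[OF assms(2)]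
  by simp_all

lemma sum_conj:
  assumes Y: "Y \<subseteq> carrier G" and g: "normalizes G Y g"
  shows "(\<Sum>y\<in>Y. f (g \<otimes> y \<otimes> inv g)) = (\<Sum>y\<in>Y. f y)"
  by (rule sum.reindex_bij_witness[of _ "\<lambda>y. inv g \<otimes> y \<otimes> g" "\<lambda>y. g \<otimes> y \<otimes> inv g"])
    (use normalizesD[OF g] Y conj_inv_cancel in \<open>auto simp: subset_iff\<close>)

lemma char_inner_conj:
  assumes Y: "Y \<subseteq> carrier G" and g: "normalizes G Y g"
  shows "char_inner (G\<lparr>carrier := Y\<rparr>) (conj_char G Y g \<phi>) (conj_char G Y g \<theta>)
    = char_inner (G\<lparr>carrier := Y\<rparr>) \<phi> \<theta>"
  using sum_conj[OF assms, of "\<lambda>y. \<phi> y * cnj (\<theta> y)"]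
  by (simp add: char_inner_def conj_char_def Coset.order_def)

lemma conj_char_Chars:
  assumes Y: "subgroup Y G" and g: "normalizes G Y g" and \<theta>: "\<theta> \<in> Chars (G\<lparr>carrier := Y\<rparr>)"
  shows "conj_char G Y g \<theta> \<in> Chars (G\<lparr>carrier := Y\<rparr>)"
proof -
  interpret Y: group "G\<lparr>carrier := Y\<rparr>" by (rule subgroup_imp_group[OF Y])
  note gc = normalizesD(1)[OF g]
  obtain n \<rho> where \<rho>: "\<theta> = rep_char (G\<lparr>carrier := Y\<rparr>) n \<rho>" "is_rep (G\<lparr>carrier := Y\<rparr>) n \<rho>"
    using \<theta> by (auto simp: Chars_def)
  note r = Y.is_repD[OF \<rho>(2)]
  let ?R = "\<lambda>y. \<rho> (g \<otimes> y \<otimes> inv g)"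
  have "is_rep (G\<lparr>carrier := Y\<rparr>) n ?R"
  proof (rule Y.is_repI)
    show "0 < n" by (rule r(1))
    show "?R y \<in> carrier_mat n n" if "y \<in> carrier (G\<lparr>carrier := Y\<rparr>)" for y
      using r(2)[of "g \<otimes> y \<otimes> inv g"] normalizesD(2)[OF g] that by simp
    show "?R (y \<otimes>\<^bsub>G\<lparr>carrier := Y\<rparr>\<^esub> z) = ?R y * ?R z"
      if "y \<in> carrier (G\<lparr>carrier := Y\<rparr>)" "z \<in> carrier (G\<lparr>carrier := Y\<rparr>)" for y z
    proof -
      have y: "y \<in> Y" "y \<in> carrier G" and z: "z \<in> Y" "z \<in> carrier G"
        using that subgroup.mem_carrier[OF Y] by auto
      have "g \<otimes> (y \<otimes> z) \<otimes> inv g = (g \<otimes> y \<otimes> inv g) \<otimes> (g \<otimes> z \<otimes> inv g)"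
        using gc y z by (simp add: m_assoc) (simp flip: m_assoc)
      then show ?thesis using r(3)[of "g \<otimes> y \<otimes> inv g" "g \<otimes> z \<otimes> inv g"] normalizesD(2)[OF g] y z by simp
    qed
    show "?R \<one>\<^bsub>G\<lparr>carrier := Y\<rparr>\<^esub> = 1\<^sub>m n" using gc r(4) by simp
  qed
  moreover have "rep_char (G\<lparr>carrier := Y\<rparr>) n ?R = conj_char G Y g \<theta>"
    using normalizesD(2)[OF g] by (auto simp: rep_char_def conj_char_def \<rho>(1))
  ultimately show ?thesis unfolding Chars_def by (metis (mono_tags, lifting) mem_Collect_eq)
qed

lemma conj_char_at_one:
  assumes "subgroup Y G" "g \<in> carrier G" shows "conj_char G Y g \<theta> \<one> = \<theta> \<one>"
  using assms by (simp add: conj_char_def subgroup.one_closed)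

lemma char_degree_conj:
  assumes "subgroup Y G" "g \<in> carrier G"
  shows "char_degree (G\<lparr>carrier := Y\<rparr>) (conj_char G Y g \<theta>) = char_degree (G\<lparr>carrier := Y\<rparr>) \<theta>"
  using conj_char_at_one[OF assms, of \<theta>] by (simp add: char_degree_def)

lemma conj_char_res:
  assumes "A \<subseteq> B" "normalizes G A g"
  shows "char_res A (conj_char G B g \<theta>) = conj_char G A g (char_res A \<theta>)"
  using assms(1) normalizesD(2)[OF assms(2)] by (auto simp: char_res_def conj_char_def fun_eq_iff)

lemma conj_char_res_Chars:
  assumes X: "subgroup X G" and Y: "Y \<subseteq> X" and g: "g \<in> X" and ng: "normalizes G Y g"
    and \<chi>: "\<chi> \<in> Chars (G\<lparr>carrier := X\<rparr>)"
  shows "conj_char G Y g (char_res Y \<chi>) = char_res Y \<chi>"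
proof -
  interpret X: group "G\<lparr>carrier := X\<rparr>" by (rule subgroup_imp_group[OF X])
  have "\<chi> (g \<otimes> y \<otimes> inv g) = \<chi> y" if "y \<in> Y" for y
    using X.Chars_conj(2)[OF \<chi>, of g y] g that Y X by (auto simp: m_inv_consistent)
  then show ?thesis using normalizesD(2)[OF ng] by (auto simp: char_res_def conj_char_def fun_eq_iff)
qed

end

context finite_group begin

lemma conj_char_Irr:
  assumes Y: "subgroup Y G" and g: "normalizes G Y g" and \<theta>: "\<theta> \<in> Irr (G\<lparr>carrier := Y\<rparr>)"
  shows "conj_char G Y g \<theta> \<in> Irr (G\<lparr>carrier := Y\<rparr>)"
proof -
  interpret Y: finite_group "G\<lparr>carrier := Y\<rparr>" by (rule subgroup_finite_group[OF Y])
  show ?thesis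
    by (rule Y.irreducible_iff_norm[OF conj_char_Chars[OF Y g Y.Irr_Chars[OF \<theta>]]])
      (simp add: char_inner_conj[OF subgroup.subset[OF Y] g] Y.Irr_norm[OF \<theta>])
qed

lemma cmult_conj:
  assumes Y: "Y \<subseteq> carrier G" and g: "normalizes G Y g"
  shows "cmult (G\<lparr>carrier := Y\<rparr>) (conj_char G Y g \<chi>) (conj_char G Y g \<theta>) = cmult (G\<lparr>carrier := Y\<rparr>) \<chi> \<theta>"
  by (simp add: cmult_def char_inner_conj[OF assms])

lemma cmult_ind:
  assumes H: "subgroup H G" and \<psi>: "\<psi> \<in> Irr (G\<lparr>carrier := H\<rparr>)" and \<chi>: "\<chi> \<in> Irr G"
  shows "cmult G (ind_char G H \<psi>) \<chi> = cmult (G\<lparr>carrier := H\<rparr>) (char_res H \<chi>) \<psi>"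
proof -
  interpret H: finite_group "G\<lparr>carrier := H\<rparr>" by (rule subgroup_finite_group[OF H])
  have C: "\<psi> \<in> Chars (G\<lparr>carrier := H\<rparr>)" "\<chi> \<in> Chars G" using \<psi> \<chi> H.Irr_Chars Irr_Chars by auto
  have "char_inner G (ind_char G H \<psi>) \<chi> = char_inner (G\<lparr>carrier := H\<rparr>) \<psi> (char_res H \<chi>)"
    by (rule frobenius[OF H _ C(2)]) (use Chars_outside[OF C(1)] in simp)
  also have "\<dots> = cnj (of_nat (cmult (G\<lparr>carrier := H\<rparr>) (char_res H \<chi>) \<psi>))"
    unfolding H.of_nat_cmult[OF Chars_res[OF H C(2)] \<psi>] by (rule char_inner_cnj)
  finally show ?thesis by (intro cmult_eqI[OF ind_char_Chars[OF H C(1)] \<chi>]) simp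
qed

lemma degree_ind:
  assumes H: "subgroup H G" and \<psi>: "\<psi> \<in> Chars (G\<lparr>carrier := H\<rparr>)"
  shows "char_degree G (ind_char G H \<psi>) * card H = Coset.order G * char_degree (G\<lparr>carrier := H\<rparr>) \<psi>"
proof -
  interpret H: finite_group "G\<lparr>carrier := H\<rparr>" by (rule subgroup_finite_group[OF H])
  have "ind_char G H \<psi> \<one> = (\<Sum>x\<in>carrier G. \<psi> \<one>) / of_nat (card H)"
    by (simp add: ind_char_def cong: sum.cong)
  then have "ind_char G H \<psi> \<one> * of_nat (card H) = of_nat (Coset.order G) * \<psi> \<one>"
    using H.order_pos by (simp add: Coset.order_def)
  then have "of_nat (char_degree G (ind_char G H \<psi>) * card H)
      = (of_nat (Coset.order G * char_degree (G\<lparr>carrier := H\<rparr>) \<psi>) :: complex)"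
    using Chars_one(1)[OF ind_char_Chars[OF H \<psi>]] H.Chars_one(1)[OF \<psi>] by simp
  then show ?thesis unfolding of_nat_eq_iff .
qed

lemma sum_cmult_res_degree:
  assumes H: "subgroup H G" and \<psi>: "\<psi> \<in> Irr (G\<lparr>carrier := H\<rparr>)"
  shows "(\<Sum>\<chi>\<in>Irr G. cmult (G\<lparr>carrier := H\<rparr>) (char_res H \<chi>) \<psi> * char_degree G \<chi>) * card H
    = Coset.order G * char_degree (G\<lparr>carrier := H\<rparr>) \<psi>"
proof -
  interpret H: finite_group "G\<lparr>carrier := H\<rparr>" by (rule subgroup_finite_group[OF H])
  show ?thesis
    using degree_ind[OF H H.Irr_Chars[OF \<psi>]] degree_decomp[OF ind_char_Chars[OF H H.Irr_Chars[OF \<psi>]]]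
    by (simp add: cmult_ind[OF H \<psi>])
qed

text \<open>Restricting the character induced from \<theta> gives a combination of conjugates of
  \<theta>. By reciprocity \<chi> is a constituent of the induced character, so \<eta>, occurring in
  \<chi>, must be one of these conjugates.\<close>

lemma clifford_conjugate:
  assumes N: "N \<lhd> G" and \<chi>: "\<chi> \<in> Irr G"
    and \<theta>: "\<theta> \<in> Irr (G\<lparr>carrier := N\<rparr>)" "cmult (G\<lparr>carrier := N\<rparr>) (char_res N \<chi>) \<theta> \<noteq> 0"
    and \<eta>: "\<eta> \<in> Irr (G\<lparr>carrier := N\<rparr>)" "cmult (G\<lparr>carrier := N\<rparr>) (char_res N \<chi>) \<eta> \<noteq> 0"
  shows "\<exists>g\<in>carrier G. \<eta> = conj_char G N g \<theta>"
proof (rule ccontr)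
  assume no: "\<not> ?thesis"
  let ?N = "G\<lparr>carrier := N\<rparr>"
  have sN: "subgroup N G" using N normal_imp_subgroup by blast
  interpret N: finite_group ?N by (rule subgroup_finite_group[OF sN])
  have nx: "normalizes G N x" if "x \<in> carrier G" for x using normal_normalizes[OF N that] .
  have ind: "ind_char G N \<theta> \<in> Chars G" by (rule ind_char_Chars[OF sN N.Irr_Chars[OF \<theta>(1)]])
  have res: "char_res N (ind_char G N \<theta>) = (\<lambda>y. \<Sum>x\<in>carrier G. (1 / of_nat (card N)) * conj_char G N (inv x) \<theta> y)"
    using subgroup.subset[OF sN]
    by (auto simp: char_res_def ind_char_def conj_char_def fun_eq_iff sum_divide_distrib)
  have "char_inner ?N (conj_char G N (inv x) \<theta>) \<eta> = 0" if x: "x \<in> carrier G" for x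
    using N.char_inner_Irr[OF conj_char_Irr[OF sN nx \<theta>(1)] \<eta>(1), of "inv x"] no x by auto
  then have "char_inner ?N (char_res N (ind_char G N \<theta>)) \<eta> = 0"
    unfolding res by (simp only: char_inner_sum char_inner_scale) simp
  then have "cmult ?N (char_res N (ind_char G N \<theta>)) \<eta> = 0"
    by (intro N.cmult_eqI[OF Chars_res[OF sN ind] \<eta>(1)]) simp
  moreover have "cmult ?N (char_res N (ind_char G N \<theta>)) \<eta> \<noteq> 0"
    by (rule constituent_trans[OF sN ind \<chi> \<eta>(1)]) (simp_all add: cmult_ind[OF sN \<theta>(1) \<chi>] \<theta>(2) \<eta>(2))
  ultimately show False by simp
qed

lemma cmult_res_conj:
  assumes N: "N \<lhd> G" and \<chi>: "\<chi> \<in> Chars G" and g: "g \<in> carrier G"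
  shows "cmult (G\<lparr>carrier := N\<rparr>) (char_res N \<chi>) (conj_char G N g \<theta>) = cmult (G\<lparr>carrier := N\<rparr>) (char_res N \<chi>) \<theta>"
proof -
  have sN: "subgroup N G" using N normal_imp_subgroup by blast
  have "conj_char G N g (char_res N \<chi>) = char_res N \<chi>"
    by (rule conj_char_res_Chars[OF subgroup_self]) (use subgroup.subset[OF sN] g normal_normalizes[OF N g] \<chi> in auto)
  then show ?thesis using cmult_conj[OF subgroup.subset[OF sN] normal_normalizes[OF N g], of "char_res N \<chi>" \<theta>] by simp
qed

end

lemma degree_res:
  "subgroup H G \<Longrightarrow> char_degree (G\<lparr>carrier := H\<rparr>) (char_res H \<chi>) = char_degree G \<chi>"
  by (simp add: char_degree_def char_res_def subgroup.one_closed)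

section \<open>Orbit lengths and Clifford theory over linear characters\<close>

context finite_group begin

text \<open>Orbit counting in a form that fits conjugation of characters as well as translation of
  cosets: the fibres of \<open>f\<close> are the right cosets of \<open>S\<close>.\<close>

lemma card_image_cosets:
  assumes S: "subgroup S G"
    and f: "\<And>x y. x \<in> carrier G \<Longrightarrow> y \<in> carrier G \<Longrightarrow> f x = f y \<longleftrightarrow> x \<otimes> inv y \<in> S"
  shows "card (f ` carrier G) * card S = Coset.order G"
proof -
  have "card {x' \<in> carrier G. f x' = z} = card S" if "z \<in> f ` carrier G" for z
  proof -
    from that obtain x where x: "x \<in> carrier G" "z = f x" by (rule imageE) auto
    have "{x' \<in> carrier G. f x' = z} = (\<lambda>s. s \<otimes> x) ` S"
    proof (intro equalityI subsetI)
      fix x' assume "x' \<in> {x' \<in> carrier G. f x' = z}"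
      then have x'c: "x' \<in> carrier G" and "f x' = f x" using x(2) by simp_all
      then have x': "x' \<in> carrier G" "x' \<otimes> inv x \<in> S" using f[OF x'c x(1)] by simp_all
      then have "x' = (x' \<otimes> inv x) \<otimes> x" using x(1) by (simp add: m_assoc)
      then show "x' \<in> (\<lambda>s. s \<otimes> x) ` S" using x'(2) by blast
    next
      fix x' assume "x' \<in> (\<lambda>s. s \<otimes> x) ` S"
      then obtain s where s: "s \<in> S" "x' = s \<otimes> x" by blast
      then have sx: "x' \<otimes> inv x = s" and x'c: "x' \<in> carrier G"
        using subgroup.mem_carrier[OF S s(1)] x(1) by (simp_all add: m_assoc)
      have "f x' = f x" using f[OF x'c x(1)] sx s(1) by simp
      then show "x' \<in> {x' \<in> carrier G. f x' = z}" using x'c x(2) by simp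
    qed
    moreover have "inj_on (\<lambda>s. s \<otimes> x) S"
      using x(1) subgroup.mem_carrier[OF S] by (auto intro!: inj_onI)
    ultimately show ?thesis by (simp add: card_image)
  qed
  then have "(\<Sum>z\<in>f ` carrier G. \<Sum>x\<in>{x \<in> carrier G. f x = z}. 1) = card (f ` carrier G) * card S"
    by simp
  then show ?thesis using sum.image_gen[OF fin, of "\<lambda>_. 1::nat" f] by (simp add: Coset.order_def)
qed

lemma stabilizer_conj_char:
  assumes N: "N \<lhd> G" and \<theta>: "\<And>y. y \<notin> N \<Longrightarrow> \<theta> y = 0"
  shows "subgroup (stabilizer G (conj_char G N) \<theta>) G"
    "\<And>x y. x \<in> carrier G \<Longrightarrow> y \<in> carrier G \<Longrightarrow>
      conj_char G N x \<theta> = conj_char G N y \<theta> \<longleftrightarrow> x \<otimes> inv y \<in> stabilizer G (conj_char G N) \<theta>"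
proof -
  have sN: "subgroup N G" using N normal_imp_subgroup by blast
  note Nc = subgroup.subset[OF sN] and nz = normal_normalizes[OF N]
  note comp = conj_char_comp[OF Nc nz nz] and one = conj_char_one[OF Nc \<theta>]
    and cinv = conj_char_inv[OF Nc nz \<theta>]
  show iff: "conj_char G N x \<theta> = conj_char G N y \<theta> \<longleftrightarrow> x \<otimes> inv y \<in> stabilizer G (conj_char G N) \<theta>"
    if x: "x \<in> carrier G" and y: "y \<in> carrier G" for x y
  proof
    assume eq: "conj_char G N x \<theta> = conj_char G N y \<theta>"
    have "conj_char G N (x \<otimes> inv y) \<theta> = conj_char G N (inv y) (conj_char G N x \<theta>)"
      using comp[of "inv y" x] x y by simp
    also have "\<dots> = \<theta>" using eq cinv(1)[OF y] by simp
    finally show "x \<otimes> inv y \<in> stabilizer G (conj_char G N) \<theta>" using x y by (simp add: stabilizer_def)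
  next
    assume "x \<otimes> inv y \<in> stabilizer G (conj_char G N) \<theta>"
    then have "conj_char G N y (conj_char G N (x \<otimes> inv y) \<theta>) = conj_char G N y \<theta>" by (simp add: stabilizer_def)
    moreover have "(x \<otimes> inv y) \<otimes> y = x" using x y by (simp add: m_assoc)
    ultimately show "conj_char G N x \<theta> = conj_char G N y \<theta>" using comp[of y "x \<otimes> inv y"] x y by simp
  qed
  show "subgroup (stabilizer G (conj_char G N) \<theta>) G"
  proof (rule subgroupI)
    show "stabilizer G (conj_char G N) \<theta> \<subseteq> carrier G" by (auto simp: stabilizer_def)
    show "stabilizer G (conj_char G N) \<theta> \<noteq> {}" using one by (auto simp: stabilizer_def)
    show "inv a \<in> stabilizer G (conj_char G N) \<theta>" if "a \<in> stabilizer G (conj_char G N) \<theta>" for a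
      using that iff[of \<one> a] one by (auto simp: stabilizer_def)
    show "a \<otimes> b \<in> stabilizer G (conj_char G N) \<theta>"
      if "a \<in> stabilizer G (conj_char G N) \<theta>" "b \<in> stabilizer G (conj_char G N) \<theta>" for a b
    proof -
      have ab: "a \<in> carrier G" "b \<in> carrier G" "conj_char G N a \<theta> = \<theta>" "conj_char G N b \<theta> = \<theta>"
        using that by (auto simp: stabilizer_def)
      have "conj_char G N (a \<otimes> b) \<theta> = conj_char G N b (conj_char G N a \<theta>)" using comp[OF ab(2,1)] by simp
      then show ?thesis using ab by (simp add: stabilizer_def)
    qed
  qed
qed

text \<open>On \<open>M\<close> the character is a multiple of the sum over the orbit of \<nu>, and
  all members of the orbit have degree 1. So the degree is the multiplicity times the orbit
  length.\<close>

lemma clifford_degree_Lin: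
  assumes M: "M \<lhd> G" and \<nu>: "\<nu> \<in> Lin (G\<lparr>carrier := M\<rparr>)" and \<chi>: "\<chi> \<in> Irr G"
    and over: "cmult (G\<lparr>carrier := M\<rparr>) (char_res M \<chi>) \<nu> \<noteq> 0"
  shows "char_degree G \<chi> * card (stabilizer G (conj_char G M) \<nu>)
     = cmult (G\<lparr>carrier := M\<rparr>) (char_res M \<chi>) \<nu> * Coset.order G"
proof -
  let ?M = "G\<lparr>carrier := M\<rparr>" and ?O = "(\<lambda>g. conj_char G M g \<nu>) ` carrier G"
  have sM: "subgroup M G" using M normal_imp_subgroup by blast
  interpret M: finite_group ?M by (rule subgroup_finite_group[OF sM])
  have C: "char_res M \<chi> \<in> Chars ?M" by (rule Chars_res[OF sM Irr_Chars[OF \<chi>]])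
  have \<nu>I: "\<nu> \<in> Irr ?M" by (rule M.Lin_Irr[OF \<nu>])
  have \<nu>0: "\<And>y. y \<notin> M \<Longrightarrow> \<nu> y = 0" using M.LinD(1)[OF \<nu>] by simp
  have O: "?O \<subseteq> Irr ?M" using conj_char_Irr[OF sM normal_normalizes[OF M] \<nu>I] by blast
  have "char_degree G \<chi> = (\<Sum>\<eta>\<in>Irr ?M. cmult ?M (char_res M \<chi>) \<eta> * char_degree ?M \<eta>)"
    using M.degree_decomp[OF C] degree_res[OF sM] by metis
  also have "\<dots> = (\<Sum>\<eta>\<in>?O. cmult ?M (char_res M \<chi>) \<eta> * char_degree ?M \<eta>)"
    using clifford_conjugate[OF M \<chi> \<nu>I over]
    by (intro sum.mono_neutral_right M.finite_Irr O) auto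
  also have "\<dots> = (\<Sum>\<eta>\<in>?O. cmult ?M (char_res M \<chi>) \<nu>)"
    using cmult_res_conj[OF M Irr_Chars[OF \<chi>]] char_degree_conj[OF sM] M.Lin_degree[OF \<nu>]
    by (intro sum.cong) auto
  also have "\<dots> = card ?O * cmult ?M (char_res M \<chi>) \<nu>" by simp
  finally show ?thesis
    using card_image_cosets[OF stabilizer_conj_char[where \<theta> = \<nu>, OF M \<nu>0]] by (simp add: mult_ac)
qed

text \<open>Invariance of \<nu> makes its averaging element \<open>e\<close> commute with the
  representation, so \<open>e\<close> is a scalar \<open>x\<close>. If \<open>x\<close> is 0 the
  averages vanish; otherwise \<open>\<rho> d * e = \<nu> d * e\<close> forces \<open>D\<close> to
  act through \<nu>.\<close>

lemma normal_Lin_dichotomy: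
  assumes D: "D \<lhd> G" and l: "\<nu> \<in> Lin (G\<lparr>carrier := D\<rparr>)"
    and inv: "\<And>g. g \<in> carrier G \<Longrightarrow> conj_char G D g \<nu> = \<nu>" and \<psi>: "\<psi> \<in> Irr G"
  shows "(\<forall>g\<in>carrier G. \<forall>d\<in>D. \<psi> (g \<otimes> d) = \<psi> g * \<nu> d) \<or>
    (\<forall>g\<in>carrier G. (\<Sum>d\<in>D. \<psi> (g \<otimes> d) * cnj (\<nu> d)) = 0)"
proof -
  let ?D = "G\<lparr>carrier := D\<rparr>"
  have sD: "subgroup D G" using D normal_imp_subgroup by blast
  interpret D: finite_group ?D by (rule subgroup_finite_group[OF sD])
  note Dc = subgroup.mem_carrier[OF sD]
  obtain n \<rho> where \<rho>: "\<psi> = rep_char G n \<rho>" "irreducible_rep G n \<rho>" using \<psi> by (auto simp: Irr_def)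
  have rep: "is_rep G n \<rho>" using \<rho>(2) by (simp add: irreducible_rep_def)
  note r = is_repD[OF rep]
  have repD: "is_rep ?D n \<rho>" by (rule subgroup_rep[OF sD rep])
  define c where "c d = cnj (\<nu> d) / of_nat (card D)" for d
  define e where "e = rep_sum ?D n c \<rho>"
  have e: "e \<in> carrier_mat n n" by (simp add: e_def rep_sum_carrier)
  have e_alt: "e = rep_sum ?D n (\<lambda>d. \<nu> (inv\<^bsub>?D\<^esub> d) / of_nat (Coset.order ?D)) \<rho>"
    using D.Lin_norm(2)[OF l] by (auto simp: e_def c_def rep_sum_def Coset.order_def intro!: mat_eqI cong: sum.cong)
  have absorb: "\<rho> d * e = \<nu> d \<cdot>\<^sub>m e" if "d \<in> D" for d
    unfolding e_alt by (rule D.rep_average[OF l repD]) (use that in simp)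
  have left: "(\<rho> g * e) $$ (i,j) = (\<Sum>d\<in>D. c d * \<rho> (g \<otimes> d) $$ (i,j))"
    if g: "g \<in> carrier G" and i: "i < n" and j: "j < n" for g i j
  proof -
    have "(\<rho> g * e) $$ (i,j) = (\<Sum>a<n. \<Sum>d\<in>D. c d * (\<rho> g $$ (i,a) * \<rho> d $$ (a,j)))"
      unfolding mult_mat_index[OF r(2)[OF g] e i j] using j
      by (simp add: e_def rep_sum_def sum_distrib_left mult_ac)
    also have "\<dots> = (\<Sum>d\<in>D. \<Sum>a<n. c d * (\<rho> g $$ (i,a) * \<rho> d $$ (a,j)))" by (rule sum.swap)
    also have "\<dots> = (\<Sum>d\<in>D. c d * (\<rho> g * \<rho> d) $$ (i,j))"
      using mult_mat_index[OF r(2)[OF g] r(2)[OF Dc] i j] by (intro sum.cong) (auto simp: sum_distrib_left)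
    finally show ?thesis using r(3)[OF g Dc] by simp
  qed
  have right: "(e * \<rho> g) $$ (i,j) = (\<Sum>d\<in>D. c d * \<rho> (d \<otimes> g) $$ (i,j))"
    if g: "g \<in> carrier G" and i: "i < n" and j: "j < n" for g i j
  proof -
    have "(e * \<rho> g) $$ (i,j) = (\<Sum>a<n. \<Sum>d\<in>D. c d * (\<rho> d $$ (i,a) * \<rho> g $$ (a,j)))"
      unfolding mult_mat_index[OF e r(2)[OF g] i j] using i
      by (simp add: e_def rep_sum_def sum_distrib_left sum_distrib_right mult_ac)
    also have "\<dots> = (\<Sum>d\<in>D. \<Sum>a<n. c d * (\<rho> d $$ (i,a) * \<rho> g $$ (a,j)))" by (rule sum.swap)
    also have "\<dots> = (\<Sum>d\<in>D. c d * (\<rho> d * \<rho> g) $$ (i,j))"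
      using mult_mat_index[OF r(2)[OF Dc] r(2)[OF g] i j] by (intro sum.cong) (auto simp: sum_distrib_left)
    finally show ?thesis using r(3)[OF Dc g] by simp
  qed
  have comm: "\<rho> g * e = e * \<rho> g" if g: "g \<in> carrier G" for g
  proof (rule mat_eqI[of _ n n])
    fix i j assume ij: "i < n" "j < n"
    have "(e * \<rho> g) $$ (i,j) = (\<Sum>d\<in>D. c (g \<otimes> d \<otimes> inv g) * \<rho> (g \<otimes> d \<otimes> inv g \<otimes> g) $$ (i,j))"
      unfolding right[OF g ij]
      using sum_conj[OF subgroup.subset[OF sD] normal_normalizes[OF D g], of "\<lambda>d. c d * \<rho> (d \<otimes> g) $$ (i,j)"]
      by simp
    also have "\<dots> = (\<Sum>d\<in>D. c d * \<rho> (g \<otimes> d) $$ (i,j))"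
    proof (rule sum.cong[OF refl])
      fix d assume d: "d \<in> D"
      have "\<nu> (g \<otimes> d \<otimes> inv g) = \<nu> d" using fun_cong[OF inv[OF g], of d] d by (simp add: conj_char_def)
      moreover have "g \<otimes> d \<otimes> inv g \<otimes> g = g \<otimes> d" using g Dc[OF d] by (simp add: m_assoc)
      ultimately show "c (g \<otimes> d \<otimes> inv g) * \<rho> (g \<otimes> d \<otimes> inv g \<otimes> g) $$ (i,j) = c d * \<rho> (g \<otimes> d) $$ (i,j)"
        by (simp add: c_def)
    qed
    finally show "(\<rho> g * e) $$ (i,j) = (e * \<rho> g) $$ (i,j)" using left[OF g ij] by simp
  qed (use r(2)[OF g] e in auto)
  obtain x where x: "e = x \<cdot>\<^sub>m 1\<^sub>m n" using schur_scalar[OF \<rho>(2) e comm] by metis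
  show ?thesis
  proof (cases "x = 0")
    case True
    have "(\<Sum>d\<in>D. \<psi> (g \<otimes> d) * cnj (\<nu> d)) = 0" if g: "g \<in> carrier G" for g
    proof -
      have z: "(\<rho> g * e) $$ (i,i) = 0" if "i < n" for i
        using r(2)[OF g] that by (simp add: x True scalar_prod_def)
      have "(\<Sum>d\<in>D. \<psi> (g \<otimes> d) * cnj (\<nu> d)) = (\<Sum>d\<in>D. \<Sum>i<n. of_nat (card D) * (c d * \<rho> (g \<otimes> d) $$ (i,i)))"
      proof (rule sum.cong[OF refl])
        fix d assume d: "d \<in> D"
        have card: "of_nat (card D) * c d = cnj (\<nu> d)" using D.order_pos by (simp add: c_def Coset.order_def)
        have "(\<Sum>i<n. of_nat (card D) * (c d * \<rho> (g \<otimes> d) $$ (i,i))) = cnj (\<nu> d) * tr n (\<rho> (g \<otimes> d))"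
          unfolding card[symmetric] by (simp add: sum_distrib_left mult.assoc)
        then show "\<psi> (g \<otimes> d) * cnj (\<nu> d) = (\<Sum>i<n. of_nat (card D) * (c d * \<rho> (g \<otimes> d) $$ (i,i)))"
          using g Dc[OF d] by (simp add: \<rho>(1) rep_char_def)
      qed
      also have "\<dots> = of_nat (card D) * (\<Sum>i<n. (\<rho> g * e) $$ (i,i))"
        using left[OF g] by (subst sum.swap) (simp add: sum_distrib_left)
      finally show ?thesis using z by simp
    qed
    then show ?thesis by blast
  next
    case False
    have "\<rho> d = \<nu> d \<cdot>\<^sub>m 1\<^sub>m n" if d: "d \<in> D" for d
    proof (rule mat_eqI[OF r(2)[OF Dc[OF d]]])
      fix i j assume ij: "i < n" "j < n"
      have "x \<cdot>\<^sub>m \<rho> d = \<nu> d \<cdot>\<^sub>m (x \<cdot>\<^sub>m 1\<^sub>m n)"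
        using absorb[OF d] r(2)[OF Dc[OF d]] mult_smult_distrib[OF r(2)[OF Dc[OF d]] one_carrier_mat] by (simp add: x)
      from arg_cong[OF this, of "\<lambda>A. A $$ (i,j)"] ij carrier_matD[OF r(2)[OF Dc[OF d]]] False
      show "\<rho> d $$ (i,j) = (\<nu> d \<cdot>\<^sub>m 1\<^sub>m n) $$ (i,j)" by auto
    qed simp
    then have "\<psi> (g \<otimes> d) = \<psi> g * \<nu> d" if "g \<in> carrier G" "d \<in> D" for g d
      using that Dc[OF that(2)] r(2)[OF that(1)] r(3)[OF that(1) Dc[OF that(2)]]
        mult_smult_distrib[OF r(2)[OF that(1)] one_carrier_mat]
      by (simp add: \<rho>(1) rep_char_def sum_distrib_left mult.commute[of _ "\<nu> d"])
    then show ?thesis by blast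
  qed
qed

lemma normal_Lin_cases:
  assumes D: "D \<lhd> G" and l: "\<nu> \<in> Lin (G\<lparr>carrier := D\<rparr>)"
    and inv: "\<And>g. g \<in> carrier G \<Longrightarrow> conj_char G D g \<nu> = \<nu>" and \<psi>: "\<psi> \<in> Irr G"
  obtains (over) "cmult (G\<lparr>carrier := D\<rparr>) (char_res D \<psi>) \<nu> = char_degree G \<psi>"
      "\<And>g d. g \<in> carrier G \<Longrightarrow> d \<in> D \<Longrightarrow> \<psi> (g \<otimes> d) = \<psi> g * \<nu> d"
    | (not_over) "cmult (G\<lparr>carrier := D\<rparr>) (char_res D \<psi>) \<nu> = 0"
      "\<And>g. g \<in> carrier G \<Longrightarrow> (\<Sum>d\<in>D. \<psi> (g \<otimes> d) * cnj (\<nu> d)) = 0"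
proof -
  let ?D = "G\<lparr>carrier := D\<rparr>"
  have sD: "subgroup D G" using D normal_imp_subgroup by blast
  interpret D: finite_group ?D by (rule subgroup_finite_group[OF sD])
  note Dc = subgroup.mem_carrier[OF sD]
  have C: "char_res D \<psi> \<in> Chars ?D" by (rule Chars_res[OF sD Irr_Chars[OF \<psi>]])
  have inner: "char_inner ?D (char_res D \<psi>) \<nu> = (\<Sum>d\<in>D. \<psi> (\<one> \<otimes> d) * cnj (\<nu> d)) / of_nat (card D)"
    using Dc by (auto simp: char_inner_def char_res_def Coset.order_def intro!: sum.cong)
  from normal_Lin_dichotomy[OF assms] show ?thesis
  proof
    assume *: "\<forall>g\<in>carrier G. \<forall>d\<in>D. \<psi> (g \<otimes> d) = \<psi> g * \<nu> d"
    have "(\<Sum>d\<in>D. \<psi> (\<one> \<otimes> d) * cnj (\<nu> d)) = (\<Sum>d\<in>D. \<psi> \<one>)"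
      using * D.Lin_norm(1)[OF l] by (intro sum.cong) (auto simp: mult.assoc)
    then have "char_inner ?D (char_res D \<psi>) \<nu> = of_nat (char_degree G \<psi>)"
      using inner D.order_pos Chars_one(1)[OF Irr_Chars[OF \<psi>]] by (simp add: Coset.order_def)
    then have "cmult ?D (char_res D \<psi>) \<nu> = char_degree G \<psi>" by (rule D.cmult_eqI[OF C D.Lin_Irr[OF l]])
    then show ?thesis by (rule over) (use * in blast)
  next
    assume *: "\<forall>g\<in>carrier G. (\<Sum>d\<in>D. \<psi> (g \<otimes> d) * cnj (\<nu> d)) = 0"
    then have "char_inner ?D (char_res D \<psi>) \<nu> = of_nat 0" using inner by simp
    then have "cmult ?D (char_res D \<psi>) \<nu> = 0" by (rule D.cmult_eqI[OF C D.Lin_Irr[OF l]])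
    then show ?thesis by (rule not_over) (use * in blast)
  qed
qed

end

section \<open>Kernels, extensions and the Mackey formula\<close>

context finite_group begin

lemma triv_char_Lin: "(\<lambda>g. if g \<in> carrier G then 1 else 0) \<in> Lin G"
  by (rule LinI) auto

end

abbreviation triv_char :: "'a set \<Rightarrow> 'a \<Rightarrow> complex" where
  "triv_char Z \<equiv> (\<lambda>z. if z \<in> Z then 1 else 0)"

text \<open>For a character this means that \<open>Z\<close> acts trivially
  (\<open>in_kernel_rep\<close>). In terms of values, the group enters only through its identity
  element, so the predicate transfers freely between a group and its subgroups.\<close>

definition in_kernel :: "('a, 'b) monoid_scheme \<Rightarrow> 'a set \<Rightarrow> ('a \<Rightarrow> complex) \<Rightarrow> bool" where
  "in_kernel G Z \<chi> \<longleftrightarrow> (\<forall>z\<in>Z. \<chi> z = \<chi> \<one>\<^bsub>G\<^esub>)"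

section \<open>Homogeneous restrictions and kernels\<close>

context finite_group begin

lemma triv_char_subgroup:
  assumes "subgroup Z G" shows "triv_char Z \<in> Lin (G\<lparr>carrier := Z\<rparr>)"
proof -
  interpret Z: finite_group "G\<lparr>carrier := Z\<rparr>" by (rule subgroup_finite_group[OF assms])
  show ?thesis using Z.triv_char_Lin by simp
qed

text \<open>The degree is the weighted sum of all multiplicities in the restriction to
  \<open>Z\<close>. Equality with the multiplicity of \<nu> leaves no room for another
  constituent.\<close>

lemma homogeneous_iff:
  assumes Z: "subgroup Z G" and \<nu>: "\<nu> \<in> Lin (G\<lparr>carrier := Z\<rparr>)" and \<chi>: "\<chi> \<in> Chars G"
  shows "(\<forall>z\<in>Z. \<chi> z = \<chi> \<one> * \<nu> z) \<longleftrightarrow> cmult (G\<lparr>carrier := Z\<rparr>) (char_res Z \<chi>) \<nu> = char_degree G \<chi>"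
    "cmult (G\<lparr>carrier := Z\<rparr>) (char_res Z \<chi>) \<nu> \<le> char_degree G \<chi>"
proof -
  let ?Z = "G\<lparr>carrier := Z\<rparr>"
  interpret Z: finite_group ?Z by (rule subgroup_finite_group[OF Z])
  have C: "char_res Z \<chi> \<in> Chars ?Z" by (rule Chars_res[OF Z \<chi>])
  have \<nu>I: "\<nu> \<in> Irr ?Z" by (rule Z.Lin_Irr[OF \<nu>])
  have "char_degree G \<chi> = (\<Sum>\<eta>\<in>Irr ?Z. cmult ?Z (char_res Z \<chi>) \<eta> * char_degree ?Z \<eta>)"
    using Z.degree_decomp[OF C] degree_res[OF Z, of \<chi>] by metis
  also have "\<dots> = cmult ?Z (char_res Z \<chi>) \<nu> * char_degree ?Z \<nu>
      + (\<Sum>\<eta>\<in>Irr ?Z - {\<nu>}. cmult ?Z (char_res Z \<chi>) \<eta> * char_degree ?Z \<eta>)"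
    by (rule sum.remove[OF Z.finite_Irr \<nu>I])
  finally have deg: "char_degree G \<chi> = cmult ?Z (char_res Z \<chi>) \<nu>
      + (\<Sum>\<eta>\<in>Irr ?Z - {\<nu>}. cmult ?Z (char_res Z \<chi>) \<eta> * char_degree ?Z \<eta>)"
    using Z.Lin_degree[OF \<nu>] by simp
  then show "cmult ?Z (char_res Z \<chi>) \<nu> \<le> char_degree G \<chi>" by simp
  show "(\<forall>z\<in>Z. \<chi> z = \<chi> \<one> * \<nu> z) \<longleftrightarrow> cmult ?Z (char_res Z \<chi>) \<nu> = char_degree G \<chi>"
  proof
    assume *: "\<forall>z\<in>Z. \<chi> z = \<chi> \<one> * \<nu> z"
    have "(\<Sum>z\<in>Z. char_res Z \<chi> z * cnj (\<nu> z)) = (\<Sum>z\<in>Z. \<chi> \<one>)"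
    proof (rule sum.cong[OF refl])
      fix z assume z: "z \<in> Z"
      have "\<nu> z * cnj (\<nu> z) = 1" using Z.Lin_norm(1)[OF \<nu>, of z] z by simp
      moreover have "char_res Z \<chi> z = \<chi> \<one> * \<nu> z" using * z by (simp add: char_res_def)
      ultimately show "char_res Z \<chi> z * cnj (\<nu> z) = \<chi> \<one>" by (simp add: mult.assoc)
    qed
    then have "char_inner ?Z (char_res Z \<chi>) \<nu> = of_nat (char_degree G \<chi>)"
      using Z.order_pos Chars_one(1)[OF \<chi>] by (simp add: char_inner_def Coset.order_def)
    then show "cmult ?Z (char_res Z \<chi>) \<nu> = char_degree G \<chi>" by (rule Z.cmult_eqI[OF C \<nu>I])
  next
    assume *: "cmult ?Z (char_res Z \<chi>) \<nu> = char_degree G \<chi>"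
    then have "(\<Sum>\<eta>\<in>Irr ?Z - {\<nu>}. cmult ?Z (char_res Z \<chi>) \<eta> * char_degree ?Z \<eta>) = 0" using deg by simp
    then have z: "cmult ?Z (char_res Z \<chi>) \<eta> = 0" if "\<eta> \<in> Irr ?Z" "\<eta> \<noteq> \<nu>" for \<eta>
      using that Z.finite_Irr Z.Chars_one(2)[OF Z.Irr_Chars[OF that(1)]] by (auto simp: sum_eq_0_iff)
    show "\<forall>z\<in>Z. \<chi> z = \<chi> \<one> * \<nu> z"
    proof
      fix z assume zZ: "z \<in> Z"
      have "char_res Z \<chi> z = (\<Sum>\<eta>\<in>Irr ?Z. of_nat (cmult ?Z (char_res Z \<chi>) \<eta>) * \<eta> z)" by (rule Z.decomp[OF C])
      also have "\<dots> = of_nat (cmult ?Z (char_res Z \<chi>) \<nu>) * \<nu> z"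
        using z by (subst sum.remove[OF Z.finite_Irr \<nu>I]) simp
      finally show "\<chi> z = \<chi> \<one> * \<nu> z" using * Chars_one(1)[OF \<chi>] zZ by (simp add: char_res_def)
    qed
  qed
qed

text \<open>Each constituent contains \<nu> on \<open>Z\<close> at most as often as its degree. A
  strict inequality for \<psi> would make the total for \<chi> strict as well.\<close>

lemma homogeneous_constituent:
  assumes Z: "subgroup Z G" and \<nu>: "\<nu> \<in> Lin (G\<lparr>carrier := Z\<rparr>)" and \<chi>: "\<chi> \<in> Chars G"
    and hom: "\<forall>z\<in>Z. \<chi> z = \<chi> \<one> * \<nu> z" and \<psi>: "\<psi> \<in> Irr G" "cmult G \<chi> \<psi> \<noteq> 0"
  shows "\<forall>z\<in>Z. \<psi> z = \<psi> \<one> * \<nu> z"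
proof (rule ccontr)
  assume neg: "\<not> (\<forall>z\<in>Z. \<psi> z = \<psi> \<one> * \<nu> z)"
  let ?Z = "G\<lparr>carrier := Z\<rparr>"
  interpret Z: finite_group ?Z by (rule subgroup_finite_group[OF Z])
  have lt: "cmult ?Z (char_res Z \<psi>) \<nu> < char_degree G \<psi>"
    using homogeneous_iff[OF Z \<nu> Irr_Chars[OF \<psi>(1)]] neg by (metis le_neq_implies_less)
  have "char_degree G \<chi> = (\<Sum>\<phi>\<in>Irr G. cmult G \<chi> \<phi> * cmult ?Z (char_res Z \<phi>) \<nu>)"
    using homogeneous_iff(1)[OF Z \<nu> \<chi>] hom cmult_res_decomp[OF Z \<chi> Z.Lin_Irr[OF \<nu>]] by simp
  also have "\<dots> < (\<Sum>\<phi>\<in>Irr G. cmult G \<chi> \<phi> * char_degree G \<phi>)"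
    using homogeneous_iff(2)[OF Z \<nu> Irr_Chars] lt \<psi>
    by (intro sum_strict_mono_ex1 finite_Irr) auto
  also have "\<dots> = char_degree G \<chi>" using degree_decomp[OF \<chi>] by simp
  finally show False by simp
qed

lemma homogeneous_mult:
  assumes Z: "subgroup Z G" and \<nu>: "\<nu> \<in> Lin (G\<lparr>carrier := Z\<rparr>)"
    and \<rho>: "is_rep G n \<rho>" and hom: "\<forall>z\<in>Z. rep_char G n \<rho> z = of_nat n * \<nu> z" and z: "z \<in> Z"
  shows "\<rho> z = \<nu> z \<cdot>\<^sub>m 1\<^sub>m n"
proof -
  let ?Z = "G\<lparr>carrier := Z\<rparr>"
  interpret Z: finite_group ?Z by (rule subgroup_finite_group[OF Z])
  show ?thesis
  proof (rule Z.rep_scalar[OF \<nu> subgroup_rep(1)[OF Z \<rho>]])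
    show "rep_char ?Z n \<rho> g = of_nat n * \<nu> g" if "g \<in> carrier ?Z" for g
      unfolding subgroup_rep(2)[OF Z \<rho>] using hom that by (simp add: char_res_def)
  qed (use z in simp)
qed

lemma in_kernel_hom: "in_kernel G Z \<chi> \<longleftrightarrow> (\<forall>z\<in>Z. \<chi> z = \<chi> \<one> * triv_char Z z)"
  by (auto simp: in_kernel_def)

lemma in_kernel_rep:
  assumes Z: "subgroup Z G" and \<rho>: "is_rep G n \<rho>" and ker: "in_kernel G Z (rep_char G n \<rho>)" and z: "z \<in> Z"
  shows "\<rho> z = 1\<^sub>m n"
proof -
  have "\<rho> z = triv_char Z z \<cdot>\<^sub>m 1\<^sub>m n"
    using homogeneous_mult[OF Z triv_char_subgroup[OF Z] \<rho> _ z] ker rep_char_one[OF \<rho>]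
    by (simp add: in_kernel_hom)
  also have "\<dots> = 1\<^sub>m n" using z by (intro eq_matI) auto
  finally show ?thesis .
qed

lemma in_kernel_mult:
  assumes Z: "subgroup Z G" and \<chi>: "\<chi> \<in> Chars G" and ker: "in_kernel G Z \<chi>"
    and g: "g \<in> carrier G" and z: "z \<in> Z"
  shows "\<chi> (g \<otimes> z) = \<chi> g" "\<chi> (z \<otimes> g) = \<chi> g"
proof -
  obtain n \<rho> where \<rho>: "\<chi> = rep_char G n \<rho>" "is_rep G n \<rho>" using \<chi> by (auto simp: Chars_def)
  note r = is_repD[OF \<rho>(2)]
  have zc: "z \<in> carrier G" using subgroup.mem_carrier[OF Z z] .
  have "\<rho> z = 1\<^sub>m n" using in_kernel_rep[OF Z \<rho>(2) _ z] ker \<rho>(1) by simp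
  then show "\<chi> (g \<otimes> z) = \<chi> g" "\<chi> (z \<otimes> g) = \<chi> g"
    using r(2)[OF g] r(3)[OF g zc] r(3)[OF zc g] g zc by (simp_all add: \<rho>(1) rep_char_def)
qed

lemma in_kernel_constituent:
  assumes "subgroup Z G" "\<chi> \<in> Chars G" "in_kernel G Z \<chi>" "\<psi> \<in> Irr G" "cmult G \<chi> \<psi> \<noteq> 0"
  shows "in_kernel G Z \<psi>"
  using homogeneous_constituent[OF assms(1) triv_char_subgroup[OF assms(1)] assms(2) _ assms(4,5)] assms(3)
  by (simp add: in_kernel_hom)

lemma conj_triv_char: "normalizes G Z g \<Longrightarrow> conj_char G Z g (triv_char Z) = triv_char Z"
  using normalizesD(2) by (auto simp: conj_char_def)

text \<open>The trivial character of a normal subgroup is invariant, so by the dichotomy one trivial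
  constituent makes the whole restriction trivial.\<close>

lemma in_kernel_normal_iff:
  assumes Z: "Z \<lhd> G" and \<psi>: "\<psi> \<in> Irr G"
  shows "in_kernel G Z \<psi> \<longleftrightarrow> cmult (G\<lparr>carrier := Z\<rparr>) (char_res Z \<psi>) (triv_char Z) \<noteq> 0"
proof -
  have sZ: "subgroup Z G" using Z normal_imp_subgroup by blast
  note L = triv_char_subgroup[OF sZ] and C = Irr_Chars[OF \<psi>]
  show ?thesis
    by (rule normal_Lin_cases[OF Z L conj_triv_char[OF normal_normalizes[OF Z]] \<psi>])
      (use homogeneous_iff(1)[OF sZ L C] Chars_one(2)[OF C] in \<open>auto simp: in_kernel_hom\<close>)
qed

text \<open>Commutators act trivially, so the matrices of the representation commute and its
  dimension is 1.\<close>

lemma commutator_kernel_linear: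
  assumes Z: "subgroup Z G" and comm: "\<And>x y. x \<in> carrier G \<Longrightarrow> y \<in> carrier G \<Longrightarrow> x \<otimes> y \<otimes> inv x \<otimes> inv y \<in> Z"
    and \<psi>: "\<psi> \<in> Irr G" and ker: "in_kernel G Z \<psi>"
  shows "\<psi> \<in> Lin G"
proof -
  obtain n \<rho> where \<rho>: "\<psi> = rep_char G n \<rho>" "irreducible_rep G n \<rho>" using \<psi> by (auto simp: Irr_def)
  have rep: "is_rep G n \<rho>" using \<rho>(2) by (simp add: irreducible_rep_def)
  note r = is_repD[OF rep]
  have "\<rho> x * \<rho> y = \<rho> y * \<rho> x" if x: "x \<in> carrier G" and y: "y \<in> carrier G" for x y
  proof -
    let ?z = "x \<otimes> y \<otimes> inv x \<otimes> inv y"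
    have "x \<otimes> y = ?z \<otimes> (y \<otimes> x)" using x y by (simp add: m_assoc) (simp flip: m_assoc)
    moreover have "\<rho> ?z = 1\<^sub>m n" using in_kernel_rep[OF Z rep _ comm[OF x y]] ker \<rho>(1) by simp
    ultimately have "\<rho> (x \<otimes> y) = \<rho> (y \<otimes> x)"
      using r(2)[of "y \<otimes> x"] r(3)[of ?z "y \<otimes> x"] x y by simp
    then show ?thesis using r(3) x y by simp
  qed
  then have "n = 1" by (rule commuting_irreducible_dim_one[OF \<rho>(2)])
  then have "char_degree G \<psi> = 1" using rep_char_one[OF rep] \<rho>(1) char_degree_eqI[of \<psi> G 1] by simp
  then show ?thesis using \<psi> by (simp add: Lin_iff_Irr)
qed

text \<open>The extension is a power of the determinant of a representation lying over \<open>\<nu>\<close>.\<close>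

lemma extend_linear:
  assumes D: "subgroup D G" and \<nu>: "\<nu> \<in> Lin (G\<lparr>carrier := D\<rparr>)"
    and \<xi>: "\<xi> \<in> Chars G" and hom: "\<forall>d\<in>D. \<xi> d = \<xi> \<one> * \<nu> d"
    and cop: "coprime (char_degree G \<xi>) k" and pow: "\<And>d. d \<in> D \<Longrightarrow> \<nu> d ^ k = 1"
  obtains \<mu> where "\<mu> \<in> Lin G" "char_res D \<mu> = \<nu>"
proof -
  let ?D = "G\<lparr>carrier := D\<rparr>"
  interpret D: finite_group ?D by (rule subgroup_finite_group[OF D])
  obtain n \<rho> where \<rho>: "\<xi> = rep_char G n \<rho>" "is_rep G n \<rho>" using \<xi> by (auto simp: Chars_def)
  note r = is_repD[OF \<rho>(2)]
  have n: "\<xi> \<one> = of_nat n" "char_degree G \<xi> = n"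
    using rep_char_one[OF \<rho>(2)] \<rho>(1) char_degree_eqI[of \<xi> G n] by auto
  \<comment> \<open>The determinant restricts to the \<open>n\<close>-th power of \<nu>. Raising it
    to an inverse \<open>x\<close> of \<open>n\<close> modulo the exponent \<open>k\<close> recovers
    \<nu>.\<close>
  obtain x where x: "[n * x = 1] (mod k)" using cong_solve_coprime_nat[of n k] cop n(2) by auto
  define \<mu> where "\<mu> g = (if g \<in> carrier G then det (\<rho> g) ^ x else 0)" for g
  have "\<mu> \<in> Lin G"
  proof (rule LinI)
    show "\<mu> (g \<otimes> h) = \<mu> g * \<mu> h" if "g \<in> carrier G" "h \<in> carrier G" for g h
      using that r(3)[OF that] det_mult[OF r(2)[OF that(1)] r(2)[OF that(2)]]
      by (simp add: \<mu>_def power_mult_distrib)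
  qed (simp_all add: \<mu>_def r(4))
  moreover have "char_res D \<mu> = \<nu>"
  proof
    fix d
    show "char_res D \<mu> d = \<nu> d"
    proof (cases "d \<in> D")
      case True
      have "\<rho> d = \<nu> d \<cdot>\<^sub>m 1\<^sub>m n" using homogeneous_mult[OF D \<nu> \<rho>(2) _ True] hom \<rho>(1) n(1) by simp
      then have "\<mu> d = \<nu> d ^ (n * x)"
        using subgroup.mem_carrier[OF D True] by (simp add: \<mu>_def power_mult)
      also have "\<dots> = \<nu> d"
      proof (cases "k = 0")
        case True
        \<comment> \<open>Congruence modulo 0 is equality, so \<open>n * x = 1\<close> already in
          the natural numbers.\<close>
        then show ?thesis using x by (simp add: cong_def)
      next
        case False
        have red: "\<nu> d ^ m = \<nu> d ^ (m mod k)" for m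
        proof -
          have "\<nu> d ^ m = \<nu> d ^ (k * (m div k) + m mod k)" by simp
          also have "\<dots> = (\<nu> d ^ k) ^ (m div k) * \<nu> d ^ (m mod k)" by (simp only: power_add power_mult)
          finally show ?thesis using pow[OF True] by simp
        qed
        have "\<nu> d ^ (n * x) = \<nu> d ^ 1" using red[of "n * x"] red[of 1] x by (simp add: cong_def)
        then show ?thesis by simp
      qed
      finally show ?thesis using True by (simp add: char_res_def)
    next
      case False
      then show ?thesis using D.LinD(1)[OF \<nu>] by (simp add: char_res_def)
    qed
  qed
  ultimately show ?thesis by (rule that)
qed

section \<open>Products of subgroups, Mackey's formula and the Clifford correspondence\<close>

lemma sum_product_subgroups:
  fixes F :: "'a \<Rightarrow> complex"
  assumes N: "subgroup N G" and H: "subgroup H G"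
    and NH: "\<And>g. g \<in> carrier G \<Longrightarrow> \<exists>n\<in>N. \<exists>h\<in>H. g = n \<otimes> h"
  shows "(\<Sum>n\<in>N. \<Sum>h\<in>H. F (n \<otimes> h)) = of_nat (card (N \<inter> H)) * (\<Sum>x\<in>carrier G. F x)"
proof -
  have fin': "finite (N \<times> H)" using subgroup.subset[OF N] subgroup.subset[OF H] finite_subset[OF _ fin] by blast
  note Nc = subgroup.mem_carrier[OF N] and Hc = subgroup.mem_carrier[OF H]
  let ?f = "\<lambda>(n,h). n \<otimes> h"
  have img: "?f ` (N \<times> H) = carrier G" using NH Nc Hc by (auto simp: image_iff) (metis+)?
  have fib: "card {p \<in> N \<times> H. ?f p = x} = card (N \<inter> H)" if x: "x \<in> carrier G" for x
  proof -
    obtain n h where nh: "n \<in> N" "h \<in> H" "x = n \<otimes> h" using NH[OF x] by blast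
    \<comment> \<open>Two factorizations of the same element differ by moving an element of the
      intersection from one factor to the other.\<close>
    have "bij_betw (\<lambda>q. (n \<otimes> q, inv q \<otimes> h)) (N \<inter> H) {p \<in> N \<times> H. ?f p = x}"
    proof (rule bij_betwI[where g = "\<lambda>(n',h'). inv n \<otimes> n'"])
      show "(\<lambda>q. (n \<otimes> q, inv q \<otimes> h)) \<in> N \<inter> H \<rightarrow> {p \<in> N \<times> H. ?f p = x}"
      proof
        fix q assume q: "q \<in> N \<inter> H"
        have "n \<otimes> q \<otimes> (inv q \<otimes> h) = x"
          using q Nc[of q] Nc[OF nh(1)] Hc[OF nh(2)] nh(3) by (simp add: m_assoc) (simp flip: m_assoc)
        then show "(n \<otimes> q, inv q \<otimes> h) \<in> {p \<in> N \<times> H. ?f p = x}"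
          using q nh subgroup.m_closed[OF N] subgroup.m_closed[OF H] subgroup.m_inv_closed[OF H] by auto
      qed
      show "(\<lambda>(n',h'). inv n \<otimes> n') \<in> {p \<in> N \<times> H. ?f p = x} \<rightarrow> N \<inter> H"
      proof
        fix p assume "p \<in> {p \<in> N \<times> H. ?f p = x}"
        then obtain n' h' where p: "p = (n',h')" "n' \<in> N" "h' \<in> H" "n' \<otimes> h' = n \<otimes> h" using nh(3) by auto
        have "inv n \<otimes> n' = inv n \<otimes> (n' \<otimes> h') \<otimes> inv h'"
          using Nc[OF nh(1)] Nc[OF p(2)] Hc[OF p(3)] by (simp add: m_assoc)
        also have "\<dots> = h \<otimes> inv h'" unfolding p(4) using Nc[OF nh(1)] Hc[OF nh(2)] Hc[OF p(3)] by (simp flip: m_assoc)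
        finally have "inv n \<otimes> n' \<in> H"
          using subgroup.m_closed[OF H nh(2) subgroup.m_inv_closed[OF H p(3)]] by simp
        then show "(case p of (n',h') \<Rightarrow> inv n \<otimes> n') \<in> N \<inter> H"
          using subgroup.m_closed[OF N subgroup.m_inv_closed[OF N nh(1)] p(2)] p(1) by simp
      qed
      show "(case (n \<otimes> q, inv q \<otimes> h) of (n',h') \<Rightarrow> inv n \<otimes> n') = q" if "q \<in> N \<inter> H" for q
        using that Nc[of q] Nc[OF nh(1)] by (simp flip: m_assoc)
      show "(n \<otimes> (case p of (n',h') \<Rightarrow> inv n \<otimes> n'), inv (case p of (n',h') \<Rightarrow> inv n \<otimes> n') \<otimes> h) = p"
        if pp: "p \<in> {p \<in> N \<times> H. ?f p = x}" for p
      proof -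
        obtain n' h' where p: "p = (n',h')" "n' \<in> N" "h' \<in> H" "n' \<otimes> h' = n \<otimes> h" using pp nh(3) by auto
        note c = Nc[OF nh(1)] Hc[OF nh(2)] Nc[OF p(2)] Hc[OF p(3)]
        have "inv (inv n \<otimes> n') \<otimes> h = inv n' \<otimes> (n \<otimes> h)" using c by (simp add: inv_mult_group m_assoc)
        also have "\<dots> = h'" unfolding p(4)[symmetric] using c by (simp flip: m_assoc)
        finally show ?thesis using c p(1) by (simp flip: m_assoc)
      qed
    qed
    then show ?thesis by (simp add: bij_betw_same_card)
  qed
  have "(\<Sum>n\<in>N. \<Sum>h\<in>H. F (n \<otimes> h)) = (\<Sum>p\<in>N \<times> H. F (?f p))"
    by (simp add: sum.cartesian_product case_prod_unfold)
  also have "\<dots> = (\<Sum>x\<in>?f ` (N \<times> H). \<Sum>p\<in>{p \<in> N \<times> H. ?f p = x}. F (?f p))"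
    by (rule sum.image_gen[OF fin'])
  also have "\<dots> = (\<Sum>x\<in>carrier G. \<Sum>p\<in>{p \<in> N \<times> H. ?f p = x}. F x)"
    unfolding img by (intro sum.cong) auto
  also have "\<dots> = (\<Sum>x\<in>carrier G. of_nat (card (N \<inter> H)) * F x)"
    using fib by (intro sum.cong) auto
  finally show ?thesis by (simp add: sum_distrib_left)
qed

text \<open>Since \<open>G = N H\<close> there is a single double coset, so restricting to
  \<open>N\<close> a character induced from \<open>H\<close> is the same as inducing from the
  intersection its restriction. The left side is the multiplicity of \<theta> in that restriction;
  reciprocity moves it down to the intersection.\<close>

lemma mackey_sum:
  assumes N: "subgroup N G" and H: "subgroup H G"
    and NH: "\<And>g. g \<in> carrier G \<Longrightarrow> \<exists>n\<in>N. \<exists>h\<in>H. g = n \<otimes> h"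
    and \<psi>: "\<psi> \<in> Irr (G\<lparr>carrier := H\<rparr>)" and \<theta>: "\<theta> \<in> Irr (G\<lparr>carrier := N\<rparr>)"
  shows "of_nat (\<Sum>\<chi>\<in>Irr G. cmult (G\<lparr>carrier := H\<rparr>) (char_res H \<chi>) \<psi> * cmult (G\<lparr>carrier := N\<rparr>) (char_res N \<chi>) \<theta>)
    = char_inner (G\<lparr>carrier := N \<inter> H\<rparr>) (char_res (N \<inter> H) \<psi>) (char_res (N \<inter> H) \<theta>)"
proof -
  let ?Q = "N \<inter> H" and ?N = "G\<lparr>carrier := N\<rparr>" and ?H = "G\<lparr>carrier := H\<rparr>"
  interpret N: finite_group ?N by (rule subgroup_finite_group[OF N])
  interpret H: finite_group ?H by (rule subgroup_finite_group[OF H])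
  have Q: "subgroup ?Q G" using subgroups_Inter_pair[OF N H] .
  have QN: "subgroup ?Q ?N" using subgroup_incl[OF Q N] by simp
  interpret Q: finite_group "G\<lparr>carrier := ?Q\<rparr>" by (rule subgroup_finite_group[OF Q])
  note Nc = subgroup.mem_carrier[OF N] and Hc = subgroup.mem_carrier[OF H]
  have \<psi>C: "\<psi> \<in> Chars ?H" by (rule H.Irr_Chars[OF \<psi>])
  have \<theta>C: "\<theta> \<in> Chars ?N" by (rule N.Irr_Chars[OF \<theta>])
  have ind: "ind_char G H \<psi> \<in> Chars G" by (rule ind_char_Chars[OF H \<psi>C])
  have key: "char_res N (ind_char G H \<psi>) = ind_char ?N ?Q (char_res ?Q \<psi>)"
  proof
    fix y
    show "char_res N (ind_char G H \<psi>) y = ind_char ?N ?Q (char_res ?Q \<psi>) y"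
    proof (cases "y \<in> N")
      case True
      have yc: "y \<in> carrier G" by (rule Nc[OF True])
      have "(\<Sum>n\<in>N. \<Sum>h\<in>H. \<psi> (inv (n \<otimes> h) \<otimes> y \<otimes> (n \<otimes> h)))
          = (\<Sum>n\<in>N. \<Sum>h\<in>H. char_res ?Q \<psi> (inv n \<otimes> y \<otimes> n))"
      proof (intro sum.cong refl)
        fix n h assume n: "n \<in> N" and h: "h \<in> H"
        have "inv (n \<otimes> h) \<otimes> y \<otimes> (n \<otimes> h) = inv h \<otimes> (inv n \<otimes> y \<otimes> n) \<otimes> h"
          using Nc[OF n] Hc[OF h] yc by (simp add: inv_mult_group m_assoc)
        then have "\<psi> (inv (n \<otimes> h) \<otimes> y \<otimes> (n \<otimes> h)) = \<psi> (inv n \<otimes> y \<otimes> n)"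
          using Chars_conj_subgroup[OF H \<psi>C h, of "inv n \<otimes> y \<otimes> n"] Nc[OF n] yc by simp
        moreover have "inv n \<otimes> y \<otimes> n \<in> N"
          using subgroup.m_closed[OF N] subgroup.m_inv_closed[OF N] n True by blast
        ultimately show "\<psi> (inv (n \<otimes> h) \<otimes> y \<otimes> (n \<otimes> h)) = char_res ?Q \<psi> (inv n \<otimes> y \<otimes> n)"
          using Chars_outside[OF \<psi>C] by (auto simp: char_res_def)
      qed
      also have "\<dots> = of_nat (card H) * (\<Sum>n\<in>N. char_res ?Q \<psi> (inv n \<otimes> y \<otimes> n))"
        by (simp add: sum_distrib_left)
      finally have "of_nat (card ?Q) * (\<Sum>x\<in>carrier G. \<psi> (inv x \<otimes> y \<otimes> x))
          = of_nat (card H) * (\<Sum>n\<in>N. char_res ?Q \<psi> (inv n \<otimes> y \<otimes> n))"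
        using sum_product_subgroups[OF N H NH, of "\<lambda>x. \<psi> (inv x \<otimes> y \<otimes> x)"] by simp
      moreover have "of_nat (card ?Q) \<noteq> (0::complex)" "of_nat (card H) \<noteq> (0::complex)"
        using Q.order_pos H.order_pos by (simp_all add: Coset.order_def)
      ultimately have "(\<Sum>x\<in>carrier G. \<psi> (inv x \<otimes> y \<otimes> x)) / of_nat (card H)
          = (\<Sum>n\<in>N. char_res ?Q \<psi> (inv n \<otimes> y \<otimes> n)) / of_nat (card ?Q)"
        by (simp add: field_simps)
      moreover have "(\<Sum>n\<in>N. char_res ?Q \<psi> (inv n \<otimes> y \<otimes> n))
          = (\<Sum>n\<in>N. char_res ?Q \<psi> (inv\<^bsub>?N\<^esub> n \<otimes> y \<otimes> n))"
        using m_inv_consistent[OF N] by simp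
      ultimately show ?thesis using True yc by (simp add: char_res_def[of N] ind_char_def)
    qed (simp add: char_res_def[of N] ind_char_def)
  qed
  have "of_nat (\<Sum>\<chi>\<in>Irr G. cmult ?H (char_res H \<chi>) \<psi> * cmult ?N (char_res N \<chi>) \<theta>)
      = (of_nat (cmult ?N (char_res N (ind_char G H \<psi>)) \<theta>) :: complex)"
    by (simp add: cmult_res_decomp[OF N ind \<theta>] cmult_ind[OF H \<psi>])
  also have "\<dots> = char_inner ?N (ind_char ?N ?Q (char_res ?Q \<psi>)) \<theta>"
    using N.of_nat_cmult[OF Chars_res[OF N ind] \<theta>] key by simp
  also have "\<dots> = char_inner (G\<lparr>carrier := ?Q\<rparr>) (char_res ?Q \<psi>) (char_res ?Q \<theta>)"
  proof -
    have "char_res ?Q \<psi> h = 0" if "h \<notin> ?Q" for h unfolding char_res_def by (rule if_not_P[OF that])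
    from N.frobenius[OF QN this \<theta>C] show ?thesis by simp
  qed
  finally show ?thesis .
qed

text \<open>The matrix of multiplicities of characters of \<open>S\<close> in characters of
  \<open>G\<close> is balanced with constant weight, the index of \<open>S\<close>. Rows are
  computed by \<open>clifford_degree_Lin\<close>, since the multiplicity of \<nu> in a character of
  \<open>S\<close> over \<nu> is its full degree. Columns are degrees of induced characters.\<close>

lemma clifford_correspondence:
  assumes M: "M \<lhd> G" and \<nu>: "\<nu> \<in> Lin (G\<lparr>carrier := M\<rparr>)"
  defines "S \<equiv> stabilizer G (conj_char G M) \<nu>"
  obtains f where "bij_betw f {\<theta> \<in> Irr G. cmult (G\<lparr>carrier := M\<rparr>) (char_res M \<theta>) \<nu> \<noteq> 0}
      {\<psi> \<in> Irr (G\<lparr>carrier := S\<rparr>). cmult (G\<lparr>carrier := M\<rparr>) (char_res M \<psi>) \<nu> \<noteq> 0}"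
    "\<And>\<theta> \<psi>. \<theta> \<in> Irr G \<Longrightarrow> cmult (G\<lparr>carrier := M\<rparr>) (char_res M \<theta>) \<nu> \<noteq> 0 \<Longrightarrow>
      \<psi> \<in> Irr (G\<lparr>carrier := S\<rparr>) \<Longrightarrow> cmult (G\<lparr>carrier := M\<rparr>) (char_res M \<psi>) \<nu> \<noteq> 0 \<Longrightarrow>
      cmult (G\<lparr>carrier := S\<rparr>) (char_res S \<theta>) \<psi> = (if \<psi> = f \<theta> then 1 else 0)"
    "\<And>\<theta>. \<theta> \<in> Irr G \<Longrightarrow> cmult (G\<lparr>carrier := M\<rparr>) (char_res M \<theta>) \<nu> \<noteq> 0 \<Longrightarrow>
      char_degree G \<theta> = card (rcosets S) * char_degree (G\<lparr>carrier := S\<rparr>) (f \<theta>)"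
proof -
  let ?M = "G\<lparr>carrier := M\<rparr>" and ?S = "G\<lparr>carrier := S\<rparr>"
  have sM: "subgroup M G" using M normal_imp_subgroup by blast
  interpret M: finite_group ?M by (rule subgroup_finite_group[OF sM])
  have \<nu>I: "\<nu> \<in> Irr ?M" by (rule M.Lin_Irr[OF \<nu>])
  have \<nu>0: "\<And>y. y \<notin> M \<Longrightarrow> \<nu> y = 0" using M.LinD(1)[OF \<nu>] by simp
  have S: "subgroup S G" unfolding S_def by (rule stabilizer_conj_char(1)[where \<theta> = \<nu>, OF M \<nu>0])
  interpret S: finite_group ?S by (rule subgroup_finite_group[OF S])
  have MS: "M \<subseteq> S"
  proof
    fix m assume m: "m \<in> M"
    have "conj_char G M m (char_res M \<nu>) = char_res M \<nu>"
      by (rule conj_char_res_Chars[OF sM _ m subgroup_normalizes[OF sM m] M.Irr_Chars[OF \<nu>I]]) simp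
    moreover have "char_res M \<nu> = \<nu>" using \<nu>0 by (auto simp: char_res_def)
    ultimately show "m \<in> S" using m subgroup.mem_carrier[OF sM] by (simp add: S_def stabilizer_def)
  qed
  have MSn: "M \<lhd> ?S" using normal_restrict_supergroup[OF S M MS] .
  have sMS: "subgroup M ?S" using subgroup_incl[OF sM S MS] .
  have inv: "conj_char ?S M g \<nu> = \<nu>" if "g \<in> carrier ?S" for g
  proof -
    have "conj_char ?S M g \<nu> = conj_char G M g \<nu>"
      using that m_inv_consistent[OF S] by (auto simp: conj_char_def fun_eq_iff)
    then show ?thesis using that by (simp add: S_def stabilizer_def)
  qed
  let ?A = "{\<theta> \<in> Irr G. cmult ?M (char_res M \<theta>) \<nu> \<noteq> 0}"
  let ?B = "{\<psi> \<in> Irr ?S. cmult ?M (char_res M \<psi>) \<nu> \<noteq> 0}"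
  let ?a = "\<lambda>\<theta> \<psi>. cmult ?S (char_res S \<theta>) \<psi>"
  let ?w = "card (rcosets S)"
  have lag: "?w * card S = Coset.order G" by (rule lagrange[OF S])
  have cS: "0 < card S" using S.order_pos by (simp add: Coset.order_def)
  have w: "0 < ?w" using lag order_pos by (metis mult_eq_0_iff neq0_conv)
  have \<nu>S: "\<nu> \<in> Lin (?S\<lparr>carrier := M\<rparr>)" using \<nu> by simp
  have ov: "cmult ?M (char_res M \<psi>) \<nu> = (if \<psi> \<in> ?B then char_degree ?S \<psi> else 0)" if \<psi>: "\<psi> \<in> Irr ?S" for \<psi>
    by (rule S.normal_Lin_cases[OF MSn \<nu>S inv \<psi>]) (use \<psi> S.Chars_one(2)[OF S.Irr_Chars[OF \<psi>]] in auto)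
  have row: "?w * (\<Sum>\<psi>\<in>?B. ?a \<theta> \<psi> * char_degree ?S \<psi>) = char_degree G \<theta>" if \<theta>: "\<theta> \<in> ?A" for \<theta>
  proof -
    have C: "char_res S \<theta> \<in> Chars ?S" using Chars_res[OF S Irr_Chars] \<theta> by blast
    have "cmult ?M (char_res M \<theta>) \<nu> = (\<Sum>\<psi>\<in>Irr ?S. ?a \<theta> \<psi> * cmult ?M (char_res M \<psi>) \<nu>)"
      using S.cmult_res_decomp[OF sMS C, of \<nu>] \<nu>I char_res_res[OF MS, of \<theta>] by simp
    also have "\<dots> = (\<Sum>\<psi>\<in>Irr ?S. if \<psi> \<in> ?B then ?a \<theta> \<psi> * char_degree ?S \<psi> else 0)"
    proof (rule sum.cong[OF refl])
      fix \<psi> assume \<psi>: "\<psi> \<in> Irr ?S"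
      show "?a \<theta> \<psi> * cmult ?M (char_res M \<psi>) \<nu> = (if \<psi> \<in> ?B then ?a \<theta> \<psi> * char_degree ?S \<psi> else 0)"
        using trans[OF ov[OF \<psi>] if_P] trans[OF ov[OF \<psi>] if_not_P] by (cases "\<psi> \<in> ?B") simp_all
    qed
    also have "\<dots> = (\<Sum>\<psi>\<in>Irr ?S \<inter> ?B. ?a \<theta> \<psi> * char_degree ?S \<psi>)"
      by (rule sum.inter_restrict[OF S.finite_Irr, symmetric])
    also have "Irr ?S \<inter> ?B = ?B" by blast
    finally have "?w * card S * (\<Sum>\<psi>\<in>?B. ?a \<theta> \<psi> * char_degree ?S \<psi>) = char_degree G \<theta> * card S"
      using clifford_degree_Lin[OF M \<nu>, of \<theta>] \<theta> lag by (simp add: S_def mult.commute)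
    then show ?thesis using cS by (simp add: mult_ac)
  qed
  have col: "(\<Sum>\<theta>\<in>?A. ?a \<theta> \<psi> * char_degree G \<theta>) = ?w * char_degree ?S \<psi>" if \<psi>: "\<psi> \<in> ?B" for \<psi>
  proof -
    have "?a \<theta> \<psi> = 0" if "\<theta> \<in> Irr G - ?A" for \<theta>
    proof (rule ccontr)
      assume nz: "?a \<theta> \<psi> \<noteq> 0"
      have C: "char_res S \<theta> \<in> Chars ?S" using Chars_res[OF S Irr_Chars] that by blast
      have "cmult ?M (char_res M (char_res S \<theta>)) \<nu> \<noteq> 0"
        using S.constituent_trans[OF sMS C, of \<psi> \<nu>] \<psi> nz \<nu>I by simp
      then show False using that char_res_res[OF MS, of \<theta>] by simp
    qed
    then have "(\<Sum>\<theta>\<in>?A. ?a \<theta> \<psi> * char_degree G \<theta>) = (\<Sum>\<theta>\<in>Irr G. ?a \<theta> \<psi> * char_degree G \<theta>)"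
      by (intro sum.mono_neutral_left finite_Irr) auto
    then have "(\<Sum>\<theta>\<in>?A. ?a \<theta> \<psi> * char_degree G \<theta>) * card S = ?w * card S * char_degree ?S \<psi>"
      using sum_cmult_res_degree[OF S, of \<psi>] \<psi> lag by simp
    then show ?thesis using cS by (simp add: mult_ac)
  qed
  obtain f where f: "bij_betw f ?A ?B" "\<And>\<theta> \<psi>. \<theta> \<in> ?A \<Longrightarrow> \<psi> \<in> ?B \<Longrightarrow> ?a \<theta> \<psi> = (if \<psi> = f \<theta> then 1 else 0)"
    "\<And>\<theta>. \<theta> \<in> ?A \<Longrightarrow> char_degree G \<theta> = ?w * char_degree ?S (f \<theta>)"
  proof (rule weighted_permutation_matrix[of ?A ?B "char_degree G" "char_degree ?S" "\<lambda>_. ?w" "\<lambda>_. ?w" ?a])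
    show "finite ?A" "finite ?B" using finite_Irr S.finite_Irr by auto
    show "0 < char_degree G \<theta>" if "\<theta> \<in> ?A" for \<theta> using that Chars_one(2)[OF Irr_Chars] by blast
    show "0 < char_degree ?S \<psi>" if "\<psi> \<in> ?B" for \<psi> using that S.Chars_one(2)[OF S.Irr_Chars] by blast
  qed (use w row col in auto)
  show ?thesis by (rule that[OF f(1)]) (use f(2,3) in auto)
qed

end

section \<open>Sylow subgroups modulo a normal subgroup\<close>

context finite_group begin

lemma card_subgroup_pos: "subgroup H G \<Longrightarrow> 0 < card H"
  using finite_group.order_pos[OF subgroup_finite_group] by (fastforce simp: Coset.order_def)

lemma card_subgroup_dvd:
  assumes "subgroup H G" "subgroup K G" "H \<subseteq> K" shows "card H dvd card K"
proof -
  interpret K: finite_group "G\<lparr>carrier := K\<rparr>" by (rule subgroup_finite_group[OF assms(2)])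
  have "card (rcosets\<^bsub>G\<lparr>carrier := K\<rparr>\<^esub> H) * card H = card K"
    using K.lagrange[OF subgroup_incl[OF assms]] by (simp add: Coset.order_def)
  then show ?thesis by (metis dvd_triv_right)
qed

text \<open>Let \<open>R\<close> permute the right cosets of \<open>S\<close>: modulo \<open>Z\<close> the orbits have \<open>p\<close>-power length.\<close>

lemma sylow_fixed_coset:
  assumes p: "Factorial_Ring.prime p" and Z: "Z \<lhd> G" and R: "subgroup R G" "Z \<subseteq> R" "card R = p ^ a * card Z"
    and S: "subgroup S G" "Z \<subseteq> S" and ind: "\<not> p dvd card (rcosets S)"
  shows "\<exists>g\<in>carrier G. \<forall>x\<in>R. g \<otimes> x \<otimes> inv g \<in> S"
proof (rule ccontr)
  assume neg: "\<not> ?thesis"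
  note Rc = subgroup.mem_carrier[OF R(1)] and Sc = subgroup.subset[OF S(1)]
  have sZ: "subgroup Z G" using Z normal_imp_subgroup by blast
  interpret R: finite_group "G\<lparr>carrier := R\<rparr>" by (rule subgroup_finite_group[OF R(1)])
  let ?o = "\<lambda>D. (\<lambda>x. D #> x) ` R"
  have ex: "\<exists>d\<in>carrier G. D = S #> d" if "D \<in> rcosets S" for D using that by (auto simp: RCOSETS_def)
  have sub: "D \<subseteq> carrier G" if "D \<in> rcosets S" for D using rcosets_subset_PowG[OF S(1)] that by blast
  have in_orbit: "?o D \<subseteq> rcosets S" if D: "D \<in> rcosets S" for D
  proof
    fix C assume "C \<in> ?o D"
    then obtain x where x: "x \<in> R" "C = D #> x" by blast
    obtain d where d: "d \<in> carrier G" "D = S #> d" using ex[OF D] by blast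
    have "C = S #> (d \<otimes> x)" using coset_mult_assoc[OF Sc d(1) Rc[OF x(1)]] x d by simp
    then show "C \<in> rcosets S" using rcosetsI[OF Sc, of "d \<otimes> x"] d(1) Rc[OF x(1)] by simp
  qed
  have act: "D #> x #> y = D #> (x \<otimes> y)" if "D \<in> rcosets S" "x \<in> R" "y \<in> R" for D x y
    using coset_mult_assoc[OF sub[OF that(1)] Rc[OF that(2)] Rc[OF that(3)]] .
  have act1: "D #> \<one> = D" if "D \<in> rcosets S" for D using coset_mult_one[OF sub[OF that]] .
  have div: "p dvd card (?o D)" if D: "D \<in> rcosets S" for D
  proof -
    obtain d where d: "d \<in> carrier G" "D = S #> d" using ex[OF D] by blast
    \<comment> \<open>The stabilizer of a coset contains the normal subgroup \<open>Z\<close>. So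
      the orbit length divides \<open>card R\<close> divided by \<open>card Z\<close>, a power of
      p.\<close>
    define T where "T = {x \<in> R. D #> x = D}"
    have T: "subgroup T (G\<lparr>carrier := R\<rparr>)"
    proof (rule R.subgroupI)
      show "T \<noteq> {}" using act1[OF D] subgroup.one_closed[OF R(1)] by (auto simp: T_def)
      show "inv\<^bsub>G\<lparr>carrier := R\<rparr>\<^esub> x \<in> T" if x: "x \<in> T" for x
      proof -
        have xR: "x \<in> R" "D #> x = D" using x by (auto simp: T_def)
        have "D #> inv x = D #> x #> inv x" using xR by simp
        also have "\<dots> = D" using act[OF D xR(1) subgroup.m_inv_closed[OF R(1) xR(1)]] act1[OF D] Rc[OF xR(1)] by simp
        finally show ?thesis using xR(1) subgroup.m_inv_closed[OF R(1)] m_inv_consistent[OF R(1)] by (simp add: T_def)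
      qed
      show "x \<otimes>\<^bsub>G\<lparr>carrier := R\<rparr>\<^esub> y \<in> T" if "x \<in> T" "y \<in> T" for x y
        using that act[OF D, of x y] subgroup.m_closed[OF R(1)] by (auto simp: T_def)
    qed (auto simp: T_def)
    have sT: "subgroup T G" using T by (rule incl_subgroup[OF R(1)])
    have iff: "D #> x = D #> y \<longleftrightarrow> x \<otimes>\<^bsub>G\<lparr>carrier := R\<rparr>\<^esub> inv\<^bsub>G\<lparr>carrier := R\<rparr>\<^esub> y \<in> T"
      if "x \<in> carrier (G\<lparr>carrier := R\<rparr>)" "y \<in> carrier (G\<lparr>carrier := R\<rparr>)" for x y
    proof -
      have xy: "x \<in> R" "y \<in> R" "inv y \<in> R" using that subgroup.m_inv_closed[OF R(1)] by auto
      have "D #> x = D #> y \<longleftrightarrow> D #> (x \<otimes> inv y) = D"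
      proof
        assume "D #> x = D #> y"
        then have "D #> x #> inv y = D #> y #> inv y" by simp
        then show "D #> (x \<otimes> inv y) = D" using act[OF D] act1[OF D] xy Rc[OF xy(2)] by simp
      next
        assume *: "D #> (x \<otimes> inv y) = D"
        have "D #> (x \<otimes> inv y) #> y = D #> (x \<otimes> inv y \<otimes> y)"
          using act[OF D _ xy(2)] subgroup.m_closed[OF R(1) xy(1,3)] by blast
        also have "x \<otimes> inv y \<otimes> y = x" using Rc xy by (simp add: m_assoc)
        finally show "D #> x = D #> y" using * by simp
      qed
      then show ?thesis using xy subgroup.m_closed[OF R(1) xy(1,3)] m_inv_consistent[OF R(1) xy(2)] by (simp add: T_def)
    qed
    have ZT: "Z \<subseteq> T"
    proof
      fix z assume z: "z \<in> Z"
      have zc: "z \<in> carrier G" using subgroup.mem_carrier[OF sZ z] .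
      have zz: "d \<otimes> z \<otimes> inv d \<in> S" using normal.inv_op_closed2[OF Z d(1) z] S(2) by blast
      have "d \<otimes> z = (d \<otimes> z \<otimes> inv d) \<otimes> d" using d(1) zc by (simp add: m_assoc)
      then have "D #> z = S #> (d \<otimes> z \<otimes> inv d) #> d"
        using coset_mult_assoc[OF Sc d(1) zc] coset_mult_assoc[OF Sc _ d(1), of "d \<otimes> z \<otimes> inv d"] d zc by simp
      also have "S #> (d \<otimes> z \<otimes> inv d) = S"
        by (rule coset_join2[OF _ S(1) zz]) (use d zc in simp)
      finally show "z \<in> T" using z R(2) d(2) by (auto simp: T_def)
    qed
    obtain m where m: "card T = card Z * m" using card_subgroup_dvd[OF sZ sT ZT] by (auto simp: dvd_def)
    have "card (?o D) * card T = card R"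
      using R.card_image_cosets[OF T iff] by (simp add: Coset.order_def)
    then have "card (?o D) * m = p ^ a"
      using R(3) m card_subgroup_pos[OF sZ] by simp
    then have "card (?o D) dvd p ^ a" by (metis dvd_triv_left)
    then obtain b where b: "card (?o D) = p ^ b" using divides_primepow_nat[OF p] by blast
    \<comment> \<open>A coset \<open>S #> d\<close> fixed by \<open>R\<close> would give an element
      \<open>d\<close> conjugating \<open>R\<close> into \<open>S\<close>, which was assumed not to
      exist.\<close>
    have "card (?o D) \<noteq> 1"
    proof
      assume "card (?o D) = 1"
      then obtain C where C: "?o D = {C}" by (auto simp: card_1_singleton_iff)
      have "D \<in> ?o D" using act1[OF D] subgroup.one_closed[OF R(1)] by (metis image_eqI)
      then have fixed: "D #> x = D" if "x \<in> R" for x using C that by auto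
      have "d \<otimes> x \<otimes> inv d \<in> S" if x: "x \<in> R" for x
      proof -
        have "S #> (d \<otimes> x) = S #> d" using fixed[OF x] coset_mult_assoc[OF Sc d(1) Rc[OF x]] d(2) by simp
        then have "d \<otimes> x \<in> S #> d" using rcos_self[OF _ S(1), of "d \<otimes> x"] d(1) Rc[OF x] by simp
        then obtain s where "s \<in> S" "d \<otimes> x = s \<otimes> d" by (auto simp: r_coset_def)
        then show ?thesis using d(1) subgroup.mem_carrier[OF S(1)] by (simp add: m_assoc)
      qed
      then show False using neg d(1) by blast
    qed
    then show ?thesis using b by (cases b) auto
  qed
  let ?C = "?o ` (rcosets S)"
  have un: "\<Union>?C = rcosets S"
  proof
    show "\<Union>?C \<subseteq> rcosets S" using in_orbit by blast
    show "rcosets S \<subseteq> \<Union>?C"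
    proof
      fix D assume D: "D \<in> rcosets S"
      then have "D \<in> ?o D" using act1[OF D] subgroup.one_closed[OF R(1)] by (metis image_eqI)
      then show "D \<in> \<Union>?C" using D by blast
    qed
  qed
  have eq_orbit: "?o C = ?o D" if C: "C \<in> rcosets S" and D: "D \<in> rcosets S" and E: "E \<in> ?o C" "E \<in> ?o D" for C D E
  proof -
    have half: "?o C \<subseteq> ?o D" if C: "C \<in> rcosets S" and D: "D \<in> rcosets S" and E: "E \<in> ?o C" "E \<in> ?o D" for C D
    proof -
      obtain x y where xy: "x \<in> R" "y \<in> R" "E = C #> x" "E = D #> y" using E by blast
      have ix: "inv x \<in> R" using subgroup.m_inv_closed[OF R(1) xy(1)] .
      have "C = C #> x #> inv x" using act[OF C xy(1) ix] act1[OF C] Rc[OF xy(1)] by simp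
      then have "C = D #> (y \<otimes> inv x)" using act[OF D xy(2) ix] xy by simp
      then have "C #> z = D #> (y \<otimes> inv x \<otimes> z)" if "z \<in> R" for z
        using act[OF D _ that] subgroup.m_closed[OF R(1) xy(2) ix] by simp
      note shift = this
      show ?thesis
      proof
        fix F assume "F \<in> ?o C"
        then obtain z where z: "z \<in> R" "F = C #> z" by (rule imageE)
        have "y \<otimes> inv x \<otimes> z \<in> R"
          using subgroup.m_closed[OF R(1) subgroup.m_closed[OF R(1) xy(2) ix] z(1)] .
        then show "F \<in> ?o D" unfolding z(2) shift[OF z(1)] by (rule imageI)
      qed
    qed
    show ?thesis by (rule equalityI[OF half[OF C D E] half[OF D C E(2,1)]])
  qed
  have "p dvd card (\<Union>?C)"
  proof (rule dvd_partition)
    have "finite (rcosets S)" using finite_UnionD[of "rcosets S"] rcosets_part_G[OF S(1)] fin by simp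
    then show "finite (\<Union>?C)" unfolding un .
    show "\<forall>c\<in>?C. p dvd card c" using div by blast
    show "\<forall>c1\<in>?C. \<forall>c2\<in>?C. c1 \<noteq> c2 \<longrightarrow> c1 \<inter> c2 = {}"
    proof (intro ballI impI)
      fix c1 c2 assume "c1 \<in> ?C" "c2 \<in> ?C" and neq: "c1 \<noteq> c2"
      then obtain C D where CD: "C \<in> rcosets S" "c1 = ?o C" "D \<in> rcosets S" "c2 = ?o D" by (elim imageE)
      show "c1 \<inter> c2 = {}"
      proof (rule ccontr)
        assume "c1 \<inter> c2 \<noteq> {}"
        then obtain E where "E \<in> c1" "E \<in> c2" by (meson Int_emptyI)
        then show False using eq_orbit[OF CD(1,3)] CD(2,4) neq by simp
      qed
    qed
  qed
  then show False using un ind by simp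
qed

lemma rcosets_index_mult:
  assumes H: "subgroup H G" and K: "subgroup K G" "H \<subseteq> K"
  shows "card (rcosets H) = card (rcosets\<^bsub>G\<lparr>carrier := K\<rparr>\<^esub> H) * card (rcosets K)"
proof -
  interpret K: finite_group "G\<lparr>carrier := K\<rparr>" by (rule subgroup_finite_group[OF K(1)])
  have "card (rcosets\<^bsub>G\<lparr>carrier := K\<rparr>\<^esub> H) * card H = card K"
    using K.lagrange[OF subgroup_incl[OF H K]] by (simp add: Coset.order_def)
  then have "card (rcosets\<^bsub>G\<lparr>carrier := K\<rparr>\<^esub> H) * card (rcosets K) * card H = card (rcosets K) * card K" by (metis mult.assoc mult.commute)
  also have "\<dots> = card (rcosets H) * card H" using lagrange[OF H] lagrange[OF K(1)] by simp
  finally show ?thesis using card_subgroup_pos[OF H] by simp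
qed

lemma conj_subgroup:
  assumes R: "subgroup R G" and h: "h \<in> carrier G"
  shows "subgroup ((\<lambda>x. h \<otimes> x \<otimes> inv h) ` R) G" "card ((\<lambda>x. h \<otimes> x \<otimes> inv h) ` R) = card R"
proof -
  note Rc = subgroup.mem_carrier[OF R]
  show "subgroup ((\<lambda>x. h \<otimes> x \<otimes> inv h) ` R) G"
  proof (rule subgroupI)
    show "(\<lambda>x. h \<otimes> x \<otimes> inv h) ` R \<subseteq> carrier G" using Rc h by auto
    show "(\<lambda>x. h \<otimes> x \<otimes> inv h) ` R \<noteq> {}" using subgroup.one_closed[OF R] by blast
    show "inv a \<in> (\<lambda>x. h \<otimes> x \<otimes> inv h) ` R" if "a \<in> (\<lambda>x. h \<otimes> x \<otimes> inv h) ` R" for a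
    proof -
      from that obtain x where x: "x \<in> R" "a = h \<otimes> x \<otimes> inv h" by blast
      then have "inv a = h \<otimes> inv x \<otimes> inv h" using Rc[OF x(1)] h by (simp add: inv_mult_group m_assoc)
      then show ?thesis using subgroup.m_inv_closed[OF R x(1)] by blast
    qed
    show "a \<otimes> b \<in> (\<lambda>x. h \<otimes> x \<otimes> inv h) ` R"
      if "a \<in> (\<lambda>x. h \<otimes> x \<otimes> inv h) ` R" "b \<in> (\<lambda>x. h \<otimes> x \<otimes> inv h) ` R" for a b
    proof -
      from that obtain x y where xy: "x \<in> R" "a = h \<otimes> x \<otimes> inv h" "y \<in> R" "b = h \<otimes> y \<otimes> inv h" by blast
      then have "a \<otimes> b = h \<otimes> (x \<otimes> y) \<otimes> inv h"
        using Rc[OF xy(1)] Rc[OF xy(3)] h by (simp add: m_assoc) (simp flip: m_assoc)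
      then show ?thesis using subgroup.m_closed[OF R xy(1,3)] by blast
    qed
  qed
  have "inj_on (\<lambda>x. h \<otimes> x \<otimes> inv h) R" using Rc h by (intro inj_onI) simp
  then show "card ((\<lambda>x. h \<otimes> x \<otimes> inv h) ` R) = card R" by (rule card_image)
qed

end

text \<open>The image of \<open>P\<close> in \<open>G/Z\<close> is a self-normalizing Sylow \<open>p\<close>-subgroup. Avoiding the quotient keeps
  the type of group elements fixed, so that one can induct over all such triples.\<close>

locale self_normalizing_sylow = finite_group +
  fixes p :: nat and Z P :: "'a set"
  assumes prime: "Factorial_Ring.prime p" and Z: "Z \<lhd> G" and P: "subgroup P G" and ZP: "Z \<subseteq> P"
    and card_P: "\<exists>a. card P = p ^ a * card Z" and index_P: "\<not> p dvd card (rcosets P)"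
    and selfnorm: "\<And>g. g \<in> carrier G \<Longrightarrow> (\<And>x. x \<in> P \<Longrightarrow> g \<otimes> x \<otimes> inv g \<in> P) \<Longrightarrow> g \<in> P"
begin

lemma sZ: "subgroup Z G" using Z normal_imp_subgroup by blast

text \<open>Inside \<open>K\<close> the conjugate of \<open>P\<close> by \<open>h\<close> can be
  moved back into \<open>P\<close> by some \<open>y\<close> in \<open>K\<close>. Then
  \<open>y \<otimes> h\<close> normalizes \<open>P\<close>, so it lies in \<open>P\<close>, and
  \<open>h\<close> lies in \<open>K\<close>.\<close>

lemma abnormal:
  assumes K: "subgroup K G" "P \<subseteq> K" and h: "h \<in> carrier G" "\<And>x. x \<in> P \<Longrightarrow> h \<otimes> x \<otimes> inv h \<in> K"
  shows "h \<in> K"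
proof -
  let ?K = "G\<lparr>carrier := K\<rparr>"
  interpret K: finite_group ?K by (rule subgroup_finite_group[OF K(1)])
  let ?R = "(\<lambda>x. h \<otimes> x \<otimes> inv h) ` P"
  obtain a where a: "card P = p ^ a * card Z" using card_P by blast
  note R = conj_subgroup[OF P h(1)]
  have RK: "?R \<subseteq> K" using h(2) by blast
  have ZR: "Z \<subseteq> ?R"
  proof
    fix z assume z: "z \<in> Z"
    have zc: "z \<in> carrier G" using subgroup.mem_carrier[OF sZ z] .
    have "inv h \<otimes> z \<otimes> h \<in> P" using normal.inv_op_closed1[OF Z h(1) z] ZP by blast
    moreover have "h \<otimes> (inv h \<otimes> z \<otimes> h) \<otimes> inv h = z" using conj_inv_cancel(1)[OF h(1) zc] .
    ultimately show "z \<in> ?R" by (metis image_eqI)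
  qed
  have "\<not> p dvd card (rcosets\<^bsub>?K\<^esub> P)"
    using index_P rcosets_index_mult[OF P K] by (metis dvd_mult2)
  moreover have "Z \<lhd> ?K" using normal_restrict_supergroup[OF K(1) Z] ZP K(2) by blast
  moreover have "subgroup ?R ?K" "subgroup P ?K" using subgroup_incl R(1) P K RK by blast+
  ultimately have "\<exists>y\<in>carrier ?K. \<forall>x\<in>?R. y \<otimes>\<^bsub>?K\<^esub> x \<otimes>\<^bsub>?K\<^esub> inv\<^bsub>?K\<^esub> y \<in> P"
    using K.sylow_fixed_coset[OF prime _ _ ZR _ _ ZP, of a] R(2) a by simp
  then obtain y where y: "y \<in> K" "\<And>x. x \<in> ?R \<Longrightarrow> y \<otimes> x \<otimes> inv y \<in> P"
    using m_inv_consistent[OF K(1)] by auto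
  have yc: "y \<in> carrier G" using subgroup.mem_carrier[OF K(1) y(1)] .
  have "(y \<otimes> h) \<otimes> x \<otimes> inv (y \<otimes> h) \<in> P" if x: "x \<in> P" for x
    using y(2)[of "h \<otimes> x \<otimes> inv h"] x conj_mult[OF yc h(1), of x] subgroup.mem_carrier[OF P x] by simp
  then have "y \<otimes> h \<in> K" using selfnorm[of "y \<otimes> h"] yc h(1) K(2) by blast
  then have "inv y \<otimes> (y \<otimes> h) \<in> K" using subgroup.m_closed[OF K(1)] subgroup.m_inv_closed[OF K(1) y(1)] by blast
  then show ?thesis using yc h(1) by (simp flip: m_assoc)
qed

text \<open>An element normalizing \<open>P'\<close> conjugates \<open>P\<close> into
  \<open>P'\<close>, so abnormality puts it into \<open>P'\<close>. This lets the induction pass to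
  a subgroup \<open>S\<close> and a larger normal section at the same time.\<close>

lemma restrict:
  assumes S: "subgroup S G" and M: "M \<lhd> G\<lparr>carrier := S\<rparr>" and P': "subgroup P' G" "P \<subseteq> P'" "P' \<subseteq> S" "M \<subseteq> P'"
    and ZM: "Z \<subseteq> M" and card: "card P' = p ^ b * card M"
  shows "self_normalizing_sylow (G\<lparr>carrier := S\<rparr>) p M P'"
proof -
  interpret S: finite_group "G\<lparr>carrier := S\<rparr>" by (rule subgroup_finite_group[OF S])
  have PS: "P \<subseteq> S" using P' by blast
  show ?thesis
  proof (intro self_normalizing_sylow.intro self_normalizing_sylow_axioms.intro S.finite_group_axioms)
    show "Factorial_Ring.prime p" by (rule prime)
    show "M \<lhd> G\<lparr>carrier := S\<rparr>" by (rule M)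
    show "subgroup P' (G\<lparr>carrier := S\<rparr>)" using subgroup_incl[OF P'(1) S P'(3)] .
    show "M \<subseteq> P'" by (rule P'(4))
    show "\<exists>a. card P' = p ^ a * card M" using card by blast
    have "card (rcosets P) = card (rcosets\<^bsub>G\<lparr>carrier := P'\<rparr>\<^esub> P) * card (rcosets\<^bsub>G\<lparr>carrier := S\<rparr>\<^esub> P') * card (rcosets S)"
      using rcosets_index_mult[OF P P'(1,2)] rcosets_index_mult[OF P'(1) S P'(3)] by simp
    then show "\<not> p dvd card (rcosets\<^bsub>G\<lparr>carrier := S\<rparr>\<^esub> P')" using index_P by (metis dvd_mult dvd_mult2)
    show "g \<in> P'" if g: "g \<in> carrier (G\<lparr>carrier := S\<rparr>)"
      "\<And>x. x \<in> P' \<Longrightarrow> g \<otimes>\<^bsub>G\<lparr>carrier := S\<rparr>\<^esub> x \<otimes>\<^bsub>G\<lparr>carrier := S\<rparr>\<^esub> inv\<^bsub>G\<lparr>carrier := S\<rparr>\<^esub> g \<in> P'" for g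
    proof (rule abnormal[OF P'(1,2)])
      show "g \<in> carrier G" using g(1) subgroup.mem_carrier[OF S] by simp
      show "g \<otimes> x \<otimes> inv g \<in> P'" if "x \<in> P" for x
        using g(2)[of x] that P'(2) g(1) m_inv_consistent[OF S] by auto
    qed
  qed
qed

end

section \<open>Abelian normal layers of a solvable group\<close>

lemma (in finite_group) solvable_normal_layer:
  assumes p: "Factorial_Ring.prime p" and sol: "solvable G" and nt: "carrier G \<noteq> {\<one>}"
  obtains M where "M \<lhd> G" "M \<noteq> {\<one>}" "\<And>x y. x \<in> M \<Longrightarrow> y \<in> M \<Longrightarrow> x \<otimes> y = y \<otimes> x"
    "\<not> p dvd card M \<or> (\<exists>a. card M = p ^ a)"
proof -
  obtain n where n: "(derived G ^^ n) (carrier G) = {\<one>}" using sol solvable_iff_trivial_derived_seq by blast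
  \<comment> \<open>The last nontrivial term of the derived series is abelian and normal. If p
    divides its order, it is replaced by its Sylow p-subgroup.\<close>
  define k where "k = (LEAST k. (derived G ^^ k) (carrier G) = {\<one>})"
  have k: "(derived G ^^ k) (carrier G) = {\<one>}" unfolding k_def by (rule LeastI[of _ n]) (rule n)
  have k0: "k \<noteq> 0" using k nt by (cases k) auto
  define A where "A = (derived G ^^ (k - 1)) (carrier G)"
  have "A \<noteq> {\<one>}" unfolding A_def k_def using not_less_Least[of "k - 1" "\<lambda>k. (derived G ^^ k) (carrier G) = {\<one>}"] k0
    by (simp add: k_def)
  have norm: "(derived G ^^ j) (carrier G) \<lhd> G" for j
    by (induction j) (auto simp: normal_self derived_is_normal)
  have A: "A \<lhd> G" unfolding A_def by (rule norm)
  have sA: "subgroup A G" using A normal_imp_subgroup by blast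
  note Ac = subgroup.mem_carrier[OF sA]
  have dA: "derived G A = {\<one>}" using k k0 unfolding A_def by (metis Suc_pred' comp_apply funpow.simps(2) neq0_conv)
  have comm: "x \<otimes> y = y \<otimes> x" if x: "x \<in> A" and y: "y \<in> A" for x y
  proof -
    have "x \<otimes> y \<otimes> inv x \<otimes> inv y \<in> derived G A"
      unfolding derived_def using x y by (intro generate.incl) blast
    then have "x \<otimes> y \<otimes> inv x \<otimes> inv y = \<one>" using dA by simp
    then have "x \<otimes> y \<otimes> inv x = y" using Ac[OF x] Ac[OF y] by (metis inv_closed inv_equality inv_inv m_closed)
    then show ?thesis using Ac[OF x] Ac[OF y] by (metis inv_solve_right m_closed)
  qed
  interpret A: finite_group "G\<lparr>carrier := A\<rparr>" by (rule subgroup_finite_group[OF sA])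
  have cA: "card A \<noteq> 0" using card_subgroup_pos[OF sA] by simp
  define a where "a = multiplicity p (card A)"
  obtain m where m: "card A = p ^ a * m" "\<not> p dvd m"
    using multiplicity_decompose'[of "card A" p] cA p unfolding a_def by (metis not_prime_unit)
  obtain R where R: "subgroup R (G\<lparr>carrier := A\<rparr>)" "card R = p ^ a"
    using sylow_thm[OF p A.is_group, of a m] m(1) A.fin by (auto simp: Coset.order_def)
  have sR: "subgroup R G" by (rule incl_subgroup[OF sA R(1)])
  have RA: "R \<subseteq> A" using subgroup.subset[OF R(1)] by simp
  have idx: "\<not> p dvd card (rcosets\<^bsub>G\<lparr>carrier := A\<rparr>\<^esub> R)"
  proof -
    have "card (rcosets\<^bsub>G\<lparr>carrier := A\<rparr>\<^esub> R) * p ^ a = m * p ^ a"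
      using A.lagrange[OF R(1)] R(2) m(1) by (simp add: Coset.order_def mult.commute)
    then have "card (rcosets\<^bsub>G\<lparr>carrier := A\<rparr>\<^esub> R) = m" using p by (simp add: prime_gt_0_nat)
    then show ?thesis using m(2) by simp
  qed
  have Rn: "R \<lhd> G"
  proof (rule normal_inv_iff[THEN iffD2], intro conjI ballI)
    show "subgroup R G" by (rule sR)
    fix g r assume g: "g \<in> carrier G" and r: "r \<in> R"
    let ?R = "(\<lambda>x. g \<otimes> x \<otimes> inv g) ` R"
    have RA': "?R \<subseteq> A" using normal.inv_op_closed2[OF A g] RA by blast
    have "subgroup ?R (G\<lparr>carrier := A\<rparr>)" using subgroup_incl[OF conj_subgroup(1)[OF sR g] sA RA'] .
    moreover have "{\<one>\<^bsub>G\<lparr>carrier := A\<rparr>\<^esub>} \<subseteq> ?R" "{\<one>\<^bsub>G\<lparr>carrier := A\<rparr>\<^esub>} \<subseteq> R"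
      using subgroup.one_closed[OF conj_subgroup(1)[OF sR g]] subgroup.one_closed[OF sR] by auto
    ultimately obtain y where y: "y \<in> A" "\<forall>x\<in>?R. y \<otimes> x \<otimes> inv\<^bsub>G\<lparr>carrier := A\<rparr>\<^esub> y \<in> R"
      using A.sylow_fixed_coset[OF p A.one_is_normal, of ?R a R] R idx conj_subgroup(2)[OF sR g] by auto
    have x: "g \<otimes> r \<otimes> inv g \<in> ?R" using r by blast
    have "y \<otimes> (g \<otimes> r \<otimes> inv g) \<otimes> inv\<^bsub>G\<lparr>carrier := A\<rparr>\<^esub> y \<in> R" by (rule bspec[OF y(2) x])
    then have "y \<otimes> (g \<otimes> r \<otimes> inv g) \<otimes> inv y \<in> R" unfolding m_inv_consistent[OF sA y(1)] .
    \<comment> \<open>A conjugate of \<open>R\<close> under \<open>G\<close> is moved into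
      \<open>R\<close> by an element \<open>y\<close> of the abelian group \<open>A\<close>, which
      acts trivially on it. So the conjugate was contained in \<open>R\<close> already.\<close>
    moreover have "y \<otimes> (g \<otimes> r \<otimes> inv g) \<otimes> inv y = g \<otimes> r \<otimes> inv g"
      using comm[OF y(1), of "g \<otimes> r \<otimes> inv g"] x RA' Ac[OF y(1)] Ac[of "g \<otimes> r \<otimes> inv g"] by (auto simp: m_assoc subset_iff)
    ultimately show "g \<otimes> r \<otimes> inv g \<in> R" by simp
  qed
  show ?thesis
  proof (cases "p dvd card A")
    case True
    have "a \<noteq> 0" using m True by (cases a) auto
    then have "1 < card R" using R(2) one_less_power[OF prime_gt_1_nat[OF p]] by simp
    then have "R \<noteq> {\<one>}" by auto
    then show ?thesis by (rule that[OF Rn]) (use comm RA R(2) in blast)+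
  next
    case False
    show ?thesis by (rule that[OF A \<open>A \<noteq> {\<one>}\<close> comm]) (use False in blast)+
  qed
qed

section \<open>The correspondence for self-normalizing Sylow subgroups\<close>

text \<open>The extension sends \<open>m \<otimes> q\<close> to \<open>\<nu> m * \<kappa> q\<close>.
  Agreement on the intersection makes it well defined, and invariance of \<nu> under
  \<open>P\<close> makes it multiplicative.\<close>

lemma (in group) linear_extension_set_mult:
  assumes M: "M \<lhd> G" and P: "subgroup P G"
    and \<nu>: "\<nu> \<in> Lin (G\<lparr>carrier := M\<rparr>)" and \<kappa>: "\<kappa> \<in> Lin (G\<lparr>carrier := P\<rparr>)"
    and agree: "\<And>x. x \<in> M \<Longrightarrow> x \<in> P \<Longrightarrow> \<nu> x = \<kappa> x"
    and inv: "\<And>x m. x \<in> P \<Longrightarrow> m \<in> M \<Longrightarrow> \<nu> (x \<otimes> m \<otimes> inv x) = \<nu> m"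
  obtains \<mu> where "\<mu> \<in> Lin (G\<lparr>carrier := M <#> P\<rparr>)" "char_res M \<mu> = \<nu>" "char_res P \<mu> = \<kappa>"
proof -
  have sM: "subgroup M G" using M normal_imp_subgroup by blast
  interpret sec: second_isomorphism_grp M G P
    using M P by (simp add: second_isomorphism_grp_def second_isomorphism_grp_axioms_def)
  have MP: "subgroup (M <#> P) G" by (rule sec.normal_set_mult_subgroup)
  interpret M: group "G\<lparr>carrier := M\<rparr>" by (rule subgroup_imp_group[OF sM])
  interpret P: group "G\<lparr>carrier := P\<rparr>" by (rule subgroup_imp_group[OF P])
  interpret MP: group "G\<lparr>carrier := M <#> P\<rparr>" by (rule subgroup_imp_group[OF MP])
  note l = M.LinD[OF \<nu>] and k = P.LinD[OF \<kappa>]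
  note Mc = subgroup.mem_carrier[OF sM] and Pc = subgroup.mem_carrier[OF P]
  have mem: "x \<in> M <#> P \<longleftrightarrow> (\<exists>m\<in>M. \<exists>q\<in>P. x = m \<otimes> q)" for x by (auto simp: set_mult_def)
  have M1: "\<one> \<in> M" and P1: "\<one> \<in> P" using subgroup.one_closed[OF sM] subgroup.one_closed[OF P] .
  have uniq: "\<nu> m * \<kappa> q = \<nu> m' * \<kappa> q'"
    if m: "m \<in> M" and q: "q \<in> P" and m': "m' \<in> M" and q': "q' \<in> P" and eq: "m \<otimes> q = m' \<otimes> q'" for m q m' q'
  proof -
    note c = Mc[OF m] Pc[OF q] Mc[OF m'] Pc[OF q']
    let ?z = "inv m' \<otimes> m"
    have "?z = inv m' \<otimes> (m \<otimes> q) \<otimes> inv q" using c by (simp add: m_assoc)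
    also have "\<dots> = q' \<otimes> inv q" unfolding eq using c by (simp flip: m_assoc)
    finally have z: "?z = q' \<otimes> inv q" .
    have zM: "?z \<in> M" using subgroup.m_closed[OF sM subgroup.m_inv_closed[OF sM m'] m] .
    have zP: "?z \<in> P" unfolding z using subgroup.m_closed[OF P q' subgroup.m_inv_closed[OF P q]] .
    have "m = m' \<otimes> ?z" using c by (simp flip: m_assoc)
    then have a: "\<nu> m = \<nu> m' * \<nu> ?z" using l(3)[of m' ?z] m' zM by simp
    have "?z \<otimes> q = q'" unfolding z using c by (simp add: m_assoc)
    then have b: "\<kappa> q' = \<kappa> ?z * \<kappa> q" using k(3)[of ?z q] q zP by simp
    show ?thesis using a b agree[OF zM zP] by simp
  qed
  define \<mu> where "\<mu> x = (if x \<in> M <#> P then (THE c. \<exists>m\<in>M. \<exists>q\<in>P. x = m \<otimes> q \<and> c = \<nu> m * \<kappa> q) else 0)" for x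
  have val: "\<mu> (m \<otimes> q) = \<nu> m * \<kappa> q" if m: "m \<in> M" and q: "q \<in> P" for m q
  proof -
    have "(THE c. \<exists>m'\<in>M. \<exists>q'\<in>P. m \<otimes> q = m' \<otimes> q' \<and> c = \<nu> m' * \<kappa> q') = \<nu> m * \<kappa> q"
    proof (rule the_equality)
      show "\<exists>m'\<in>M. \<exists>q'\<in>P. m \<otimes> q = m' \<otimes> q' \<and> \<nu> m * \<kappa> q = \<nu> m' * \<kappa> q'" using m q by blast
      fix c assume "\<exists>m'\<in>M. \<exists>q'\<in>P. m \<otimes> q = m' \<otimes> q' \<and> c = \<nu> m' * \<kappa> q'"
      then obtain m' q' where "m' \<in> M" "q' \<in> P" "m \<otimes> q = m' \<otimes> q'" "c = \<nu> m' * \<kappa> q'" by (elim bexE conjE)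
      then show "c = \<nu> m * \<kappa> q" using uniq[OF m q] by metis
    qed
    moreover have "m \<otimes> q \<in> M <#> P" using m q mem by blast
    ultimately show ?thesis by (simp add: \<mu>_def)
  qed
  have "\<mu> \<in> Lin (G\<lparr>carrier := M <#> P\<rparr>)"
  proof (rule MP.LinI)
    show "\<mu> \<one>\<^bsub>G\<lparr>carrier := M <#> P\<rparr>\<^esub> = 1" using val[OF M1 P1] l(2) k(2) by simp
    fix x y assume "x \<in> carrier (G\<lparr>carrier := M <#> P\<rparr>)" "y \<in> carrier (G\<lparr>carrier := M <#> P\<rparr>)"
    then obtain m q m' q' where x: "m \<in> M" "q \<in> P" "x = m \<otimes> q" and y: "m' \<in> M" "q' \<in> P" "y = m' \<otimes> q'"
      using mem by auto
    note c = Mc[OF x(1)] Pc[OF x(2)] Mc[OF y(1)] Pc[OF y(2)]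
    have e: "q \<otimes> m' \<otimes> inv q \<in> M" using normal.inv_op_closed2[OF M c(2) y(1)] .
    have "x \<otimes> y = (m \<otimes> (q \<otimes> m' \<otimes> inv q)) \<otimes> (q \<otimes> q')"
      using c by (simp add: x y m_assoc) (simp flip: m_assoc)
    then have "\<mu> (x \<otimes> y) = \<nu> (m \<otimes> (q \<otimes> m' \<otimes> inv q)) * \<kappa> (q \<otimes> q')"
      using val[OF subgroup.m_closed[OF sM x(1) e] subgroup.m_closed[OF P x(2) y(2)]] by simp
    also have "\<dots> = \<nu> m * \<nu> m' * (\<kappa> q * \<kappa> q')"
      using l(3)[of m "q \<otimes> m' \<otimes> inv q"] k(3)[of q q'] inv[OF x(2) y(1)] x y e by simp
    finally show "\<mu> (x \<otimes>\<^bsub>G\<lparr>carrier := M <#> P\<rparr>\<^esub> y) = \<mu> x * \<mu> y" using val x y by simp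
  qed (simp add: \<mu>_def)
  moreover have "char_res M \<mu> = \<nu>"
  proof
    fix x show "char_res M \<mu> x = \<nu> x"
      using val[of x \<one>] P1 k(2) l(1)[of x] Mc[of x] by (auto simp: char_res_def)
  qed
  moreover have "char_res P \<mu> = \<kappa>"
  proof
    fix x show "char_res P \<mu> x = \<kappa> x"
      using val[of \<one> x] M1 l(2) k(1)[of x] Pc[of x] by (auto simp: char_res_def)
  qed
  ultimately show ?thesis by (rule that)
qed

lemma carrier_update_self: "G\<lparr>carrier := carrier G\<rparr> = (G :: ('a, 'b) monoid_scheme)"
  by (cases G) simp

text \<open>The characters of \<open>G/Z\<close> and \<open>P/Z\<close> appear as those with \<open>Z\<close> in the kernel.\<close>

definition sylow_corr :: "('a, 'b) monoid_scheme \<Rightarrow> nat \<Rightarrow> 'a set \<Rightarrow> 'a set \<Rightarrow> bool" where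
  "sylow_corr G p Z P \<longleftrightarrow> (\<exists>f.
     bij_betw f {\<theta> \<in> Irr_p' p G. in_kernel G Z \<theta>} {l \<in> Lin (G\<lparr>carrier := P\<rparr>). in_kernel G Z l} \<and>
     (\<forall>\<theta> l. \<theta> \<in> Irr_p' p G \<longrightarrow> in_kernel G Z \<theta> \<longrightarrow> l \<in> Lin (G\<lparr>carrier := P\<rparr>) \<longrightarrow> in_kernel G Z l \<longrightarrow>
        cmult (G\<lparr>carrier := P\<rparr>) (char_res P \<theta>) l = (if l = f \<theta> then 1 else 0)))"

section \<open>Invariant constituents and layers of order prime to p\<close>

context self_normalizing_sylow
begin

lemma index_above_P: "subgroup S G \<Longrightarrow> P \<subseteq> S \<Longrightarrow> \<not> p dvd card (rcosets S)"
  using index_P rcosets_index_mult[OF P] by (metis dvd_mult)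

text \<open>Modulo \<open>Z\<close> the layer is abelian, so constituents on \<open>M\<close> are
  linear. The index of the stabilizer of such a constituent divides the degree of \<theta>, so it is
  prime to p and \<open>P\<close> has a conjugate inside the stabilizer. The corresponding conjugate
  of the constituent is invariant under \<open>P\<close>.\<close>

lemma exists_invariant_constituent:
  assumes M: "M \<lhd> G" and ZM: "Z \<subseteq> M"
    and comm: "\<And>x y. x \<in> M \<Longrightarrow> y \<in> M \<Longrightarrow> x \<otimes> y \<otimes> inv x \<otimes> inv y \<in> Z"
    and \<theta>: "\<theta> \<in> Irr_p' p G" "in_kernel G Z \<theta>"
  obtains \<nu> where "\<nu> \<in> Lin (G\<lparr>carrier := M\<rparr>)" "in_kernel G Z \<nu>"
    "cmult (G\<lparr>carrier := M\<rparr>) (char_res M \<theta>) \<nu> \<noteq> 0" "P \<subseteq> stabilizer G (conj_char G M) \<nu>"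
proof -
  let ?M = "G\<lparr>carrier := M\<rparr>"
  have sM: "subgroup M G" using M normal_imp_subgroup by blast
  interpret M: finite_group ?M by (rule subgroup_finite_group[OF sM])
  have \<theta>I: "\<theta> \<in> Irr G" and deg: "\<not> p dvd char_degree G \<theta>" using \<theta>(1) by (auto simp: Irr_p'_def)
  have C: "char_res M \<theta> \<in> Chars ?M" by (rule Chars_res[OF sM Irr_Chars[OF \<theta>I]])
  obtain \<nu>0 where \<nu>0: "\<nu>0 \<in> Irr ?M" "cmult ?M (char_res M \<theta>) \<nu>0 \<noteq> 0" using M.ex_constituent[OF C] by metis
  have sZM: "subgroup Z ?M" using subgroup_incl[OF sZ sM ZM] .
  have kerM: "in_kernel ?M Z (char_res M \<theta>)"
    using \<theta>(2) ZM subgroup.one_closed[OF sM] by (auto simp: in_kernel_def char_res_def)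
  have ker0: "in_kernel ?M Z \<nu>0" by (rule M.in_kernel_constituent[OF sZM C kerM \<nu>0])
  have lin0: "\<nu>0 \<in> Lin ?M"
    by (rule M.commutator_kernel_linear[OF sZM _ \<nu>0(1) ker0]) (use comm m_inv_consistent[OF sM] in simp)
  let ?S0 = "stabilizer G (conj_char G M) \<nu>0"
  have z0: "\<nu>0 y = 0" if "y \<notin> M" for y using M.LinD(1)[OF lin0, of y] that by simp
  have S0: "subgroup ?S0 G" by (rule stabilizer_conj_char(1)[where \<theta> = \<nu>0, OF M z0])
  have ZS0: "Z \<subseteq> ?S0"
  proof
    fix z assume z: "z \<in> Z"
    have zM: "z \<in> M" using z ZM by blast
    have "conj_char G M z (char_res M \<nu>0) = char_res M \<nu>0"
      by (rule conj_char_res_Chars[OF sM _ zM subgroup_normalizes[OF sM zM] M.Irr_Chars[OF \<nu>0(1)]]) simp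
    moreover have "char_res M \<nu>0 = \<nu>0" using z0 by (auto simp: char_res_def)
    ultimately show "z \<in> ?S0" using subgroup.mem_carrier[OF sM zM] by (simp add: stabilizer_def)
  qed
  have "char_degree G \<theta> * card ?S0 = cmult ?M (char_res M \<theta>) \<nu>0 * card (rcosets ?S0) * card ?S0"
    using clifford_degree_Lin[OF M lin0 \<theta>I \<nu>0(2)] lagrange[OF S0] by simp
  then have "char_degree G \<theta> = cmult ?M (char_res M \<theta>) \<nu>0 * card (rcosets ?S0)"
    using card_subgroup_pos[OF S0] by simp
  then have idx: "\<not> p dvd card (rcosets ?S0)" using deg by (metis dvd_mult)
  obtain a where a: "card P = p ^ a * card Z" using card_P by blast
  obtain g where g: "g \<in> carrier G" "\<And>x. x \<in> P \<Longrightarrow> g \<otimes> x \<otimes> inv g \<in> ?S0"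
    using sylow_fixed_coset[OF prime Z P ZP a S0 ZS0 idx] by blast
  note nz = normal_normalizes[OF M] and Mc = subgroup.subset[OF sM]
  let ?\<nu> = "conj_char G M g \<nu>0"
  have \<nu>I: "?\<nu> \<in> Irr ?M" by (rule conj_char_Irr[OF sM nz[OF g(1)] \<nu>0(1)])
  have "char_degree ?M ?\<nu> = 1" using char_degree_conj[OF sM g(1), of \<nu>0] M.Lin_degree[OF lin0] by simp
  then have lin: "?\<nu> \<in> Lin ?M" using \<nu>I by (simp add: M.Lin_iff_Irr)
  have over: "cmult ?M (char_res M \<theta>) ?\<nu> \<noteq> 0" using cmult_res_conj[OF M Irr_Chars[OF \<theta>I] g(1)] \<nu>0(2) by simp
  have ker: "in_kernel G Z ?\<nu>"
    using M.in_kernel_constituent[OF sZM C kerM \<nu>I over] by (simp add: in_kernel_def)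
  have "P \<subseteq> stabilizer G (conj_char G M) ?\<nu>"
  proof
    fix x assume x: "x \<in> P"
    have xc: "x \<in> carrier G" using subgroup.mem_carrier[OF P x] .
    let ?y = "g \<otimes> x \<otimes> inv g"
    have y: "?y \<in> carrier G" "conj_char G M ?y \<nu>0 = \<nu>0" using g(2)[OF x] by (auto simp: stabilizer_def)
    have "conj_char G M x ?\<nu> = conj_char G M (g \<otimes> x) \<nu>0" by (rule conj_char_comp[OF Mc nz[OF xc] nz[OF g(1)]])
    also have "g \<otimes> x = ?y \<otimes> g" using g(1) xc by (simp add: m_assoc)
    also have "conj_char G M (?y \<otimes> g) \<nu>0 = conj_char G M g (conj_char G M ?y \<nu>0)"
      by (rule conj_char_comp[OF Mc nz[OF g(1)] nz[OF y(1)], symmetric])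
    finally show "x \<in> stabilizer G (conj_char G M) ?\<nu>" using xc y(2) by (simp add: stabilizer_def)
  qed
  then show ?thesis using that lin ker over by blast
qed

text \<open>If both characters are invariant, then \<open>g\<close> conjugates \<open>P\<close> into
  the stabilizer of \<nu>. The stabilizer contains \<open>P\<close>, so by abnormality it contains
  \<open>g\<close>.\<close>

lemma invariant_conjugate_unique:
  assumes M: "M \<lhd> G" and \<nu>: "\<And>y. y \<notin> M \<Longrightarrow> \<nu> y = 0" and g: "g \<in> carrier G"
    and inv: "P \<subseteq> stabilizer G (conj_char G M) \<nu>" "P \<subseteq> stabilizer G (conj_char G M) (conj_char G M g \<nu>)"
  shows "conj_char G M g \<nu> = \<nu>"
proof -
  have sM: "subgroup M G" using M normal_imp_subgroup by blast
  note nz = normal_normalizes[OF M] and Mc = subgroup.subset[OF sM]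
  have S: "subgroup (stabilizer G (conj_char G M) \<nu>) G" by (rule stabilizer_conj_char(1)[where \<theta> = \<nu>, OF M \<nu>])
  have "g \<in> stabilizer G (conj_char G M) \<nu>"
  proof (rule abnormal[OF S inv(1) g])
    fix x assume x: "x \<in> P"
    have xc: "x \<in> carrier G" using subgroup.mem_carrier[OF P x] .
    have "conj_char G M (g \<otimes> x) \<nu> = conj_char G M g \<nu>"
      using inv(2) x conj_char_comp[OF Mc nz[OF xc] nz[OF g], of \<nu>] by (auto simp: stabilizer_def)
    then show "g \<otimes> x \<otimes> inv g \<in> stabilizer G (conj_char G M) \<nu>"
      using stabilizer_conj_char(2)[where \<theta> = \<nu>, OF M \<nu>, of "g \<otimes> x" g] g xc by simp
  qed
  then show ?thesis by (simp add: stabilizer_def)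
qed

text \<open>A \<open>P\<close>-invariant linear character of \<open>M\<close> under a \<open>p'\<close>-character must be trivial, by abnormality of \<open>P\<close>
  applied to the product of \<open>P\<close> and its kernel. So the \<open>p'\<close>-characters in question are already trivial on \<open>M\<close>.\<close>

lemma coprime_layer:
  assumes M: "M \<lhd> G" and ZM: "Z \<subseteq> M"
    and comm: "\<And>x y. x \<in> M \<Longrightarrow> y \<in> M \<Longrightarrow> x \<otimes> y \<otimes> inv x \<otimes> inv y \<in> Z"
    and card_M: "card M = m * card Z" "\<not> p dvd m"
  shows "self_normalizing_sylow G p M (M <#> P)"
    "sylow_corr G p M (M <#> P) \<Longrightarrow> sylow_corr G p Z P"
proof -
  let ?M = "G\<lparr>carrier := M\<rparr>" and ?P = "G\<lparr>carrier := P\<rparr>" and ?MP = "G\<lparr>carrier := M <#> P\<rparr>"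
  have sM: "subgroup M G" using M normal_imp_subgroup by blast
  interpret M: finite_group ?M by (rule subgroup_finite_group[OF sM])
  interpret P: finite_group ?P by (rule subgroup_finite_group[OF P])
  interpret sec: second_isomorphism_grp M G P
    using M P by (simp add: second_isomorphism_grp_def second_isomorphism_grp_axioms_def)
  have MP: "subgroup (M <#> P) G" by (rule sec.normal_set_mult_subgroup)
  interpret MP: finite_group ?MP by (rule subgroup_finite_group[OF MP])
  note Mc = subgroup.mem_carrier[OF sM] and Pc = subgroup.mem_carrier[OF P]
  have subs: "M \<subseteq> M <#> P" "P \<subseteq> M <#> P" using sec.H_contained_in_set_mult sec.S_contained_in_set_mult .
  have mem: "\<exists>m\<in>M. \<exists>q\<in>P. x = m \<otimes> q" if "x \<in> M <#> P" for x using that by (auto simp: set_mult_def)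
  obtain a where a: "card P = p ^ a * card Z" using card_P by blast
  \<comment> \<open>The index of \<open>Z\<close> in the intersection divides both a power of p and
    \<open>m\<close>, which is prime to p.\<close>
  have int: "M \<inter> P = Z"
  proof -
    have I: "subgroup (M \<inter> P) G" by (rule subgroups_Inter_pair[OF sM P])
    obtain k where k: "card (M \<inter> P) = card Z * k" using card_subgroup_dvd[OF sZ I] ZM ZP by (auto simp: dvd_def)
    have zp: "card Z \<noteq> 0" using card_subgroup_pos[OF sZ] by simp
    have "card Z * k dvd card Z * p ^ a" using card_subgroup_dvd[OF I P] k a by (simp add: mult.commute)
    then have kp: "k dvd p ^ a" using zp by simp
    have "card Z * k dvd card Z * m" using card_subgroup_dvd[OF I sM] k card_M(1) by (simp add: mult.commute)
    then have km: "k dvd m" using zp by simp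
    have "k = 1"
    proof -
      obtain b where b: "k = p ^ b" using divides_primepow_nat[OF prime] kp by blast
      then show ?thesis using km card_M(2) by (cases b) (auto dest: dvd_mult_left)
    qed
    then have "card (M \<inter> P) = card Z" using k by simp
    then show ?thesis using card_subset_eq[of "M \<inter> P" Z] ZM ZP finite_subset[OF subgroup.subset[OF I] fin] by simp
  qed
  have prodsum: "(\<Sum>m\<in>M. \<Sum>q\<in>P. F (m \<otimes> q)) = of_nat (card Z) * (\<Sum>x\<in>M <#> P. F x)" for F :: "'a \<Rightarrow> complex"
    using MP.sum_product_subgroups[OF subgroup_incl[OF sM MP subs(1)] subgroup_incl[OF P MP subs(2)], of F] mem int by simp
  have "of_nat (card M * card P) = (of_nat (card Z * card (M <#> P)) :: complex)" using prodsum[of "\<lambda>_. 1"] by simp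
  then have cardMP: "card M * card P = card Z * card (M <#> P)" unfolding of_nat_eq_iff .
  have zp: "card Z \<noteq> 0" using card_subgroup_pos[OF sZ] by simp
  have cMP: "card (M <#> P) = p ^ a * card M" using cardMP a zp by (simp add: mult.commute)
  show sns: "self_normalizing_sylow G p M (M <#> P)"
    using restrict[OF subgroup_self _ MP subs(2) subgroup.subset[OF MP] subs(1) ZM cMP] M
    unfolding carrier_update_self .
  have kernel: "in_kernel G M \<theta>" if \<theta>: "\<theta> \<in> Irr_p' p G" "in_kernel G Z \<theta>" for \<theta>
  proof -
    have \<theta>I: "\<theta> \<in> Irr G" using \<theta>(1) by (simp add: Irr_p'_def)
    obtain \<nu> where \<nu>: "\<nu> \<in> Lin ?M" "in_kernel G Z \<nu>" "cmult ?M (char_res M \<theta>) \<nu> \<noteq> 0"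
       "P \<subseteq> stabilizer G (conj_char G M) \<nu>"
      by (rule exists_invariant_constituent[OF M ZM comm \<theta>])
    note l = M.LinD[OF \<nu>(1)]
    have inv: "\<nu> (x \<otimes> m \<otimes> inv x) = \<nu> m" if "x \<in> P" "m \<in> M" for x m
    proof -
      have "conj_char G M x \<nu> = \<nu>" using \<nu>(4) that(1) by (auto simp: stabilizer_def)
      from fun_cong[OF this, of m] show ?thesis using that(2) by (simp add: conj_char_def)
    qed
    have agree: "\<nu> x = triv_char P x" if "x \<in> M" "x \<in> P" for x
      using \<nu>(2) that int l(2) by (auto simp: in_kernel_def)
    \<comment> \<open>The invariant character is glued with the trivial character of
      \<open>P\<close>, so that the kernel \<open>K\<close> of the result contains
      \<open>P\<close>.\<close>
    obtain \<mu> where \<mu>: "\<mu> \<in> Lin ?MP" "char_res M \<mu> = \<nu>" "char_res P \<mu> = triv_char P"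
      by (rule linear_extension_set_mult[OF M P \<nu>(1) triv_char_subgroup[OF P] agree inv])
    note n = MP.LinD[OF \<mu>(1)]
    define K where "K = {x \<in> M <#> P. \<mu> x = 1}"
    have K: "subgroup K ?MP"
    proof (rule MP.subgroupI)
      have "\<one> \<in> K" using subgroup.one_closed[OF MP] n(2) by (simp add: K_def)
      then show "K \<noteq> {}" by blast
      show "K \<subseteq> carrier ?MP" by (simp add: K_def)
      fix x assume x: "x \<in> K"
      then have xc: "x \<in> carrier ?MP" "\<mu> x = 1" by (simp_all add: K_def)
      show "inv\<^bsub>?MP\<^esub> x \<in> K"
        using MP.Lin_norm(2)[OF \<mu>(1) xc(1)] MP.inv_closed[OF xc(1)] xc(2) by (simp add: K_def)
      fix y assume "y \<in> K"
      then have yc: "y \<in> carrier ?MP" "\<mu> y = 1" by (simp_all add: K_def)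
      show "x \<otimes>\<^bsub>?MP\<^esub> y \<in> K"
        using n(3)[OF xc(1) yc(1)] MP.m_closed[OF xc(1) yc(1)] xc(2) yc(2) by (simp add: K_def)
    qed
    have sK: "subgroup K G" by (rule incl_subgroup[OF MP K])
    have PK: "P \<subseteq> K"
    proof
      fix x assume x: "x \<in> P"
      then show "x \<in> K" using fun_cong[OF \<mu>(3), of x] subs(2) by (auto simp: K_def char_res_def)
    qed
    have one: "\<nu> m = 1" if m: "m \<in> M" for m
    proof -
      have mMP: "m \<in> M <#> P" using m subs(1) by blast
      \<comment> \<open>The values of \<mu> at \<open>m\<close> and \<open>inv m\<close> cancel, so
        \<open>m\<close> conjugates \<open>P\<close> into \<open>K\<close>. Abnormality yields
        \<open>m\<close> in \<open>K\<close>, which says that \<nu> is trivial at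
        \<open>m\<close>.\<close>
      have "m \<in> K"
      proof (rule abnormal[OF sK PK Mc[OF m]])
        fix x assume x: "x \<in> P"
        have xMP: "x \<in> M <#> P" using x subs(2) by blast
        have im: "inv m \<in> M <#> P" using subgroup.m_inv_closed[OF MP mMP] .
        have "\<mu> (m \<otimes> x \<otimes> inv m) = \<mu> m * \<mu> x * \<mu> (inv m)"
          using n(3)[of "m \<otimes> x" "inv m"] n(3)[of m x] mMP xMP im subgroup.m_closed[OF MP mMP xMP] by simp
        also have "\<mu> x = 1" using PK x by (auto simp: K_def)
        also have "\<mu> m * 1 * \<mu> (inv m) = 1"
          using MP.Lin_norm(1,2)[OF \<mu>(1), of m] mMP m_inv_consistent[OF MP mMP] by simp
        finally show "m \<otimes> x \<otimes> inv m \<in> K"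
          using subgroup.m_closed[OF MP subgroup.m_closed[OF MP mMP xMP] im] by (simp add: K_def)
      qed
      then show ?thesis using fun_cong[OF \<mu>(2), of m] m by (simp add: K_def char_res_def)
    qed
    have "\<nu> = triv_char M" using one l(1) by auto
    then show ?thesis using in_kernel_normal_iff[OF M \<theta>I] \<nu>(3) by simp
  qed
  have sub_ker: "in_kernel G Z \<theta>" if "in_kernel G M \<theta>" for \<theta> using that ZM unfolding in_kernel_def by blast
  let ?L' = "{l \<in> Lin ?MP. in_kernel G M l}" and ?L = "{l \<in> Lin ?P. in_kernel G Z l}"
  have res_mult: "l (m \<otimes> q) = l q" if l: "l \<in> Lin ?MP" "in_kernel G M l" and m: "m \<in> M" and q: "q \<in> P" for l m q
  proof -
    have c: "m \<in> carrier ?MP" "q \<in> carrier ?MP" using m q subs by auto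
    have "l (m \<otimes> q) = l m * l q" using MP.LinD(3)[OF l(1) c] by simp
    moreover have "l m = l \<one>" using l(2) m unfolding in_kernel_def by blast
    then have "l m = 1" using MP.LinD(2)[OF l(1)] by simp
    ultimately show ?thesis by simp
  qed
  have resL: "char_res P l \<in> Lin ?P" if l: "l \<in> Lin ?MP" for l
  proof (rule P.LinI)
    show "char_res P l x = 0" if "x \<notin> carrier ?P" for x using that by (simp add: char_res_def)
    show "char_res P l \<one>\<^bsub>?P\<^esub> = 1"
      using MP.LinD(2)[OF l] subgroup.one_closed[OF P] by (simp add: char_res_def)
    show "char_res P l (x \<otimes>\<^bsub>?P\<^esub> y) = char_res P l x * char_res P l y"
      if "x \<in> carrier ?P" "y \<in> carrier ?P" for x y
    proof -
      have xy: "x \<in> P" "y \<in> P" "x \<in> carrier ?MP" "y \<in> carrier ?MP" using that subs(2) by auto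
      then show ?thesis using MP.LinD(3)[OF l xy(3,4)] subgroup.m_closed[OF P xy(1,2)]
        by (simp add: char_res_def)
    qed
  qed
  have bij: "bij_betw (char_res P) ?L' ?L"
  proof (rule bij_betw_imageI)
    show "inj_on (char_res P) ?L'"
    proof (rule inj_onI)
      fix l l' assume l: "l \<in> ?L'" and l': "l' \<in> ?L'" and eq: "char_res P l = char_res P l'"
      show "l = l'"
      proof
        fix x
        show "l x = l' x"
        proof (cases "x \<in> M <#> P")
          case True
          then obtain m q where mq: "m \<in> M" "q \<in> P" "x = m \<otimes> q" using mem by blast
          have "l q = l' q" using fun_cong[OF eq, of q] mq(2) by (simp add: char_res_def)
          then show ?thesis using res_mult[of l m q] res_mult[of l' m q] mq l l' by simp
        next
          case False
          then show ?thesis using MP.LinD(1)[of l x] MP.LinD(1)[of l' x] l l' by simp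
        qed
      qed
    qed
    show "char_res P ` ?L' = ?L"
    proof
      show "char_res P ` ?L' \<subseteq> ?L"
      proof
        fix l assume "l \<in> char_res P ` ?L'"
        then obtain l' where l': "l' \<in> Lin ?MP" "in_kernel G M l'" "l = char_res P l'" by blast
        have "l z = l \<one>" if z: "z \<in> Z" for z
        proof -
          have "l' z = l' \<one>" using sub_ker[OF l'(2)] z unfolding in_kernel_def by blast
          then show ?thesis using z ZP subgroup.one_closed[OF P] by (auto simp: char_res_def l'(3))
        qed
        then have "in_kernel G Z l" by (simp add: in_kernel_def)
        then show "l \<in> ?L" using resL[OF l'(1)] l'(3) by blast
      qed
      show "?L \<subseteq> char_res P ` ?L'"
      proof
        fix l assume l: "l \<in> ?L"
        have agree: "triv_char M x = l x" if "x \<in> M" "x \<in> P" for x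
          using that l int P.LinD(2)[of l] by (auto simp: in_kernel_def)
        have inv: "triv_char M (x \<otimes> m \<otimes> inv x) = triv_char M m" if "x \<in> P" "m \<in> M" for x m
          using normal.inv_op_closed2[OF M Pc[OF that(1)] that(2)] that(2) by simp
        have lL: "l \<in> Lin ?P" using l by blast
        obtain \<mu> where \<mu>: "\<mu> \<in> Lin ?MP" "char_res M \<mu> = triv_char M" "char_res P \<mu> = l"
          by (rule linear_extension_set_mult[OF M P triv_char_subgroup[OF sM] lL agree inv])
        have "\<mu> m = 1" if "m \<in> M" for m using fun_cong[OF \<mu>(2), of m] that by (simp add: char_res_def)
        then have "in_kernel G M \<mu>" using MP.LinD(2)[OF \<mu>(1)] by (simp add: in_kernel_def)
        then show "l \<in> char_res P ` ?L'" using \<mu> by blast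
      qed
    qed
  qed
  \<comment> \<open>Both \<theta> and \<open>l\<close> ignore left factors from \<open>M\<close>, so
    averaging over the product \<open>M <#> P\<close> is the same as averaging over
    \<open>P\<close>.\<close>
  have cm: "cmult ?P (char_res P \<theta>) (char_res P l) = cmult ?MP (char_res (M <#> P) \<theta>) l"
    if \<theta>: "\<theta> \<in> Irr G" "in_kernel G M \<theta>" and l: "l \<in> Lin ?MP" "in_kernel G M l" for \<theta> l
  proof -
    let ?F = "\<lambda>x. \<theta> x * cnj (l x)"
    have "(\<Sum>m\<in>M. \<Sum>q\<in>P. ?F (m \<otimes> q)) = (\<Sum>m\<in>M. \<Sum>q\<in>P. ?F q)"
      using in_kernel_mult(2)[OF sM Irr_Chars[OF \<theta>(1)] \<theta>(2)] res_mult[OF l] Pc by (intro sum.cong) auto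
    then have e: "of_nat (card M) * (\<Sum>q\<in>P. ?F q) = of_nat (card Z) * (\<Sum>x\<in>M <#> P. ?F x)"
      using prodsum[of ?F] by simp
    have c: "of_nat (card M) * of_nat (card P) = (of_nat (card Z) * of_nat (card (M <#> P)) :: complex)"
      using cardMP by (metis of_nat_mult)
    have nz: "of_nat (card Z) \<noteq> (0::complex)" "of_nat (card P) \<noteq> (0::complex)" "of_nat (card (M <#> P)) \<noteq> (0::complex)"
      "of_nat (card M) \<noteq> (0::complex)"
      using card_subgroup_pos[OF sZ] card_subgroup_pos[OF P] card_subgroup_pos[OF MP] card_subgroup_pos[OF sM] by simp_all
    have "(\<Sum>q\<in>P. ?F q) / of_nat (card P) = of_nat (card M) * (\<Sum>q\<in>P. ?F q) / (of_nat (card M) * of_nat (card P))"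
      using nz by simp
    also have "\<dots> = (\<Sum>x\<in>M <#> P. ?F x) / of_nat (card (M <#> P))" unfolding e c using nz by simp
    finally have "(\<Sum>q\<in>P. ?F q) / of_nat (card P) = (\<Sum>x\<in>M <#> P. ?F x) / of_nat (card (M <#> P))" .
    then have "char_inner ?P (char_res P \<theta>) (char_res P l) = char_inner ?MP (char_res (M <#> P) \<theta>) l"
      by (simp add: char_inner_def char_res_def Coset.order_def)
    then show ?thesis by (simp add: cmult_def)
  qed
  assume "sylow_corr G p M (M <#> P)"
  then obtain f where f: "bij_betw f {\<theta> \<in> Irr_p' p G. in_kernel G M \<theta>} ?L'"
    "\<And>\<theta> l. \<theta> \<in> Irr_p' p G \<Longrightarrow> in_kernel G M \<theta> \<Longrightarrow> l \<in> Lin ?MP \<Longrightarrow> in_kernel G M l \<Longrightarrow>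
      cmult ?MP (char_res (M <#> P) \<theta>) l = (if l = f \<theta> then 1 else 0)"
    by (auto simp: sylow_corr_def)
  have I: "{\<theta> \<in> Irr_p' p G. in_kernel G Z \<theta>} = {\<theta> \<in> Irr_p' p G. in_kernel G M \<theta>}"
    using kernel sub_ker by blast
  show "sylow_corr G p Z P"
    unfolding sylow_corr_def
  proof (intro exI[of _ "char_res P \<circ> f"] conjI allI impI)
    show "bij_betw (char_res P \<circ> f) {\<theta> \<in> Irr_p' p G. in_kernel G Z \<theta>} ?L"
      unfolding I by (rule bij_betw_trans[OF f(1) bij])
    fix \<theta> l assume \<theta>: "\<theta> \<in> Irr_p' p G" "in_kernel G Z \<theta>" and l: "l \<in> Lin ?P" "in_kernel G Z l"
    have "l \<in> char_res P ` ?L'" using bij l by (simp add: bij_betw_def)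
    then obtain l' where l': "l' \<in> ?L'" "l = char_res P l'" by blast
    have k: "in_kernel G M \<theta>" by (rule kernel[OF \<theta>])
    have "f \<theta> \<in> ?L'" using bij_betwE[OF f(1)] \<theta>(1) k by blast
    then have "l = (char_res P \<circ> f) \<theta> \<longleftrightarrow> l' = f \<theta>"
      using bij l' by (auto simp: bij_betw_def dest: inj_onD)
    then show "cmult ?P (char_res P \<theta>) l = (if l = (char_res P \<circ> f) \<theta> then 1 else 0)"
      using cm[of \<theta> l'] f(2)[of \<theta> l'] \<theta>(1) k l' by (auto simp: Irr_p'_def)
  qed
qed

end

section \<open>Layers of p-power order\<close>

context self_normalizing_sylow
begin

text \<open>Clifford correspondence over \<open>\<nu>\<close>, followed by a twist with an extension of \<open>\<nu>\<close> to its stabilizer,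
  moves the problem to characters that are trivial on \<open>M\<close>.\<close>

lemma block_corr:
  assumes M: "M \<lhd> G" and MP: "M \<subseteq> P" and \<nu>: "\<nu> \<in> Lin (G\<lparr>carrier := M\<rparr>)"
  defines "S \<equiv> stabilizer G (conj_char G M) \<nu>"
  assumes PS: "P \<subseteq> S" and \<mu>: "\<mu> \<in> Lin (G\<lparr>carrier := S\<rparr>)" "char_res M \<mu> = \<nu>"
    and corr: "sylow_corr (G\<lparr>carrier := S\<rparr>) p M P"
  obtains h where "bij_betw h {\<theta> \<in> Irr_p' p G. cmult (G\<lparr>carrier := M\<rparr>) (char_res M \<theta>) \<nu> \<noteq> 0}
      {l \<in> Lin (G\<lparr>carrier := P\<rparr>). char_res M l = \<nu>}"
    "\<And>\<theta> l. \<theta> \<in> Irr_p' p G \<Longrightarrow> cmult (G\<lparr>carrier := M\<rparr>) (char_res M \<theta>) \<nu> \<noteq> 0 \<Longrightarrow>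
      l \<in> Lin (G\<lparr>carrier := P\<rparr>) \<Longrightarrow> char_res M l = \<nu> \<Longrightarrow>
      cmult (G\<lparr>carrier := P\<rparr>) (char_res P \<theta>) l = (if l = h \<theta> then 1 else 0)"
proof -
  let ?M = "G\<lparr>carrier := M\<rparr>" and ?P = "G\<lparr>carrier := P\<rparr>" and ?S = "G\<lparr>carrier := S\<rparr>"
  have sM: "subgroup M G" using M normal_imp_subgroup by blast
  interpret M: finite_group ?M by (rule subgroup_finite_group[OF sM])
  interpret P: finite_group ?P by (rule subgroup_finite_group[OF P])
  have \<nu>0: "\<And>y. y \<notin> M \<Longrightarrow> \<nu> y = 0" using M.LinD(1)[OF \<nu>] by simp
  have S: "subgroup S G" unfolding S_def by (rule stabilizer_conj_char(1)[where \<theta> = \<nu>, OF M \<nu>0])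
  interpret S: finite_group ?S by (rule subgroup_finite_group[OF S])
  have MS: "M \<subseteq> S" using MP PS by blast
  have sMS: "subgroup M ?S" using subgroup_incl[OF sM S MS] .
  have sPS: "subgroup P ?S" using subgroup_incl[OF P S PS] .
  have sMP: "subgroup M ?P" using subgroup_incl[OF sM P MP] .
  have \<nu>I: "\<nu> \<in> Irr ?M" by (rule M.Lin_Irr[OF \<nu>])
  have \<nu>S: "\<nu> \<in> Lin (?S\<lparr>carrier := M\<rparr>)" using \<nu> by simp
  have MSn: "M \<lhd> ?S" using normal_restrict_supergroup[OF S M MS] .
  have inv: "conj_char ?S M g \<nu> = \<nu>" if "g \<in> carrier ?S" for g
  proof -
    have "conj_char ?S M g \<nu> = conj_char G M g \<nu>"
      using that m_inv_consistent[OF S] by (auto simp: conj_char_def fun_eq_iff)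
    then show ?thesis using that by (simp add: S_def stabilizer_def)
  qed
  \<comment> \<open>The inverse of \<mu> under multiplication of linear characters. Twisting by
    \<open>c\<close> turns characters over \<nu> into characters with \<open>M\<close> in the
    kernel.\<close>
  define c where "c = (\<lambda>g. cnj (\<mu> g))"
  have c: "c \<in> Lin ?S" unfolding c_def by (rule S.Lin_cnj[OF \<mu>(1)])
  have resL: "char_res P l \<in> Lin ?P" if l: "l \<in> Lin ?S" for l
  proof (rule P.LinI)
    show "char_res P l x = 0" if "x \<notin> carrier ?P" for x using that by (simp add: char_res_def)
    show "char_res P l \<one>\<^bsub>?P\<^esub> = 1"
      using S.LinD(2)[OF l] subgroup.one_closed[OF P] by (simp add: char_res_def)
    show "char_res P l (x \<otimes>\<^bsub>?P\<^esub> y) = char_res P l x * char_res P l y"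
      if "x \<in> carrier ?P" "y \<in> carrier ?P" for x y
    proof -
      have xy: "x \<in> P" "y \<in> P" "x \<in> carrier ?S" "y \<in> carrier ?S" using that PS by auto
      then show ?thesis using S.LinD(3)[OF l xy(3,4)] subgroup.m_closed[OF P xy(1,2)]
        by (simp add: char_res_def)
    qed
  qed
  have \<mu>M: "\<mu> m = \<nu> m" if "m \<in> M" for m using fun_cong[OF \<mu>(2), of m] that by (simp add: char_res_def)
  have cancelS: "\<mu> x * c x = 1" "c x * \<mu> x = 1" if "x \<in> S" for x
    using S.Lin_norm(1)[OF \<mu>(1), of x] that by (simp_all add: c_def mult.commute)
  have twist: "(\<lambda>x. f x * \<mu> x * c x) = f" "(\<lambda>x. f x * c x * \<mu> x) = f" if "\<And>x. x \<notin> S \<Longrightarrow> f x = 0" for f :: "'a \<Rightarrow> complex"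
  proof -
    have "f x * \<mu> x * c x = f x \<and> f x * c x * \<mu> x = f x" for x
      by (cases "x \<in> S") (use that cancelS[of x] in \<open>simp_all add: mult.assoc\<close>)
    then show "(\<lambda>x. f x * \<mu> x * c x) = f" "(\<lambda>x. f x * c x * \<mu> x) = f" by auto
  qed
  let ?A = "{\<theta> \<in> Irr G. cmult ?M (char_res M \<theta>) \<nu> \<noteq> 0}"
  let ?B = "{\<psi> \<in> Irr ?S. cmult ?M (char_res M \<psi>) \<nu> \<noteq> 0}"
  obtain g where g: "bij_betw g ?A ?B"
    "\<And>\<theta> \<psi>. \<theta> \<in> Irr G \<Longrightarrow> cmult ?M (char_res M \<theta>) \<nu> \<noteq> 0 \<Longrightarrow> \<psi> \<in> Irr ?S \<Longrightarrow> cmult ?M (char_res M \<psi>) \<nu> \<noteq> 0 \<Longrightarrow>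
      cmult ?S (char_res S \<theta>) \<psi> = (if \<psi> = g \<theta> then 1 else 0)"
    "\<And>\<theta>. \<theta> \<in> Irr G \<Longrightarrow> cmult ?M (char_res M \<theta>) \<nu> \<noteq> 0 \<Longrightarrow>
      char_degree G \<theta> = card (rcosets S) * char_degree ?S (g \<theta>)"
  proof (rule clifford_correspondence[OF M \<nu>, folded S_def], goal_cases)
    case (1 f)
    show ?case by (rule 1(1)[OF 1(2-4)])
  qed
  let ?I = "{\<theta> \<in> Irr_p' p G. cmult ?M (char_res M \<theta>) \<nu> \<noteq> 0}"
  let ?J = "{\<psi> \<in> Irr_p' p ?S. cmult ?M (char_res M \<psi>) \<nu> \<noteq> 0}"
  let ?I' = "{\<psi> \<in> Irr_p' p ?S. in_kernel ?S M \<psi>}"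
  let ?L' = "{l \<in> Lin ?P. in_kernel ?S M l}"
  let ?L = "{l \<in> Lin ?P. char_res M l = \<nu>}"
  have pS: "\<not> p dvd card (rcosets S)" by (rule index_above_P[OF S PS])
  \<comment> \<open>\<open>P\<close> lies in the stabilizer, so its index is prime to p; the
    Clifford correspondence therefore respects the degree condition.\<close>
  have deg_iff: "p dvd char_degree G \<theta> \<longleftrightarrow> p dvd char_degree ?S (g \<theta>)" if "\<theta> \<in> ?A" for \<theta>
    using g(3) that pS prime by (simp add: prime_dvd_mult_iff)
  have bij1: "bij_betw g ?I ?J"
  proof (rule bij_betw_subset[OF g(1)])
    show "?I \<subseteq> ?A" by (auto simp: Irr_p'_def)
    show "g ` ?I = ?J"
    proof
      show "g ` ?I \<subseteq> ?J"
      proof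
        fix \<psi> assume "\<psi> \<in> g ` ?I"
        then obtain \<theta> where \<theta>: "\<theta> \<in> ?I" "\<psi> = g \<theta>" by blast
        then have A: "\<theta> \<in> ?A" by (simp add: Irr_p'_def)
        have "\<psi> \<in> ?B" using bij_betwE[OF g(1)] A \<theta>(2) by blast
        then show "\<psi> \<in> ?J" using deg_iff[OF A] \<theta> by (simp add: Irr_p'_def)
      qed
      show "?J \<subseteq> g ` ?I"
      proof
        fix \<psi> assume \<psi>: "\<psi> \<in> ?J"
        then have "\<psi> \<in> g ` ?A" using g(1) by (simp add: Irr_p'_def bij_betw_def)
        then obtain \<theta> where \<theta>: "\<theta> \<in> ?A" "\<psi> = g \<theta>" by blast
        then have "\<theta> \<in> ?I" using deg_iff[OF \<theta>(1)] \<psi> by (simp add: Irr_p'_def)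
        then show "\<psi> \<in> g ` ?I" using \<theta>(2) by blast
      qed
    qed
  qed
  have outS: "\<psi> x = 0" if "\<psi> \<in> Irr ?S" "x \<notin> S" for \<psi> x
    using Chars_outside[OF S.Irr_Chars[OF that(1)], of x] that(2) by simp
  have overB: "\<psi> m = \<psi> \<one> * \<nu> m" if \<psi>: "\<psi> \<in> Irr ?S" "cmult ?M (char_res M \<psi>) \<nu> \<noteq> 0" and m: "m \<in> M" for \<psi> m
  proof (rule S.normal_Lin_cases[OF MSn \<nu>S inv \<psi>(1)])
    assume "\<And>g d. g \<in> carrier ?S \<Longrightarrow> d \<in> M \<Longrightarrow> \<psi> (g \<otimes>\<^bsub>?S\<^esub> d) = \<psi> g * \<nu> d"
    from this[of \<one> m] show ?thesis using m subgroup.one_closed[OF S] subgroup.mem_carrier[OF sM m] by simp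
  next
    assume "cmult (?S\<lparr>carrier := M\<rparr>) (char_res M \<psi>) \<nu> = 0"
    then show ?thesis using \<psi>(2) by simp
  qed
  let ?t = "\<lambda>\<psi> x. \<psi> x * c x"
  have bij2: "bij_betw ?t ?J ?I'"
  proof (rule bij_betwI[where g = "\<lambda>\<psi> x. \<psi> x * \<mu> x"])
    show "?t \<in> ?J \<rightarrow> ?I'"
    proof
      fix \<psi> assume "\<psi> \<in> ?J"
      then have \<psi>: "\<psi> \<in> Irr ?S" "\<not> p dvd char_degree ?S \<psi>" "cmult ?M (char_res M \<psi>) \<nu> \<noteq> 0" by (auto simp: Irr_p'_def)
      have "?t \<psi> \<in> Irr ?S" by (rule S.Irr_times_Lin[OF \<psi>(1) c])
      moreover have "\<not> p dvd char_degree ?S (?t \<psi>)"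
        using S.degree_times_Lin[OF S.Irr_Chars[OF \<psi>(1)] c] \<psi>(2) by simp
      moreover have "?t \<psi> m = ?t \<psi> \<one>" if m: "m \<in> M" for m
      proof -
        have "?t \<psi> m = \<psi> \<one> * (\<mu> m * c m)" using overB[OF \<psi>(1,3) m] \<mu>M[OF m] by simp
        also have "\<dots> = \<psi> \<one>" using cancelS(1)[of m] m MS by auto
        finally show ?thesis using S.LinD(2)[OF c] by simp
      qed
      ultimately show "?t \<psi> \<in> ?I'" by (simp add: Irr_p'_def in_kernel_def)
    qed
    show "(\<lambda>\<psi> x. \<psi> x * \<mu> x) \<in> ?I' \<rightarrow> ?J"
    proof
      fix \<psi> assume "\<psi> \<in> ?I'"
      then have \<psi>: "\<psi> \<in> Irr ?S" "\<not> p dvd char_degree ?S \<psi>" "in_kernel ?S M \<psi>" by (auto simp: Irr_p'_def)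
      let ?\<psi> = "\<lambda>x. \<psi> x * \<mu> x"
      have I: "?\<psi> \<in> Irr ?S" by (rule S.Irr_times_Lin[OF \<psi>(1) \<mu>(1)])
      have d: "\<not> p dvd char_degree ?S ?\<psi>"
        using S.degree_times_Lin[OF S.Irr_Chars[OF \<psi>(1)] \<mu>(1)] \<psi>(2) by simp
      have "?\<psi> m = ?\<psi> \<one>\<^bsub>?S\<^esub> * \<nu> m" if m: "m \<in> M" for m
      proof -
        have "\<psi> m = \<psi> \<one>\<^bsub>?S\<^esub>" using \<psi>(3) m unfolding in_kernel_def by blast
        then show ?thesis using \<mu>M[OF m] S.LinD(2)[OF \<mu>(1)] by simp
      qed
      then have "cmult ?M (char_res M ?\<psi>) \<nu> = char_degree ?S ?\<psi>"
        using S.homogeneous_iff(1)[OF sMS \<nu>S S.Irr_Chars[OF I]] by simp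
      then have "cmult ?M (char_res M ?\<psi>) \<nu> \<noteq> 0" using S.Chars_one(2)[OF S.Irr_Chars[OF I]] by simp
      then show "?\<psi> \<in> ?J" using I d by (simp add: Irr_p'_def)
    qed
    show "(\<lambda>x. ?t \<psi> x * \<mu> x) = \<psi>" if "\<psi> \<in> ?J" for \<psi>
      by (rule twist(2)) (use that outS in \<open>auto simp: Irr_p'_def\<close>)
    show "?t (\<lambda>x. \<psi> x * \<mu> x) = \<psi>" if "\<psi> \<in> ?I'" for \<psi>
      by (rule twist(1)) (use that outS in \<open>auto simp: Irr_p'_def\<close>)
  qed
  obtain f where f: "bij_betw f ?I' ?L'"
    "\<And>\<psi> l. \<psi> \<in> Irr_p' p ?S \<Longrightarrow> in_kernel ?S M \<psi> \<Longrightarrow> l \<in> Lin ?P \<Longrightarrow> in_kernel ?S M l \<Longrightarrow>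
      cmult ?P (char_res P \<psi>) l = (if l = f \<psi> then 1 else 0)"
    using corr by (auto simp: sylow_corr_def)
  have outP: "l x = 0" if "l \<in> Lin ?P" "x \<notin> S" for l x
    using P.LinD(1)[OF that(1), of x] that(2) PS by auto
  have times_res: "(\<lambda>x. l x * k x) = (\<lambda>x. l x * char_res P k x)" if "l \<in> Lin ?P" for l k
    using P.LinD(1)[OF that] by (auto simp: char_res_def fun_eq_iff)
  let ?u = "\<lambda>l x. l x * \<mu> x"
  have toL: "?u l \<in> ?L" if l: "l \<in> ?L'" for l
  proof -
    have lL: "l \<in> Lin ?P" "in_kernel ?S M l" using l by auto
    have "?u l \<in> Lin ?P" by (subst times_res[OF lL(1)]) (rule P.Lin_mult[OF lL(1) resL[OF \<mu>(1)]])
    moreover have "char_res M (?u l) = \<nu>"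
    proof
      fix x show "char_res M (?u l) x = \<nu> x"
      proof (cases "x \<in> M")
        case True
        have "l x = l \<one>\<^bsub>?S\<^esub>" using lL(2) True unfolding in_kernel_def by blast
        then have "l x = 1" using P.LinD(2)[OF lL(1)] by simp
        then show ?thesis using True \<mu>M by (simp add: char_res_def)
      qed (use \<nu>0 in \<open>simp add: char_res_def\<close>)
    qed
    ultimately show ?thesis by blast
  qed
  have fromL: "(\<lambda>x. l x * c x) \<in> ?L'" if l: "l \<in> ?L" for l
  proof -
    have lL: "l \<in> Lin ?P" "char_res M l = \<nu>" using l by auto
    have I: "(\<lambda>x. l x * c x) \<in> Lin ?P" by (subst times_res[OF lL(1)]) (rule P.Lin_mult[OF lL(1) resL[OF c]])
    have "l x * c x = 1" if x: "x \<in> M" for x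
      using fun_cong[OF lL(2), of x] x \<mu>M[OF x] cancelS(1)[of x] MS by (auto simp: char_res_def)
    then show ?thesis using I P.LinD(2)[OF I] by (simp add: in_kernel_def)
  qed
  have bij3: "bij_betw ?u ?L' ?L"
  proof (rule bij_betwI[where g = "\<lambda>l x. l x * c x"])
    show "?u \<in> ?L' \<rightarrow> ?L" using toL by blast
    show "(\<lambda>l x. l x * c x) \<in> ?L \<rightarrow> ?L'" using fromL by blast
    show "(\<lambda>x. ?u l x * c x) = l" if "l \<in> ?L'" for l
      by (rule twist(1)) (use that outP in auto)
    show "?u (\<lambda>x. l x * c x) = l" if "l \<in> ?L" for l
      by (rule twist(2)) (use that outP in auto)
  qed
  let ?h = "?u \<circ> (f \<circ> (?t \<circ> g))"
  show ?thesis
  proof (rule that)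
    show "bij_betw ?h ?I ?L"
      by (rule bij_betw_trans[OF bij_betw_trans[OF bij_betw_trans[OF bij1 bij2] f(1)] bij3])
    fix \<theta> l assume \<theta>: "\<theta> \<in> Irr_p' p G" "cmult ?M (char_res M \<theta>) \<nu> \<noteq> 0"
      and l: "l \<in> Lin ?P" "char_res M l = \<nu>"
    have \<theta>I: "\<theta> \<in> Irr G" using \<theta>(1) by (simp add: Irr_p'_def)
    have C: "char_res S \<theta> \<in> Chars ?S" by (rule Chars_res[OF S Irr_Chars[OF \<theta>I]])
    have lI: "l \<in> Irr ?P" by (rule P.Lin_Irr[OF l(1)])
    have g\<theta>: "g \<theta> \<in> ?J" using bij_betwE[OF bij1] \<theta> by blast
    have g\<theta>I: "g \<theta> \<in> Irr ?S" using g\<theta> by (simp add: Irr_p'_def)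
    have t\<theta>: "?t (g \<theta>) \<in> ?I'" using bij_betwE[OF bij2] g\<theta> by blast
    have ft: "f (?t (g \<theta>)) \<in> ?L'" using bij_betwE[OF f(1)] t\<theta> by blast
    have lc: "(\<lambda>x. l x * c x) \<in> ?L'" using fromL l by blast
    \<comment> \<open>Because \<open>l\<close> restricts to \<nu>, a character of \<open>S\<close>
      whose restriction contains \<open>l\<close> must itself lie over \<nu>.\<close>
    have zero: "cmult ?P (char_res P \<psi>) l = 0" if \<psi>: "\<psi> \<in> Irr ?S" "cmult ?M (char_res M \<psi>) \<nu> = 0" for \<psi>
    proof (rule ccontr)
      assume nz: "cmult ?P (char_res P \<psi>) l \<noteq> 0"
      have C: "char_res P \<psi> \<in> Chars ?P" using S.Chars_res[OF sPS S.Irr_Chars[OF \<psi>(1)]] by simp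
      have "cmult ?M (char_res M l) \<nu> \<noteq> 0" using l(2) M.cmult_Irr[OF \<nu>I \<nu>I] by simp
      then have "cmult ?M (char_res M (char_res P \<psi>)) \<nu> \<noteq> 0"
        using P.constituent_trans[OF sMP C lI, of \<nu>] nz \<nu>I by simp
      then show False using \<psi>(2) char_res_res[OF MP, of \<psi>] by simp
    qed
    have "cmult ?P (char_res P \<theta>) l = (\<Sum>\<psi>\<in>Irr ?S. cmult ?S (char_res S \<theta>) \<psi> * cmult ?P (char_res P \<psi>) l)"
      using S.cmult_res_decomp[OF sPS C, of l] lI char_res_res[OF PS, of \<theta>] by simp
    also have "\<dots> = (\<Sum>\<psi>\<in>Irr ?S. if \<psi> = g \<theta> then cmult ?P (char_res P (g \<theta>)) l else 0)"
    proof (rule sum.cong[OF refl])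
      fix \<psi> assume \<psi>: "\<psi> \<in> Irr ?S"
      show "cmult ?S (char_res S \<theta>) \<psi> * cmult ?P (char_res P \<psi>) l
        = (if \<psi> = g \<theta> then cmult ?P (char_res P (g \<theta>)) l else 0)"
      proof (cases "cmult ?M (char_res M \<psi>) \<nu> = 0")
        case True
        then have "\<psi> \<noteq> g \<theta>" using g\<theta> by auto
        then show ?thesis using zero[OF \<psi> True] by simp
      next
        case False
        show ?thesis using g(2)[OF \<theta>I \<theta>(2) \<psi> False] by simp
      qed
    qed
    also have "\<dots> = cmult ?P (char_res P (g \<theta>)) l" using S.finite_Irr g\<theta>I by simp
    also have "\<dots> = cmult ?P (char_res P (?t (g \<theta>))) (\<lambda>x. l x * c x)"
    proof -
      have "char_res P (?t (g \<theta>)) = (\<lambda>x. char_res P (g \<theta>) x * char_res P c x)" by (auto simp: char_res_def)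
      then have "cmult ?P (char_res P (?t (g \<theta>))) (\<lambda>x. l x * c x)
          = cmult ?P (\<lambda>x. char_res P (g \<theta>) x * char_res P c x) (\<lambda>x. l x * char_res P c x)"
        using arg_cong[OF times_res[OF l(1), of c]] by simp
      then show ?thesis
        using P.char_inner_times_Lin[OF resL[OF c], of "char_res P (g \<theta>)" l] by (simp add: cmult_def)
    qed
    \<comment> \<open>Both characters have been twisted by the same linear character, which
      preserves the inner product; now \<open>M\<close> is in both kernels and \<open>f\<close>
      applies.\<close>
    also have "\<dots> = (if (\<lambda>x. l x * c x) = f (?t (g \<theta>)) then 1 else 0)"
      by (rule f(2)) (use t\<theta> lc in auto)
    also have "(\<lambda>x. l x * c x) = f (?t (g \<theta>)) \<longleftrightarrow> l = ?h \<theta>"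
    proof
      assume "(\<lambda>x. l x * c x) = f (?t (g \<theta>))"
      then have "?u (\<lambda>x. l x * c x) = ?u (f (?t (g \<theta>)))" by (rule arg_cong)
      then have "?u (\<lambda>x. l x * c x) = ?h \<theta>" by simp
      moreover have "?u (\<lambda>x. l x * c x) = l" by (rule twist(2)) (use outP l in auto)
      ultimately show "l = ?h \<theta>" by simp
    next
      assume "l = ?h \<theta>"
      then have "(\<lambda>x. l x * c x) = (\<lambda>x. f (?t (g \<theta>)) x * \<mu> x * c x)" by simp
      also have "\<dots> = f (?t (g \<theta>))" by (rule twist(1)) (use outP ft in auto)
      finally show "(\<lambda>x. l x * c x) = f (?t (g \<theta>))" .
    qed
    finally show "cmult ?P (char_res P \<theta>) l = (if l = ?h \<theta> then 1 else 0)" .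
  qed
qed

text \<open>Each side splits into blocks according to the unique \<open>P\<close>-invariant linear constituent on \<open>M\<close>.\<close>

lemma p_layer:
  assumes M: "M \<lhd> G" and ZM: "Z \<subseteq> M"
    and comm: "\<And>x y. x \<in> M \<Longrightarrow> y \<in> M \<Longrightarrow> x \<otimes> y \<otimes> inv x \<otimes> inv y \<in> Z"
    and card_M: "card M = p ^ b * card Z"
    and IH: "\<And>S. subgroup S G \<Longrightarrow> self_normalizing_sylow (G\<lparr>carrier := S\<rparr>) p M P \<Longrightarrow> sylow_corr (G\<lparr>carrier := S\<rparr>) p M P"
  shows "sylow_corr G p Z P"
proof -
  let ?M = "G\<lparr>carrier := M\<rparr>" and ?P = "G\<lparr>carrier := P\<rparr>"
  have sM: "subgroup M G" using M normal_imp_subgroup by blast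
  interpret M: finite_group ?M by (rule subgroup_finite_group[OF sM])
  interpret P: finite_group ?P by (rule subgroup_finite_group[OF P])
  note Mc = subgroup.mem_carrier[OF sM] and Pc = subgroup.mem_carrier[OF P]
  \<comment> \<open>Some conjugate of \<open>M\<close> lies in \<open>P\<close>, because
    \<open>M\<close> has p-power order modulo \<open>Z\<close>. As \<open>M\<close> is normal, that
    conjugate is \<open>M\<close> itself.\<close>
  have MP: "M \<subseteq> P"
  proof
    fix m assume m: "m \<in> M"
    obtain g where g: "g \<in> carrier G" "\<forall>x\<in>M. g \<otimes> x \<otimes> inv g \<in> P"
      using sylow_fixed_coset[OF prime Z sM ZM card_M P ZP index_P] by blast
    have "inv g \<otimes> m \<otimes> g \<in> M" using normal.inv_op_closed1[OF M g(1) m] .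
    then have "g \<otimes> (inv g \<otimes> m \<otimes> g) \<otimes> inv g \<in> P" using g(2) by blast
    then show "m \<in> P" unfolding conj_inv_cancel(1)[OF g(1) Mc[OF m]] .
  qed
  have sMP: "subgroup M ?P" using subgroup_incl[OF sM P MP] .
  have sZM: "subgroup Z ?M" using subgroup_incl[OF sZ sM ZM] .
  obtain a where a: "card P = p ^ a * card Z" using card_P by blast
  have cPM: "card P = p ^ (a - b) * card M"
  proof -
    have zp: "card Z \<noteq> 0" using card_subgroup_pos[OF sZ] by simp
    have "p ^ b * card Z dvd p ^ a * card Z" using card_subgroup_dvd[OF sM P MP] a card_M by simp
    then have "p ^ b dvd p ^ a" using zp by simp
    then have "b \<le> a" using prime_gt_1_nat[OF prime] by (simp add: power_dvd_imp_le)
    then show ?thesis using a card_M by (simp flip: power_add)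
  qed
  \<comment> \<open>The quotient of \<open>M\<close> by \<open>Z\<close> has order
    \<open>p ^ b\<close> and \<nu> is trivial on \<open>Z\<close>. This bounds the order of \<nu>
    for \<open>extend_linear\<close>.\<close>
  have pow: "\<nu> m ^ (p ^ b) = 1" if \<nu>: "\<nu> \<in> Lin ?M" "in_kernel G Z \<nu>" and m: "m \<in> M" for \<nu> m
  proof -
    have ZnM: "Z \<lhd> ?M" using normal_restrict_supergroup[OF sM Z ZM] .
    interpret ZnM: normal Z ?M by (rule ZnM)
    have F: "group (?M Mod Z)" by (rule ZnM.factorgroup_is_group)
    have "card (rcosets\<^bsub>?M\<^esub> Z) * card Z = p ^ b * card Z"
      using M.lagrange[OF sZM] card_M by (simp add: Coset.order_def)
    then have ord: "Coset.order (?M Mod Z) = p ^ b"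
      using card_subgroup_pos[OF sZ] by (simp add: Coset.order_def FactGroup_def)
    have mc: "Z #>\<^bsub>?M\<^esub> m \<in> carrier (?M Mod Z)" using m by (auto simp: FactGroup_def RCOSETS_def)
    have "Z #>\<^bsub>?M\<^esub> (m [^]\<^bsub>?M\<^esub> (p ^ b)) = Z"
      using group.pow_order_eq_1[OF F mc] ZnM.FactGroup_pow[of m "p ^ b"] m ord by (simp add: FactGroup_def)
    moreover have "m [^]\<^bsub>?M\<^esub> (p ^ b) \<in> Z #>\<^bsub>?M\<^esub> (m [^]\<^bsub>?M\<^esub> (p ^ b))"
      using M.rcos_self[OF _ sZM] M.nat_pow_closed m by simp
    ultimately have "m [^]\<^bsub>?M\<^esub> (p ^ b) \<in> Z" by simp
    then have "\<nu> (m [^]\<^bsub>?M\<^esub> (p ^ b)) = \<nu> \<one>" using \<nu>(2) unfolding in_kernel_def by blast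
    then show ?thesis using M.Lin_pow[OF \<nu>(1), of m "p ^ b"] M.LinD(2)[OF \<nu>(1)] m by simp
  qed
  have block: "\<exists>h. bij_betw h {\<theta> \<in> Irr_p' p G. cmult ?M (char_res M \<theta>) \<nu> \<noteq> 0} {l \<in> Lin ?P. char_res M l = \<nu>} \<and>
      (\<forall>\<theta> l. \<theta> \<in> Irr_p' p G \<longrightarrow> cmult ?M (char_res M \<theta>) \<nu> \<noteq> 0 \<longrightarrow> l \<in> Lin ?P \<longrightarrow> char_res M l = \<nu> \<longrightarrow>
        cmult ?P (char_res P \<theta>) l = (if l = h \<theta> then 1 else 0))"
    if \<nu>: "\<nu> \<in> Lin ?M" "in_kernel G Z \<nu>" "P \<subseteq> stabilizer G (conj_char G M) \<nu>"
      and ne: "(\<exists>\<theta>\<in>Irr_p' p G. cmult ?M (char_res M \<theta>) \<nu> \<noteq> 0) \<or> (\<exists>l\<in>Lin ?P. char_res M l = \<nu>)" for \<nu>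
  proof -
    let ?S = "stabilizer G (conj_char G M) \<nu>"
    let ?GS = "G\<lparr>carrier := ?S\<rparr>"
    have \<nu>0: "\<And>y. y \<notin> M \<Longrightarrow> \<nu> y = 0" using M.LinD(1)[OF \<nu>(1)] by simp
    have S: "subgroup ?S G" by (rule stabilizer_conj_char(1)[where \<theta> = \<nu>, OF M \<nu>0])
    interpret S: finite_group ?GS by (rule subgroup_finite_group[OF S])
    have MS: "M \<subseteq> ?S" using MP \<nu>(3) by blast
    have MSn: "M \<lhd> ?GS" using normal_restrict_supergroup[OF S M MS] .
    have sMS: "subgroup M ?GS" using subgroup_incl[OF sM S MS] .
    have sPS: "subgroup P ?GS" using subgroup_incl[OF P S \<nu>(3)] .
    have \<nu>S: "\<nu> \<in> Lin (?GS\<lparr>carrier := M\<rparr>)" using \<nu>(1) by simp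
    have \<nu>inv: "\<nu> (inv g \<otimes> m \<otimes> g) = \<nu> m" if g: "g \<in> ?S" and m: "m \<in> M" for g m
    proof -
      have gc: "g \<in> carrier G" "conj_char G M g \<nu> = \<nu>" using g by (auto simp: stabilizer_def)
      have i: "inv g \<otimes> m \<otimes> g \<in> M" using normal.inv_op_closed1[OF M gc(1) m] .
      from fun_cong[OF gc(2), of "inv g \<otimes> m \<otimes> g"] show ?thesis
        using i conj_inv_cancel(1)[OF gc(1) Mc[OF m]] by (simp add: conj_char_def)
    qed
    have inv: "conj_char ?GS M g \<nu> = \<nu>" if "g \<in> carrier ?GS" for g
    proof -
      have "conj_char ?GS M g \<nu> = conj_char G M g \<nu>"
        using that m_inv_consistent[OF S] by (auto simp: conj_char_def fun_eq_iff)
      then show ?thesis using that by (simp add: stabilizer_def)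
    qed
    \<comment> \<open>To extend \<nu> to its stabilizer one needs a character that is a multiple of
      \<nu> on \<open>M\<close> and has degree prime to p. If a \<theta> lies over \<nu>, its
      Clifford correspondent serves; if some \<open>l\<close> restricts to \<nu>, the induced
      character serves, with degree the index of \<open>P\<close>.\<close>
    have "\<exists>\<xi>\<in>Chars ?GS. (\<forall>m\<in>M. \<xi> m = \<xi> \<one> * \<nu> m) \<and> \<not> p dvd char_degree ?GS \<xi>"
      using ne
    proof
      assume "\<exists>\<theta>\<in>Irr_p' p G. cmult ?M (char_res M \<theta>) \<nu> \<noteq> 0"
      then obtain \<theta> where \<theta>: "\<theta> \<in> Irr G" "\<not> p dvd char_degree G \<theta>" "cmult ?M (char_res M \<theta>) \<nu> \<noteq> 0"
        by (auto simp: Irr_p'_def)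
      obtain g where g: "bij_betw g {\<theta> \<in> Irr G. cmult ?M (char_res M \<theta>) \<nu> \<noteq> 0}
          {\<psi> \<in> Irr ?GS. cmult ?M (char_res M \<psi>) \<nu> \<noteq> 0}"
        "\<And>\<theta>. \<theta> \<in> Irr G \<Longrightarrow> cmult ?M (char_res M \<theta>) \<nu> \<noteq> 0 \<Longrightarrow>
          char_degree G \<theta> = card (rcosets ?S) * char_degree ?GS (g \<theta>)"
      proof (rule clifford_correspondence[OF M \<nu>(1)], goal_cases)
        case (1 f)
        show ?case by (rule 1(1)[OF 1(2,4)])
      qed
      have \<psi>: "g \<theta> \<in> Irr ?GS" "cmult ?M (char_res M (g \<theta>)) \<nu> \<noteq> 0" using bij_betwE[OF g(1)] \<theta> by auto
      have "\<forall>m\<in>M. g \<theta> m = g \<theta> \<one> * \<nu> m"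
      proof (rule S.normal_Lin_cases[OF MSn \<nu>S inv \<psi>(1)])
        assume *: "\<And>x d. x \<in> carrier ?GS \<Longrightarrow> d \<in> M \<Longrightarrow> g \<theta> (x \<otimes>\<^bsub>?GS\<^esub> d) = g \<theta> x * \<nu> d"
        show ?thesis using *[of \<one>] subgroup.one_closed[OF S] Mc by simp
      next
        assume "cmult (?GS\<lparr>carrier := M\<rparr>) (char_res M (g \<theta>)) \<nu> = 0"
        then show ?thesis using \<psi>(2) by simp
      qed
      moreover have "\<not> p dvd char_degree ?GS (g \<theta>)" using g(2)[OF \<theta>(1,3)] \<theta>(2) by auto
      ultimately show ?thesis using S.Irr_Chars[OF \<psi>(1)] by blast
    next
      assume "\<exists>l\<in>Lin ?P. char_res M l = \<nu>"
      then obtain l where l: "l \<in> Lin ?P" "char_res M l = \<nu>" by blast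
      have lC: "l \<in> Chars (?GS\<lparr>carrier := P\<rparr>)" using P.Irr_Chars[OF P.Lin_Irr[OF l(1)]] by simp
      let ?\<xi> = "ind_char ?GS P l"
      have C: "?\<xi> \<in> Chars ?GS" by (rule S.ind_char_Chars[OF sPS lC])
      have lm: "l m = \<nu> m" if "m \<in> M" for m using fun_cong[OF l(2), of m] that by (simp add: char_res_def)
      have \<xi>m: "?\<xi> m = (of_nat (card ?S) / of_nat (card P)) * \<nu> m" if m: "m \<in> M" for m
      proof -
        have "(\<Sum>x\<in>?S. l (inv\<^bsub>?GS\<^esub> x \<otimes> m \<otimes> x)) = (\<Sum>x\<in>?S. \<nu> m)"
        proof (rule sum.cong[OF refl])
          fix x assume x: "x \<in> ?S"
          have "inv x \<otimes> m \<otimes> x \<in> M" using normal.inv_op_closed1[OF M subgroup.mem_carrier[OF S x] m] .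
          then show "l (inv\<^bsub>?GS\<^esub> x \<otimes> m \<otimes> x) = \<nu> m" using lm \<nu>inv[OF x m] m_inv_consistent[OF S x] by simp
        qed
        then show ?thesis using m MS by (auto simp: ind_char_def)
      qed
      have "\<forall>m\<in>M. ?\<xi> m = ?\<xi> \<one> * \<nu> m"
        using \<xi>m subgroup.one_closed[OF sM] M.LinD(2)[OF \<nu>(1)] by simp
      moreover have "\<not> p dvd char_degree ?GS ?\<xi>"
      proof -
        have "char_degree (?GS\<lparr>carrier := P\<rparr>) l = 1" using P.Lin_degree[OF l(1)] by simp
        then have "char_degree ?GS ?\<xi> * card P = card (rcosets\<^bsub>?GS\<^esub> P) * card P"
          using S.degree_ind[OF sPS lC] S.lagrange[OF sPS] by simp
        then have "char_degree ?GS ?\<xi> = card (rcosets\<^bsub>?GS\<^esub> P)" using card_subgroup_pos[OF P] by simp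
        then show ?thesis using index_P rcosets_index_mult[OF P S \<nu>(3)] by (metis dvd_mult2)
      qed
      ultimately show ?thesis using C by blast
    qed
    then obtain \<xi> where \<xi>: "\<xi> \<in> Chars ?GS" "\<forall>m\<in>M. \<xi> m = \<xi> \<one>\<^bsub>?GS\<^esub> * \<nu> m" "\<not> p dvd char_degree ?GS \<xi>" by auto
    have "coprime (char_degree ?GS \<xi>) (p ^ b)"
      using prime_imp_coprime[OF prime \<xi>(3)] by (simp add: coprime_commute)
    then obtain \<mu> where \<mu>: "\<mu> \<in> Lin ?GS" "char_res M \<mu> = \<nu>"
      using S.extend_linear[OF sMS \<nu>S \<xi>(1,2), of "p ^ b"] pow[OF \<nu>(1,2)] by metis
    have "self_normalizing_sylow ?GS p M P"
      by (rule restrict[OF S MSn P _ \<nu>(3) MP ZM cPM]) simp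
    then have corr: "sylow_corr ?GS p M P" by (rule IH[OF S])
    show ?thesis
    proof (rule block_corr[OF M MP \<nu>(1,3) \<mu> corr], goal_cases)
      case (1 h)
      then show ?case by blast
    qed
  qed
  have over_res: "cmult ?M (char_res M \<theta>) (char_res M l) \<noteq> 0"
    if \<theta>: "\<theta> \<in> Irr G" and l: "l \<in> Lin ?P" "cmult ?P (char_res P \<theta>) l \<noteq> 0" for \<theta> l
  proof -
    have C: "char_res P \<theta> \<in> Chars ?P" by (rule Chars_res[OF P Irr_Chars[OF \<theta>]])
    have lI: "l \<in> Irr ?P" by (rule P.Lin_Irr[OF l(1)])
    have "char_res M l \<in> Lin ?M"
      using P.LinD[OF l(1)] MP subgroup.one_closed[OF sM] subgroup.m_closed[OF sM]
      by (intro M.LinI) (auto simp: char_res_def)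
    then have I: "char_res M l \<in> Irr ?M" by (rule M.Lin_Irr)
    have "cmult ?M (char_res M l) (char_res M l) \<noteq> 0" using M.cmult_Irr[OF I I] by simp
    then have "cmult ?M (char_res M (char_res P \<theta>)) (char_res M l) \<noteq> 0"
      using P.constituent_trans[OF sMP C lI, of "char_res M l"] l(2) I by simp
    then show ?thesis using char_res_res[OF MP, of \<theta>] by simp
  qed
  have res_inv: "P \<subseteq> stabilizer G (conj_char G M) (char_res M l)" if l: "l \<in> Lin ?P" for l
  proof
    fix x assume x: "x \<in> P"
    have "conj_char G M x (char_res M l) = char_res M l"
      by (rule conj_char_res_Chars[OF P MP x normal_normalizes[OF M Pc[OF x]] P.Irr_Chars[OF P.Lin_Irr[OF l]]])
    then show "x \<in> stabilizer G (conj_char G M) (char_res M l)" using Pc[OF x] by (simp add: stabilizer_def)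
  qed
  have resL: "char_res M l \<in> Lin ?M" if l: "l \<in> Lin ?P" for l
    using P.LinD[OF l] MP subgroup.one_closed[OF sM] subgroup.m_closed[OF sM]
    by (intro M.LinI) (auto simp: char_res_def)
  \<comment> \<open>Two \<open>P\<close>-invariant linear constituents of \<theta> on
    \<open>M\<close> are conjugate by Clifford and then equal by abnormality. Hence multiplicities
    between different blocks vanish.\<close>
  have uniq: "char_res M l = \<nu>" if \<theta>: "\<theta> \<in> Irr G" and l: "l \<in> Lin ?P" "cmult ?P (char_res P \<theta>) l \<noteq> 0"
    and \<nu>: "\<nu> \<in> Lin ?M" "cmult ?M (char_res M \<theta>) \<nu> \<noteq> 0" "P \<subseteq> stabilizer G (conj_char G M) \<nu>" for \<theta> l \<nu>
  proof -
    have I: "char_res M l \<in> Irr ?M" by (rule M.Lin_Irr[OF resL[OF l(1)]])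
    obtain g where g: "g \<in> carrier G" "char_res M l = conj_char G M g \<nu>"
      using clifford_conjugate[OF M \<theta> M.Lin_Irr[OF \<nu>(1)] \<nu>(2) I over_res[OF \<theta> l]] by blast
    have z: "\<nu> y = 0" if "y \<notin> M" for y using M.LinD(1)[OF \<nu>(1), of y] that by simp
    show ?thesis using invariant_conjugate_unique[where \<nu> = \<nu>, OF M z g(1) \<nu>(3)] res_inv[OF l(1)] g(2) by simp
  qed
  let ?I = "{\<theta> \<in> Irr_p' p G. in_kernel G Z \<theta>}" and ?L = "{l \<in> Lin ?P. in_kernel G Z l}"
  let ?a = "\<lambda>\<theta> l. cmult ?P (char_res P \<theta>) l"
  have row: "\<exists>l\<in>?L. ?a \<theta> l = 1 \<and> (\<forall>l'\<in>?L. l' \<noteq> l \<longrightarrow> ?a \<theta> l' = 0)" if \<theta>: "\<theta> \<in> ?I" for \<theta>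
  proof -
    have \<theta>': "\<theta> \<in> Irr_p' p G" "in_kernel G Z \<theta>" "\<theta> \<in> Irr G" using \<theta> by (auto simp: Irr_p'_def)
    obtain \<nu> where \<nu>: "\<nu> \<in> Lin ?M" "in_kernel G Z \<nu>" "cmult ?M (char_res M \<theta>) \<nu> \<noteq> 0"
       "P \<subseteq> stabilizer G (conj_char G M) \<nu>"
      by (rule exists_invariant_constituent[OF M ZM comm \<theta>'(1,2)])
    obtain h where h: "bij_betw h {\<theta> \<in> Irr_p' p G. cmult ?M (char_res M \<theta>) \<nu> \<noteq> 0} {l \<in> Lin ?P. char_res M l = \<nu>}"
      "\<And>l. l \<in> Lin ?P \<Longrightarrow> char_res M l = \<nu> \<Longrightarrow> ?a \<theta> l = (if l = h \<theta> then 1 else 0)"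
      using block[OF \<nu>(1,2,4)] \<theta>'(1) \<nu>(3) by blast
    have hL: "h \<theta> \<in> Lin ?P" "char_res M (h \<theta>) = \<nu>" using bij_betwE[OF h(1)] \<theta>'(1) \<nu>(3) by auto
    have "h \<theta> z = h \<theta> \<one>" if z: "z \<in> Z" for z
    proof -
      have "h \<theta> z = \<nu> z" using fun_cong[OF hL(2), of z] z ZM by (auto simp: char_res_def)
      also have "\<nu> z = \<nu> \<one>" using \<nu>(2) z unfolding in_kernel_def by blast
      also have "\<dots> = h \<theta> \<one>" using P.LinD(2)[OF hL(1)] M.LinD(2)[OF \<nu>(1)] by simp
      finally show ?thesis .
    qed
    then have hk: "in_kernel G Z (h \<theta>)" unfolding in_kernel_def by blast
    have "?a \<theta> l' = 0" if l': "l' \<in> ?L" "l' \<noteq> h \<theta>" for l'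
    proof (rule ccontr)
      assume nz: "?a \<theta> l' \<noteq> 0"
      have "char_res M l' = \<nu>" using uniq[OF \<theta>'(3) _ nz \<nu>(1,3,4)] l'(1) by blast
      then show False using h(2)[of l'] l' nz by simp
    qed
    then show ?thesis using h(2)[OF hL] hL(1) hk by (intro bexI[of _ "h \<theta>"]) auto
  qed
  \<comment> \<open>The block of \<open>l\<close> is determined by its restriction to
    \<open>M\<close>, so every \<theta> whose restriction to \<open>P\<close> contains
    \<open>l\<close> is found in that block.\<close>
  have col: "\<exists>\<theta>\<in>?I. \<forall>\<theta>'\<in>?I. ?a \<theta>' l \<noteq> 0 \<longleftrightarrow> \<theta>' = \<theta>" if l: "l \<in> ?L" for l
  proof -
    have lL: "l \<in> Lin ?P" "in_kernel G Z l" using l by auto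
    let ?\<nu> = "char_res M l"
    have \<nu>: "?\<nu> \<in> Lin ?M" by (rule resL[OF lL(1)])
    have ker: "in_kernel G Z ?\<nu>"
    proof -
      have "l z = l \<one>" if "z \<in> Z" for z using lL(2) that unfolding in_kernel_def by blast
      then show ?thesis using ZM subgroup.one_closed[OF sM] by (auto simp: in_kernel_def char_res_def)
    qed
    obtain h where h: "bij_betw h {\<theta> \<in> Irr_p' p G. cmult ?M (char_res M \<theta>) ?\<nu> \<noteq> 0} {l \<in> Lin ?P. char_res M l = ?\<nu>}"
      "\<And>\<theta>. \<theta> \<in> Irr_p' p G \<Longrightarrow> cmult ?M (char_res M \<theta>) ?\<nu> \<noteq> 0 \<Longrightarrow> ?a \<theta> l = (if l = h \<theta> then 1 else 0)"
      using block[OF \<nu> ker res_inv[OF lL(1)]] lL(1) by blast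
    have "l \<in> h ` {\<theta> \<in> Irr_p' p G. cmult ?M (char_res M \<theta>) ?\<nu> \<noteq> 0}" using h(1) lL(1) by (simp add: bij_betw_def)
    then obtain \<theta> where \<theta>: "\<theta> \<in> Irr_p' p G" "cmult ?M (char_res M \<theta>) ?\<nu> \<noteq> 0" "l = h \<theta>" by blast
    have \<theta>I: "\<theta> \<in> Irr G" using \<theta>(1) by (simp add: Irr_p'_def)
    have "in_kernel G Z \<theta>"
    proof -
      have C: "char_res M \<theta> \<in> Chars ?M" by (rule Chars_res[OF sM Irr_Chars[OF \<theta>I]])
      have tZ: "triv_char Z \<in> Lin (?M\<lparr>carrier := Z\<rparr>)" using triv_char_subgroup[OF sZ] by simp
      have "char_res Z ?\<nu> = triv_char Z"
      proof
        fix z show "char_res Z ?\<nu> z = triv_char Z z"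
        proof (cases "z \<in> Z")
          case True
          have "?\<nu> z = ?\<nu> \<one>" using ker True unfolding in_kernel_def by blast
          then show ?thesis using True M.LinD(2)[OF \<nu>] by (simp add: char_res_def[of Z])
        qed (simp add: char_res_def[of Z])
      qed
      then have "cmult (?M\<lparr>carrier := Z\<rparr>) (char_res Z ?\<nu>) (triv_char Z) \<noteq> 0"
        using finite_group.cmult_Irr[OF subgroup_finite_group[OF sZ], of "triv_char Z" "triv_char Z"]
          finite_group.Lin_Irr[OF subgroup_finite_group[OF sZ] triv_char_subgroup[OF sZ]] by simp
      then have "cmult (?M\<lparr>carrier := Z\<rparr>) (char_res Z (char_res M \<theta>)) (triv_char Z) \<noteq> 0"
        using M.constituent_trans[OF sZM C M.Lin_Irr[OF \<nu>], of "triv_char Z"] \<theta>(2)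
          finite_group.Lin_Irr[OF subgroup_finite_group[OF sZ] triv_char_subgroup[OF sZ]] by simp
      then show ?thesis using in_kernel_normal_iff[OF Z \<theta>I] char_res_res[OF ZM, of \<theta>] by simp
    qed
    then have I: "\<theta> \<in> ?I" using \<theta>(1) by blast
    have "?a \<theta>' l \<noteq> 0 \<longleftrightarrow> \<theta>' = \<theta>" if \<theta>': "\<theta>' \<in> ?I" for \<theta>'
    proof
      assume nz: "?a \<theta>' l \<noteq> 0"
      have \<theta>'p: "\<theta>' \<in> Irr_p' p G" "\<theta>' \<in> Irr G" using \<theta>' by (auto simp: Irr_p'_def)
      have ov: "cmult ?M (char_res M \<theta>') ?\<nu> \<noteq> 0" by (rule over_res[OF \<theta>'p(2) lL(1) nz])
      have "l = h \<theta>'" using h(2)[OF \<theta>'p(1) ov] nz by (metis)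
      then show "\<theta>' = \<theta>" using h(1) \<theta> \<theta>'p(1) ov by (auto simp: bij_betw_def dest: inj_onD)
    next
      assume "\<theta>' = \<theta>"
      then show "?a \<theta>' l \<noteq> 0" using h(2)[OF \<theta>(1,2)] \<theta>(3) by simp
    qed
    then show ?thesis using I by blast
  qed
  have ex: "\<forall>\<theta>\<in>?I. \<exists>l. l \<in> ?L \<and> ?a \<theta> l = 1 \<and> (\<forall>l'\<in>?L. l' \<noteq> l \<longrightarrow> ?a \<theta> l' = 0)"
    by (rule ballI, drule row, simp only: Bex_def)
  obtain f where f': "\<forall>\<theta>\<in>?I. f \<theta> \<in> ?L \<and> ?a \<theta> (f \<theta>) = 1 \<and> (\<forall>l'\<in>?L. l' \<noteq> f \<theta> \<longrightarrow> ?a \<theta> l' = 0)"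
    by (rule exE[OF bchoice[OF ex]])
  have f: "f \<theta> \<in> ?L \<and> ?a \<theta> (f \<theta>) = 1 \<and> (\<forall>l'\<in>?L. l' \<noteq> f \<theta> \<longrightarrow> ?a \<theta> l' = 0)" if "\<theta> \<in> ?I" for \<theta>
    using bspec[OF f' that] .
  have "bij_betw f ?I ?L"
  proof (rule bij_betw_imageI)
    show "inj_on f ?I"
    proof (rule inj_onI)
      fix \<theta> \<theta>' assume t: "\<theta> \<in> ?I" "\<theta>' \<in> ?I" and eq: "f \<theta> = f \<theta>'"
      have fL: "f \<theta> \<in> ?L" using f[OF t(1)] by (rule conjunct1)
      obtain \<theta>0 where \<theta>0: "\<forall>\<theta>'\<in>?I. ?a \<theta>' (f \<theta>) \<noteq> 0 \<longleftrightarrow> \<theta>' = \<theta>0" using col[OF fL] by (rule bexE)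
      have "?a \<theta> (f \<theta>) = 1" "?a \<theta>' (f \<theta>) = 1" using f[OF t(1)] f[OF t(2)] eq by simp_all
      then have "\<theta> = \<theta>0" "\<theta>' = \<theta>0" using bspec[OF \<theta>0 t(1)] bspec[OF \<theta>0 t(2)] by simp_all
      then show "\<theta> = \<theta>'" by simp
    qed
    show "f ` ?I = ?L"
    proof
      show "f ` ?I \<subseteq> ?L" by (rule image_subsetI) (erule f[THEN conjunct1])
      show "?L \<subseteq> f ` ?I"
      proof
        fix l assume l: "l \<in> ?L"
        obtain \<theta> where \<theta>: "\<theta> \<in> ?I" "\<forall>\<theta>'\<in>?I. ?a \<theta>' l \<noteq> 0 \<longleftrightarrow> \<theta>' = \<theta>" using col[OF l] by (rule bexE)
        have "?a \<theta> l \<noteq> 0" using bspec[OF \<theta>(2,1)] by simp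
        then have "l = f \<theta>" using bspec[OF f[OF \<theta>(1), THEN conjunct2, THEN conjunct2] l] by argo
        then show "l \<in> f ` ?I" using \<theta>(1) by blast
      qed
    qed
  qed
  moreover have "?a \<theta> l = (if l = f \<theta> then 1 else 0)" if "\<theta> \<in> Irr_p' p G" "in_kernel G Z \<theta>" "l \<in> Lin ?P" "in_kernel G Z l" for \<theta> l
  proof -
    have "\<theta> \<in> ?I" and l: "l \<in> ?L" using that by blast+
    note F = f[OF this(1)]
    show ?thesis using F[THEN conjunct2, THEN conjunct1] bspec[OF F[THEN conjunct2, THEN conjunct2] l] by argo
  qed
  ultimately show ?thesis unfolding sylow_corr_def by (intro exI[of _ f] conjI allI impI)
qed

end

section \<open>Induction along the layers\<close>

lemma (in finite_group) normal_layer_over: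
  assumes p: "Factorial_Ring.prime p" and sol: "solvable G" and Z: "Z \<lhd> G" and ne: "Z \<noteq> carrier G"
  obtains M m where "M \<lhd> G" "Z \<subset> M" "\<And>x y. x \<in> M \<Longrightarrow> y \<in> M \<Longrightarrow> x \<otimes> y \<otimes> inv x \<otimes> inv y \<in> Z"
    "card M = m * card Z" "\<not> p dvd m \<or> (\<exists>a. m = p ^ a)"
proof -
  interpret Z: normal Z G by (rule Z)
  have sZ: "subgroup Z G" using Z normal_imp_subgroup by blast
  interpret F: group "G Mod Z" by (rule Z.factorgroup_is_group)
  interpret F: finite_group "G Mod Z" by unfold_locales (simp add: carrier_FactGroup fin)
  interpret h: group_hom G "G Mod Z" "\<lambda>x. Z #> x"
    using Z.r_coset_hom_Mod by unfold_locales
  have solF: "solvable (G Mod Z)" by (rule h.surj_hom_imp_solvable) (use sol in \<open>auto simp: carrier_FactGroup\<close>)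
  have one: "\<one>\<^bsub>G Mod Z\<^esub> = Z" by (simp add: FactGroup_def)
  have nt: "carrier (G Mod Z) \<noteq> {\<one>\<^bsub>G Mod Z\<^esub>}"
  proof
    assume "carrier (G Mod Z) = {\<one>\<^bsub>G Mod Z\<^esub>}"
    then have "Z #> x = Z" if "x \<in> carrier G" for x using that one by (auto simp: carrier_FactGroup)
    then have "carrier G \<subseteq> Z" using rcos_self[OF _ sZ] by auto
    then show False using ne subgroup.subset[OF sZ] by blast
  qed
  obtain A where A: "A \<lhd> G Mod Z" "A \<noteq> {\<one>\<^bsub>G Mod Z\<^esub>}"
    "\<And>x y. x \<in> A \<Longrightarrow> y \<in> A \<Longrightarrow> x \<otimes>\<^bsub>G Mod Z\<^esub> y = y \<otimes>\<^bsub>G Mod Z\<^esub> x" "\<not> p dvd card A \<or> (\<exists>a. card A = p ^ a)"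
    using F.solvable_normal_layer[OF p solF nt] by blast
  have sA: "subgroup A (G Mod Z)" using A(1) normal_imp_subgroup by blast
  \<comment> \<open>The union of the cosets in \<open>A\<close> is the preimage of the layer of the
    quotient; commutativity of the layer says that commutators of \<open>?M\<close> lie in
    \<open>Z\<close>.\<close>
  let ?M = "\<Union>A"
  have M: "?M \<lhd> G" by (rule Z.factgroup_subgroup_union_normal[OF A(1)])
  have sM: "subgroup ?M G" using M normal_imp_subgroup by blast
  have char: "?M = {x \<in> carrier G. Z #> x \<in> A}" by (rule Z.factgroup_subgroup_union_char[OF sA])
  have ZA: "Z \<in> A" using subgroup.one_closed[OF sA] one by simp
  have "Z \<noteq> ?M"
  proof
    assume eq: "Z = ?M"
    have "X = Z" if X: "X \<in> A" for X
    proof -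
      obtain x where x: "x \<in> carrier G" "X = Z #> x" using subgroup.mem_carrier[OF sA X] by (auto simp: carrier_FactGroup)
      then have "x \<in> Z" using X char eq by blast
      then show ?thesis using x coset_join2[OF x(1) sZ] by simp
    qed
    have "A = {Z}"
    proof
      show "A \<subseteq> {Z}" by (rule subsetI) (simp add: \<open>\<And>X. X \<in> A \<Longrightarrow> X = Z\<close>)
    qed (simp add: ZA)
    then show False using A(2) unfolding one by (rule notE[rotated])
  qed
  then have ZM: "Z \<subset> ?M" using Union_upper[OF ZA] by (rule psubsetI[rotated])
  have comm: "x \<otimes> y \<otimes> inv x \<otimes> inv y \<in> Z" if x: "x \<in> ?M" and y: "y \<in> ?M" for x y
  proof -
    have c: "x \<in> carrier G" "y \<in> carrier G" "Z #> x \<in> A" "Z #> y \<in> A" using x y char by blast+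
    have "Z #> (x \<otimes> y) = Z #> (y \<otimes> x)"
      using A(3)[OF c(3,4)] unfolding mult_FactGroup Z.rcos_sum[OF c(1,2)] Z.rcos_sum[OF c(2,1)] .
    then have "x \<otimes> y \<in> Z #> (y \<otimes> x)" using rcos_self[OF _ sZ, of "x \<otimes> y"] c by auto
    then obtain z where z: "z \<in> Z" "x \<otimes> y = z \<otimes> (y \<otimes> x)" by (auto simp: r_coset_def)
    have zc: "z \<in> carrier G" using subgroup.mem_carrier[OF sZ z(1)] .
    have "x \<otimes> y \<otimes> inv x \<otimes> inv y = z"
    proof -
      have "x \<otimes> (inv x \<otimes> inv y) = inv y" using c(1,2) by (simp flip: m_assoc)
      then show ?thesis unfolding z(2) using zc c(1,2) by (simp add: m_assoc)
    qed
    then show ?thesis using z(1) by simp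
  qed
  have "card ?M = card A * card Z"
  proof -
    interpret MM: finite_group "G\<lparr>carrier := ?M\<rparr>" by (rule subgroup_finite_group[OF sM])
    have "subgroup Z (G\<lparr>carrier := ?M\<rparr>)" using subgroup_incl[OF sZ sM] ZM by blast
    then show ?thesis using MM.lagrange[of Z] Z.factgroup_subgroup_union_factor[OF sA] by (simp add: Coset.order_def mult.commute)
  qed
  then show ?thesis using that[OF M ZM comm _ A(4)] by blast
qed

text \<open>The measure is the order of the group minus the order of \<open>Z\<close>. A p'-layer
  enlarges \<open>Z\<close> in the same group; a p-layer enlarges \<open>Z\<close> and may also
  shrink the group to a stabilizer. Both decrease the measure.\<close>

theorem sylow_corr_solvable:
  fixes G :: "('a, 'b) monoid_scheme"
  assumes "self_normalizing_sylow G p Z P" and "solvable G"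
  shows "sylow_corr G p Z P"
  using assms
proof (induction "Coset.order G - card Z" arbitrary: G Z P rule: less_induct)
  case less
  interpret self_normalizing_sylow G p Z P by (rule less.prems(1))
  show ?case
  proof (cases "Z = carrier G")
    case True
    \<comment> \<open>Everything in sight is trivial on the whole group and restriction changes
      nothing, so the identity is the correspondence.\<close>
    then have Pc: "P = carrier G" using ZP subgroup.subset[OF P] by blast
    have comm: "x \<otimes>\<^bsub>G\<^esub> y \<otimes>\<^bsub>G\<^esub> inv\<^bsub>G\<^esub> x \<otimes>\<^bsub>G\<^esub> inv\<^bsub>G\<^esub> y \<in> Z" if "x \<in> carrier G" "y \<in> carrier G" for x y using that True by simp
    have "{\<theta> \<in> Irr_p' p G. in_kernel G Z \<theta>} = {l \<in> Lin G. in_kernel G Z l}"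
      using commutator_kernel_linear[OF sZ comm] Lin_Irr Lin_degree prime
      by (auto simp: Irr_p'_def not_prime_unit)
    moreover have "cmult G (char_res (carrier G) \<theta>) l = (if l = \<theta> then 1 else 0)"
      if "\<theta> \<in> Irr_p' p G" "l \<in> Lin G" for \<theta> l
      using that cmult_Irr[of \<theta> l] Lin_Irr char_res_self[OF Irr_Chars, of \<theta>] by (auto simp: Irr_p'_def)
    ultimately show ?thesis unfolding sylow_corr_def Pc carrier_update_self
      by (intro exI[of _ id]) simp
  next
    case False
    obtain M m where M: "M \<lhd> G" "Z \<subset> M" "\<And>x y. x \<in> M \<Longrightarrow> y \<in> M \<Longrightarrow> x \<otimes>\<^bsub>G\<^esub> y \<otimes>\<^bsub>G\<^esub> inv\<^bsub>G\<^esub> x \<otimes>\<^bsub>G\<^esub> inv\<^bsub>G\<^esub> y \<in> Z"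
      "card M = m * card Z" "\<not> p dvd m \<or> (\<exists>a. m = p ^ a)"
      by (rule normal_layer_over[OF prime less.prems(2) Z False]) (rule that; blast)
    have sub: "Coset.order H - card M < Coset.order G - card Z"
      if H: "carrier H \<subseteq> carrier G" "M \<subseteq> carrier H" for H :: "('a, 'b) monoid_scheme"
    proof -
      have "finite (carrier H)" using H(1) fin finite_subset by blast
      then have "finite M" "card M \<le> Coset.order H" "Coset.order H \<le> Coset.order G"
        using H fin by (auto simp: Coset.order_def card_mono finite_subset)
      moreover have "card Z < card M" using M(2) psubset_card_mono[of M Z] \<open>finite M\<close> by blast
      ultimately show ?thesis by linarith
    qed
    from M(5) show ?thesis
    proof
      assume m: "\<not> p dvd m"
      have "sylow_corr G p M (M <#>\<^bsub>G\<^esub> P)"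
        using less.hyps[OF sub coprime_layer(1)[OF M(1) _ M(3,4) m] less.prems(2)] M(2)
          subgroup.subset[OF normal_imp_subgroup[OF M(1)]] by blast
      then show ?thesis using coprime_layer(2)[OF M(1) _ M(3,4) m] M(2) by blast
    next
      assume "\<exists>a. m = p ^ a"
      then obtain a where a: "m = p ^ a" by blast
      have "sylow_corr (G\<lparr>carrier := S\<rparr>) p M P"
        if S: "subgroup S G" "self_normalizing_sylow (G\<lparr>carrier := S\<rparr>) p M P" for S
      proof -
        interpret S: self_normalizing_sylow "G\<lparr>carrier := S\<rparr>" p M P by (rule S(2))
        interpret i: group_hom "G\<lparr>carrier := S\<rparr>" G id
          by unfold_locales (use subgroup.subset[OF S(1)] in \<open>auto simp: hom_def\<close>)
        have "solvable (G\<lparr>carrier := S\<rparr>)" by (rule i.inj_hom_imp_solvable[OF _ less.prems(2)]) simp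
        then show ?thesis
          using less.hyps[OF sub S(2)] subgroup.subset[OF S(1)] subgroup.subset[OF S.sZ] by simp
      qed
      then show ?thesis using p_layer[OF M(1) _ M(3) M(4)[unfolded a]] M(2) by blast
    qed
  qed
qed

section \<open>A self-normalizing Sylow subgroup of a normal subgroup\<close>

lemma (in group) normalizer_iff_normalizes:
  assumes Q: "Q \<subseteq> carrier G"
  shows "g \<in> normalizer G Q \<longleftrightarrow> normalizes G Q g"
proof -
  have im: "g <# Q #> inv g = (\<lambda>x. g \<otimes> x \<otimes> inv g) ` Q" by (auto simp: l_coset_def r_coset_def)
  have "normalizes G Q g \<longleftrightarrow> g \<in> carrier G \<and> (\<lambda>x. g \<otimes> x \<otimes> inv g) ` Q = Q"
  proof (intro iffI conjI)
    assume n: "normalizes G Q g"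
    then show g: "g \<in> carrier G" by (rule normalizesD(1))
    show "(\<lambda>x. g \<otimes> x \<otimes> inv g) ` Q = Q"
    proof
      show "(\<lambda>x. g \<otimes> x \<otimes> inv g) ` Q \<subseteq> Q" using normalizesD(2)[OF n] by blast
      show "Q \<subseteq> (\<lambda>x. g \<otimes> x \<otimes> inv g) ` Q"
      proof
        fix x assume x: "x \<in> Q"
        have "x = g \<otimes> (inv g \<otimes> x \<otimes> g) \<otimes> inv g" using conj_inv_cancel(1)[OF g] x Q by auto
        then show "x \<in> (\<lambda>x. g \<otimes> x \<otimes> inv g) ` Q" using normalizesD(3)[OF n x] by (rule image_eqI)
      qed
    qed
  next
    assume a: "g \<in> carrier G \<and> (\<lambda>x. g \<otimes> x \<otimes> inv g) ` Q = Q"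
    have "inv g \<otimes> y \<otimes> g \<in> Q" if "y \<in> Q" for y
    proof -
      have "y \<in> (\<lambda>x. g \<otimes> x \<otimes> inv g) ` Q" using a that by blast
      then obtain x where x: "x \<in> Q" "y = g \<otimes> x \<otimes> inv g" by blast
      then show ?thesis using conj_inv_cancel(2)[of g x] a Q by auto
    qed
    then show "normalizes G Q g" unfolding normalizes_def using a by blast
  qed
  then show ?thesis using Q by (simp add: normalizer_def stabilizer_def im)
qed

text \<open>\<open>normalizes\<close> asks for conjugation in both directions, which makes it closed
  under inverses. On a finite set one direction suffices, an injective self-map being
  surjective.\<close>

lemma (in finite_group) normalizes_finite:
  assumes Q: "Q \<subseteq> carrier G" and g: "g \<in> carrier G" and sub: "\<And>x. x \<in> Q \<Longrightarrow> g \<otimes> x \<otimes> inv g \<in> Q"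
  shows "normalizes G Q g"
proof -
  have inj: "inj_on (\<lambda>x. g \<otimes> x \<otimes> inv g) Q"
    using Q g by (auto simp: inj_on_def subset_iff)
  have "(\<lambda>x. g \<otimes> x \<otimes> inv g) ` Q = Q"
    by (rule card_subset_eq) (use sub Q finite_subset[OF Q fin] card_image[OF inj] in auto)
  then have "g \<in> normalizer G Q" using Q g
    by (simp add: normalizer_def stabilizer_def l_coset_def r_coset_def image_UN UNION_singleton_eq_range image_image)
  then show ?thesis using normalizer_iff_normalizes[OF Q] by blast
qed

section \<open>The normal subgroup, its Sylow subgroup and the Frattini argument\<close>

locale self_normalizing_in_normal = finite_group +
  fixes p :: nat and N Q :: "'a set"
  assumes prime: "Factorial_Ring.prime p" and N: "N \<lhd> G"
    and solvable_N: "solvable (G\<lparr>carrier := N\<rparr>)"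
    and sylow_Q: "sylow_subgroup p (G\<lparr>carrier := N\<rparr>) Q"
    and selfnorm_Q: "normalizer (G\<lparr>carrier := N\<rparr>) Q = Q"
begin

abbreviation H :: "'a set" where "H \<equiv> normalizer G Q"

lemma sN: "subgroup N G" using N normal_imp_subgroup by blast

lemma QN: "Q \<subseteq> N" using sylow_Q subgroup.subset by (fastforce simp: sylow_subgroup_def)

lemma sQ: "subgroup Q G"
  using sylow_Q incl_subgroup[OF sN] by (simp add: sylow_subgroup_def)

lemma sQN: "subgroup Q (G\<lparr>carrier := N\<rparr>)" using sylow_Q by (simp add: sylow_subgroup_def)

lemma sH: "subgroup H G" by (rule normalizer_imp_subgroup[OF subgroup.subset[OF sQ]])

lemma H_iff: "g \<in> H \<longleftrightarrow> normalizes G Q g"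
  by (rule normalizer_iff_normalizes[OF subgroup.subset[OF sQ]])

lemma QH: "Q \<subseteq> H" using subgroup_normalizes[OF sQ] H_iff by blast

lemma selfnorm: "g \<in> Q" if g: "g \<in> N" and sub: "\<And>x. x \<in> Q \<Longrightarrow> g \<otimes> x \<otimes> inv g \<in> Q"
proof -
  interpret N: finite_group "G\<lparr>carrier := N\<rparr>" by (rule subgroup_finite_group[OF sN])
  have "normalizes (G\<lparr>carrier := N\<rparr>) Q g"
    by (rule N.normalizes_finite) (use g sub QN m_inv_consistent[OF sN] in auto)
  then show ?thesis using N.normalizer_iff_normalizes[of Q g] QN selfnorm_Q by simp
qed

lemma N_H: "N \<inter> H = Q"
proof
  show "N \<inter> H \<subseteq> Q"
  proof
    fix g assume g: "g \<in> N \<inter> H"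
    then have "normalizes G Q g" using H_iff by blast
    then show "g \<in> Q" using g by (rule_tac selfnorm) (simp, rule normalizesD(2))
  qed
qed (use QN QH in blast)

lemma normal_Q: "subgroup X G \<Longrightarrow> Q \<subseteq> X \<Longrightarrow> X \<subseteq> H \<Longrightarrow> Q \<lhd> G\<lparr>carrier := X\<rparr>"
proof -
  assume X: "subgroup X G" "Q \<subseteq> X" "X \<subseteq> H"
  interpret X: finite_group "G\<lparr>carrier := X\<rparr>" by (rule subgroup_finite_group[OF X(1)])
  show "Q \<lhd> G\<lparr>carrier := X\<rparr>"
    unfolding X.normal_inv_iff
    using subgroup_incl[OF sQ X(1,2)] X(3) H_iff normalizesD(2) m_inv_consistent[OF X(1)] by auto
qed

lemma card_Q: "card Q = p_part p (card N)" using sylow_Q by (simp add: sylow_subgroup_def Coset.order_def)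

lemma self_normalizing_sylow_N: "self_normalizing_sylow (G\<lparr>carrier := N\<rparr>) p {\<one>} Q"
proof -
  interpret N: finite_group "G\<lparr>carrier := N\<rparr>" by (rule subgroup_finite_group[OF sN])
  show ?thesis
  proof (intro self_normalizing_sylow.intro self_normalizing_sylow_axioms.intro N.finite_group_axioms prime sQN)
    show "{\<one>} \<lhd> G\<lparr>carrier := N\<rparr>" using N.one_is_normal by simp
    show "{\<one>} \<subseteq> Q" using subgroup.one_closed[OF sQ] by simp
    show "\<exists>a. card Q = p ^ a * card {\<one>}" using card_Q by (auto simp: p_part_def)
    have "card (rcosets\<^bsub>G\<lparr>carrier := N\<rparr>\<^esub> Q) * card Q = card N"
      using N.lagrange[OF sQN] by (simp add: Coset.order_def)
    then have eq: "card N = p ^ multiplicity p (card N) * card (rcosets\<^bsub>G\<lparr>carrier := N\<rparr>\<^esub> Q)"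
      using card_Q by (simp add: p_part_def mult.commute)
    have "card N \<noteq> 0" using card_subgroup_pos[OF sN] by simp
    show "\<not> p dvd card (rcosets\<^bsub>G\<lparr>carrier := N\<rparr>\<^esub> Q)"
    proof
      assume "p dvd card (rcosets\<^bsub>G\<lparr>carrier := N\<rparr>\<^esub> Q)"
      then have "p ^ Suc (multiplicity p (card N)) dvd card N"
        by (subst eq) (simp add: mult.commute mult_dvd_mono)
      then have "Suc (multiplicity p (card N)) \<le> multiplicity p (card N)"
        using \<open>card N \<noteq> 0\<close> prime_gt_1_nat[OF prime] by (intro multiplicity_geI) auto
      then show False by simp
    qed
    show "g \<in> Q" if "g \<in> carrier (G\<lparr>carrier := N\<rparr>)"
      "\<And>x. x \<in> Q \<Longrightarrow> g \<otimes>\<^bsub>G\<lparr>carrier := N\<rparr>\<^esub> x \<otimes>\<^bsub>G\<lparr>carrier := N\<rparr>\<^esub> inv\<^bsub>G\<lparr>carrier := N\<rparr>\<^esub> g \<in> Q" for g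
      using that m_inv_consistent[OF sN] by (rule_tac selfnorm) auto
  qed
qed

lemma correspondence:
  obtains f where "bij_betw f (Irr_p' p (G\<lparr>carrier := N\<rparr>)) (Lin (G\<lparr>carrier := Q\<rparr>))"
    "\<And>\<theta> l. \<theta> \<in> Irr_p' p (G\<lparr>carrier := N\<rparr>) \<Longrightarrow> l \<in> Lin (G\<lparr>carrier := Q\<rparr>) \<Longrightarrow>
      cmult (G\<lparr>carrier := Q\<rparr>) (char_res Q \<theta>) l = (if l = f \<theta> then 1 else 0)"
proof -
  have ker: "in_kernel (G\<lparr>carrier := N\<rparr>) {\<one>} \<chi>" for \<chi> by (simp add: in_kernel_def)
  show ?thesis
    using sylow_corr_solvable[OF self_normalizing_sylow_N solvable_N] that
    by (auto simp: sylow_corr_def ker)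
qed

text \<open>The conjugate of \<open>Q\<close> by \<open>g\<close> lies in \<open>N\<close> and can
  be returned into \<open>Q\<close> by some \<open>y\<close> in \<open>N\<close>. Then
  \<open>y \<otimes> g\<close> normalizes \<open>Q\<close>.\<close>

lemma frattini:
  assumes g: "g \<in> carrier G" shows "\<exists>n\<in>N. \<exists>h\<in>H. g = n \<otimes> h"
proof -
  interpret N: self_normalizing_sylow "G\<lparr>carrier := N\<rparr>" p "{\<one>}" Q by (rule self_normalizing_sylow_N)
  let ?R = "(\<lambda>x. g \<otimes> x \<otimes> inv g) ` Q"
  obtain a where a: "card Q = p ^ a * card {\<one>}" using N.card_P by blast
  have R: "subgroup ?R G" "card ?R = card Q" by (rule conj_subgroup[OF sQ g])+
  have RN: "?R \<subseteq> N" using normal.inv_op_closed2[OF N g] QN by blast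
  have "\<exists>y\<in>carrier (G\<lparr>carrier := N\<rparr>). \<forall>x\<in>?R. y \<otimes>\<^bsub>G\<lparr>carrier := N\<rparr>\<^esub> x \<otimes>\<^bsub>G\<lparr>carrier := N\<rparr>\<^esub> inv\<^bsub>G\<lparr>carrier := N\<rparr>\<^esub> y \<in> Q"
    by (rule N.sylow_fixed_coset[OF prime N.Z _ _ _ sQN N.ZP N.index_P, of _ a])
      (use subgroup_incl[OF R(1) sN RN] subgroup.one_closed[OF R(1)] R(2) a in auto)
  then obtain y where y: "y \<in> N" "\<And>x. x \<in> ?R \<Longrightarrow> y \<otimes> x \<otimes> inv y \<in> Q"
    using m_inv_consistent[OF sN] by auto
  have yc: "y \<in> carrier G" using subgroup.mem_carrier[OF sN y(1)] .
  have "(y \<otimes> g) \<otimes> x \<otimes> inv (y \<otimes> g) \<in> Q" if x: "x \<in> Q" for x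
    using y(2)[of "g \<otimes> x \<otimes> inv g"] x conj_mult[OF yc g, of x] subgroup.mem_carrier[OF sQ x] by simp
  then have h: "y \<otimes> g \<in> H" unfolding H_iff
    by (intro normalizes_finite) (use subgroup.subset[OF sQ] yc g in auto)
  have "g = inv y \<otimes> (y \<otimes> g)" using yc g by (simp flip: m_assoc)
  then show ?thesis using h subgroup.m_inv_closed[OF sN y(1)] by blast
qed

text \<open>Dedekind's rule: if \<open>g = n \<otimes> h\<close> with \<open>g\<close> and
  \<open>n\<close> in \<open>X\<close>, then \<open>h\<close> is in \<open>X\<close> too. The
  setting thereby restricts to every group between \<open>N\<close> and \<open>G\<close>.\<close>

lemma frattini_between:
  assumes X: "subgroup X G" "N \<subseteq> X" and g: "g \<in> X" shows "\<exists>n\<in>N. \<exists>h\<in>X \<inter> H. g = n \<otimes> h"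
proof -
  obtain n h where nh: "n \<in> N" "h \<in> H" "g = n \<otimes> h" using frattini[OF subgroup.mem_carrier[OF X(1) g]] by blast
  have c: "n \<in> carrier G" "h \<in> carrier G"
    using subgroup.mem_carrier[OF sN nh(1)] subgroup.mem_carrier[OF sH nh(2)] by auto
  have "inv n \<otimes> g = h" unfolding nh(3) using c by (simp flip: m_assoc)
  moreover have "inv n \<otimes> g \<in> X"
    using subgroup.m_closed[OF X(1) subgroup.m_inv_closed[OF X(1)] g] nh(1) X(2) by blast
  ultimately show ?thesis using nh by (intro bexI[of _ n] bexI[of _ h]) auto
qed

text \<open>The correspondence is applied to \<open>Q\<close> inside itself. Restriction is then the
  identity, so an irreducible \<theta> has the linear constituent \<open>f \<theta>\<close> and must
  be equal to it.\<close>

lemma Irr_p'_Q: "Irr_p' p (G\<lparr>carrier := Q\<rparr>) = Lin (G\<lparr>carrier := Q\<rparr>)"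
proof -
  interpret N: self_normalizing_sylow "G\<lparr>carrier := N\<rparr>" p "{\<one>}" Q by (rule self_normalizing_sylow_N)
  let ?Q = "G\<lparr>carrier := Q\<rparr>"
  interpret Q: finite_group ?Q by (rule subgroup_finite_group[OF sQ])
  have "self_normalizing_sylow ?Q p {\<one>} Q"
  proof (intro self_normalizing_sylow.intro self_normalizing_sylow_axioms.intro Q.finite_group_axioms prime)
    show "{\<one>} \<lhd> ?Q" using Q.one_is_normal by simp
    show "subgroup Q ?Q" using Q.subgroup_self by simp
    show "{\<one>} \<subseteq> Q" by (rule N.ZP)
    show "\<exists>a. card Q = p ^ a * card {\<one>}" by (rule N.card_P)
    have "card (rcosets\<^bsub>?Q\<^esub> Q) * card Q = card Q" using Q.lagrange[OF Q.subgroup_self] by (simp add: Coset.order_def)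
    then show "\<not> p dvd card (rcosets\<^bsub>?Q\<^esub> Q)" using card_subgroup_pos[OF sQ] prime_gt_1_nat[OF prime] by simp
  qed simp
  moreover have "solvable ?Q"
  proof -
    interpret i: group_hom ?Q "G\<lparr>carrier := N\<rparr>" id
      by unfold_locales (use QN in \<open>auto simp: hom_def\<close>)
    show ?thesis by (rule i.inj_hom_imp_solvable[OF _ solvable_N]) simp
  qed
  ultimately have "sylow_corr ?Q p {\<one>} Q" by (rule sylow_corr_solvable)
  moreover have ker: "in_kernel ?Q {\<one>} \<chi>" for \<chi> by (simp add: in_kernel_def)
  ultimately obtain f where f: "bij_betw f (Irr_p' p ?Q) (Lin ?Q)"
    "\<And>\<theta> l. \<theta> \<in> Irr_p' p ?Q \<Longrightarrow> l \<in> Lin ?Q \<Longrightarrow> cmult ?Q (char_res Q \<theta>) l = (if l = f \<theta> then 1 else 0)"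
    by (auto simp: sylow_corr_def ker)
  have "\<theta> \<in> Lin ?Q" if \<theta>: "\<theta> \<in> Irr_p' p ?Q" for \<theta>
  proof -
    have \<theta>I: "\<theta> \<in> Irr ?Q" using \<theta> by (simp add: Irr_p'_def)
    have L: "f \<theta> \<in> Lin ?Q" using bij_betwE[OF f(1)] \<theta> by blast
    have "cmult ?Q \<theta> (f \<theta>) = 1" using f(2)[OF \<theta> L] Q.char_res_self[OF Q.Irr_Chars[OF \<theta>I]] by simp
    moreover have "cmult ?Q \<theta> (f \<theta>) = 0" if "\<theta> \<noteq> f \<theta>"
      using Q.cmult_Irr[OF \<theta>I Q.Lin_Irr[OF L]] that by argo
    ultimately have "\<theta> = f \<theta>" by linarith
    then show ?thesis by (metis L)
  qed
  moreover have "l \<in> Irr_p' p ?Q" if "l \<in> Lin ?Q" for l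
  proof -
    have "\<not> p dvd 1" using prime_gt_1_nat[OF prime] by simp
    then have "\<not> p dvd char_degree ?Q l" unfolding Q.Lin_degree[OF that] .
    then show ?thesis using Q.Lin_Irr[OF that] unfolding Irr_p'_def by blast
  qed
  ultimately show ?thesis by (intro equalityI subsetI)
qed

end

section \<open>Galois action on characters\<close>

lemma class_ring_inverses:
  fixes x :: complex
  shows "\<ominus>\<^bsub>class_ring\<^esub> x = - x" "x \<noteq> 0 \<Longrightarrow> inv\<^bsub>class_ring\<^esub> x = inverse x"
  by (simp_all add: class_ring_simps)

lemma cyclotomic_closed:
  shows "1 \<in> cyclotomic n" "0 \<in> cyclotomic n"
    "x \<in> cyclotomic n \<Longrightarrow> y \<in> cyclotomic n \<Longrightarrow> x + y \<in> cyclotomic n"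
    "x \<in> cyclotomic n \<Longrightarrow> y \<in> cyclotomic n \<Longrightarrow> x * y \<in> cyclotomic n"
    "x \<in> cyclotomic n \<Longrightarrow> inverse x \<in> cyclotomic n"
    "cis (2 * pi / real n) \<in> cyclotomic n"
proof -
  note [simp] = class_ring_simps class_ring_inverses
  note I = generate_field.intros[where R = "class_ring :: complex ring" and H = "{cis (2 * pi / real n)}", folded cyclotomic_def]
  show 1: "1 \<in> cyclotomic n" using I(1) by simp
  show add: "x \<in> cyclotomic n \<Longrightarrow> y \<in> cyclotomic n \<Longrightarrow> x + y \<in> cyclotomic n" for x y using I(5)[of x y] by simp
  show 0: "0 \<in> cyclotomic n" using add[OF 1 I(3)[OF 1]] by simp
  show "x \<in> cyclotomic n \<Longrightarrow> y \<in> cyclotomic n \<Longrightarrow> x * y \<in> cyclotomic n" using I(6)[of x y] by simp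
  show "x \<in> cyclotomic n \<Longrightarrow> inverse x \<in> cyclotomic n" using I(4)[of x] 0 by (cases "x = 0") auto
  show "cis (2 * pi / real n) \<in> cyclotomic n" using I(2) by simp
qed

lemma cyclotomic_sum: "(\<And>a. a \<in> A \<Longrightarrow> f a \<in> cyclotomic n) \<Longrightarrow> (\<Sum>a\<in>A. f a) \<in> cyclotomic n"
  by (induction A rule: infinite_finite_induct) (auto intro: cyclotomic_closed)

lemma cyclotomic_of_nat: "of_nat k \<in> cyclotomic n"
  by (induction k) (auto intro: cyclotomic_closed)

lemma cyclotomic_root_of_unity:
  assumes "z ^ n = 1" "0 < n" shows "z \<in> cyclotomic n"
proof -
  have pow: "cis (2 * pi / real n) ^ k \<in> cyclotomic n" for k
    by (induction k) (auto intro: cyclotomic_closed)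
  have "z \<in> {z. z ^ n = 1}" using assms by simp
  then obtain k where "z = cis (2 * pi * real k / real n)"
    using bij_betw_imp_surj_on[OF bij_betw_roots_unity[OF assms(2)]] by blast
  then have "z = cis (2 * pi / real n) ^ k" by (simp add: DeMoivre algebra_simps)
  then show ?thesis using pow by simp
qed

lemma (in finite_group) Chars_cyclotomic:
  assumes \<chi>: "\<chi> \<in> Chars G" and d: "Coset.order G dvd n" "0 < n"
  shows "\<chi> g \<in> cyclotomic n"
proof (cases "g \<in> carrier G")
  case True
  obtain zs where zs: "\<chi> g = sum_list zs" "\<And>z. z \<in> set zs \<Longrightarrow> z ^ Coset.order G = 1"
    by (rule char_value_roots_of_unity[OF fin \<chi> True]) (rule that; blast)
  have "z \<in> cyclotomic n" if "z \<in> set zs" for z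
    using zs(2)[OF that] d by (intro cyclotomic_root_of_unity) (auto simp: power_mult elim!: dvdE)
  then have "sum_list zs \<in> cyclotomic n"
    by (induction zs) (auto intro: cyclotomic_closed)
  then show ?thesis using zs(1) by simp
qed (use Chars_outside[OF \<chi>] cyclotomic_closed(2) in auto)

lemma Gal_cyclotomicD:
  assumes "\<sigma> \<in> Gal_cyclotomic n"
  shows "\<And>x y. x \<in> cyclotomic n \<Longrightarrow> y \<in> cyclotomic n \<Longrightarrow> \<sigma> (x + y) = \<sigma> x + \<sigma> y"
    "\<And>x y. x \<in> cyclotomic n \<Longrightarrow> y \<in> cyclotomic n \<Longrightarrow> \<sigma> (x * y) = \<sigma> x * \<sigma> y"
    "\<And>q. q \<in> \<rat> \<Longrightarrow> \<sigma> q = q" "inj_on \<sigma> (cyclotomic n)" "\<And>x. x \<in> cyclotomic n \<Longrightarrow> \<sigma> x \<in> cyclotomic n"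
  using assms by (auto simp: Gal_cyclotomic_def ring_iso_def Ring.ring_hom_def class_ring_simps bij_betw_def)

lemma Gal_cyclotomic_sum:
  assumes \<sigma>: "\<sigma> \<in> Gal_cyclotomic n" and f: "\<And>a. a \<in> A \<Longrightarrow> f a \<in> cyclotomic n"
  shows "\<sigma> (\<Sum>a\<in>A. f a) = (\<Sum>a\<in>A. \<sigma> (f a))"
  using f by (induction A rule: infinite_finite_induct)
    (auto simp: Gal_cyclotomicD[OF \<sigma>] cyclotomic_sum)

context finite_group begin

text \<open>The second claim, that \<sigma> commutes with complex conjugation on values, holds
  because conjugating a value of a linear character means passing to the inverse element, both
  before and after applying \<sigma>.\<close>

lemma galois_Lin:
  assumes \<sigma>: "\<sigma> \<in> Gal_cyclotomic n" and d: "Coset.order G dvd n" "0 < n" and l: "l \<in> Lin G"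
  shows "galois_char \<sigma> l \<in> Lin G" "\<And>g. \<sigma> (cnj (l g)) = cnj (\<sigma> (l g))"
proof -
  note S = Gal_cyclotomicD[OF \<sigma>]
  have K: "l g \<in> cyclotomic n" for g
    by (rule Chars_cyclotomic[OF Irr_Chars[OF LinD(4)[OF l]] d])
  show L: "galois_char \<sigma> l \<in> Lin G"
    by (rule LinI) (auto simp: galois_char_def LinD(1-3)[OF l] S K)
  show "\<sigma> (cnj (l g)) = cnj (\<sigma> (l g))" for g
  proof (cases "g \<in> carrier G")
    case True
    then have "cnj (l g) = l (inv g)" "cnj (galois_char \<sigma> l g) = galois_char \<sigma> l (inv g)"
      using Lin_norm(2)[OF l True] Lin_norm(2)[OF L True] by simp_all
    then show ?thesis by (simp add: galois_char_def)
  qed (use LinD(1)[OF l] S(3)[of 0] in auto)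
qed

text \<open>Injectivity of \<sigma> on the cyclotomic field gives an injective self-map of a finite
  set. Every linear character is thus a Galois conjugate.\<close>

lemma galois_Lin_surj:
  assumes \<sigma>: "\<sigma> \<in> Gal_cyclotomic n" and d: "Coset.order G dvd n" "0 < n"
  shows "galois_char \<sigma> ` Lin G = Lin G"
proof (rule endo_inj_surj)
  show "finite (Lin G)" by (rule finite_subset[OF _ finite_Irr]) (use Lin_Irr in blast)
  show "galois_char \<sigma> ` Lin G \<subseteq> Lin G" using galois_Lin(1)[OF \<sigma> d] by blast
  show "inj_on (galois_char \<sigma>) (Lin G)"
  proof (rule inj_onI)
    fix l l' assume l: "l \<in> Lin G" "l' \<in> Lin G" and eq: "galois_char \<sigma> l = galois_char \<sigma> l'"
    have "l g \<in> cyclotomic n" "l' g \<in> cyclotomic n" for g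
      by (rule Chars_cyclotomic[OF Irr_Chars[OF LinD(4)] d], rule l)+
    then show "l = l'" using eq Gal_cyclotomicD(4)[OF \<sigma>] unfolding galois_char_def fun_eq_iff inj_on_def by blast
  qed
qed

lemma galois_inner:
  assumes \<sigma>: "\<sigma> \<in> Gal_cyclotomic n" and d: "Coset.order G dvd n" "0 < n" and l: "l \<in> Lin G"
    and \<chi>: "\<And>g. \<chi> g \<in> cyclotomic n"
  shows "char_inner G (galois_char \<sigma> \<chi>) (galois_char \<sigma> l) = \<sigma> (char_inner G \<chi> l)"
proof -
  note S = Gal_cyclotomicD[OF \<sigma>]
  have K: "l g \<in> cyclotomic n" for g
    by (rule Chars_cyclotomic[OF Irr_Chars[OF LinD(4)[OF l]] d])
  have Kc: "cnj (l g) \<in> cyclotomic n" for g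
    using K[of "inv g"] Lin_norm(2)[OF l, of g] LinD(1)[OF l, of g] cyclotomic_closed(2)
    by (cases "g \<in> carrier G") auto
  \<comment> \<open>The normalizing factor is rational and so fixed by \<sigma>, and it lies in the
    field where \<sigma> is multiplicative.\<close>
  have q: "1 / of_nat (Coset.order G) \<in> \<rat>" "1 / of_nat (Coset.order G) \<in> cyclotomic n"
    using cyclotomic_closed(5)[OF cyclotomic_of_nat] by (auto simp: field_simps)
  have "char_inner G \<chi> l = (\<Sum>g\<in>carrier G. \<chi> g * cnj (l g)) * (1 / of_nat (Coset.order G))"
    by (simp add: char_inner_def)
  then have "\<sigma> (char_inner G \<chi> l) = \<sigma> (\<Sum>g\<in>carrier G. \<chi> g * cnj (l g)) * (1 / of_nat (Coset.order G))"
    using S(2)[OF cyclotomic_sum[of "carrier G" "\<lambda>g. \<chi> g * cnj (l g)", OF cyclotomic_closed(4)[OF \<chi> Kc]] q(2)] S(3)[OF q(1)]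
    by simp
  also have "\<sigma> (\<Sum>g\<in>carrier G. \<chi> g * cnj (l g)) = (\<Sum>g\<in>carrier G. \<sigma> (\<chi> g) * cnj (\<sigma> (l g)))"
    using Gal_cyclotomic_sum[OF \<sigma> cyclotomic_closed(4)[OF \<chi> Kc]] S(2)[OF \<chi> Kc] galois_Lin(2)[OF \<sigma> d l] by simp
  finally show ?thesis by (simp add: char_inner_def galois_char_def)
qed

end

section \<open>The map \<open>star\<close> and its equivariance\<close>

context self_normalizing_in_normal begin

text \<open>Defined for arbitrary functions: the Galois conjugate of a character need not be known to be
  a character, yet uniqueness of \<open>l\<close> still makes the map equivariant.\<close>

definition star :: "('a \<Rightarrow> complex) \<Rightarrow> 'a \<Rightarrow> complex" where
  "star \<theta> = (THE l. l \<in> Lin (G\<lparr>carrier := Q\<rparr>) \<and> char_inner (G\<lparr>carrier := Q\<rparr>) (char_res Q \<theta>) l \<noteq> 0)"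

lemma finite_group_Q: "finite_group (G\<lparr>carrier := Q\<rparr>)" by (rule subgroup_finite_group[OF sQ])

lemma star_eqI:
  assumes "l \<in> Lin (G\<lparr>carrier := Q\<rparr>)"
    "\<And>l'. l' \<in> Lin (G\<lparr>carrier := Q\<rparr>) \<Longrightarrow> char_inner (G\<lparr>carrier := Q\<rparr>) (char_res Q \<theta>) l' \<noteq> 0 \<longleftrightarrow> l' = l"
  shows "star \<theta> = l"
  unfolding star_def using assms by (intro the_equality) blast+

lemma Irr_p'_res:
  assumes "\<theta> \<in> Irr_p' p (G\<lparr>carrier := N\<rparr>)"
  shows "\<theta> \<in> Irr (G\<lparr>carrier := N\<rparr>)" "\<theta> \<in> Chars (G\<lparr>carrier := N\<rparr>)" "char_res Q \<theta> \<in> Chars (G\<lparr>carrier := Q\<rparr>)"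
proof -
  interpret NN: finite_group "G\<lparr>carrier := N\<rparr>" by (rule subgroup_finite_group[OF sN])
  show 1: "\<theta> \<in> Irr (G\<lparr>carrier := N\<rparr>)" using assms by (simp add: Irr_p'_def)
  then show "\<theta> \<in> Chars (G\<lparr>carrier := N\<rparr>)" by (rule NN.Irr_Chars)
  then show "char_res Q \<theta> \<in> Chars (G\<lparr>carrier := Q\<rparr>)" using NN.Chars_res[OF sQN] by simp
qed

lemma star_bij: "bij_betw star (Irr_p' p (G\<lparr>carrier := N\<rparr>)) (Lin (G\<lparr>carrier := Q\<rparr>))"
  and star_inner: "\<theta> \<in> Irr_p' p (G\<lparr>carrier := N\<rparr>) \<Longrightarrow> l \<in> Lin (G\<lparr>carrier := Q\<rparr>) \<Longrightarrow>
      char_inner (G\<lparr>carrier := Q\<rparr>) (char_res Q \<theta>) l = (if l = star \<theta> then 1 else 0)"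
proof -
  interpret Q: finite_group "G\<lparr>carrier := Q\<rparr>" by (rule finite_group_Q)
  obtain f where f: "bij_betw f (Irr_p' p (G\<lparr>carrier := N\<rparr>)) (Lin (G\<lparr>carrier := Q\<rparr>))"
    "\<And>\<theta> l. \<theta> \<in> Irr_p' p (G\<lparr>carrier := N\<rparr>) \<Longrightarrow> l \<in> Lin (G\<lparr>carrier := Q\<rparr>) \<Longrightarrow>
      cmult (G\<lparr>carrier := Q\<rparr>) (char_res Q \<theta>) l = (if l = f \<theta> then 1 else 0)"
    by (rule correspondence) (rule that; blast)
  have inner: "char_inner (G\<lparr>carrier := Q\<rparr>) (char_res Q \<theta>) l = (if l = f \<theta> then 1 else 0)"
    if "\<theta> \<in> Irr_p' p (G\<lparr>carrier := N\<rparr>)" "l \<in> Lin (G\<lparr>carrier := Q\<rparr>)" for \<theta> l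
    using f(2)[OF that] Q.of_nat_cmult[OF Irr_p'_res(3)[OF that(1)] Q.Lin_Irr[OF that(2)]] by (auto split: if_splits)
  have star: "star \<theta> = f \<theta>" if "\<theta> \<in> Irr_p' p (G\<lparr>carrier := N\<rparr>)" for \<theta>
    by (rule star_eqI) (use bij_betwE[OF f(1)] that inner[OF that] in auto)
  show "bij_betw star (Irr_p' p (G\<lparr>carrier := N\<rparr>)) (Lin (G\<lparr>carrier := Q\<rparr>))"
    using f(1) star by (simp cong: bij_betw_cong)
  show "\<theta> \<in> Irr_p' p (G\<lparr>carrier := N\<rparr>) \<Longrightarrow> l \<in> Lin (G\<lparr>carrier := Q\<rparr>) \<Longrightarrow>
      char_inner (G\<lparr>carrier := Q\<rparr>) (char_res Q \<theta>) l = (if l = star \<theta> then 1 else 0)"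
    using inner star by simp
qed

lemma star_Lin: "\<theta> \<in> Irr_p' p (G\<lparr>carrier := N\<rparr>) \<Longrightarrow> star \<theta> \<in> Lin (G\<lparr>carrier := Q\<rparr>)"
  using star_bij by (rule bij_betwE[rule_format])

lemma conj_Irr_p':
  assumes \<theta>: "\<theta> \<in> Irr_p' p (G\<lparr>carrier := N\<rparr>)" and g: "g \<in> carrier G"
  shows "conj_char G N g \<theta> \<in> Irr_p' p (G\<lparr>carrier := N\<rparr>)"
  using conj_char_Irr[OF sN normal_normalizes[OF N g] Irr_p'_res(1)[OF \<theta>]] char_degree_conj[OF sN g, of \<theta>] \<theta>
  by (simp add: Irr_p'_def)

lemma conj_Lin:
  assumes l: "l \<in> Lin (G\<lparr>carrier := Q\<rparr>)" and g: "g \<in> H"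
  shows "conj_char G Q g l \<in> Lin (G\<lparr>carrier := Q\<rparr>)"
proof -
  interpret Q: finite_group "G\<lparr>carrier := Q\<rparr>" by (rule finite_group_Q)
  have ng: "normalizes G Q g" using g H_iff by blast
  show ?thesis
    using conj_char_Irr[OF sQ ng Q.Lin_Irr[OF l]] char_degree_conj[OF sQ normalizesD(1)[OF ng], of l] Q.Lin_degree[OF l]
    by (simp add: Q.Lin_iff_Irr)
qed

text \<open>Inner products are invariant under simultaneous conjugation, so the conjugate of
  \<open>star \<theta>\<close> pairs to 1 with the conjugate of \<theta>; only one linear character
  does so.\<close>

lemma star_conj:
  assumes \<theta>: "\<theta> \<in> Irr_p' p (G\<lparr>carrier := N\<rparr>)" and g: "g \<in> H"
  shows "star (conj_char G N g \<theta>) = conj_char G Q g (star \<theta>)"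
proof -
  have ng: "normalizes G Q g" using g H_iff by blast
  have L: "conj_char G Q g (star \<theta>) \<in> Lin (G\<lparr>carrier := Q\<rparr>)" by (rule conj_Lin[OF star_Lin[OF \<theta>] g])
  have "char_inner (G\<lparr>carrier := Q\<rparr>) (char_res Q (conj_char G N g \<theta>)) (conj_char G Q g (star \<theta>)) = 1"
    unfolding conj_char_res[OF QN ng] char_inner_conj[OF subgroup.subset[OF sQ] ng]
    using star_inner[OF \<theta> star_Lin[OF \<theta>]] by simp
  then show ?thesis
    using star_inner[OF conj_Irr_p'[OF \<theta> normalizesD(1)[OF ng]] L] by (simp split: if_splits)
qed

text \<open>Every linear character of \<open>Q\<close> has the form
  \<open>galois_char \<sigma> l\<close>. Its pairing with the Galois conjugate of \<theta> is the
  image under \<sigma> of the pairing of \<theta> with \<open>l\<close>, hence 0 or 1 exactly as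
  before.\<close>

lemma star_galois:
  assumes \<theta>: "\<theta> \<in> Irr_p' p (G\<lparr>carrier := N\<rparr>)" and \<sigma>: "\<sigma> \<in> Gal_cyclotomic (Coset.order G)"
  shows "star (galois_char \<sigma> \<theta>) = galois_char \<sigma> (star \<theta>)"
proof -
  let ?Q = "G\<lparr>carrier := Q\<rparr>"
  interpret Q: finite_group ?Q by (rule finite_group_Q)
  interpret NN: finite_group "G\<lparr>carrier := N\<rparr>" by (rule subgroup_finite_group[OF sN])
  have d: "Coset.order ?Q dvd Coset.order G" "Coset.order (G\<lparr>carrier := N\<rparr>) dvd Coset.order G" "0 < Coset.order G"
    using card_subgroup_dvd[OF sQ subgroup_self subgroup.subset[OF sQ]]
      card_subgroup_dvd[OF sN subgroup_self subgroup.subset[OF sN]] order_pos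
    by (simp_all add: Coset.order_def)
  have \<sigma>0: "\<sigma> 0 = 0" using Gal_cyclotomicD(3)[OF \<sigma>, of 0] by simp
  have \<sigma>1: "\<sigma> 1 = 1" using Gal_cyclotomicD(3)[OF \<sigma>, of 1] by simp
  have K: "char_res Q \<theta> g \<in> cyclotomic (Coset.order G)" for g
    using NN.Chars_cyclotomic[OF Irr_p'_res(2)[OF \<theta>] d(2,3), of g] cyclotomic_closed(2) by (simp add: char_res_def)
  have res: "char_res Q (galois_char \<sigma> \<theta>) = galois_char \<sigma> (char_res Q \<theta>)"
    using \<sigma>0 by (auto simp: char_res_def galois_char_def)
  have inner: "char_inner ?Q (char_res Q (galois_char \<sigma> \<theta>)) (galois_char \<sigma> l) = (if l = star \<theta> then 1 else 0)"
    if "l \<in> Lin ?Q" for l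
    unfolding res Q.galois_inner[OF \<sigma> d(1,3) that K] star_inner[OF \<theta> that] using \<sigma>0 \<sigma>1 by simp
  show ?thesis
  proof (rule star_eqI)
    show "galois_char \<sigma> (star \<theta>) \<in> Lin ?Q" by (rule Q.galois_Lin(1)[OF \<sigma> d(1,3) star_Lin[OF \<theta>]])
    fix l' assume "l' \<in> Lin ?Q"
    then have "l' \<in> galois_char \<sigma> ` Lin ?Q" using Q.galois_Lin_surj[OF \<sigma> d(1,3)] by simp
    then obtain l where l: "l \<in> Lin ?Q" "l' = galois_char \<sigma> l" by blast
    show "char_inner ?Q (char_res Q (galois_char \<sigma> \<theta>)) l' \<noteq> 0 \<longleftrightarrow> l' = galois_char \<sigma> (star \<theta>)"
    proof
      assume "char_inner ?Q (char_res Q (galois_char \<sigma> \<theta>)) l' \<noteq> 0"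
      then show "l' = galois_char \<sigma> (star \<theta>)" using inner[OF l(1)] l(2) by (auto split: if_splits)
    next
      assume "l' = galois_char \<sigma> (star \<theta>)"
      then show "char_inner ?Q (char_res Q (galois_char \<sigma> \<theta>)) l' \<noteq> 0" using inner[OF star_Lin[OF \<theta>]] by simp
    qed
  qed
qed

end

section \<open>Isomorphism of character triples\<close>

lemma (in group) conj_char_subgroup:
  assumes "subgroup H G" "h \<in> H"
  shows "conj_char (G\<lparr>carrier := H\<rparr>) Y h = conj_char G Y h"
  using m_inv_consistent[OF assms] by (auto simp: conj_char_def fun_eq_iff)

lemma (in finite_group) normal_Int_subgroup:
  assumes "N \<lhd> G" "subgroup H G" shows "N \<inter> H \<lhd> G\<lparr>carrier := H\<rparr>"
  using normal_Int_subgroup[OF assms(2,1)] by (simp add: Int_commute)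

lemma (in finite_group) cmult_of_multiple:
  assumes \<theta>: "\<theta> \<in> Irr G" and \<psi>: "\<psi> \<in> Irr G" and \<chi>: "\<chi> \<in> Chars G" "\<chi> = (\<lambda>x. of_nat m * \<theta> x)"
  shows "cmult G \<chi> \<psi> = (if \<psi> = \<theta> then m else 0)"
  by (rule cmult_eqI[OF \<chi>(1) \<psi>]) (auto simp: \<chi>(2) char_inner_scale char_inner_Irr[OF \<theta> \<psi>])

text \<open>By Clifford the constituents on \<open>N\<close> are conjugates of \<theta>, and
  invariance leaves only \<theta>.\<close>

lemma (in finite_group) res_invariant:
  assumes N: "N \<lhd> G" and \<theta>: "\<theta> \<in> Irr (G\<lparr>carrier := N\<rparr>)" and inv: "\<And>g. g \<in> carrier G \<Longrightarrow> conj_char G N g \<theta> = \<theta>"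
    and \<chi>: "\<chi> \<in> Irr G" "cmult (G\<lparr>carrier := N\<rparr>) (char_res N \<chi>) \<theta> \<noteq> 0"
  shows "char_res N \<chi> = (\<lambda>x. of_nat (cmult (G\<lparr>carrier := N\<rparr>) (char_res N \<chi>) \<theta>) * \<theta> x)"
proof
  fix x
  let ?N = "G\<lparr>carrier := N\<rparr>"
  have sN: "subgroup N G" using N normal_imp_subgroup by blast
  interpret N: finite_group ?N by (rule subgroup_finite_group[OF sN])
  have C: "char_res N \<chi> \<in> Chars ?N" by (rule Chars_res[OF sN Irr_Chars[OF \<chi>(1)]])
  have z: "cmult ?N (char_res N \<chi>) \<eta> = 0" if "\<eta> \<in> Irr ?N - {\<theta>}" for \<eta>
  proof (rule ccontr)
    assume "cmult ?N (char_res N \<chi>) \<eta> \<noteq> 0"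
    then obtain g where "g \<in> carrier G" "\<eta> = conj_char G N g \<theta>"
      using clifford_conjugate[OF N \<chi>(1) \<theta> \<chi>(2), of \<eta>] \<open>\<eta> \<in> Irr ?N - {\<theta>}\<close> by blast
    then show False using inv[of g] that by simp
  qed
  have "char_res N \<chi> x = (\<Sum>\<eta>\<in>Irr ?N. of_nat (cmult ?N (char_res N \<chi>) \<eta>) * \<eta> x)" by (rule N.decomp[OF C])
  also have "\<dots> = of_nat (cmult ?N (char_res N \<chi>) \<theta>) * \<theta> x
      + (\<Sum>\<eta>\<in>Irr ?N - {\<theta>}. of_nat (cmult ?N (char_res N \<chi>) \<eta>) * \<eta> x)"
    by (rule sum.remove[OF N.finite_Irr \<theta>])
  also have "(\<Sum>\<eta>\<in>Irr ?N - {\<theta>}. of_nat (cmult ?N (char_res N \<chi>) \<eta>) * \<eta> x) = 0"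
    by (rule sum.neutral) (use z in simp)
  finally show "char_res N \<chi> x = of_nat (cmult ?N (char_res N \<chi>) \<theta>) * \<theta> x" by simp
qed

text \<open>Translates the definition by multiples of \<theta> into a condition on irreducible
  constituents, so that both sides of a triple isomorphism are described by the irreducible
  characters over \<theta>.\<close>

lemma (in finite_group) Char_over_iff:
  assumes N: "N \<lhd> G" and \<theta>: "\<theta> \<in> Irr (G\<lparr>carrier := N\<rparr>)" and inv: "\<And>g. g \<in> carrier G \<Longrightarrow> conj_char G N g \<theta> = \<theta>"
  shows "\<xi> \<in> Char_over G N \<theta> \<longleftrightarrow> \<xi> \<in> Chars G \<and>
    (\<forall>\<chi>\<in>Irr G. cmult G \<xi> \<chi> \<noteq> 0 \<longrightarrow> cmult (G\<lparr>carrier := N\<rparr>) (char_res N \<chi>) \<theta> \<noteq> 0)"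
proof -
  let ?N = "G\<lparr>carrier := N\<rparr>"
  have sN: "subgroup N G" using N normal_imp_subgroup by blast
  interpret N: finite_group ?N by (rule subgroup_finite_group[OF sN])
  have 1: "cmult ?N (char_res N \<chi>) \<theta> \<noteq> 0"
    if \<xi>: "\<xi> \<in> Chars G" "char_res N \<xi> = (\<lambda>x. of_nat m * \<theta> x)" and \<chi>: "\<chi> \<in> Irr G" "cmult G \<xi> \<chi> \<noteq> 0" for m \<chi>
  proof -
    have C: "char_res N \<chi> \<in> Chars ?N" by (rule Chars_res[OF sN Irr_Chars[OF \<chi>(1)]])
    obtain \<eta> where \<eta>: "\<eta> \<in> Irr ?N" "cmult ?N (char_res N \<chi>) \<eta> \<noteq> 0" by (rule N.ex_constituent[OF C])
    have "cmult ?N (char_res N \<xi>) \<eta> \<noteq> 0" by (rule constituent_trans[OF sN \<xi>(1) \<chi>(1) \<eta>(1) \<chi>(2) \<eta>(2)])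
    then have "\<eta> = \<theta>" using N.cmult_of_multiple[OF \<theta> \<eta>(1) Chars_res[OF sN \<xi>(1)] \<xi>(2)] by argo
    then show ?thesis using \<eta>(2) by argo
  qed
  have 2: "\<exists>m::nat. char_res N \<xi> = (\<lambda>x. of_nat m * \<theta> x)"
    if \<xi>: "\<xi> \<in> Chars G" and over: "\<forall>\<chi>\<in>Irr G. cmult G \<xi> \<chi> \<noteq> 0 \<longrightarrow> cmult ?N (char_res N \<chi>) \<theta> \<noteq> 0"
  proof (intro exI ext)
    fix x
    let ?e = "\<lambda>\<chi>. cmult ?N (char_res N \<chi>) \<theta>"
    have "of_nat (cmult G \<xi> \<chi>) * char_res N \<chi> x = of_nat (cmult G \<xi> \<chi> * ?e \<chi>) * \<theta> x" if \<chi>: "\<chi> \<in> Irr G" for \<chi>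
    proof (cases "cmult G \<xi> \<chi> = 0")
      case False
      then have "?e \<chi> \<noteq> 0" using over \<chi> by blast
      from fun_cong[OF res_invariant[OF N \<theta> inv \<chi> this], of x] show ?thesis by simp
    qed simp
    then have "(\<Sum>\<chi>\<in>Irr G. of_nat (cmult G \<xi> \<chi>) * char_res N \<chi> x) = (\<Sum>\<chi>\<in>Irr G. of_nat (cmult G \<xi> \<chi> * ?e \<chi>) * \<theta> x)"
      by (rule sum.cong[OF refl])
    also have "\<dots> = of_nat (\<Sum>\<chi>\<in>Irr G. cmult G \<xi> \<chi> * ?e \<chi>) * \<theta> x"
      by (simp add: sum_distrib_right)
    finally have "(\<Sum>\<chi>\<in>Irr G. of_nat (cmult G \<xi> \<chi>) * char_res N \<chi> x) = \<dots>" .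
    moreover have "char_res N \<xi> x = (\<Sum>\<chi>\<in>Irr G. of_nat (cmult G \<xi> \<chi>) * char_res N \<chi> x)"
      using decomp[OF \<xi>, of x] by (simp add: char_res_def)
    ultimately show "char_res N \<xi> x = of_nat (\<Sum>\<chi>\<in>Irr G. cmult G \<xi> \<chi> * ?e \<chi>) * \<theta> x" by argo
  qed
  show ?thesis unfolding Char_over_def using 1 2 by blast
qed

text \<open>To be instantiated with \<open>G\<close> replaced by any \<open>X\<close> between
  \<open>N\<close> and the stabilizer of \<theta>, and \<open>H\<close> by the intersection of
  \<open>X\<close> with the normalizer of \<open>Q\<close>. Multiplicity one of \<open>l\<close> in
  \<theta> links the two sides.\<close>

locale triple_pair = finite_group +
  fixes N H Q :: "'a set" and \<theta> l :: "'a \<Rightarrow> complex"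
  assumes N: "N \<lhd> G" and sH: "subgroup H G"
    and NH: "\<And>g. g \<in> carrier G \<Longrightarrow> \<exists>n\<in>N. \<exists>h\<in>H. g = n \<otimes> h" and Q_eq: "N \<inter> H = Q"
    and \<theta>: "\<theta> \<in> Irr (G\<lparr>carrier := N\<rparr>)" and \<theta>_inv: "\<And>g. g \<in> carrier G \<Longrightarrow> conj_char G N g \<theta> = \<theta>"
    and l: "l \<in> Lin (G\<lparr>carrier := Q\<rparr>)" and l_inv: "\<And>h. h \<in> H \<Longrightarrow> conj_char G Q h l = l"
    and mult_one: "char_inner (G\<lparr>carrier := Q\<rparr>) (char_res Q \<theta>) l = 1"
begin

abbreviation (input) GN where "GN \<equiv> G\<lparr>carrier := N\<rparr>"
abbreviation (input) GH where "GH \<equiv> G\<lparr>carrier := H\<rparr>"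
abbreviation (input) GQ where "GQ \<equiv> G\<lparr>carrier := Q\<rparr>"

lemma sN: "subgroup N G" using N normal_imp_subgroup by blast

lemma QH: "Q \<lhd> GH" using normal_Int_subgroup[OF N sH] Q_eq by simp

lemma sQH: "subgroup Q GH" using QH normal_imp_subgroup by blast

lemma sQ: "subgroup Q G" using subgroups_Inter_pair[OF sN sH] Q_eq by simp

lemma QsH: "Q \<subseteq> H" using Q_eq by blast

lemma QsN: "Q \<subseteq> N" using Q_eq by blast

sublocale N: finite_group GN by (rule subgroup_finite_group[OF sN])
sublocale H: finite_group GH by (rule subgroup_finite_group[OF sH])
sublocale Q: finite_group GQ by (rule subgroup_finite_group[OF sQ])

definition A where "A = {\<chi> \<in> Irr G. cmult GN (char_res N \<chi>) \<theta> \<noteq> 0}"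
definition B where "B = {\<psi> \<in> Irr GH. cmult GQ (char_res Q \<psi>) l \<noteq> 0}"

text \<open>The projection of \<open>\<chi>\<close>, restricted to \<open>H\<close>, onto the characters lying over \<open>l\<close>.\<close>

definition slice where
  "slice \<chi> = (\<lambda>g. if g \<in> H then (\<Sum>q\<in>Q. \<chi> (g \<otimes> q) * cnj (l q)) / of_nat (card Q) else 0)"

lemma A_Irr: "\<chi> \<in> A \<Longrightarrow> \<chi> \<in> Irr G" and B_Irr: "\<psi> \<in> B \<Longrightarrow> \<psi> \<in> Irr GH"
  by (simp_all add: A_def B_def)

text \<open>On irreducible characters of \<open>H\<close> the average \<open>slice\<close> is the
  identity or zero. If \<open>Q\<close> acts through \<open>l\<close>, all terms equal \<psi> at
  \<open>g\<close>; otherwise the dichotomy for invariant linear characters makes the sum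
  vanish.\<close>

lemma B_cases:
  assumes \<psi>: "\<psi> \<in> Irr GH"
  shows "\<psi> \<in> B \<Longrightarrow> cmult GQ (char_res Q \<psi>) l = char_degree GH \<psi>" "\<psi> \<in> B \<Longrightarrow> slice \<psi> = \<psi>"
    "\<psi> \<notin> B \<Longrightarrow> cmult GQ (char_res Q \<psi>) l = 0" "\<psi> \<notin> B \<Longrightarrow> slice \<psi> = (\<lambda>_. 0)"
proof -
  have inv: "conj_char GH Q g l = l" if "g \<in> carrier GH" for g
    using l_inv that conj_char_subgroup[OF sH] by simp
  have lQ: "l \<in> Lin (GH\<lparr>carrier := Q\<rparr>)" using l by simp
  have pos: "0 < char_degree GH \<psi>" by (rule H.Chars_one(2)[OF H.Irr_Chars[OF \<psi>]])
  have cQ: "of_nat (card Q) \<noteq> (0::complex)" using card_subgroup_pos[OF sQ] by simp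
  have "(cmult GQ (char_res Q \<psi>) l = char_degree GH \<psi> \<and> slice \<psi> = \<psi>) \<or>
    (cmult GQ (char_res Q \<psi>) l = 0 \<and> slice \<psi> = (\<lambda>_. 0))"
  proof (rule H.normal_Lin_cases[OF QH lQ inv \<psi>])
    assume over: "cmult (GH\<lparr>carrier := Q\<rparr>) (char_res Q \<psi>) l = char_degree GH \<psi>"
      "\<And>g d. g \<in> carrier GH \<Longrightarrow> d \<in> Q \<Longrightarrow> \<psi> (g \<otimes>\<^bsub>GH\<^esub> d) = \<psi> g * l d"
    have "slice \<psi> = \<psi>"
    proof
      fix g show "slice \<psi> g = \<psi> g"
      proof (cases "g \<in> H")
        case True
        have "\<psi> (g \<otimes> q) * cnj (l q) = \<psi> g" if "q \<in> Q" for q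
          using over(2)[of g q] True that Q.Lin_norm(1)[OF l, of q] by simp
        then show ?thesis using True cQ by (simp add: slice_def)
      next
        case False
        then show ?thesis using Chars_outside[OF H.Irr_Chars[OF \<psi>]] by (simp add: slice_def)
      qed
    qed
    then show ?thesis using over(1) by simp
  next
    assume "cmult (GH\<lparr>carrier := Q\<rparr>) (char_res Q \<psi>) l = 0"
      "\<And>g. g \<in> carrier GH \<Longrightarrow> (\<Sum>d\<in>Q. \<psi> (g \<otimes>\<^bsub>GH\<^esub> d) * cnj (l d)) = 0"
    then show ?thesis by (auto simp: slice_def fun_eq_iff)
  qed simp_all
  then show "\<psi> \<in> B \<Longrightarrow> cmult GQ (char_res Q \<psi>) l = char_degree GH \<psi>" "\<psi> \<in> B \<Longrightarrow> slice \<psi> = \<psi>"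
    "\<psi> \<notin> B \<Longrightarrow> cmult GQ (char_res Q \<psi>) l = 0" "\<psi> \<notin> B \<Longrightarrow> slice \<psi> = (\<lambda>_. 0)"
    using \<psi> pos by (auto simp: B_def)
qed

lemma slice_sum: "slice (\<lambda>g. \<Sum>a\<in>S. c a * f a g) = (\<lambda>g. \<Sum>a\<in>S. c a * slice (f a) g)"
proof
  fix g
  have "(\<Sum>q\<in>Q. (\<Sum>a\<in>S. c a * f a (g \<otimes> q)) * cnj (l q)) = (\<Sum>a\<in>S. c a * (\<Sum>q\<in>Q. f a (g \<otimes> q) * cnj (l q)))"
    by (subst sum_distrib_right, subst sum.swap) (simp add: sum_distrib_left mult.assoc)
  then show "slice (\<lambda>g. \<Sum>a\<in>S. c a * f a g) g = (\<Sum>a\<in>S. c a * slice (f a) g)"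
    by (auto simp: slice_def sum_divide_distrib[of _ S] simp flip: times_divide_eq_right)
qed

lemma slice_res: "slice (char_res H \<chi>) = slice \<chi>"
  using subgroup.m_closed[OF sH] QsH by (auto simp: slice_def char_res_def fun_eq_iff intro!: sum.cong)

lemma slice_H: "\<eta> \<in> Chars GH \<Longrightarrow> slice \<eta> = (\<lambda>g. \<Sum>\<psi>\<in>B. of_nat (cmult GH \<eta> \<psi>) * \<psi> g)"
proof
  fix g assume \<eta>: "\<eta> \<in> Chars GH"
  have "\<eta> = (\<lambda>g. \<Sum>\<psi>\<in>Irr GH. of_nat (cmult GH \<eta> \<psi>) * \<psi> g)" using H.decomp[OF \<eta>] by blast
  then have "slice \<eta> g = slice (\<lambda>g. \<Sum>\<psi>\<in>Irr GH. of_nat (cmult GH \<eta> \<psi>) * \<psi> g) g" by (rule arg_cong[where f = "\<lambda>x. slice x g"])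
  also have "\<dots> = (\<Sum>\<psi>\<in>Irr GH. of_nat (cmult GH \<eta> \<psi>) * slice \<psi> g)" by (simp add: slice_sum)
  also have "\<dots> = (\<Sum>\<psi>\<in>B. of_nat (cmult GH \<eta> \<psi>) * \<psi> g)"
    by (rule sum.mono_neutral_cong_right[OF H.finite_Irr]) (use B_Irr B_cases in auto)
  finally show "slice \<eta> g = (\<Sum>\<psi>\<in>B. of_nat (cmult GH \<eta> \<psi>) * \<psi> g)" .
qed

lemma A_res: "\<chi> \<in> A \<Longrightarrow> char_res N \<chi> = (\<lambda>x. of_nat (cmult GN (char_res N \<chi>) \<theta>) * \<theta> x)"
  by (rule res_invariant[OF N \<theta> \<theta>_inv]) (auto simp: A_def)

lemma A_degree: assumes "\<chi> \<in> A" shows "char_degree G \<chi> = char_degree GN \<theta> * cmult GN (char_res N \<chi>) \<theta>"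
proof -
  have "of_nat (char_degree G \<chi>) = \<chi> \<one>" using Chars_one(1)[OF Irr_Chars] assms by (simp add: A_def)
  also have "\<dots> = char_res N \<chi> \<one>" using subgroup.one_closed[OF sN] by (simp add: char_res_def)
  also have "\<dots> = of_nat (cmult GN (char_res N \<chi>) \<theta>) * \<theta> \<one>" by (rule fun_cong[OF A_res[OF assms]])
  also have "\<theta> \<one> = of_nat (char_degree GN \<theta>)" using N.Chars_one(1)[OF N.Irr_Chars[OF \<theta>]] by simp
  finally show ?thesis by (simp flip: of_nat_mult add: mult.commute)
qed

text \<open>The matrix is balanced with the degree of \<theta> as constant weight. For rows, \<chi>
  is a multiple of \<theta> on \<open>N\<close>, and \<theta> contains \<open>l\<close> once, so the
  multiplicities of \<theta> and of \<open>l\<close> in \<chi> agree. Columns follow from Mackey's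
  formula, since \<psi> is a multiple of \<open>l\<close> on \<open>Q\<close>.\<close>

lemma correspondence:
  obtains f where "bij_betw f A B" "\<And>\<chi> \<psi>. \<chi> \<in> A \<Longrightarrow> \<psi> \<in> B \<Longrightarrow> cmult GH (char_res H \<chi>) \<psi> = (if \<psi> = f \<chi> then 1 else 0)"
proof -
  have l': "l \<in> Irr GQ" by (rule Q.Lin_Irr[OF l])
  have fA: "finite A" and fB: "finite B" using finite_Irr H.finite_Irr by (auto simp: A_def B_def)
  have row: "char_degree GN \<theta> * (\<Sum>\<psi>\<in>B. cmult GH (char_res H \<chi>) \<psi> * char_degree GH \<psi>) = char_degree G \<chi>"
    if \<chi>: "\<chi> \<in> A" for \<chi>
  proof -
    have \<chi>I: "\<chi> \<in> Irr G" using \<chi> by (simp add: A_def)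
    have CH: "char_res H \<chi> \<in> Chars GH" by (rule Chars_res[OF sH Irr_Chars[OF \<chi>I]])
    have CQ: "char_res Q \<chi> \<in> Chars GQ" by (rule Chars_res[OF sQ Irr_Chars[OF \<chi>I]])
    have "(\<Sum>\<psi>\<in>B. cmult GH (char_res H \<chi>) \<psi> * char_degree GH \<psi>)
        = (\<Sum>\<psi>\<in>Irr GH. cmult GH (char_res H \<chi>) \<psi> * cmult GQ (char_res Q \<psi>) l)"
      by (rule sum.mono_neutral_cong_left[OF H.finite_Irr]) (use B_Irr B_cases in auto)
    also have "\<dots> = cmult GQ (char_res Q \<chi>) l"
      using H.cmult_res_decomp[OF sQH CH, of l] l' char_res_res[OF QsH] by simp
    also have "\<dots> = cmult GN (char_res N \<chi>) \<theta>"
    proof (rule Q.cmult_eqI[OF CQ l'])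
      have "char_res Q \<chi> = char_res Q (char_res N \<chi>)" by (rule char_res_res[OF QsN, symmetric])
      also have "\<dots> = (\<lambda>x. of_nat (cmult GN (char_res N \<chi>) \<theta>) * char_res Q \<theta> x)"
        by (subst A_res[OF \<chi>]) (auto simp: char_res_def fun_eq_iff)
      finally show "char_inner GQ (char_res Q \<chi>) l = of_nat (cmult GN (char_res N \<chi>) \<theta>)"
        using mult_one by (simp add: char_inner_scale)
    qed
    finally show ?thesis using A_degree[OF \<chi>] by simp
  qed
  have col: "(\<Sum>\<chi>\<in>A. cmult GH (char_res H \<chi>) \<psi> * char_degree G \<chi>) = char_degree GN \<theta> * char_degree GH \<psi>"
    if \<psi>: "\<psi> \<in> B" for \<psi>
  proof -
    have \<psi>I: "\<psi> \<in> Irr GH" using \<psi> by (simp add: B_def)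
    have C: "char_res Q \<psi> \<in> Chars GQ" using H.Chars_res[OF sQH H.Irr_Chars[OF \<psi>I]] by simp
    have hom: "char_res Q \<psi> = (\<lambda>x. of_nat (char_degree GH \<psi>) * l x)"
    proof -
      have "\<forall>z\<in>Q. \<psi> z = \<psi> \<one> * l z"
        using H.homogeneous_iff(1)[OF sQH _ H.Irr_Chars[OF \<psi>I], of l] l B_cases(1)[OF \<psi>I \<psi>] by simp
      then show ?thesis using H.Chars_one(1)[OF H.Irr_Chars[OF \<psi>I]] Q.LinD(1)[OF l] by (auto simp: char_res_def fun_eq_iff)
    qed
    have "of_nat (\<Sum>\<chi>\<in>Irr G. cmult GH (char_res H \<chi>) \<psi> * cmult GN (char_res N \<chi>) \<theta>)
        = char_inner GQ (char_res Q \<psi>) (char_res Q \<theta>)"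
      using mackey_sum[OF sN sH NH \<psi>I \<theta>] Q_eq by simp
    also have "\<dots> = of_nat (char_degree GH \<psi>) * char_inner GQ l (char_res Q \<theta>)"
      unfolding hom by (rule char_inner_scale)
    also have "char_inner GQ l (char_res Q \<theta>) = 1" using mult_one char_inner_cnj[of GQ l "char_res Q \<theta>"] by simp
    finally have "(\<Sum>\<chi>\<in>Irr G. cmult GH (char_res H \<chi>) \<psi> * cmult GN (char_res N \<chi>) \<theta>) = char_degree GH \<psi>"
      using of_nat_eq_iff by fastforce
    moreover have "(\<Sum>\<chi>\<in>A. cmult GH (char_res H \<chi>) \<psi> * char_degree G \<chi>)
       = (\<Sum>\<chi>\<in>Irr G. char_degree GN \<theta> * (cmult GH (char_res H \<chi>) \<psi> * cmult GN (char_res N \<chi>) \<theta>))"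
      by (rule sum.mono_neutral_cong_left[OF finite_Irr]) (auto simp: A_degree, auto simp: A_def)
    ultimately show ?thesis by (simp flip: sum_distrib_left)
  qed
  show ?thesis
    by (rule weighted_permutation_matrix[where A = A and B = B and a = "\<lambda>\<chi> \<psi>. cmult GH (char_res H \<chi>) \<psi>"
        and d = "char_degree G" and e = "char_degree GH" and w = "\<lambda>_. char_degree GN \<theta>" and w' = "\<lambda>_. char_degree GN \<theta>", OF fA fB])
      (use row col that Chars_one(2)[OF Irr_Chars] H.Chars_one(2)[OF H.Irr_Chars] N.Chars_one(2)[OF N.Irr_Chars[OF \<theta>]]
        in \<open>auto simp: A_def B_def\<close>)
qed

lemma l_inv': "g \<in> carrier GH \<Longrightarrow> conj_char GH Q g l = l"
  using l_inv conj_char_subgroup[OF sH] by simp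

lemma Char_over_A:
  "\<xi> \<in> Char_over G N \<theta> \<longleftrightarrow> \<xi> \<in> Chars G \<and> (\<forall>\<chi>\<in>Irr G. cmult G \<xi> \<chi> \<noteq> 0 \<longrightarrow> \<chi> \<in> A)"
  using Char_over_iff[OF N \<theta> \<theta>_inv, of \<xi>] by (auto simp: A_def)

lemma Char_over_B:
  "\<eta> \<in> Char_over GH Q l \<longleftrightarrow> \<eta> \<in> Chars GH \<and> (\<forall>\<psi>\<in>Irr GH. cmult GH \<eta> \<psi> \<noteq> 0 \<longrightarrow> \<psi> \<in> B)"
proof -
  have "l \<in> Irr (GH\<lparr>carrier := Q\<rparr>)" using Q.Lin_Irr[OF l] by simp
  from H.Char_over_iff[OF QH this l_inv'] show ?thesis by (auto simp: B_def)
qed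

context
  fixes f
  assumes f: "bij_betw f A B" "\<And>\<chi> \<psi>. \<chi> \<in> A \<Longrightarrow> \<psi> \<in> B \<Longrightarrow> cmult GH (char_res H \<chi>) \<psi> = (if \<psi> = f \<chi> then 1 else 0)"
begin

lemma fB: "\<chi> \<in> A \<Longrightarrow> f \<chi> \<in> B" using f(1) bij_betwE by blast

text \<open>Among the constituents over \<open>l\<close> of the restriction to \<open>H\<close> only
  \<open>f \<chi>\<close> remains, with multiplicity one. Hence the chosen bijection agrees with the
  explicit average and can be eliminated from the final statements.\<close>

lemma slice_A: assumes \<chi>: "\<chi> \<in> A" shows "slice \<chi> = f \<chi>"
proof
  fix g
  have finB: "finite B" using finite_subset[OF _ H.finite_Irr] B_Irr by blast
  have "slice \<chi> g = (\<Sum>\<psi>\<in>B. of_nat (cmult GH (char_res H \<chi>) \<psi>) * \<psi> g)"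
    using slice_H[OF Chars_res[OF sH Irr_Chars[OF A_Irr[OF \<chi>]]]] by (simp add: slice_res)
  also have "\<dots> = (\<Sum>\<psi>\<in>B. if \<psi> = f \<chi> then \<psi> g else 0)" by (rule sum.cong) (auto simp: f(2)[OF \<chi>])
  also have "\<dots> = f \<chi> g" using finB fB[OF \<chi>] by simp
  finally show "slice \<chi> g = f \<chi> g" .
qed

lemma slice_Char_over:
  assumes \<xi>: "\<xi> \<in> Char_over G N \<theta>"
  shows "slice \<xi> = (\<lambda>g. \<Sum>\<chi>\<in>A. of_nat (cmult G \<xi> \<chi>) * f \<chi> g)"
proof
  fix g
  have C: "\<xi> \<in> Chars G" using \<xi> Char_over_A by blast
  have "\<xi> = (\<lambda>g. \<Sum>\<chi>\<in>Irr G. of_nat (cmult G \<xi> \<chi>) * \<chi> g)" using decomp[OF C] by blast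
  then have "slice \<xi> g = slice (\<lambda>g. \<Sum>\<chi>\<in>Irr G. of_nat (cmult G \<xi> \<chi>) * \<chi> g) g" by (rule arg_cong[where f = "\<lambda>x. slice x g"])
  also have "\<dots> = (\<Sum>\<chi>\<in>Irr G. of_nat (cmult G \<xi> \<chi>) * slice \<chi> g)" by (simp add: slice_sum)
  also have "\<dots> = (\<Sum>\<chi>\<in>A. of_nat (cmult G \<xi> \<chi>) * f \<chi> g)"
  proof (rule sum.mono_neutral_cong_right[OF finite_Irr])
    show "A \<subseteq> Irr G" using A_Irr by blast
    show "\<forall>\<chi>\<in>Irr G - A. of_nat (cmult G \<xi> \<chi>) * slice \<chi> g = 0" using \<xi> Char_over_A by auto
  qed (simp add: slice_A)
  finally show "slice \<xi> g = (\<Sum>\<chi>\<in>A. of_nat (cmult G \<xi> \<chi>) * f \<chi> g)" .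
qed

lemma f_inner: "\<chi> \<in> A \<Longrightarrow> \<chi>' \<in> A \<Longrightarrow> char_inner GH (f \<chi>) (f \<chi>') = (if \<chi> = \<chi>' then 1 else 0)"
  using H.char_inner_Irr[OF B_Irr[OF fB] B_Irr[OF fB], of \<chi> \<chi>'] f(1) by (auto simp: bij_betw_def dest: inj_onD)

lemma slice_inner_f:
  assumes \<xi>: "\<xi> \<in> Char_over G N \<theta>" and \<chi>: "\<chi> \<in> A"
  shows "char_inner GH (slice \<xi>) (f \<chi>) = of_nat (cmult G \<xi> \<chi>)"
proof -
  have finA: "finite A" using finite_subset[OF _ finite_Irr] A_Irr by blast
  have "char_inner GH (slice \<xi>) (f \<chi>) = (\<Sum>\<chi>'\<in>A. of_nat (cmult G \<xi> \<chi>') * char_inner GH (f \<chi>') (f \<chi>))"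
    unfolding slice_Char_over[OF \<xi>] by (simp add: char_inner_sum char_inner_scale)
  also have "\<dots> = (\<Sum>\<chi>'\<in>A. if \<chi>' = \<chi> then of_nat (cmult G \<xi> \<chi>') else 0)"
    by (rule sum.cong) (auto simp: f_inner \<chi>)
  finally show ?thesis using finA \<chi> by simp
qed

lemma slice_inner:
  assumes \<xi>: "\<xi> \<in> Char_over G N \<theta>" and \<zeta>: "\<zeta> \<in> Char_over G N \<theta>"
  shows "char_inner G \<xi> \<zeta> = char_inner GH (slice \<xi>) (slice \<zeta>)"
proof -
  have finA: "finite A" using finite_subset[OF _ finite_Irr] A_Irr by blast
  have C: "\<xi> \<in> Chars G" "\<zeta> \<in> Chars G" using \<xi> \<zeta> Char_over_A by blast+
  have "char_inner G \<xi> \<zeta> = of_nat (\<Sum>\<chi>\<in>Irr G. cmult G \<xi> \<chi> * cmult G \<zeta> \<chi>)" by (rule inner_cmult[OF C])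
  also have "(\<Sum>\<chi>\<in>Irr G. cmult G \<xi> \<chi> * cmult G \<zeta> \<chi>) = (\<Sum>\<chi>\<in>A. cmult G \<xi> \<chi> * cmult G \<zeta> \<chi>)"
  proof (rule sum.mono_neutral_right[OF finite_Irr])
    show "A \<subseteq> Irr G" using A_Irr by blast
    show "\<forall>\<chi>\<in>Irr G - A. cmult G \<xi> \<chi> * cmult G \<zeta> \<chi> = 0" using \<xi> Char_over_A by auto
  qed
  also have "of_nat \<dots> = (\<Sum>\<chi>\<in>A. of_nat (cmult G \<xi> \<chi>) * char_inner GH (f \<chi>) (slice \<zeta>))"
  proof -
    have "char_inner GH (f \<chi>) (slice \<zeta>) = of_nat (cmult G \<zeta> \<chi>)" if "\<chi> \<in> A" for \<chi>
      using slice_inner_f[OF \<zeta> that] char_inner_cnj[of GH "f \<chi>" "slice \<zeta>"] by simp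
    then show ?thesis by simp
  qed
  also have "\<dots> = char_inner GH (slice \<xi>) (slice \<zeta>)"
    unfolding slice_Char_over[OF \<xi>] by (simp add: char_inner_sum char_inner_scale)
  finally show ?thesis .
qed

lemma slice_mem:
  assumes \<xi>: "\<xi> \<in> Char_over G N \<theta>"
  shows "slice \<xi> \<in> Char_over GH Q l"
proof -
  have finB: "finite B" using finite_subset[OF _ H.finite_Irr] B_Irr by blast
  have C: "\<xi> \<in> Chars G" using \<xi> Char_over_A by blast
  have CH: "char_res H \<xi> \<in> Chars GH" by (rule Chars_res[OF sH C])
  obtain \<chi> where \<chi>: "\<chi> \<in> Irr G" "cmult G \<xi> \<chi> \<noteq> 0" by (rule ex_constituent[OF C])
  have \<chi>A: "\<chi> \<in> A" using \<chi> \<xi> Char_over_A by blast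
  \<comment> \<open>A combination of irreducible characters is a character only if it is nonzero;
    one constituent of \<xi> provides the required positive coefficient.\<close>
  have nz: "cmult GH (char_res H \<xi>) (f \<chi>) \<noteq> 0"
    by (rule constituent_trans[OF sH C \<chi>(1) B_Irr[OF fB[OF \<chi>A]] \<chi>(2)]) (use f(2)[OF \<chi>A fB[OF \<chi>A]] in simp)
  have eq: "slice \<xi> = (\<lambda>g. \<Sum>\<psi>\<in>B. of_nat (cmult GH (char_res H \<xi>) \<psi>) * \<psi> g)"
    using slice_H[OF CH] by (simp add: slice_res)
  have "(\<lambda>g. \<Sum>\<psi>\<in>B. of_nat (cmult GH (char_res H \<xi>) \<psi>) * \<psi> g) \<in> Chars GH"
    by (rule H.Chars_combination[OF finB _ fB[OF \<chi>A]]) (use nz B_Irr in auto)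
  then have S: "slice \<xi> \<in> Chars GH" using eq by argo
  moreover have "char_res Q (slice \<xi>) = (\<lambda>x. of_nat (char_degree GH (slice \<xi>)) * l x)"
  proof
    fix q
    show "char_res Q (slice \<xi>) q = of_nat (char_degree GH (slice \<xi>)) * l q"
    proof (cases "q \<in> Q")
      case True
      have "\<psi> q = \<psi> \<one> * l q" if \<psi>: "\<psi> \<in> B" for \<psi>
      proof -
        have "\<forall>z\<in>Q. \<psi> z = \<psi> \<one> * l z"
          using H.homogeneous_iff(1)[OF sQH _ H.Irr_Chars[OF B_Irr[OF \<psi>]], of l] l B_cases(1)[OF B_Irr[OF \<psi>] \<psi>] by simp
        then show ?thesis using True by blast
      qed
      then have "slice \<xi> q = slice \<xi> \<one> * l q" unfolding eq sum_distrib_right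
        by (intro sum.cong) (auto simp: mult.assoc)
      also have "slice \<xi> \<one> = of_nat (char_degree GH (slice \<xi>))" using H.Chars_one(1)[OF S] by simp
      finally show ?thesis using True by (simp add: char_res_def)
    qed (simp add: char_res_def Q.LinD(1)[OF l])
  qed
  ultimately show ?thesis unfolding Char_over_def by blast
qed

lemma slice_inj: "inj_on slice (Char_over G N \<theta>)"
proof (rule inj_onI)
  fix \<xi> \<zeta> assume \<xi>: "\<xi> \<in> Char_over G N \<theta>" and \<zeta>: "\<zeta> \<in> Char_over G N \<theta>" and eq: "slice \<xi> = slice \<zeta>"
  have C: "\<xi> \<in> Chars G" "\<zeta> \<in> Chars G" using \<xi> \<zeta> Char_over_A by blast+
  have "cmult G \<xi> \<chi> = cmult G \<zeta> \<chi>" if \<chi>: "\<chi> \<in> Irr G" for \<chi>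
  proof (cases "\<chi> \<in> A")
    case True
    have "(of_nat (cmult G \<xi> \<chi>) :: complex) = of_nat (cmult G \<zeta> \<chi>)"
      using slice_inner_f[OF \<xi> True] slice_inner_f[OF \<zeta> True] eq by simp
    then show ?thesis by simp
  next
    case False
    then have "cmult G \<xi> \<chi> = 0" "cmult G \<zeta> \<chi> = 0" using \<xi> \<zeta> \<chi> Char_over_A by blast+
    then show ?thesis by simp
  qed
  then show "\<xi> = \<zeta>" using decomp[OF C(1)] decomp[OF C(2)] by (simp add: fun_eq_iff)
qed

lemma slice_surj:
  assumes \<eta>: "\<eta> \<in> Char_over GH Q l"
  shows "\<exists>\<xi>\<in>Char_over G N \<theta>. slice \<xi> = \<eta>"
proof
  have finA: "finite A" using finite_subset[OF _ finite_Irr] A_Irr by blast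
  have C: "\<eta> \<in> Chars GH" using \<eta> Char_over_B by blast
  let ?c = "\<lambda>\<chi>. cmult GH \<eta> (f \<chi>)"
  \<comment> \<open>The preimage carries over the multiplicities of \<eta> along the bijection
    \<open>f\<close>.\<close>
  let ?\<xi> = "\<lambda>g. \<Sum>\<chi>\<in>A. of_nat (?c \<chi>) * \<chi> g"
  obtain \<psi> where \<psi>: "\<psi> \<in> Irr GH" "cmult GH \<eta> \<psi> \<noteq> 0" by (rule H.ex_constituent[OF C])
  then have "\<psi> \<in> B" using \<eta> Char_over_B by blast
  then obtain \<chi> where \<chi>: "\<chi> \<in> A" "\<psi> = f \<chi>" using f(1) by (auto simp: bij_betw_def)
  have "?\<xi> \<in> Chars G" by (rule Chars_combination[OF finA _ \<chi>(1)]) (use \<psi>(2) \<chi>(2) A_Irr in auto)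
  moreover have "char_res N ?\<xi> = (\<lambda>x. of_nat (\<Sum>\<chi>\<in>A. ?c \<chi> * cmult GN (char_res N \<chi>) \<theta>) * \<theta> x)"
  proof
    fix x
    have "char_res N ?\<xi> x = (\<Sum>\<chi>\<in>A. of_nat (?c \<chi>) * char_res N \<chi> x)" by (simp add: char_res_def)
    also have "\<dots> = (\<Sum>\<chi>\<in>A. of_nat (?c \<chi>) * (of_nat (cmult GN (char_res N \<chi>) \<theta>) * \<theta> x))"
      by (rule sum.cong[OF refl]) (simp add: fun_cong[OF A_res])
    finally show "char_res N ?\<xi> x = of_nat (\<Sum>\<chi>\<in>A. ?c \<chi> * cmult GN (char_res N \<chi>) \<theta>) * \<theta> x"
      by (simp add: sum_distrib_right mult.assoc)
  qed
  ultimately show "?\<xi> \<in> Char_over G N \<theta>" unfolding Char_over_def by blast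
  show "slice ?\<xi> = \<eta>"
  proof
    fix g
    have "slice ?\<xi> g = (\<Sum>\<chi>\<in>A. of_nat (cmult GH \<eta> (f \<chi>)) * f \<chi> g)" by (simp add: slice_sum slice_A)
    also have "\<dots> = (\<Sum>\<psi>\<in>B. of_nat (cmult GH \<eta> \<psi>) * \<psi> g)"
      by (rule sum.reindex_bij_betw[OF f(1), where g = "\<lambda>\<psi>. of_nat (cmult GH \<eta> \<psi>) * \<psi> g"])
    also have "\<dots> = (\<Sum>\<psi>\<in>Irr GH. of_nat (cmult GH \<eta> \<psi>) * \<psi> g)"
    proof (rule sum.mono_neutral_left[OF H.finite_Irr])
      show "B \<subseteq> Irr GH" using B_Irr by blast
      show "\<forall>\<psi>\<in>Irr GH - B. of_nat (cmult GH \<eta> \<psi>) * \<psi> g = 0" using \<eta> Char_over_B by auto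
    qed
    finally show "slice ?\<xi> g = \<eta> g" using H.decomp[OF C] by simp
  qed
qed

end

lemma slice_bij: "bij_betw slice (Char_over G N \<theta>) (Char_over GH Q l)"
proof -
  obtain f where f: "bij_betw f A B" "\<And>\<chi> \<psi>. \<chi> \<in> A \<Longrightarrow> \<psi> \<in> B \<Longrightarrow> cmult GH (char_res H \<chi>) \<psi> = (if \<psi> = f \<chi> then 1 else 0)"
    by (rule correspondence) (rule that; blast)
  show ?thesis
  proof (rule bij_betw_imageI[OF slice_inj[OF f]])
    show "slice ` Char_over G N \<theta> = Char_over GH Q l"
      using slice_mem[OF f] slice_surj[OF f] by fast
  qed
qed

lemma slice_isometry:
  "\<xi> \<in> Char_over G N \<theta> \<Longrightarrow> \<zeta> \<in> Char_over G N \<theta> \<Longrightarrow> char_inner G \<xi> \<zeta> = char_inner GH (slice \<xi>) (slice \<zeta>)"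
proof -
  assume \<xi>: "\<xi> \<in> Char_over G N \<theta>" "\<zeta> \<in> Char_over G N \<theta>"
  obtain f where f: "bij_betw f A B" "\<And>\<chi> \<psi>. \<chi> \<in> A \<Longrightarrow> \<psi> \<in> B \<Longrightarrow> cmult GH (char_res H \<chi>) \<psi> = (if \<psi> = f \<chi> then 1 else 0)"
    by (rule correspondence) (rule that; blast)
  show "char_inner G \<xi> \<zeta> = char_inner GH (slice \<xi>) (slice \<zeta>)" by (rule slice_inner[OF f \<xi>])
qed

end

lemma r_coset_carrier_update: "N #>\<^bsub>G\<lparr>carrier := X\<rparr>\<^esub> x = N #>\<^bsub>G\<^esub> x"
  by (simp add: r_coset_def)

lemma set_mult_carrier_update: "A <#>\<^bsub>G\<lparr>carrier := X\<rparr>\<^esub> B = A <#>\<^bsub>G\<^esub> B"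
  by (simp add: set_mult_def)

section \<open>The isomorphism of quotients and the maps between characters\<close>

context self_normalizing_in_normal begin

text \<open>Intersecting with \<open>H\<close> inverts the map from \<open>Q #> h\<close> to
  \<open>N #> h\<close>. It therefore serves as an explicit \<tau>, whose values are obtained
  without choosing representatives.\<close>

lemma coset_Int_H:
  assumes h: "h \<in> H" shows "(N #> h) \<inter> H = Q #> h"
proof
  have hc: "h \<in> carrier G" using subgroup.mem_carrier[OF sH h] .
  show "(N #> h) \<inter> H \<subseteq> Q #> h"
  proof
    fix y assume y: "y \<in> (N #> h) \<inter> H"
    then obtain n where n: "n \<in> N" "y = n \<otimes> h" by (auto simp: r_coset_def)
    have nc: "n \<in> carrier G" using subgroup.mem_carrier[OF sN n(1)] .
    have "y \<otimes> inv h \<in> H" using y subgroup.m_closed[OF sH _ subgroup.m_inv_closed[OF sH h]] by blast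
    moreover have "y \<otimes> inv h = n" using n(2) nc hc by (simp add: m_assoc)
    ultimately have "n \<in> Q" using n(1) N_H by auto
    then show "y \<in> Q #> h" using n(2) by (auto simp: r_coset_def)
  qed
  show "Q #> h \<subseteq> (N #> h) \<inter> H"
    using QN QH subgroup.m_closed[OF sH _ h] by (auto simp: r_coset_def)
qed

lemma coset_eq_iff:
  assumes h: "h \<in> H" "h' \<in> H" shows "Q #> h = Q #> h' \<longleftrightarrow> N #> h = N #> h'"
proof
  have hc: "h \<in> carrier G" "h' \<in> carrier G" using subgroup.mem_carrier[OF sH] h by auto
  assume "Q #> h = Q #> h'"
  then have "h' \<in> Q #> h" using rcos_self[OF hc(2) sQ] by blast
  then have "h' \<in> N #> h" using QN by (auto simp: r_coset_def)
  then show "N #> h = N #> h'" by (rule repr_independence[OF _ hc(1) sN])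
next
  assume "N #> h = N #> h'"
  then show "Q #> h = Q #> h'" using coset_Int_H[OF h(1)] coset_Int_H[OF h(2)] by simp
qed

context
  fixes \<theta> assumes \<theta>: "\<theta> \<in> Irr_p' p (G\<lparr>carrier := N\<rparr>)"
begin

abbreviation T :: "'a set" where "T \<equiv> stabilizer G (conj_char G N) \<theta>"

lemma \<theta>_outside: "y \<notin> N \<Longrightarrow> \<theta> y = 0" using Chars_outside[OF Irr_p'_res(2)[OF \<theta>]] by simp

lemma sT: "subgroup T G" by (rule stabilizer_conj_char(1)[OF N \<theta>_outside])

lemma T_inv: "g \<in> T \<Longrightarrow> conj_char G N g \<theta> = \<theta>" by (simp add: stabilizer_def)

lemma NT: "N \<subseteq> T"
proof
  fix n assume n: "n \<in> N"
  have "char_res N \<theta> = \<theta>" using \<theta>_outside by (auto simp: char_res_def)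
  then have "conj_char G N n \<theta> = \<theta>"
    using conj_char_res_Chars[OF sN subset_refl n subgroup_normalizes[OF sN n] Irr_p'_res(2)[OF \<theta>]] by simp
  then show "n \<in> T" using subgroup.mem_carrier[OF sN n] by (simp add: stabilizer_def)
qed

text \<open>Since \<open>star\<close> is equivariant and injective, an element of \<open>H\<close>
  fixes \<open>star \<theta>\<close> exactly when it fixes \<theta>.\<close>

lemma stabilizer_star:
  "stabilizer (G\<lparr>carrier := H\<rparr>) (conj_char G Q) (star \<theta>) = T \<inter> H"
proof -
  have "conj_char G Q g (star \<theta>) = star \<theta> \<longleftrightarrow> conj_char G N g \<theta> = \<theta>" if g: "g \<in> H" for g
  proof -
    have gc: "g \<in> carrier G" using subgroup.mem_carrier[OF sH g] .
    have "star (conj_char G N g \<theta>) = star \<theta> \<longleftrightarrow> conj_char G N g \<theta> = \<theta>"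
      using bij_betw_imp_inj_on[OF star_bij] conj_Irr_p'[OF \<theta> gc] \<theta> by (auto dest: inj_onD)
    then show ?thesis using star_conj[OF \<theta> g] by simp
  qed
  then show ?thesis using subgroup.subset[OF sH] by (auto simp: stabilizer_def)
qed

lemma triple_pair:
  assumes X: "subgroup X G" "N \<subseteq> X" "X \<subseteq> T"
  shows "triple_pair (G\<lparr>carrier := X\<rparr>) N (X \<inter> H) Q \<theta> (star \<theta>)"
proof -
  interpret X: finite_group "G\<lparr>carrier := X\<rparr>" by (rule subgroup_finite_group[OF X(1)])
  show ?thesis
  proof (intro triple_pair.intro triple_pair_axioms.intro X.finite_group_axioms)
    show "N \<lhd> G\<lparr>carrier := X\<rparr>" by (rule normal_restrict_supergroup[OF X(1) N X(2)])
    show "subgroup (X \<inter> H) (G\<lparr>carrier := X\<rparr>)"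
      by (rule subgroup_incl[OF subgroups_Inter_pair[OF X(1) sH] X(1)]) simp
    show "\<exists>n\<in>N. \<exists>h\<in>X \<inter> H. g = n \<otimes>\<^bsub>G\<lparr>carrier := X\<rparr>\<^esub> h" if "g \<in> carrier (G\<lparr>carrier := X\<rparr>)" for g
      using frattini_between[OF X(1,2)] that by simp
    show "N \<inter> (X \<inter> H) = Q" using N_H X(2) by blast
    show "\<theta> \<in> Irr (G\<lparr>carrier := X\<rparr>\<lparr>carrier := N\<rparr>)" using Irr_p'_res(1)[OF \<theta>] by simp
    show "conj_char (G\<lparr>carrier := X\<rparr>) N g \<theta> = \<theta>" if "g \<in> carrier (G\<lparr>carrier := X\<rparr>)" for g
      using conj_char_subgroup[OF X(1), of g N] T_inv[of g] X(3) that by auto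
    show "star \<theta> \<in> Lin (G\<lparr>carrier := X\<rparr>\<lparr>carrier := Q\<rparr>)" using star_Lin[OF \<theta>] by simp
    show "conj_char (G\<lparr>carrier := X\<rparr>) Q h (star \<theta>) = star \<theta>" if h: "h \<in> X \<inter> H" for h
      using conj_char_subgroup[OF X(1), of h Q] star_conj[OF \<theta>, of h] T_inv[of h] X(3) h by auto
    show "char_inner (G\<lparr>carrier := X\<rparr>\<lparr>carrier := Q\<rparr>) (char_res Q \<theta>) (star \<theta>) = 1"
      using star_inner[OF \<theta> star_Lin[OF \<theta>]] by simp
  qed
qed

abbreviation \<Gamma> where "\<Gamma> \<equiv> T \<inter> H"

lemma carrier_quotient: "carrier (G\<lparr>carrier := T\<rparr> Mod N) = (\<lambda>h. N #> h) ` \<Gamma>"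
proof -
  have "N #> x \<in> (\<lambda>h. N #> h) ` \<Gamma>" if x: "x \<in> T" for x
  proof -
    obtain n h where nh: "n \<in> N" "h \<in> \<Gamma>" "x = n \<otimes> h" using frattini_between[OF sT NT x] by blast
    have "x \<in> N #> h" using nh by (auto simp: r_coset_def)
    then have "N #> h = N #> x" by (rule repr_independence[OF _ _ sN]) (use nh(2) subgroup.mem_carrier[OF sH] in auto)
    then show ?thesis using nh(2) by blast
  qed
  then show ?thesis by (auto simp: carrier_FactGroup r_coset_carrier_update)
qed

lemma quotient_iso: "(\<lambda>C. C \<inter> H) \<in> iso (G\<lparr>carrier := T\<rparr> Mod N) (G\<lparr>carrier := \<Gamma>\<rparr> Mod Q)"
  unfolding iso_def
proof (intro CollectI conjI)
  have c: "carrier (G\<lparr>carrier := \<Gamma>\<rparr> Mod Q) = (\<lambda>h. Q #> h) ` \<Gamma>"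
    by (simp add: carrier_FactGroup r_coset_carrier_update)
  show "bij_betw (\<lambda>C. C \<inter> H) (carrier (G\<lparr>carrier := T\<rparr> Mod N)) (carrier (G\<lparr>carrier := \<Gamma>\<rparr> Mod Q))"
    unfolding c carrier_quotient
  proof (rule bij_betw_imageI)
    show "inj_on (\<lambda>C. C \<inter> H) ((\<lambda>h. N #> h) ` \<Gamma>)"
      by (auto simp: inj_on_def coset_Int_H coset_eq_iff)
    show "(\<lambda>C. C \<inter> H) ` (\<lambda>h. N #> h) ` \<Gamma> = (\<lambda>h. Q #> h) ` \<Gamma>"
      unfolding image_image by (rule image_cong) (auto simp: coset_Int_H)
  qed
  show "(\<lambda>C. C \<inter> H) \<in> hom (G\<lparr>carrier := T\<rparr> Mod N) (G\<lparr>carrier := \<Gamma>\<rparr> Mod Q)"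
  proof (rule homI)
    show "C \<inter> H \<in> carrier (G\<lparr>carrier := \<Gamma>\<rparr> Mod Q)" if "C \<in> carrier (G\<lparr>carrier := T\<rparr> Mod N)" for C
      using that unfolding c carrier_quotient by (auto simp: coset_Int_H)
    fix C D assume "C \<in> carrier (G\<lparr>carrier := T\<rparr> Mod N)" "D \<in> carrier (G\<lparr>carrier := T\<rparr> Mod N)"
    then obtain h k where hk: "h \<in> \<Gamma>" "k \<in> \<Gamma>" "C = N #> h" "D = N #> k" unfolding carrier_quotient by blast
    have k': "h \<otimes> k \<in> H" using hk subgroup.m_closed[OF sH] by blast
    have "Q \<lhd> G\<lparr>carrier := H\<rparr>" by (rule normal_Q[OF sH QH subset_refl])
    then have "(Q #> h) <#> (Q #> k) = Q #> (h \<otimes> k)"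
      using normal.rcos_sum[of Q "G\<lparr>carrier := H\<rparr>" h k] hk by (simp add: r_coset_carrier_update set_mult_carrier_update)
    moreover have "(N #> h) <#> (N #> k) = N #> (h \<otimes> k)"
      using normal.rcos_sum[OF N] subgroup.mem_carrier[OF sH] hk by simp
    ultimately show "(C \<otimes>\<^bsub>G\<lparr>carrier := T\<rparr> Mod N\<^esub> D) \<inter> H = (C \<inter> H) \<otimes>\<^bsub>G\<lparr>carrier := \<Gamma>\<rparr> Mod Q\<^esub> (D \<inter> H)"
      using hk k' by (simp add: FactGroup_def set_mult_carrier_update coset_Int_H)
  qed
qed

lemma image_subgroup_eq:
  assumes X: "subgroup X G" "N \<subseteq> X"
  shows "image_subgroup (G\<lparr>carrier := T\<rparr>) N (\<lambda>C. C \<inter> H) X = X \<inter> H"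
proof -
  have "N #> x \<subseteq> X" if "x \<in> X" for x using subgroup.m_closed[OF X(1) _ that] X(2) by (auto simp: r_coset_def)
  moreover have "x \<in> N #> x" if "x \<in> X" for x by (rule rcos_self[OF subgroup.mem_carrier[OF X(1) that] sN])
  ultimately have "(\<Union>x\<in>X. N #> x) = X" by blast
  then show ?thesis by (auto simp: image_subgroup_def carrier_FactGroup r_coset_carrier_update)
qed

lemma char_triples:
  "char_triple (G\<lparr>carrier := T\<rparr>) N \<theta>" "char_triple (G\<lparr>carrier := \<Gamma>\<rparr>) Q (star \<theta>)"
proof -
  interpret TT: triple_pair "G\<lparr>carrier := T\<rparr>" N \<Gamma> Q \<theta> "star \<theta>" by (rule triple_pair[OF sT NT subset_refl])
  show "char_triple (G\<lparr>carrier := T\<rparr>) N \<theta>"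
    unfolding char_triple_def using TT.is_group TT.fin TT.N TT.\<theta> TT.\<theta>_inv by blast
  show "char_triple (G\<lparr>carrier := \<Gamma>\<rparr>) Q (star \<theta>)"
    unfolding char_triple_def using TT.H.is_group TT.H.fin TT.QH TT.Q.Lin_Irr[OF TT.l] TT.l_inv' by simp
qed

text \<open>The formula of \<open>slice\<close> for \<open>X\<close>, with \<open>X\<close> as an
  argument. The averaging group \<open>Q\<close> is the same for all \<open>X\<close>, which makes
  the maps for different \<open>X\<close> compatible.\<close>

definition triple_map :: "'a set \<Rightarrow> ('a \<Rightarrow> complex) \<Rightarrow> 'a \<Rightarrow> complex" where
  "triple_map X \<chi> = (\<lambda>g. if g \<in> X \<inter> H then (\<Sum>q\<in>Q. \<chi> (g \<otimes> q) * cnj (star \<theta> q)) / of_nat (card Q) else 0)"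

lemma triple_map_slice:
  assumes X: "subgroup X G" "N \<subseteq> X" "X \<subseteq> T"
  shows "triple_pair.slice (G\<lparr>carrier := X\<rparr>) (X \<inter> H) Q (star \<theta>) = triple_map X"
  using triple_pair.slice_def[OF triple_pair[OF X]] by (auto simp: triple_map_def fun_eq_iff)

lemma triple_map_add: "triple_map X (\<lambda>x. \<chi> x + \<psi> x) = (\<lambda>y. triple_map X \<chi> y + triple_map X \<psi> y)"
  by (auto simp: triple_map_def distrib_right sum.distrib add_divide_distrib fun_eq_iff)

lemma triple_map_res:
  assumes Y: "subgroup Y G" "N \<subseteq> Y" "Y \<subseteq> X"
  shows "triple_map Y (char_res Y \<chi>) = char_res (Y \<inter> H) (triple_map X \<chi>)"
proof
  fix g
  have "(\<Sum>q\<in>Q. char_res Y \<chi> (g \<otimes> q) * cnj (star \<theta> q)) = (\<Sum>q\<in>Q. \<chi> (g \<otimes> q) * cnj (star \<theta> q))" if "g \<in> Y"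
    using subgroup.m_closed[OF Y(1) that] Y(2) QN by (intro sum.cong) (auto simp: char_res_def)
  then show "triple_map Y (char_res Y \<chi>) g = char_res (Y \<inter> H) (triple_map X \<chi>) g"
    using Y(3) by (auto simp: triple_map_def char_res_def)
qed

text \<open>All elements \<open>y \<otimes> q\<close> with \<open>q\<close> in \<open>Q\<close> lie
  in the coset \<open>N #> y\<close>, so the inflated factor is constant along the average and comes
  out of the sum.\<close>

lemma triple_map_times:
  assumes X: "subgroup X G" "N \<subseteq> X" "X \<subseteq> T"
  shows "triple_map X (\<lambda>x. \<chi> x * inflate (G\<lparr>carrier := X\<rparr>) N \<beta> x) =
    (\<lambda>y. triple_map X \<chi> y * inflate (G\<lparr>carrier := X \<inter> H\<rparr>) Q
       (\<beta> \<circ> inv_into (carrier (G\<lparr>carrier := T\<rparr> Mod N)) (\<lambda>C. C \<inter> H)) y)"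
proof
  fix y
  let ?i = "inv_into (carrier (G\<lparr>carrier := T\<rparr> Mod N)) (\<lambda>C. C \<inter> H)"
  show "triple_map X (\<lambda>x. \<chi> x * inflate (G\<lparr>carrier := X\<rparr>) N \<beta> x) y =
    triple_map X \<chi> y * inflate (G\<lparr>carrier := X \<inter> H\<rparr>) Q (\<beta> \<circ> ?i) y"
  proof (cases "y \<in> X \<inter> H")
    case True
    have yc: "y \<in> carrier G" using True subgroup.mem_carrier[OF sH] by blast
    have yq: "inflate (G\<lparr>carrier := X\<rparr>) N \<beta> (y \<otimes> q) = \<beta> (N #> y)" if q: "q \<in> Q" for q
    proof -
      have qc: "q \<in> carrier G" using subgroup.mem_carrier[OF sQ q] .
      have "y \<otimes> q \<in> X" using subgroup.m_closed[OF X(1)] True q QN X(2) by blast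
      moreover have "N #> y = N #> (y \<otimes> q)"
      proof (rule repr_independence[OF _ yc sN])
        have "y \<otimes> q \<otimes> inv y \<in> N" using normal.inv_op_closed2[OF N yc] q QN by blast
        moreover have "y \<otimes> q = y \<otimes> q \<otimes> inv y \<otimes> y" using yc qc by (simp add: m_assoc)
        ultimately show "y \<otimes> q \<in> N #> y" by (auto simp: r_coset_def)
      qed
      ultimately show ?thesis by (simp add: inflate_def r_coset_carrier_update)
    qed
    have "N #> y \<in> carrier (G\<lparr>carrier := T\<rparr> Mod N)" unfolding carrier_quotient using True X(3) by blast
    then have "?i ((N #> y) \<inter> H) = N #> y"
      using quotient_iso by (intro inv_into_f_f) (simp_all add: iso_def bij_betw_def)
    then have "?i (Q #> y) = N #> y" using coset_Int_H[of y] True by simp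
    then have "inflate (G\<lparr>carrier := X \<inter> H\<rparr>) Q (\<beta> \<circ> ?i) y = \<beta> (N #> y)"
      using True by (simp add: inflate_def r_coset_carrier_update)
    moreover have "(\<Sum>q\<in>Q. \<chi> (y \<otimes> q) * inflate (G\<lparr>carrier := X\<rparr>) N \<beta> (y \<otimes> q) * cnj (star \<theta> q))
      = (\<Sum>q\<in>Q. \<chi> (y \<otimes> q) * cnj (star \<theta> q)) * \<beta> (N #> y)"
      by (simp add: yq sum_distrib_left mult_ac)
    ultimately show ?thesis using True by (simp add: triple_map_def)
  qed (auto simp: triple_map_def)
qed

theorem triples_isomorphic:
  "char_triples_isomorphic (G\<lparr>carrier := T\<rparr>) N \<theta>
     (G\<lparr>carrier := stabilizer (G\<lparr>carrier := H\<rparr>) (conj_char G Q) (star \<theta>)\<rparr>) Q (star \<theta>)"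
proof -
  have "char_triple_iso (G\<lparr>carrier := T\<rparr>) N \<theta> (G\<lparr>carrier := \<Gamma>\<rparr>) Q (star \<theta>) (\<lambda>C. C \<inter> H) triple_map"
    unfolding char_triple_iso_def Let_def
  proof (intro conjI allI impI ballI quotient_iso)
    fix X assume X': "subgroup X (G\<lparr>carrier := T\<rparr>) \<and> N \<subseteq> X"
    have X: "subgroup X G" "N \<subseteq> X" "X \<subseteq> T"
      using X' incl_subgroup[OF sT] subgroup.subset[of X "G\<lparr>carrier := T\<rparr>"] by auto
    interpret X: triple_pair "G\<lparr>carrier := X\<rparr>" N "X \<inter> H" Q \<theta> "star \<theta>" by (rule triple_pair[OF X])
    note slice = triple_map_slice[OF X]
    note [simp] = image_subgroup_eq[OF X(1,2)]
    show "bij_betw (triple_map X) (Char_over (G\<lparr>carrier := T\<rparr>\<lparr>carrier := X\<rparr>) N \<theta>)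
      (Char_over (G\<lparr>carrier := \<Gamma>\<rparr>\<lparr>carrier := image_subgroup (G\<lparr>carrier := T\<rparr>) N (\<lambda>C. C \<inter> H) X\<rparr>) Q (star \<theta>))"
      using X.slice_bij by (simp add: slice)
    fix \<chi> assume \<chi>: "\<chi> \<in> Char_over (G\<lparr>carrier := T\<rparr>\<lparr>carrier := X\<rparr>) N \<theta>"
    show "triple_map X (\<lambda>x. \<chi> x + \<psi> x) = (\<lambda>y. triple_map X \<chi> y + triple_map X \<psi> y)" for \<psi>
      by (rule triple_map_add)
    show "char_inner (G\<lparr>carrier := T\<rparr>\<lparr>carrier := X\<rparr>) \<chi> \<psi> =
      char_inner (G\<lparr>carrier := \<Gamma>\<rparr>\<lparr>carrier := image_subgroup (G\<lparr>carrier := T\<rparr>) N (\<lambda>C. C \<inter> H) X\<rparr>) (triple_map X \<chi>) (triple_map X \<psi>)"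
      if "\<psi> \<in> Char_over (G\<lparr>carrier := T\<rparr>\<lparr>carrier := X\<rparr>) N \<theta>" for \<psi>
      using X.slice_isometry[of \<chi> \<psi>] \<chi> that by (simp add: slice)
    show "triple_map X (\<lambda>x. \<chi> x * inflate (G\<lparr>carrier := T\<rparr>\<lparr>carrier := X\<rparr>) N \<beta> x) = (\<lambda>y. triple_map X \<chi> y *
        inflate (G\<lparr>carrier := \<Gamma>\<rparr>\<lparr>carrier := image_subgroup (G\<lparr>carrier := T\<rparr>) N (\<lambda>C. C \<inter> H) X\<rparr>) Q
          (\<beta> \<circ> inv_into (carrier (G\<lparr>carrier := T\<rparr> Mod N)) (\<lambda>C. C \<inter> H)) y)" for \<beta>
      using triple_map_times[OF X, of \<chi> \<beta>] by simp
    fix Y assume Y': "subgroup Y (G\<lparr>carrier := T\<rparr>) \<and> N \<subseteq> Y \<and> Y \<subseteq> X"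
    then have Y: "subgroup Y G" "N \<subseteq> Y" "Y \<subseteq> X" using incl_subgroup[OF sT] by auto
    show "triple_map Y (char_res Y \<chi>) = char_res (image_subgroup (G\<lparr>carrier := T\<rparr>) N (\<lambda>C. C \<inter> H) Y) (triple_map X \<chi>)"
      unfolding image_subgroup_eq[OF Y(1,2)] by (rule triple_map_res[OF Y])
  qed
  then show ?thesis unfolding char_triples_isomorphic_def stabilizer_star using char_triples by blast
qed

end

end

section \<open>The bijection modulo the derived subgroup\<close>

context finite_group begin

lemma inflate_irreducible:
  assumes D: "D \<lhd> G" and \<rho>: "irreducible_rep (G Mod D) n \<rho>"
  shows "irreducible_rep G n (\<lambda>g. \<rho> (D #> g))" "inflate G D (rep_char (G Mod D) n \<rho>) = rep_char G n (\<lambda>g. \<rho> (D #> g))"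
proof -
  interpret F: group "G Mod D" by (rule normal.factorgroup_is_group[OF D])
  have c: "g \<in> carrier G \<Longrightarrow> D #> g \<in> carrier (G Mod D)" for g by (simp add: carrier_FactGroup)
  show "inflate G D (rep_char (G Mod D) n \<rho>) = rep_char G n (\<lambda>g. \<rho> (D #> g))"
    using c by (auto simp: inflate_def rep_char_def fun_eq_iff)
  have rep: "is_rep (G Mod D) n \<rho>" using \<rho> by (simp add: irreducible_rep_def)
  have "D #> \<one> = \<one>\<^bsub>G Mod D\<^esub>"
    using normal_imp_subgroup[OF D] subgroup.subset by (auto simp: FactGroup_def intro!: coset_mult_one)
  moreover have "\<rho> (D #> (g \<otimes> h)) = \<rho> (D #> g) * \<rho> (D #> h)" if "g \<in> carrier G" "h \<in> carrier G" for g h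
    using F.is_repD(3)[OF rep c[OF that(1)] c[OF that(2)]] normal.rcos_sum[OF D that] by simp
  ultimately have "is_rep G n (\<lambda>g. \<rho> (D #> g))"
    using F.is_repD(1,2,4)[OF rep] c by (intro is_repI) simp_all
  moreover have "(\<forall>g\<in>carrier G. \<forall>w\<in>W. \<rho> (D #> g) *\<^sub>v w \<in> W) \<longleftrightarrow> (\<forall>g\<in>carrier (G Mod D). \<forall>w\<in>W. \<rho> g *\<^sub>v w \<in> W)" for W
    by (simp add: carrier_FactGroup)
  ultimately show "irreducible_rep G n (\<lambda>g. \<rho> (D #> g))" using \<rho> unfolding irreducible_rep_def by simp
qed

text \<open>Elements of \<open>D\<close> act as the identity matrix, so \<rho> is constant on cosets
  and any representative may be chosen. Invariant subspaces are the same for the group and its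
  quotient.\<close>

lemma deflate_irreducible:
  assumes D: "D \<lhd> G" and \<rho>: "irreducible_rep G n \<rho>" and ker: "in_kernel G D (rep_char G n \<rho>)"
  obtains \<rho>' where "irreducible_rep (G Mod D) n \<rho>'" "inflate G D (rep_char (G Mod D) n \<rho>') = rep_char G n \<rho>"
proof -
  interpret F: group "G Mod D" by (rule normal.factorgroup_is_group[OF D])
  have sD: "subgroup D G" by (rule normal_imp_subgroup[OF D])
  have rep: "is_rep G n \<rho>" using \<rho> by (simp add: irreducible_rep_def)
  note R = is_repD[OF rep]
  define \<rho>' where "\<rho>' C = \<rho> (SOME g. g \<in> C)" for C
  have \<rho>': "\<rho>' (D #> g) = \<rho> g" if g: "g \<in> carrier G" for g
  proof -
    have "(SOME h. h \<in> D #> g) \<in> D #> g" using rcos_self[OF g sD] by (rule someI)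
    then obtain d where d: "d \<in> D" "(SOME h. h \<in> D #> g) = d \<otimes> g" by (auto simp: r_coset_def)
    have "\<rho>' (D #> g) = \<rho> d * \<rho> g" unfolding \<rho>'_def d(2) using R(3) subgroup.mem_carrier[OF sD d(1)] g by blast
    then show ?thesis using in_kernel_rep[OF sD rep ker d(1)] R(2)[OF g] by simp
  qed
  have eq: "rep_char G n \<rho> = inflate G D (rep_char (G Mod D) n \<rho>')"
    by (auto simp: inflate_def rep_char_def fun_eq_iff \<rho>' carrier_FactGroup)
  have one: "\<one>\<^bsub>G Mod D\<^esub> = D #> \<one>"
    using subgroup.subset[OF sD] by (simp add: FactGroup_def coset_mult_one)
  have "is_rep (G Mod D) n \<rho>'"
  proof (rule F.is_repI)
    show "0 < n" by (rule R(1))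
    show "\<rho>' C \<in> carrier_mat n n" if "C \<in> carrier (G Mod D)" for C
      using that \<rho>' R(2) by (auto simp: carrier_FactGroup)
    show "\<rho>' (C \<otimes>\<^bsub>G Mod D\<^esub> E) = \<rho>' C * \<rho>' E" if C: "C \<in> carrier (G Mod D)" "E \<in> carrier (G Mod D)" for C E
    proof -
      obtain g h where "g \<in> carrier G" "C = D #> g" "h \<in> carrier G" "E = D #> h" using C by (auto simp: carrier_FactGroup)
      then show ?thesis using \<rho>' R(3) normal.rcos_sum[OF D] by simp
    qed
    show "\<rho>' \<one>\<^bsub>G Mod D\<^esub> = 1\<^sub>m n" unfolding one using \<rho>'[OF one_closed] R(4) by simp
  qed
  moreover have "(\<forall>g\<in>carrier (G Mod D). \<forall>w\<in>W. \<rho>' g *\<^sub>v w \<in> W) \<longleftrightarrow> (\<forall>g\<in>carrier G. \<forall>w\<in>W. \<rho> g *\<^sub>v w \<in> W)" for W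
    by (simp add: carrier_FactGroup \<rho>')
  ultimately have "irreducible_rep (G Mod D) n \<rho>'" using \<rho> unfolding irreducible_rep_def by simp
  then show ?thesis using that eq by simp
qed

lemma inflate_degree: "D \<lhd> G \<Longrightarrow> char_degree G (inflate G D \<beta>) = char_degree (G Mod D) \<beta>"
  using subgroup.subset[OF normal_imp_subgroup, of D G] by (simp add: char_degree_def inflate_def FactGroup_def coset_mult_one)

lemma inflate_bij:
  assumes D: "D \<lhd> G"
  shows "bij_betw (inflate G D) (Irr (G Mod D)) {\<chi> \<in> Irr G. in_kernel G D \<chi>}"
proof (rule bij_betw_imageI)
  have sD: "subgroup D G" by (rule normal_imp_subgroup[OF D])
  show "inj_on (inflate G D) (Irr (G Mod D))"
  proof (rule inj_onI, rule ext)
    fix \<beta> \<beta>' C assume \<beta>: "\<beta> \<in> Irr (G Mod D)" "\<beta>' \<in> Irr (G Mod D)" and eq: "inflate G D \<beta> = inflate G D \<beta>'"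
    show "\<beta> C = \<beta>' C"
    proof (cases "C \<in> carrier (G Mod D)")
      case True
      then obtain g where g: "g \<in> carrier G" "C = D #> g" by (auto simp: carrier_FactGroup)
      then show ?thesis using fun_cong[OF eq, of g] by (simp add: inflate_def)
    next
      case False
      then show ?thesis using \<beta> Chars_outside Irr_subset_Chars by (metis (no_types, lifting) subsetD)
    qed
  qed
  show "inflate G D ` Irr (G Mod D) = {\<chi> \<in> Irr G. in_kernel G D \<chi>}"
  proof
    show "inflate G D ` Irr (G Mod D) \<subseteq> {\<chi> \<in> Irr G. in_kernel G D \<chi>}"
    proof
      fix \<chi> assume "\<chi> \<in> inflate G D ` Irr (G Mod D)"
      then obtain n \<rho> where \<rho>: "irreducible_rep (G Mod D) n \<rho>" "\<chi> = inflate G D (rep_char (G Mod D) n \<rho>)"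
        by (auto simp: Irr_def)
      have "\<chi> \<in> Irr G" using inflate_irreducible[OF D \<rho>(1)] \<rho>(2) by (auto simp: Irr_def)
      moreover have "\<chi> d = \<chi> \<one>" if "d \<in> D" for d
        using coset_join2[OF _ sD that] subgroup.mem_carrier[OF sD that] coset_mult_one[OF subgroup.subset[OF sD]]
        by (simp add: \<rho>(2) inflate_def)
      ultimately show "\<chi> \<in> {\<chi> \<in> Irr G. in_kernel G D \<chi>}" unfolding in_kernel_def by blast
    qed
    show "{\<chi> \<in> Irr G. in_kernel G D \<chi>} \<subseteq> inflate G D ` Irr (G Mod D)"
    proof
      fix \<chi> assume \<chi>: "\<chi> \<in> {\<chi> \<in> Irr G. in_kernel G D \<chi>}"
      then obtain n \<rho> where \<rho>: "irreducible_rep G n \<rho>" "\<chi> = rep_char G n \<rho>" by (auto simp: Irr_def)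
      have ker: "in_kernel G D (rep_char G n \<rho>)" using \<chi> \<rho>(2) by simp
      obtain \<rho>' where "irreducible_rep (G Mod D) n \<rho>'" "inflate G D (rep_char (G Mod D) n \<rho>') = rep_char G n \<rho>"
        by (rule deflate_irreducible[OF D \<rho>(1) ker])
      then show "\<chi> \<in> inflate G D ` Irr (G Mod D)" unfolding \<rho>(2) Irr_def by (intro image_eqI[of _ _ "rep_char (G Mod D) n \<rho>'"]) auto
    qed
  qed
qed

lemma constituent_degree:
  assumes N: "N \<lhd> G" and \<chi>: "\<chi> \<in> Irr G" and \<theta>: "\<theta> \<in> Irr (G\<lparr>carrier := N\<rparr>)" "cmult (G\<lparr>carrier := N\<rparr>) (char_res N \<chi>) \<theta> \<noteq> 0"
  shows "\<And>\<eta>. \<eta> \<in> Irr (G\<lparr>carrier := N\<rparr>) \<Longrightarrow> cmult (G\<lparr>carrier := N\<rparr>) (char_res N \<chi>) \<eta> \<noteq> 0 \<Longrightarrow>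
      char_degree (G\<lparr>carrier := N\<rparr>) \<eta> = char_degree (G\<lparr>carrier := N\<rparr>) \<theta>"
    "char_degree G \<chi> = char_degree (G\<lparr>carrier := N\<rparr>) \<theta> *
      (\<Sum>\<eta>\<in>Irr (G\<lparr>carrier := N\<rparr>). cmult (G\<lparr>carrier := N\<rparr>) (char_res N \<chi>) \<eta>)"
proof -
  let ?N = "G\<lparr>carrier := N\<rparr>"
  have sN: "subgroup N G" by (rule normal_imp_subgroup[OF N])
  interpret N: finite_group ?N by (rule subgroup_finite_group[OF sN])
  show deg: "char_degree ?N \<eta> = char_degree ?N \<theta>" if \<eta>: "\<eta> \<in> Irr ?N" "cmult ?N (char_res N \<chi>) \<eta> \<noteq> 0" for \<eta>
  proof -
    obtain g where g: "g \<in> carrier G" "\<eta> = conj_char G N g \<theta>" using clifford_conjugate[OF N \<chi> \<theta> \<eta>] by blast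
    show ?thesis unfolding g(2) by (rule char_degree_conj[OF sN g(1)])
  qed
  have "char_degree G \<chi> = char_degree ?N (char_res N \<chi>)" using degree_res[OF sN] by simp
  also have "\<dots> = (\<Sum>\<eta>\<in>Irr ?N. cmult ?N (char_res N \<chi>) \<eta> * char_degree ?N \<eta>)"
    by (rule N.degree_decomp[OF Chars_res[OF sN Irr_Chars[OF \<chi>]]])
  also have "\<dots> = (\<Sum>\<eta>\<in>Irr ?N. char_degree ?N \<theta> * cmult ?N (char_res N \<chi>) \<eta>)"
  proof (rule sum.cong[OF refl])
    show "cmult ?N (char_res N \<chi>) \<eta> * char_degree ?N \<eta> = char_degree ?N \<theta> * cmult ?N (char_res N \<chi>) \<eta>" if "\<eta> \<in> Irr ?N" for \<eta>
      using deg[OF that] by (cases "cmult ?N (char_res N \<chi>) \<eta> = 0") auto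
  qed
  finally show "char_degree G \<chi> = char_degree ?N \<theta> * (\<Sum>\<eta>\<in>Irr ?N. cmult ?N (char_res N \<chi>) \<eta>)"
    by (simp add: sum_distrib_left)
qed

end

section \<open>Characters of the normalizer over linear characters of \<open>Q\<close>\<close>

context self_normalizing_in_normal begin

abbreviation Q' :: "'a set" where "Q' \<equiv> derived G Q"

lemma Q'_sub: "Q' \<subseteq> Q" by (rule derived_incl[OF subset_refl sQ])

lemma sQ': "subgroup Q' G" by (rule derived_is_subgroup[OF subgroup.subset[OF sQ]])

lemma Q'_normal: "Q' \<lhd> G\<lparr>carrier := H\<rparr>"
proof -
  interpret H: finite_group "G\<lparr>carrier := H\<rparr>" by (rule subgroup_finite_group[OF sH])
  show ?thesis using H.derived_is_normal[OF normal_Q[OF sH QH subset_refl]] derived_consistent[OF QH sH] by simp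
qed

lemma Lin_derived:
  assumes l: "l \<in> Lin (G\<lparr>carrier := Q\<rparr>)" and d: "d \<in> Q'" shows "l d = 1"
proof -
  interpret Q: finite_group "G\<lparr>carrier := Q\<rparr>" by (rule finite_group_Q)
  have L: "l \<one> = 1" "\<And>x y. x \<in> Q \<Longrightarrow> y \<in> Q \<Longrightarrow> l (x \<otimes> y) = l x * l y" using Q.LinD(2,3)[OF l] by auto
  have inv: "l (inv x) * l x = 1" if "x \<in> Q" for x
    using L(2)[OF subgroup.m_inv_closed[OF sQ that] that] L(1) subgroup.mem_carrier[OF sQ that] by simp
  let ?K = "{x \<in> Q. l x = 1}"
  have "subgroup ?K G"
  proof (rule subgroupI)
    show "?K \<subseteq> carrier G" using subgroup.subset[OF sQ] by blast
    show "?K \<noteq> {}" using L(1) subgroup.one_closed[OF sQ] by blast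
    show "inv x \<in> ?K" if "x \<in> ?K" for x using inv[of x] that subgroup.m_inv_closed[OF sQ] by auto
    show "x \<otimes> y \<in> ?K" if "x \<in> ?K" "y \<in> ?K" for x y using that L(2) subgroup.m_closed[OF sQ] by auto
  qed
  moreover have "derived_set G Q \<subseteq> ?K"
  proof -
    have "x \<otimes> y \<otimes> inv x \<otimes> inv y \<in> ?K" if x: "x \<in> Q" "y \<in> Q" for x y
    proof -
      note c = x subgroup.m_inv_closed[OF sQ x(1)] subgroup.m_inv_closed[OF sQ x(2)] subgroup.m_closed[OF sQ]
      have "l (x \<otimes> y \<otimes> inv x \<otimes> inv y) = (l (inv x) * l x) * (l (inv y) * l y)"
        using c L(2) by (simp add: mult_ac)
      then show ?thesis using c inv by simp
    qed
    then show ?thesis by blast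
  qed
  ultimately have "Q' \<subseteq> ?K" unfolding derived_def by (intro generate_subgroup_incl)
  then show ?thesis using d by blast
qed

lemma in_kernel_constituents_Lin:
  assumes \<psi>: "\<psi> \<in> Irr (G\<lparr>carrier := H\<rparr>)" and ker: "in_kernel G Q' \<psi>"
    and \<eta>: "\<eta> \<in> Irr (G\<lparr>carrier := Q\<rparr>)" "cmult (G\<lparr>carrier := Q\<rparr>) (char_res Q \<psi>) \<eta> \<noteq> 0"
  shows "\<eta> \<in> Lin (G\<lparr>carrier := Q\<rparr>)"
proof -
  let ?Q = "G\<lparr>carrier := Q\<rparr>"
  interpret Q: finite_group ?Q by (rule finite_group_Q)
  interpret H: finite_group "G\<lparr>carrier := H\<rparr>" by (rule subgroup_finite_group[OF sH])
  have sQ'Q: "subgroup Q' ?Q" by (rule subgroup_incl[OF sQ' sQ Q'_sub])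
  have C: "char_res Q \<psi> \<in> Chars ?Q" using H.Chars_res[OF subgroup_incl[OF sQ sH QH] H.Irr_Chars[OF \<psi>]] by simp
  have "char_res Q \<psi> d = char_res Q \<psi> \<one>" if "d \<in> Q'" for d
  proof -
    have "\<psi> d = \<psi> \<one>" using ker that unfolding in_kernel_def by blast
    then show ?thesis using that Q'_sub subgroup.one_closed[OF sQ] by (auto simp: char_res_def)
  qed
  then have "in_kernel ?Q Q' (char_res Q \<psi>)" by (simp add: in_kernel_def)
  then have ker\<eta>: "in_kernel ?Q Q' \<eta>" by (rule Q.in_kernel_constituent[OF sQ'Q C _ \<eta>])
  have "x \<otimes> y \<otimes> inv x \<otimes> inv y \<in> Q'" if "x \<in> Q" "y \<in> Q" for x y
    unfolding derived_def by (rule generate.incl) (use that in blast)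
  then show ?thesis
    by (intro Q.commutator_kernel_linear[OF sQ'Q _ \<eta>(1) ker\<eta>]) (simp add: m_inv_consistent[OF sQ])
qed

text \<open>A linear character is trivial on \<open>Q'\<close>, and \<open>Q'\<close> is normal in
  \<open>H\<close>, so one linear constituent already puts \<open>Q'\<close> into the kernel. With
  \<open>in_kernel_constituents_Lin\<close> this identifies the characters of \<open>H\<close>
  modulo \<open>Q'\<close> with those lying over linear characters of \<open>Q\<close>.\<close>

lemma in_kernel_derivedI:
  assumes \<psi>: "\<psi> \<in> Irr (G\<lparr>carrier := H\<rparr>)"
    and l: "l \<in> Lin (G\<lparr>carrier := Q\<rparr>)" "cmult (G\<lparr>carrier := Q\<rparr>) (char_res Q \<psi>) l \<noteq> 0"
  shows "in_kernel G Q' \<psi>"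
proof -
  let ?H = "G\<lparr>carrier := H\<rparr>" and ?Q = "G\<lparr>carrier := Q\<rparr>" and ?Q' = "G\<lparr>carrier := Q'\<rparr>"
  interpret Q: finite_group ?Q by (rule finite_group_Q)
  interpret H: finite_group ?H by (rule subgroup_finite_group[OF sH])
  interpret Q': finite_group ?Q' by (rule subgroup_finite_group[OF sQ'])
  have sQ'Q: "subgroup Q' ?Q" by (rule subgroup_incl[OF sQ' sQ Q'_sub])
  have C: "char_res Q \<psi> \<in> Chars ?Q" using H.Chars_res[OF subgroup_incl[OF sQ sH QH] H.Irr_Chars[OF \<psi>]] by simp
  have t: "triv_char Q' \<in> Irr ?Q'" using Q'.Lin_Irr triv_char_subgroup[OF sQ'] by blast
  have "char_res Q' l = triv_char Q'" using Lin_derived[OF l(1)] by (auto simp: char_res_def)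
  then have "cmult ?Q' (char_res Q' l) (triv_char Q') \<noteq> 0" using Q'.cmult_Irr[OF t t] by simp
  then have "cmult ?Q' (char_res Q' (char_res Q \<psi>)) (triv_char Q') \<noteq> 0"
    using Q.constituent_trans[OF sQ'Q C Q.Lin_Irr[OF l(1)], of "triv_char Q'"] l(2) t by simp
  then have "in_kernel ?H Q' \<psi>" using H.in_kernel_normal_iff[OF Q'_normal \<psi>] char_res_res[OF Q'_sub, of \<psi>] by simp
  then show ?thesis by (simp add: in_kernel_def)
qed

end

section \<open>The degree bijection over all constituents at once\<close>

context self_normalizing_in_normal begin

abbreviation (input) GN where "GN \<equiv> G\<lparr>carrier := N\<rparr>"
abbreviation (input) GH where "GH \<equiv> G\<lparr>carrier := H\<rparr>"
abbreviation (input) GQ where "GQ \<equiv> G\<lparr>carrier := Q\<rparr>"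

lemma finite_groups: "finite_group GN" "finite_group GH" "finite_group GQ"
  by (rule subgroup_finite_group[OF sN] subgroup_finite_group[OF sH] subgroup_finite_group[OF sQ])+

lemma star_cmult: "\<theta> \<in> Irr_p' p GN \<Longrightarrow> l \<in> Lin GQ \<Longrightarrow> cmult GQ (char_res Q \<theta>) l = (if l = star \<theta> then 1 else 0)"
  using finite_group.cmult_eqI[OF finite_groups(3) Irr_p'_res(3) finite_group.Lin_Irr[OF finite_groups(3)]] star_inner by simp

definition \<A> where "\<A> = {\<chi> \<in> Irr G. \<exists>\<theta>\<in>Irr_p' p GN. cmult GN (char_res N \<chi>) \<theta> \<noteq> 0}"
text \<open>The irreducible characters of the quotient of \<open>H\<close> by \<open>Q'\<close>,
  inflated to \<open>H\<close> so that they can be compared with restrictions from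
  \<open>G\<close>.\<close>

definition \<B> where "\<B> = {\<psi> \<in> Irr GH. in_kernel G Q' \<psi>}"

lemma lies_over_iff:
  assumes "\<chi> \<in> Irr G" "\<theta> \<in> Irr GN" shows "lies_over G N \<chi> \<theta> \<longleftrightarrow> cmult GN (char_res N \<chi>) \<theta> \<noteq> 0"
  using finite_group.of_nat_cmult[OF finite_groups(1) Chars_res[OF sN Irr_Chars[OF assms(1)]] assms(2)]
  unfolding lies_over_def by (metis of_nat_eq_0_iff)

text \<open>The constituents on \<open>N\<close> are conjugate and share one degree
  \<open>w\<close>. It is the weight of \<chi> in the matrix argument, and it is prime to p because
  one constituent has p'-degree.\<close>

lemma \<A>_constituents:
  assumes \<chi>: "\<chi> \<in> \<A>"
  obtains w where "0 < w" "\<not> p dvd w" "char_degree G \<chi> = w * (\<Sum>\<theta>\<in>Irr GN. cmult GN (char_res N \<chi>) \<theta>)"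
    "\<And>\<theta>. \<theta> \<in> Irr GN \<Longrightarrow> cmult GN (char_res N \<chi>) \<theta> \<noteq> 0 \<Longrightarrow> \<theta> \<in> Irr_p' p GN \<and> char_degree GN \<theta> = w"
proof -
  interpret NN: finite_group GN by (rule finite_groups)
  have \<chi>I: "\<chi> \<in> Irr G" using \<chi> by (simp add: \<A>_def)
  obtain \<theta> where \<theta>: "\<theta> \<in> Irr_p' p GN" "cmult GN (char_res N \<chi>) \<theta> \<noteq> 0" using \<chi> unfolding \<A>_def by blast
  have \<theta>I: "\<theta> \<in> Irr GN" "\<not> p dvd char_degree GN \<theta>" using \<theta>(1) by (simp_all add: Irr_p'_def)
  note deg = constituent_degree[OF N \<chi>I \<theta>I(1) \<theta>(2)]
  show ?thesis
  proof (rule that[of "char_degree GN \<theta>"])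
    show "0 < char_degree GN \<theta>" by (rule NN.Chars_one(2)[OF NN.Irr_Chars[OF \<theta>I(1)]])
    show "\<eta> \<in> Irr_p' p GN \<and> char_degree GN \<eta> = char_degree GN \<theta>"
      if "\<eta> \<in> Irr GN" "cmult GN (char_res N \<chi>) \<eta> \<noteq> 0" for \<eta>
      using deg(1)[OF that] \<theta>I(2) that(1) by (simp add: Irr_p'_def)
  qed (use \<theta>I deg(2) in auto)
qed

text \<open>The last claim provides the weight of \<psi>. If \<open>star \<theta>\<close> and
  \<open>star \<theta>'\<close> both occur in \<psi>, they are conjugate in \<open>H\<close> by
  Clifford; as \<open>star\<close> is equivariant and injective, \<theta> and \<theta>' are
  conjugate as well and have the same degree.\<close>

lemma \<B>_constituents:
  assumes \<psi>: "\<psi> \<in> \<B>"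
  shows "\<And>\<eta>. \<eta> \<in> Irr GQ \<Longrightarrow> cmult GQ (char_res Q \<psi>) \<eta> \<noteq> 0 \<Longrightarrow> \<eta> \<in> Lin GQ"
    "char_degree GH \<psi> = (\<Sum>l\<in>Lin GQ. cmult GQ (char_res Q \<psi>) l)"
    "\<exists>w>0. \<forall>\<theta>\<in>Irr_p' p GN. cmult GQ (char_res Q \<psi>) (star \<theta>) \<noteq> 0 \<longrightarrow> char_degree GN \<theta> = w"
proof -
  interpret NN: finite_group GN by (rule finite_groups)
  interpret HH: finite_group GH by (rule finite_groups)
  interpret QQ: finite_group GQ by (rule finite_groups)
  have \<psi>I: "\<psi> \<in> Irr GH" and ker: "in_kernel G Q' \<psi>" using \<psi> by (auto simp: \<B>_def)
  have sQH: "subgroup Q GH" by (rule subgroup_incl[OF sQ sH QH])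
  have C: "char_res Q \<psi> \<in> Chars GQ" using HH.Chars_res[OF sQH HH.Irr_Chars[OF \<psi>I]] by simp
  show lin: "\<And>\<eta>. \<eta> \<in> Irr GQ \<Longrightarrow> cmult GQ (char_res Q \<psi>) \<eta> \<noteq> 0 \<Longrightarrow> \<eta> \<in> Lin GQ"
    by (rule in_kernel_constituents_Lin[OF \<psi>I ker])
  have "char_degree GH \<psi> = char_degree GQ (char_res Q \<psi>)" using degree_res[OF sQH, of \<psi>] by simp
  also have "\<dots> = (\<Sum>\<eta>\<in>Irr GQ. cmult GQ (char_res Q \<psi>) \<eta> * char_degree GQ \<eta>)" by (rule QQ.degree_decomp[OF C])
  also have "\<dots> = (\<Sum>l\<in>Lin GQ. cmult GQ (char_res Q \<psi>) l)"
  proof (rule sum.mono_neutral_cong_right[OF QQ.finite_Irr])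
    show "Lin GQ \<subseteq> Irr GQ" using QQ.Lin_Irr by blast
    show "\<forall>i\<in>Irr GQ - Lin GQ. cmult GQ (char_res Q \<psi>) i * char_degree GQ i = 0" using lin by auto
  qed (simp add: QQ.Lin_degree)
  finally show "char_degree GH \<psi> = (\<Sum>l\<in>Lin GQ. cmult GQ (char_res Q \<psi>) l)" .
  show "\<exists>w>0. \<forall>\<theta>\<in>Irr_p' p GN. cmult GQ (char_res Q \<psi>) (star \<theta>) \<noteq> 0 \<longrightarrow> char_degree GN \<theta> = w"
  proof (cases "\<exists>\<theta>\<in>Irr_p' p GN. cmult GQ (char_res Q \<psi>) (star \<theta>) \<noteq> 0")
    case True
    then obtain \<theta> where \<theta>: "\<theta> \<in> Irr_p' p GN" "cmult GQ (char_res Q \<psi>) (star \<theta>) \<noteq> 0" by blast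
    have "char_degree GN \<theta>' = char_degree GN \<theta>" if \<theta>': "\<theta>' \<in> Irr_p' p GN" "cmult GQ (char_res Q \<psi>) (star \<theta>') \<noteq> 0" for \<theta>'
    proof -
      have "\<exists>g\<in>carrier GH. star \<theta>' = conj_char GH Q g (star \<theta>)"
        by (rule HH.clifford_conjugate[OF normal_Q[OF sH QH subset_refl] \<psi>I])
          (use \<theta> \<theta>' QQ.Lin_Irr[OF star_Lin] in simp_all)
      then obtain g where g: "g \<in> H" "star \<theta>' = conj_char G Q g (star \<theta>)"
        using conj_char_subgroup[OF sH] by auto
      have gc: "g \<in> carrier G" using subgroup.mem_carrier[OF sH g(1)] .
      have "star \<theta>' = star (conj_char G N g \<theta>)" using star_conj[OF \<theta>(1) g(1)] g(2) by simp
      then have "\<theta>' = conj_char G N g \<theta>"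
        using inj_onD[OF bij_betw_imp_inj_on[OF star_bij]] \<theta>'(1) conj_Irr_p'[OF \<theta>(1) gc] by blast
      then show ?thesis using char_degree_conj[OF sN gc] by simp
    qed
    moreover have "0 < char_degree GN \<theta>" by (rule NN.Chars_one(2)[OF Irr_p'_res(2)[OF \<theta>(1)]])
    ultimately show ?thesis by blast
  qed auto
qed

text \<open>The weight of \<chi> or \<psi> is the common degree of the characters of
  \<open>N\<close> below it, where \<open>star\<close> passes from \<open>Q\<close> to
  \<open>N\<close>. Since these weights are prime to p, p-parts of degrees are preserved.\<close>

lemma degree_bijection:
  obtains f where "bij_betw f \<A> \<B>" "\<And>\<chi>. \<chi> \<in> \<A> \<Longrightarrow> \<exists>w. \<not> p dvd w \<and> char_degree G \<chi> = w * char_degree GH (f \<chi>)"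
proof -
  interpret NN: finite_group GN by (rule finite_groups)
  interpret HH: finite_group GH by (rule finite_groups)
  interpret QQ: finite_group GQ by (rule finite_groups)
  have sQH: "subgroup Q GH" by (rule subgroup_incl[OF sQ sH QH])
  have fin\<A>: "finite \<A>" and fin\<B>: "finite \<B>" using finite_Irr HH.finite_Irr by (auto simp: \<A>_def \<B>_def)
  have \<A>I: "\<A> \<subseteq> Irr G" and \<B>I: "\<B> \<subseteq> Irr GH" by (auto simp: \<A>_def \<B>_def)
  have LI: "Lin GQ \<subseteq> Irr GQ" using QQ.Lin_Irr by blast
  have finL: "finite (Lin GQ)" by (rule finite_subset[OF LI QQ.finite_Irr])
  have PI: "Irr_p' p GN \<subseteq> Irr GN" by (auto simp: Irr_p'_def)
  have finP: "finite (Irr_p' p GN)" by (rule finite_subset[OF PI NN.finite_Irr])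
  let ?a = "\<lambda>\<chi> \<psi>. cmult GH (char_res H \<chi>) \<psi>"
  let ?n = "\<lambda>\<chi> \<theta>. cmult GN (char_res N \<chi>) \<theta>" and ?q = "\<lambda>\<psi> l. cmult GQ (char_res Q \<psi>) l"
  have "\<forall>\<chi>\<in>\<A>. \<exists>w. 0 < w \<and> \<not> p dvd w \<and> char_degree G \<chi> = w * (\<Sum>\<theta>\<in>Irr GN. ?n \<chi> \<theta>) \<and>
      (\<forall>\<theta>\<in>Irr GN. ?n \<chi> \<theta> \<noteq> 0 \<longrightarrow> \<theta> \<in> Irr_p' p GN \<and> char_degree GN \<theta> = w)"
    using \<A>_constituents by (metis (no_types, lifting))
  then obtain w where w: "\<forall>\<chi>\<in>\<A>. 0 < w \<chi> \<and> \<not> p dvd w \<chi> \<and> char_degree G \<chi> = w \<chi> * (\<Sum>\<theta>\<in>Irr GN. ?n \<chi> \<theta>) \<and>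
      (\<forall>\<theta>\<in>Irr GN. ?n \<chi> \<theta> \<noteq> 0 \<longrightarrow> \<theta> \<in> Irr_p' p GN \<and> char_degree GN \<theta> = w \<chi>)"
    by (rule exE[OF bchoice])
  have wD: "0 < w \<chi>" "\<not> p dvd w \<chi>" "char_degree G \<chi> = w \<chi> * (\<Sum>\<theta>\<in>Irr GN. ?n \<chi> \<theta>)"
    "\<And>\<theta>. \<theta> \<in> Irr GN \<Longrightarrow> ?n \<chi> \<theta> \<noteq> 0 \<Longrightarrow> \<theta> \<in> Irr_p' p GN" "\<And>\<theta>. \<theta> \<in> Irr GN \<Longrightarrow> ?n \<chi> \<theta> \<noteq> 0 \<Longrightarrow> char_degree GN \<theta> = w \<chi>"
    if "\<chi> \<in> \<A>" for \<chi> using bspec[OF w that] by simp_all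
  have "\<forall>\<psi>\<in>\<B>. \<exists>w>0. \<forall>\<theta>\<in>Irr_p' p GN. ?q \<psi> (star \<theta>) \<noteq> 0 \<longrightarrow> char_degree GN \<theta> = w"
    using \<B>_constituents(3) by blast
  then obtain w' where w': "\<forall>\<psi>\<in>\<B>. 0 < w' \<psi> \<and> (\<forall>\<theta>\<in>Irr_p' p GN. ?q \<psi> (star \<theta>) \<noteq> 0 \<longrightarrow> char_degree GN \<theta> = w' \<psi>)"
    by (rule exE[OF bchoice])
  have w'D: "0 < w' \<psi>" "\<And>\<theta>. \<theta> \<in> Irr_p' p GN \<Longrightarrow> ?q \<psi> (star \<theta>) \<noteq> 0 \<Longrightarrow> char_degree GN \<theta> = w' \<psi>"
    if "\<psi> \<in> \<B>" for \<psi> using bspec[OF w' that] by simp_all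
  have CQ: "char_res Q \<psi> \<in> Chars GQ" if "\<psi> \<in> Irr GH" for \<psi> using HH.Chars_res[OF sQH HH.Irr_Chars[OF that]] by simp
  have viaH: "?q \<chi> l = (\<Sum>\<psi>\<in>Irr GH. ?a \<chi> \<psi> * ?q \<psi> l)" if "\<chi> \<in> Irr G" "l \<in> Irr GQ" for \<chi> l
    using HH.cmult_res_decomp[OF sQH Chars_res[OF sH Irr_Chars[OF that(1)]], of l] that(2) char_res_res[OF QH, of \<chi>] by simp
  have viaN: "?q \<chi> l = (\<Sum>\<theta>\<in>Irr GN. ?n \<chi> \<theta> * ?q \<theta> l)" if "\<chi> \<in> Irr G" "l \<in> Irr GQ" for \<chi> l
    using NN.cmult_res_decomp[OF sQN Chars_res[OF sN Irr_Chars[OF that(1)]], of l] that(2) char_res_res[OF QN, of \<chi>] by simp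
  have row: "w \<chi> * (\<Sum>\<psi>\<in>\<B>. ?a \<chi> \<psi> * char_degree GH \<psi>) = char_degree G \<chi>" if \<chi>: "\<chi> \<in> \<A>" for \<chi>
  proof -
    have \<chi>I: "\<chi> \<in> Irr G" using \<chi> \<A>I by blast
    have "(\<Sum>\<psi>\<in>\<B>. ?a \<chi> \<psi> * char_degree GH \<psi>) = (\<Sum>\<psi>\<in>Irr GH. ?a \<chi> \<psi> * (\<Sum>l\<in>Lin GQ. ?q \<psi> l))"
    proof (rule sum.mono_neutral_cong_left[OF HH.finite_Irr \<B>I])
      have "?q \<psi> l = 0" if "\<psi> \<in> Irr GH - \<B>" "l \<in> Lin GQ" for \<psi> l
        using in_kernel_derivedI[of \<psi> l] that by (auto simp: \<B>_def)
      then show "\<forall>\<psi>\<in>Irr GH - \<B>. ?a \<chi> \<psi> * (\<Sum>l\<in>Lin GQ. ?q \<psi> l) = 0" by simp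
    qed (simp add: \<B>_constituents(2))
    \<comment> \<open>The linear constituents of \<chi> on \<open>Q\<close> are counted twice, once
      through \<open>H\<close> and once through \<open>N\<close>. Through \<open>N\<close>, each
      constituent \<theta> contributes exactly one linear character,
      \<open>star \<theta>\<close>.\<close>
    also have "\<dots> = (\<Sum>l\<in>Lin GQ. \<Sum>\<psi>\<in>Irr GH. ?a \<chi> \<psi> * ?q \<psi> l)"
      unfolding sum_distrib_left by (rule sum.swap)
    also have "\<dots> = (\<Sum>l\<in>Lin GQ. \<Sum>\<theta>\<in>Irr GN. ?n \<chi> \<theta> * ?q \<theta> l)"
      by (rule sum.cong[OF refl]) (use viaH[OF \<chi>I] viaN[OF \<chi>I] LI in \<open>auto simp: subset_iff\<close>)
    also have "\<dots> = (\<Sum>\<theta>\<in>Irr GN. ?n \<chi> \<theta> * (\<Sum>l\<in>Lin GQ. ?q \<theta> l))"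
      unfolding sum_distrib_left by (rule sum.swap)
    also have "\<dots> = (\<Sum>\<theta>\<in>Irr GN. ?n \<chi> \<theta>)"
    proof (rule sum.cong[OF refl])
      fix \<theta> assume \<theta>: "\<theta> \<in> Irr GN"
      show "?n \<chi> \<theta> * (\<Sum>l\<in>Lin GQ. ?q \<theta> l) = ?n \<chi> \<theta>"
      proof (cases "?n \<chi> \<theta> = 0")
        case False
        then have \<theta>p: "\<theta> \<in> Irr_p' p GN" by (rule wD(4)[OF \<chi> \<theta>])
        have "(\<Sum>l\<in>Lin GQ. ?q \<theta> l) = (\<Sum>l\<in>Lin GQ. if l = star \<theta> then 1 else 0)"
          by (rule sum.cong) (simp_all add: star_cmult[OF \<theta>p])
        also have "\<dots> = 1" using finL star_Lin[OF \<theta>p] by simp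
        finally show ?thesis by simp
      qed simp
    qed
    finally show ?thesis using wD(3)[OF \<chi>] by simp
  qed
  \<comment> \<open>On \<open>Q\<close> the character \<psi> has only linear constituents, and among
    these \<theta> contains only \<open>star \<theta>\<close>, once. So the Mackey inner product
    reduces to one multiplicity.\<close>
  have mackey: "(\<Sum>\<chi>\<in>Irr G. ?a \<chi> \<psi> * ?n \<chi> \<theta>) = ?q \<psi> (star \<theta>)" if \<psi>: "\<psi> \<in> \<B>" and \<theta>: "\<theta> \<in> Irr_p' p GN" for \<psi> \<theta>
  proof -
    have \<psi>I: "\<psi> \<in> Irr GH" using \<psi> \<B>I by blast
    have "of_nat (\<Sum>\<chi>\<in>Irr G. ?a \<chi> \<psi> * ?n \<chi> \<theta>) = char_inner GQ (char_res Q \<psi>) (char_res Q \<theta>)"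
      using mackey_sum[OF sN sH frattini \<psi>I Irr_p'_res(1)[OF \<theta>]] N_H by simp
    also have "\<dots> = of_nat (\<Sum>\<eta>\<in>Irr GQ. ?q \<psi> \<eta> * ?q \<theta> \<eta>)" by (rule QQ.inner_cmult[OF CQ[OF \<psi>I] Irr_p'_res(3)[OF \<theta>]])
    also have "(\<Sum>\<eta>\<in>Irr GQ. ?q \<psi> \<eta> * ?q \<theta> \<eta>) = (\<Sum>l\<in>Lin GQ. if l = star \<theta> then ?q \<psi> l else 0)"
    proof (rule sum.mono_neutral_cong_right[OF QQ.finite_Irr LI])
      show "\<forall>\<eta>\<in>Irr GQ - Lin GQ. ?q \<psi> \<eta> * ?q \<theta> \<eta> = 0" using \<B>_constituents(1)[OF \<psi>] by auto
    qed (simp add: star_cmult[OF \<theta>])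
    also have "\<dots> = ?q \<psi> (star \<theta>)" using finL star_Lin[OF \<theta>] by simp
    finally show ?thesis by (simp only: of_nat_eq_iff)
  qed
  have col: "(\<Sum>\<chi>\<in>\<A>. ?a \<chi> \<psi> * char_degree G \<chi>) = w' \<psi> * char_degree GH \<psi>" if \<psi>: "\<psi> \<in> \<B>" for \<psi>
  proof -
    have "(\<Sum>\<chi>\<in>\<A>. ?a \<chi> \<psi> * char_degree G \<chi>) = (\<Sum>\<chi>\<in>Irr G. ?a \<chi> \<psi> * (\<Sum>\<theta>\<in>Irr_p' p GN. char_degree GN \<theta> * ?n \<chi> \<theta>))"
    proof (rule sum.mono_neutral_cong_left[OF finite_Irr \<A>I])
      show "\<forall>\<chi>\<in>Irr G - \<A>. ?a \<chi> \<psi> * (\<Sum>\<theta>\<in>Irr_p' p GN. char_degree GN \<theta> * ?n \<chi> \<theta>) = 0" by (auto simp: \<A>_def)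
      fix \<chi> assume \<chi>: "\<chi> \<in> \<A>"
      have "(\<Sum>\<theta>\<in>Irr_p' p GN. char_degree GN \<theta> * ?n \<chi> \<theta>) = (\<Sum>\<theta>\<in>Irr GN. w \<chi> * ?n \<chi> \<theta>)"
      proof (rule sum.mono_neutral_cong_left[OF NN.finite_Irr PI])
        show "\<forall>\<theta>\<in>Irr GN - Irr_p' p GN. w \<chi> * ?n \<chi> \<theta> = 0" using wD(4)[OF \<chi>] by auto
        show "char_degree GN \<theta> * ?n \<chi> \<theta> = w \<chi> * ?n \<chi> \<theta>" if "\<theta> \<in> Irr_p' p GN" for \<theta>
          using wD(5)[OF \<chi>, of \<theta>] that PI by (cases "?n \<chi> \<theta> = 0") auto
      qed
      then show "?a \<chi> \<psi> * char_degree G \<chi> = ?a \<chi> \<psi> * (\<Sum>\<theta>\<in>Irr_p' p GN. char_degree GN \<theta> * ?n \<chi> \<theta>)"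
        using wD(3)[OF \<chi>] by (simp add: sum_distrib_left)
    qed
    also have "\<dots> = (\<Sum>\<theta>\<in>Irr_p' p GN. char_degree GN \<theta> * (\<Sum>\<chi>\<in>Irr G. ?a \<chi> \<psi> * ?n \<chi> \<theta>))"
      unfolding sum_distrib_left by (subst sum.swap) (simp add: mult_ac)
    also have "\<dots> = (\<Sum>\<theta>\<in>Irr_p' p GN. w' \<psi> * ?q \<psi> (star \<theta>))"
    proof (rule sum.cong[OF refl])
      fix \<theta> assume \<theta>: "\<theta> \<in> Irr_p' p GN"
      show "char_degree GN \<theta> * (\<Sum>\<chi>\<in>Irr G. ?a \<chi> \<psi> * ?n \<chi> \<theta>) = w' \<psi> * ?q \<psi> (star \<theta>)"
        unfolding mackey[OF \<psi> \<theta>] using w'D(2)[OF \<psi> \<theta>] by (cases "?q \<psi> (star \<theta>) = 0") auto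
    qed
    \<comment> \<open>As \<theta> varies, \<open>star \<theta>\<close> runs through all linear
      characters of \<open>Q\<close>, so the sum of multiplicities is the degree of \<psi>.\<close>
    also have "\<dots> = w' \<psi> * (\<Sum>l\<in>Lin GQ. ?q \<psi> l)"
      unfolding sum_distrib_left by (rule sum.reindex_bij_betw[OF star_bij, where g = "\<lambda>l. w' \<psi> * ?q \<psi> l"])
    finally show ?thesis using \<B>_constituents(2)[OF \<psi>] by simp
  qed
  \<comment> \<open>A linear constituent of \<psi> on \<open>Q\<close> also occurs in \<chi>, hence
    in some \<theta> below \<chi>. Then it is \<open>star \<theta>\<close>, and both weights are the
    degree of \<theta>.\<close>
  have comp: "w \<chi> = w' \<psi>" if \<chi>: "\<chi> \<in> \<A>" and \<psi>: "\<psi> \<in> \<B>" and a: "?a \<chi> \<psi> \<noteq> 0" for \<chi> \<psi>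
  proof -
    have \<chi>I: "\<chi> \<in> Irr G" and \<psi>I: "\<psi> \<in> Irr GH" using \<chi> \<A>I \<psi> \<B>I by blast+
    obtain l where l: "l \<in> Irr GQ" "?q \<psi> l \<noteq> 0" by (rule QQ.ex_constituent[OF CQ[OF \<psi>I]])
    have lL: "l \<in> Lin GQ" by (rule \<B>_constituents(1)[OF \<psi> l])
    have "?q \<chi> l \<noteq> 0"
    proof
      assume "?q \<chi> l = 0"
      then have "?a \<chi> \<psi> * ?q \<psi> l = 0" using viaH[OF \<chi>I l(1)] HH.finite_Irr \<psi>I by simp
      then show False using a l(2) by simp
    qed
    then obtain \<theta> where \<theta>: "\<theta> \<in> Irr GN" "?n \<chi> \<theta> * ?q \<theta> l \<noteq> 0"
      using viaN[OF \<chi>I l(1)] sum.not_neutral_contains_not_neutral[of "\<lambda>\<theta>. ?n \<chi> \<theta> * ?q \<theta> l" "Irr GN"] by auto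
    have n: "?n \<chi> \<theta> \<noteq> 0" and q: "?q \<theta> l \<noteq> 0" using \<theta>(2) by simp_all
    have \<theta>p: "\<theta> \<in> Irr_p' p GN" by (rule wD(4)[OF \<chi> \<theta>(1) n])
    have "l = star \<theta>" using star_cmult[OF \<theta>p lL] q by (simp split: if_splits)
    then show ?thesis using wD(5)[OF \<chi> \<theta>(1) n] w'D(2)[OF \<psi> \<theta>p] l(2) by simp
  qed
  obtain f where f: "bij_betw f \<A> \<B>" "\<And>\<chi>. \<chi> \<in> \<A> \<Longrightarrow> char_degree G \<chi> = w \<chi> * char_degree GH (f \<chi>)"
  proof (rule weighted_permutation_matrix[where A = \<A> and B = \<B> and a = ?a and d = "char_degree G"
        and e = "char_degree GH" and w = w and w' = w', OF fin\<A> fin\<B>])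
    show "0 < char_degree G \<chi>" if "\<chi> \<in> \<A>" for \<chi> using Chars_one(2)[OF Irr_Chars] that \<A>I by blast
    show "0 < char_degree GH \<psi>" if "\<psi> \<in> \<B>" for \<psi> using HH.Chars_one(2)[OF HH.Irr_Chars] that \<B>I by blast
  qed (use w'D(1) row col comp in blast)+
  show ?thesis by (rule that[OF f(1)]) (use f(2) wD(2) in blast)
qed

text \<open>The degree of a constituent on \<open>N\<close> divides the degree of \<chi>, so
  p'-characters of \<open>G\<close> lie over p'-characters of \<open>N\<close>.\<close>

lemma Irr_p'_G: "Irr_p' p G = {\<chi> \<in> \<A>. \<not> p dvd char_degree G \<chi>}"
proof -
  interpret NN: finite_group GN by (rule finite_groups)
  have "\<chi> \<in> \<A>" if \<chi>: "\<chi> \<in> Irr G" "\<not> p dvd char_degree G \<chi>" for \<chi>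
  proof -
    obtain \<theta> where \<theta>: "\<theta> \<in> Irr GN" "cmult GN (char_res N \<chi>) \<theta> \<noteq> 0"
      by (rule NN.ex_constituent[OF Chars_res[OF sN Irr_Chars[OF \<chi>(1)]]])
    have "\<not> p dvd char_degree GN \<theta>" using constituent_degree(2)[OF N \<chi>(1) \<theta>] \<chi>(2) by auto
    then show ?thesis using \<chi>(1) \<theta> unfolding \<A>_def Irr_p'_def by blast
  qed
  then show ?thesis unfolding Irr_p'_def \<A>_def by blast
qed

text \<open>The same divisibility for \<open>Q\<close> in \<open>H\<close>; constituents on
  \<open>Q\<close> of p'-degree are linear by \<open>Irr_p'_Q\<close>.\<close>

lemma Irr_p'_H: "Irr_p' p GH = {\<psi> \<in> \<B>. \<not> p dvd char_degree GH \<psi>}"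
proof -
  interpret HH: finite_group GH by (rule finite_groups)
  interpret QQ: finite_group GQ by (rule finite_groups)
  have sQH: "subgroup Q GH" by (rule subgroup_incl[OF sQ sH QH])
  have "\<psi> \<in> \<B>" if \<psi>: "\<psi> \<in> Irr GH" "\<not> p dvd char_degree GH \<psi>" for \<psi>
  proof -
    have "char_res Q \<psi> \<in> Chars GQ" using HH.Chars_res[OF sQH HH.Irr_Chars[OF \<psi>(1)]] by simp
    then obtain l where l: "l \<in> Irr GQ" "cmult GQ (char_res Q \<psi>) l \<noteq> 0" by (rule QQ.ex_constituent)
    have "\<not> p dvd char_degree GQ l"
      using HH.constituent_degree(2)[OF normal_Q[OF sH QH subset_refl] \<psi>(1), of l] l \<psi>(2) by auto
    then have "l \<in> Lin GQ" using Irr_p'_Q l(1) unfolding Irr_p'_def by blast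
    then show ?thesis using in_kernel_derivedI[OF \<psi>(1) _ l(2)] \<psi>(1) by (simp add: \<B>_def)
  qed
  then show ?thesis unfolding Irr_p'_def \<B>_def by blast
qed

lemma card_Irr_p': "card (Irr_p' p G) = card (Irr_p' p GH)"
proof -
  obtain f where f: "bij_betw f \<A> \<B>" "\<And>\<chi>. \<chi> \<in> \<A> \<Longrightarrow> \<exists>w. \<not> p dvd w \<and> char_degree G \<chi> = w * char_degree GH (f \<chi>)"
    by (rule degree_bijection) (rule that; blast)
  have "(\<not> p dvd char_degree GH (f \<chi>)) = (\<not> p dvd char_degree G \<chi>)" if "\<chi> \<in> \<A>" for \<chi>
    using f(2)[OF that] prime by (auto simp: prime_dvd_mult_iff)
  then have "bij_betw f {\<chi> \<in> \<A>. \<not> p dvd char_degree G \<chi>} {\<psi> \<in> \<B>. \<not> p dvd char_degree GH \<psi>}"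
    by (rule bij_betw_Collect[OF f(1)])
  then show ?thesis unfolding Irr_p'_G Irr_p'_H by (rule bij_betw_same_card)
qed

lemma quotient_bijection:
  "\<exists>f. bij_betw f \<A> (Irr (GH Mod Q')) \<and>
    (\<forall>\<chi>\<in>\<A>. p_part p (char_degree G \<chi>) = p_part p (char_degree (GH Mod Q') (f \<chi>)))"
proof -
  interpret HH: finite_group GH by (rule finite_groups)
  obtain f where f: "bij_betw f \<A> \<B>" "\<And>\<chi>. \<chi> \<in> \<A> \<Longrightarrow> \<exists>w. \<not> p dvd w \<and> char_degree G \<chi> = w * char_degree GH (f \<chi>)"
    by (rule degree_bijection) (rule that; blast)
  let ?i = "inv_into (Irr (GH Mod Q')) (inflate GH Q')"
  have "\<B> = {\<psi> \<in> Irr GH. in_kernel GH Q' \<psi>}" by (simp add: \<B>_def in_kernel_def)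
  then have i: "bij_betw (inflate GH Q') (Irr (GH Mod Q')) \<B>" using HH.inflate_bij[OF Q'_normal] by simp
  show ?thesis
  proof (intro exI[of _ "?i \<circ> f"] conjI ballI)
    show "bij_betw (?i \<circ> f) \<A> (Irr (GH Mod Q'))" by (rule bij_betw_trans[OF f(1) bij_betw_inv_into[OF i]])
    fix \<chi> assume \<chi>: "\<chi> \<in> \<A>"
    obtain w where w: "\<not> p dvd w" "char_degree G \<chi> = w * char_degree GH (f \<chi>)" using f(2)[OF \<chi>] by blast
    have fB: "f \<chi> \<in> \<B>" using bij_betwE[OF f(1)] \<chi> by blast
    then have "inflate GH Q' (?i (f \<chi>)) = f \<chi>" by (rule bij_betw_inv_into_right[OF i])
    then have deg: "char_degree (GH Mod Q') (?i (f \<chi>)) = char_degree GH (f \<chi>)"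
      using HH.inflate_degree[OF Q'_normal, of "?i (f \<chi>)"] by simp
    have "w \<noteq> 0" using w(1) by (metis dvd_0_right)
    moreover have "char_degree GH (f \<chi>) \<noteq> 0" using HH.Chars_one(2)[OF HH.Irr_Chars, of "f \<chi>"] fB by (simp add: \<B>_def)
    ultimately have "multiplicity p (char_degree G \<chi>) = multiplicity p (char_degree GH (f \<chi>))"
      unfolding w(2) using prime w(1) by (simp add: prime_elem_multiplicity_mult_distrib not_dvd_imp_multiplicity_0)
    then show "p_part p (char_degree G \<chi>) = p_part p (char_degree (GH Mod Q') ((?i \<circ> f) \<chi>))"
      by (simp add: p_part_def deg)
  qed
qed

end

theorem corollary4p2:
  fixes G :: "('a, 'b) monoid_scheme" and N Q :: "'a set" and p :: nat
  assumes "Factorial_Ring.prime p"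
    and "group G" and "finite (carrier G)"
    and "N \<lhd> G" and "solvable (G\<lparr>carrier := N\<rparr>)"
    and "sylow_subgroup p (G\<lparr>carrier := N\<rparr>) Q"
    and "normalizer (G\<lparr>carrier := N\<rparr>) Q = Q"
  shows
    "(\<exists>star. bij_betw star (Irr_p' p (G\<lparr>carrier := N\<rparr>)) (Lin (G\<lparr>carrier := Q\<rparr>)) \<and>
        (\<forall>\<theta>\<in>Irr_p' p (G\<lparr>carrier := N\<rparr>).
           \<forall>g\<in>normalizer G Q. \<forall>\<sigma>\<in>Gal_cyclotomic (Coset.order G).
             star (galois_char \<sigma> (conj_char G N g \<theta>)) =
               galois_char \<sigma> (conj_char G Q g (star \<theta>))) \<and>
        (\<forall>\<theta>\<in>Irr_p' p (G\<lparr>carrier := N\<rparr>).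
           char_triples_isomorphic
             (G\<lparr>carrier := stabilizer G (conj_char G N) \<theta>\<rparr>) N \<theta>
             (G\<lparr>carrier := stabilizer (G\<lparr>carrier := normalizer G Q\<rparr>)
                             (conj_char G Q) (star \<theta>)\<rparr>) Q (star \<theta>))) \<and>
     (\<exists>f. bij_betw f
            {\<chi> \<in> Irr G. \<exists>\<theta>\<in>Irr_p' p (G\<lparr>carrier := N\<rparr>). lies_over G N \<chi> \<theta>}
            (Irr (G\<lparr>carrier := normalizer G Q\<rparr> Mod derived G Q)) \<and>
        (\<forall>\<chi>\<in>{\<chi> \<in> Irr G. \<exists>\<theta>\<in>Irr_p' p (G\<lparr>carrier := N\<rparr>). lies_over G N \<chi> \<theta>}.
           p_part p (char_degree G \<chi>) =
             p_part p (char_degree (G\<lparr>carrier := normalizer G Q\<rparr> Mod derived G Q) (f \<chi>)))) \<and>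
     card (Irr_p' p G) = card (Irr_p' p (G\<lparr>carrier := normalizer G Q\<rparr>))"
proof -
  interpret self_normalizing_in_normal G p N Q
    using assms by (simp add: self_normalizing_in_normal_def self_normalizing_in_normal_axioms_def
      finite_group_def finite_group_axioms_def)
  have \<A>: "{\<chi> \<in> Irr G. \<exists>\<theta>\<in>Irr_p' p (G\<lparr>carrier := N\<rparr>). lies_over G N \<chi> \<theta>} = \<A>"
    unfolding \<A>_def using lies_over_iff by (auto simp: Irr_p'_def)
  show ?thesis
    unfolding \<A>
  proof (intro conjI exI[of _ star] ballI)
    fix \<theta> g \<sigma>
    assume "\<theta> \<in> Irr_p' p (G\<lparr>carrier := N\<rparr>)" "g \<in> normalizer G Q" "\<sigma> \<in> Gal_cyclotomic (Coset.order G)"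
    then show "star (galois_char \<sigma> (conj_char G N g \<theta>)) = galois_char \<sigma> (conj_char G Q g (star \<theta>))"
      \<comment> \<open>The actions are treated one after the other: the conjugate of \<theta> is
        again a p'-character of \<open>N\<close>, to which Galois equivariance applies. In the
        opposite order one would first need the Galois conjugate to be a character.\<close>
      using star_galois[OF conj_Irr_p'] star_conj subgroup.mem_carrier[OF sH] by simp
  qed (use star_bij triples_isomorphic quotient_bijection card_Irr_p' in auto)
qed

end
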